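(* Let $A\to M$ be a vector bundle, $L\to M$ a line bundle, and $A^\dagger:=A^\ast\otimes L$. There exists a unique contactomorphism $F:J^1[2]L_A\to J^1[2]L_{A^\dagger}$ (the contact analogue of the Legendre transform) satisfying the following two conditions: (1) $F$ swaps the bidegree, i.e. $F^\ast\big(C^\infty(J^1[2]L_{A^\dagger})^{(\epsilon,\delta)}\big)=C^\infty(J^1[2]L_A)^{(\delta,\epsilon)}$; (2) $F$ induces the identity map on both $A[1]$ and $A^\dagger[1]$, i.e. $\widetilde\tau\circ F=\pi$ and $\widetilde\pi\circ F=\tau$. In particular, in local adapted coordinates, $F$ acts like $(x^i,u^a,p,p_i,p_a)\mapsto(\widetilde x^i,\widetilde u^a,\widetilde p,\widetilde p_i,\widetilde p_a)$ where $$\widetilde x^i=x^i,\qquad\widetilde u^a=p_a,\qquad\widetilde p=p-u^ap_a,\qquad\widetilde p_i=p_i,\qquad\widetilde p_a=u^a.$$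
   Context: For a vector bundle $A\to M$, $A[1]$ is the degree $1$ $\mathbb N$-manifold with $C^\infty(A[1])=\Gamma(\wedge^\bullet A^\ast)$; $L_A\to A[1]$ is the pull-back of $L\to M$. $J^1[2]L_A$ is the $\mathbb N$-manifold obtained from the first jet bundle $\pi:J^1L_A\to A[1]$ by shifting fibre degrees by $2$; $\mathcal L_A:=\pi^\ast L_A$ (so $\mathcal L_A$ is the pull-back of $L$). Local adapted coordinates: local coordinates $x^i$ on $M$, a local frame $e_a$ of $A$ with dual fibre coordinates $u^a$, a local frame $\mu$ of $L$; on $J^1[2]L_A$ one has coordinates $x^i$ (degree $0$), $u^a,p_a$ (degree $1$), $p,p_i$ (degree $2$), with $p,p_i,p_a$ the jet coordinates (the value and the $x^i$-, $u^a$-derivatives of the component of a section with respect to $\mu$). On $A^\dagger[1]$ use the fibre coordinates $\widetilde u^a$ corresponding to the frame $e_a^\ast\otimes\mu$ of $A^\dagger$, and on $J^1[2]L_{A^\dagger}$ the analogous coordinates $\widetilde x^i,\widetilde u^a,\widetilde p,\widetilde p_i,\widetilde p_a$ (with the same frame $\mu$ of $L$); $\widetilde\pi:J^1[2]L_{A^\dagger}\to A^\dagger[1]$ is the bundle projection. Contact structure: the Cartan contact form on $J^1[2]L_A$ is the $\mathcal L_A$-valued $1$-form locally given by $\theta=(\mathrm dp-p_i\mathrm dx^i-p_a\mathrm du^a)\otimes\mu$, and similarly $\widetilde\theta$ on $J^1[2]L_{A^\dagger}$; signs follow total degree (so $\mathrm d(u^ap_b)=p_b\mathrm du^a-u^a\mathrm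 dp_b$). The contact distribution is $\ker\theta$. A contactomorphism is a diffeomorphism of $\mathbb N$-manifolds intertwining the contact distributions, i.e. $F^\ast\widetilde\theta$ equals $\theta$ up to a conformal factor (both being valued in the pull-back of $L$). Second projection: $\tau:J^1[2]L_A\to A^\dagger[1]$ is locally $(x^i,u^a,p,p_i,p_a)\mapsto(\widetilde x^i,\widetilde u^a)=(x^i,p_a)$, and $\widetilde\tau:J^1[2]L_{A^\dagger}\to A[1]$ is the analogous map for $A^\dagger$ (using $(A^\dagger)^\dagger=A$), locally $(\widetilde x^i,\widetilde u^a,\widetilde p,\widetilde p_i,\widetilde p_a)\mapsto(x^i,u^a)=(\widetilde x^i,\widetilde p_a)$. Bidegree $(\epsilon,\delta)$, $\epsilon,\delta\in\mathbb N$, on $C^\infty(J^1[2]L_A)$: $x^i$ has $(0,0)$, $u^a$ has $(0,1)$, $p_a$ has $(1,0)$, $p$ and $p_i$ have $(1,1)$; analogously on $J^1[2]L_{A^\dagger}$ with tilded coordinates.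
   Formalization: A is assumed to have rank at least 1 (for rank 0 uniqueness fails: p ↦ 2p, p_i ↦ 2p_i also satisfies all conditions), and M is assumed nonempty of dimension at least 1, which leaves out only the degenerate discrete or empty bases. *)

theory Defs
  imports "HOL-Analysis.Analysis"
begin

section \<open>Smooth manifolds and vector bundles\<close>

text \<open>For an open set \<open>S\<close>, \<open>Ck_on k S f\<close> says that \<open>f\<close> is of class \<open>C\<^sup>k\<close> on \<open>S\<close>.\<close>

primrec Ck_on :: "nat \<Rightarrow> 'a::euclidean_space set \<Rightarrow> ('a \<Rightarrow> 'b::real_normed_vector) \<Rightarrow> bool" where
  "Ck_on 0 S f \<longleftrightarrow> continuous_on S f"
| "Ck_on (Suc k) S f \<longleftrightarrow>
     (\<forall>x\<in>S. f differentiable (at x)) \<and> (\<forall>b\<in>Basis. Ck_on k S (\<lambda>x. frechet_derivative f (at x) b))"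

definition smooth_on :: "'a::euclidean_space set \<Rightarrow> ('a \<Rightarrow> 'b::real_normed_vector) \<Rightarrow> bool" where
  "smooth_on S f \<longleftrightarrow> (\<forall>k. Ck_on k S f)"

text \<open>A manifold is a Hausdorff, second countable type \<open>'m\<close> with an atlas of pairs
  \<open>(U, \<phi>)\<close>; only the values of \<open>\<phi>\<close> on \<open>U\<close> matter. \<open>is_chart\<close> describes the maximal atlas.\<close>

type_synonym ('m, 'n) atlas = "('m set \<times> ('m \<Rightarrow> real^'n)) set"

definition coord_system :: "'m::topological_space set \<Rightarrow> ('m \<Rightarrow> real^'n) \<Rightarrow> bool" where
  "coord_system U \<phi> \<longleftrightarrow> open U \<and> open (\<phi> ` U) \<and> homeomorphism U (\<phi> ` U) \<phi> (inv_into U \<phi>)"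

definition coord_compatible ::
  "'m set \<Rightarrow> ('m \<Rightarrow> real^'n) \<Rightarrow> 'm set \<Rightarrow> ('m \<Rightarrow> real^'n) \<Rightarrow> bool" where
  "coord_compatible U \<phi> V \<psi> \<longleftrightarrow>
     smooth_on (\<phi> ` (U \<inter> V)) (\<psi> \<circ> inv_into U \<phi>) \<and> smooth_on (\<psi> ` (U \<inter> V)) (\<phi> \<circ> inv_into V \<psi>)"

definition smooth_manifold ::
  "('m::{t2_space,second_countable_topology}, 'n::finite) atlas \<Rightarrow> bool" where
  "smooth_manifold M \<longleftrightarrow>
     (\<forall>(U, \<phi>)\<in>M. coord_system U \<phi>) \<and>
     (\<forall>(U, \<phi>)\<in>M. \<forall>(V, \<psi>)\<in>M. coord_compatible U \<phi> V \<psi>) \<and>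
     (\<Union>(U, \<phi>)\<in>M. U) = UNIV"

definition is_chart :: "('m::topological_space, 'n::finite) atlas \<Rightarrow> 'm set \<Rightarrow> ('m \<Rightarrow> real^'n) \<Rightarrow> bool" where
  "is_chart M U \<phi> \<longleftrightarrow> coord_system U \<phi> \<and> (\<forall>(V, \<psi>)\<in>M. coord_compatible U \<phi> V \<psi>)"

definition smooth_fun :: "('m::topological_space, 'n::finite) atlas \<Rightarrow> 'm set \<Rightarrow> ('m \<Rightarrow> real) \<Rightarrow> bool" where
  "smooth_fun M W f \<longleftrightarrow> (\<forall>(U, \<phi>)\<in>M. smooth_on (\<phi> ` (U \<inter> W)) (f \<circ> inv_into U \<phi>))"

definition pderiv_chart ::
  "'m set \<Rightarrow> ('m \<Rightarrow> real^'n) \<Rightarrow> 'n \<Rightarrow> ('m \<Rightarrow> real) \<Rightarrow> 'm \<Rightarrow> real" where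
  "pderiv_chart U \<phi> i f x = frechet_derivative (f \<circ> inv_into U \<phi>) (at (\<phi> x)) (axis i 1)"

text \<open>A vector bundle of rank \<open>CARD('r)\<close> over \<open>'m\<close>; its total space is
  \<open>{(x, v). v \<in> fibre E x}\<close>. A trivialisation \<open>(U, \<psi>)\<close> is the same as the local frame
  \<open>\<lambda>x. \<psi> x (axis a 1)\<close>, with fibre coordinates \<open>\<lambda>v. inv (\<psi> x) v $ a\<close>. Bijectivity and linearity
  of the trivialisations make every fibre a vector space under \<open>vadd\<close> and \<open>vscale\<close>.\<close>

record ('m, 'v, 'r) vbundle =
  fibre :: "'m \<Rightarrow> 'v set"
  vadd :: "'m \<Rightarrow> 'v \<Rightarrow> 'v \<Rightarrow> 'v"
  vscale :: "'m \<Rightarrow> real \<Rightarrow> 'v \<Rightarrow> 'v"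
  trivs :: "('m set \<times> ('m \<Rightarrow> real^'r \<Rightarrow> 'v)) set"

definition trivialisation ::
  "('m::topological_space, 'v, 'r::finite) vbundle \<Rightarrow> 'm set \<Rightarrow> ('m \<Rightarrow> real^'r \<Rightarrow> 'v) \<Rightarrow> bool" where
  "trivialisation E U \<psi> \<longleftrightarrow> open U \<and>
     (\<forall>x\<in>U. bij_betw (\<psi> x) UNIV (fibre E x) \<and>
        (\<forall>a b. \<psi> x (a + b) = vadd E x (\<psi> x a) (\<psi> x b)) \<and>
        (\<forall>t a. \<psi> x (t *\<^sub>R a) = vscale E x t (\<psi> x a)))"

text \<open>The fibre coordinates \<open>u\<close> of \<open>\<psi>\<close> and \<open>u'\<close> of \<open>\<psi>'\<close> satisfy
  \<open>u' a = (\<Sum>b. trans_mat \<psi> \<psi>' x a b * u b)\<close>.\<close>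

definition trans_mat ::
  "('m \<Rightarrow> real^'r \<Rightarrow> 'v) \<Rightarrow> ('m \<Rightarrow> real^'r \<Rightarrow> 'v) \<Rightarrow> 'm \<Rightarrow> 'r \<Rightarrow> 'r::finite \<Rightarrow> real" where
  "trans_mat \<psi> \<psi>' x a b = inv (\<psi>' x) (\<psi> x (axis b 1)) $ a"

definition triv_compatible ::
  "('m::topological_space, 'n::finite) atlas \<Rightarrow>
   'm set \<Rightarrow> ('m \<Rightarrow> real^'r::finite \<Rightarrow> 'v) \<Rightarrow> 'm set \<Rightarrow> ('m \<Rightarrow> real^'r \<Rightarrow> 'v) \<Rightarrow> bool" where
  "triv_compatible M U \<psi> V \<eta> \<longleftrightarrow>
     (\<forall>a b. smooth_fun M (U \<inter> V) (\<lambda>x. trans_mat \<psi> \<eta> x a b) \<and>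
            smooth_fun M (U \<inter> V) (\<lambda>x. trans_mat \<eta> \<psi> x a b))"

definition vector_bundle ::
  "('m::topological_space, 'n::finite) atlas \<Rightarrow> ('m, 'v, 'r::finite) vbundle \<Rightarrow> bool" where
  "vector_bundle M E \<longleftrightarrow>
     (\<forall>(U, \<psi>)\<in>trivs E. trivialisation E U \<psi>) \<and>
     (\<forall>(U, \<psi>)\<in>trivs E. \<forall>(V, \<eta>)\<in>trivs E. triv_compatible M U \<psi> V \<eta>) \<and>
     (\<Union>(U, \<psi>)\<in>trivs E. U) = UNIV"

definition local_triv ::
  "('m::topological_space, 'n::finite) atlas \<Rightarrow> ('m, 'v, 'r::finite) vbundle \<Rightarrow>
   'm set \<Rightarrow> ('m \<Rightarrow> real^'r \<Rightarrow> 'v) \<Rightarrow> bool" where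
  "local_triv M E U \<psi> \<longleftrightarrow>
     trivialisation E U \<psi> \<and> (\<forall>(V, \<eta>)\<in>trivs E. triv_compatible M U \<psi> V \<eta>)"

type_synonym ('m, 'w) lbundle = "('m, 'w, 1) vbundle"

text \<open>\<open>A\<^sup>* \<otimes> L\<close>, realised as the bundle of fibrewise linear maps from \<open>A\<close> to \<open>L\<close>.
  If \<open>\<psi>\<close> is the frame \<open>e\<close> and \<open>\<mu>\<close> a frame of \<open>L\<close>, then \<open>dual_triv A \<psi> \<mu>\<close> is the frame
  \<open>e\<^sub>a\<^sup>* \<otimes> \<mu>\<close>, i.e. \<open>v \<mapsto> u\<^sup>a(v) \<mu>\<close>.\<close>

definition dual_triv ::
  "('m, 'v, 'r::finite) vbundle \<Rightarrow> ('m \<Rightarrow> real^'r \<Rightarrow> 'v) \<Rightarrow> ('m \<Rightarrow> real^1 \<Rightarrow> 'w) \<Rightarrow>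
   'm \<Rightarrow> real^'r \<Rightarrow> 'v \<Rightarrow> 'w" where
  "dual_triv A \<psi> \<mu> x c = (\<lambda>v\<in>fibre A x. \<mu> x (\<chi> _. \<Sum>a\<in>UNIV. c $ a * inv (\<psi> x) v $ a))"

definition dagger ::
  "('m, 'v, 'r::finite) vbundle \<Rightarrow> ('m, 'w) lbundle \<Rightarrow> ('m, 'v \<Rightarrow> 'w, 'r) vbundle" where
  "dagger A L = \<lparr>
     fibre = (\<lambda>x. {f \<in> fibre A x \<rightarrow>\<^sub>E fibre L x.
        (\<forall>v\<in>fibre A x. \<forall>w\<in>fibre A x. f (vadd A x v w) = vadd L x (f v) (f w)) \<and>
        (\<forall>t. \<forall>v\<in>fibre A x. f (vscale A x t v) = vscale L x t (f v))}),
     vadd = (\<lambda>x f g. \<lambda>v\<in>fibre A x. vadd L x (f v) (g v)),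
     vscale = (\<lambda>x t f. \<lambda>v\<in>fibre A x. vscale L x t (f v)),
     trivs = {(U \<inter> V, dual_triv A \<psi> \<mu>) | U \<psi> V \<mu>. (U, \<psi>) \<in> trivs A \<and> (V, \<mu>) \<in> trivs L}\<rparr>"

text \<open>The canonical map from \<open>A\<close> to \<open>(A\<^sup>\<dagger>)\<^sup>\<dagger>\<close>, through which these bundles are identified.\<close>

definition bidual_ev ::
  "('m, 'v, 'r::finite) vbundle \<Rightarrow> ('m, 'w) lbundle \<Rightarrow> 'm \<Rightarrow> 'v \<Rightarrow> ('v \<Rightarrow> 'w) \<Rightarrow> 'w" where
  "bidual_ev A L x v = (\<lambda>f\<in>fibre (dagger A L) x. f v)"


section \<open>\<nat>-manifolds and their morphisms\<close>

text \<open>The structure sheaf over \<open>'m\<close>, with \<open>sect X W\<close> the algebra of functions over the open set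
  \<open>W\<close> (and \<open>sect X W = {}\<close> if \<open>W\<close> is not open), \<open>homog X k W\<close> its part of degree \<open>k\<close> and
  \<open>body X s x\<close> the value of \<open>s\<close> at the point \<open>x\<close>.\<close>

record ('m, 's) nman =
  sect :: "'m set \<Rightarrow> 's set"
  homog :: "nat \<Rightarrow> 'm set \<Rightarrow> 's set"
  restr :: "'m set \<Rightarrow> 's \<Rightarrow> 's"
  nadd :: "'s \<Rightarrow> 's \<Rightarrow> 's"
  nscale :: "real \<Rightarrow> 's \<Rightarrow> 's"
  nmult :: "'s \<Rightarrow> 's \<Rightarrow> 's"
  nunit :: "'m set \<Rightarrow> 's"
  body :: "'s \<Rightarrow> 'm \<Rightarrow> real"

text \<open>A morphism with source functions \<open>'s\<close> and target functions \<open>'t\<close>: \<open>pull F W\<close> maps the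
  functions over \<open>W\<close> on the target to functions over \<open>base F -` W\<close> on the source. It is kept
  extensional, so that equality of morphisms is equality of records.\<close>

record ('m, 's, 't) nmor =
  base :: "'m \<Rightarrow> 'm"
  pull :: "'m set \<Rightarrow> 't \<Rightarrow> 's"

definition is_nmor ::
  "('m::topological_space, 's) nman \<Rightarrow> ('m, 't) nman \<Rightarrow> ('m, 's, 't) nmor \<Rightarrow> bool" where
  "is_nmor X Y F \<longleftrightarrow>
     continuous_on UNIV (base F) \<and>
     (\<forall>W. pull F W \<in> extensional (sect Y W)) \<and>
     (\<forall>W. open W \<longrightarrow>
        pull F W ` sect Y W \<subseteq> sect X (base F -` W) \<and>
        (\<forall>k. pull F W ` homog Y k W \<subseteq> homog X k (base F -` W)) \<and>
        (\<forall>s\<in>sect Y W. \<forall>t\<in>sect Y W.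
           pull F W (nadd Y s t) = nadd X (pull F W s) (pull F W t) \<and>
           pull F W (nmult Y s t) = nmult X (pull F W s) (pull F W t)) \<and>
        (\<forall>r. \<forall>s\<in>sect Y W. pull F W (nscale Y r s) = nscale X r (pull F W s)) \<and>
        pull F W (nunit Y W) = nunit X (base F -` W) \<and>
        (\<forall>V s. open V \<and> V \<subseteq> W \<and> s \<in> sect Y W \<longrightarrow>
           pull F V (restr Y V s) = restr X (base F -` V) (pull F W s)) \<and>
        (\<forall>s\<in>sect Y W. \<forall>x\<in>base F -` W. body X (pull F W s) x = body Y s (base F x)))"

definition nid :: "('m, 's) nman \<Rightarrow> ('m, 's, 's) nmor" where
  "nid X = \<lparr>base = id, pull = (\<lambda>W. \<lambda>s\<in>sect X W. s)\<rparr>"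

text \<open>\<open>ncomp Z G F\<close> is \<open>G \<circ> F\<close>, where \<open>Z W\<close> is the set of functions over \<open>W\<close> on the target of
  \<open>G\<close>.\<close>

definition ncomp ::
  "('m set \<Rightarrow> 'z set) \<Rightarrow> ('m, 't, 'z) nmor \<Rightarrow> ('m, 's, 't) nmor \<Rightarrow> ('m, 's, 'z) nmor" where
  "ncomp Z G F = \<lparr>base = base G \<circ> base F,
     pull = (\<lambda>W. \<lambda>s\<in>Z W. pull F (base G -` W) (pull G W s))\<rparr>"

definition ndiffeo ::
  "('m::topological_space, 's) nman \<Rightarrow> ('m, 't) nman \<Rightarrow> ('m, 's, 't) nmor \<Rightarrow> bool" where
  "ndiffeo X Y F \<longleftrightarrow> is_nmor X Y F \<and>
     (\<exists>G. is_nmor Y X G \<and> ncomp (sect X) G F = nid X \<and> ncomp (sect Y) F G = nid Y)"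


section \<open>The local model\<close>

text \<open>The coordinates \<open>x\<^sup>i, u\<^sup>a, p\<^sub>a, p, p\<^sub>i\<close>, of degrees \<open>0, 1, 1, 2, 2\<close>.\<close>

datatype ('n, 'r) coord = CX 'n | CU 'r | CPU 'r | CP | CPX 'n

text \<open>The monomial \<open>u\<^sup>I p\<^sub>J p\<^sup>k \<Prod>\<^sub>i p\<^sub>i\<^sup>K\<^sup>i\<close>, with the odd factors in increasing order of
  their indices.\<close>

record ('n, 'r) smono =
  mU :: "'r set"
  mPU :: "'r set"
  mP :: nat
  mPX :: "'n \<Rightarrow> nat"

type_synonym ('n, 'r) spoly = "('n, 'r) smono \<Rightarrow> real"

definition mono_bidegree :: "('n::finite, 'r) smono \<Rightarrow> nat \<times> nat" where
  "mono_bidegree m =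
     (let e = mP m + (\<Sum>i\<in>UNIV. mPX m i) in (card (mPU m) + e, card (mU m) + e))"

definition mono_degree :: "('n::finite, 'r) smono \<Rightarrow> nat" where
  "mono_degree m = card (mU m) + card (mPU m) + 2 * (mP m + (\<Sum>i\<in>UNIV. mPX m i))"

definition one_mono :: "('n, 'r) smono" where
  "one_mono = \<lparr>mU = {}, mPU = {}, mP = 0, mPX = (\<lambda>_. 0)\<rparr>"

definition single :: "('n, 'r) smono \<Rightarrow> real \<Rightarrow> ('n, 'r) spoly" where
  "single m r = (\<lambda>m'. if m' = m then r else 0)"

text \<open>\<open>CX i\<close> is not a generator at a point of the base; its value there is supplied by
  \<open>local_coord\<close> below.\<close>

fun gen :: "('n, 'r) coord \<Rightarrow> ('n, 'r) spoly" where
  "gen (CX i) = (\<lambda>_. 0)"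
| "gen (CU a) = single (one_mono\<lparr>mU := {a}\<rparr>) 1"
| "gen (CPU a) = single (one_mono\<lparr>mPU := {a}\<rparr>) 1"
| "gen CP = single (one_mono\<lparr>mP := 1\<rparr>) 1"
| "gen (CPX i) = single (one_mono\<lparr>mPX := (\<lambda>j. if j = i then 1 else 0)\<rparr>) 1"

definition inversions :: "'r::linorder set \<Rightarrow> 'r set \<Rightarrow> nat" where
  "inversions S T = card {(s, t). s \<in> S \<and> t \<in> T \<and> t < s}"

definition mono_sign :: "('n, 'r::linorder) smono \<Rightarrow> ('n, 'r) smono \<Rightarrow> real" where
  "mono_sign m m' =
     (-1) ^ (card (mPU m) * card (mU m') + inversions (mU m) (mU m') + inversions (mPU m) (mPU m'))"

definition sp_mult :: "('n::finite, 'r::{finite,linorder}) spoly \<Rightarrow> ('n, 'r) spoly \<Rightarrow> ('n, 'r) spoly" where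
  "sp_mult f g = (\<lambda>m. \<Sum>(m1, m2) \<in> {(m1, m2).
       mU m1 \<inter> mU m2 = {} \<and> mPU m1 \<inter> mPU m2 = {} \<and>
       m = \<lparr>mU = mU m1 \<union> mU m2, mPU = mPU m1 \<union> mPU m2,
            mP = mP m1 + mP m2, mPX = (\<lambda>i. mPX m1 i + mPX m2 i)\<rparr>}.
     mono_sign m1 m2 * f m1 * g m2)"

definition mono_factors :: "('n::{finite,linorder}, 'r::{finite,linorder}) smono \<Rightarrow> ('n, 'r) coord list" where
  "mono_factors m =
     map CU (sorted_list_of_set (mU m)) @ map CPU (sorted_list_of_set (mPU m)) @
     replicate (mP m) CP @ concat (map (\<lambda>i. replicate (mPX m i) (CPX i)) (sorted_list_of_set UNIV))"

text \<open>Substitution of \<open>T z\<close> for each generator \<open>z\<close> in a polynomial.\<close>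

definition subst_sp ::
  "(('n, 'r) coord \<Rightarrow> ('n::{finite,linorder}, 'r::{finite,linorder}) spoly) \<Rightarrow>
   ('n, 'r) spoly \<Rightarrow> ('n, 'r) spoly" where
  "subst_sp T f = (\<lambda>m. \<Sum>m' | f m' \<noteq> 0.
     f m' * foldr sp_mult (map T (mono_factors m')) (single one_mono 1) m)"


section \<open>The \<nat>-manifold \<open>J\<^sup>1[2]L\<^sub>A\<close>\<close>

text \<open>Adapted coordinates are given by a chart of the base and frames of \<open>A\<close> and \<open>L\<close> over the
  same open set.\<close>

record ('m, 'n, 'r, 'v, 'w) achart =
  cdom :: "'m set"
  cmap :: "'m \<Rightarrow> real^'n"
  afr :: "'m \<Rightarrow> real^'r \<Rightarrow> 'v"
  lfr :: "'m \<Rightarrow> real^1 \<Rightarrow> 'w"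

definition adapted ::
  "('m::topological_space, 'n::finite) atlas \<Rightarrow> ('m, 'v, 'r::finite) vbundle \<Rightarrow> ('m, 'w) lbundle \<Rightarrow>
   ('m, 'n, 'r, 'v, 'w) achart \<Rightarrow> bool" where
  "adapted M A L c \<longleftrightarrow> is_chart M (cdom c) (cmap c) \<and>
     local_triv M A (cdom c) (afr c) \<and> local_triv M L (cdom c) (lfr c)"

abbreviation cpderiv :: "('m, 'n::finite, 'r::finite, 'v, 'w) achart \<Rightarrow> 'n \<Rightarrow> ('m \<Rightarrow> real) \<Rightarrow> 'm \<Rightarrow> real" where
  "cpderiv c \<equiv> pderiv_chart (cdom c) (cmap c)"

text \<open>The coordinates of \<open>c'\<close> expressed through those of \<open>c\<close> at a common point \<open>x\<close> of the base.
  With \<open>u' = g u\<close>, \<open>h = g\<^sup>-\<^sup>1\<close> and \<open>f' = l f\<close> for the components of a section with respect to the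
  frames of \<open>L\<close>, the chain rule applied to \<open>f'(x', u') = l(x) f(x, h u')\<close> gives
  \<open>p' = l p\<close>, \<open>p'\<^sub>a = l h\<^sup>b\<^sub>a p\<^sub>b\<close> and
  \<open>p'\<^sub>i = l (\<partial>x\<^sup>j/\<partial>x'\<^sup>i) p\<^sub>j + (\<partial>l/\<partial>x'\<^sup>i) p + l (\<partial>h\<^sup>b\<^sub>a/\<partial>x'\<^sup>i) u'\<^sup>a p\<^sub>b\<close>, with left derivatives
  \<open>p\<^sub>b\<close> in the odd directions. The shift of the fibre degrees by 2 does not affect these formulas.\<close>

definition u_change ::
  "('m, 'n::finite, 'r::finite, 'v, 'w) achart \<Rightarrow> ('m, 'n, 'r, 'v, 'w) achart \<Rightarrow> 'm \<Rightarrow>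
   'r \<Rightarrow> ('n, 'r) spoly" where
  "u_change c c' x a = (\<lambda>m. \<Sum>b\<in>UNIV. trans_mat (afr c) (afr c') x a b * gen (CU b) m)"

fun jet_change ::
  "('m, 'n, 'r, 'v, 'w) achart \<Rightarrow> ('m, 'n, 'r, 'v, 'w) achart \<Rightarrow> 'm \<Rightarrow>
   ('n::finite, 'r::{finite,linorder}) coord \<Rightarrow> ('n, 'r) spoly" where
  "jet_change c c' x (CX i) = (\<lambda>_. 0)"
| "jet_change c c' x (CU a) = u_change c c' x a"
| "jet_change c c' x (CPU a) = (\<lambda>m. \<Sum>b\<in>UNIV.
     trans_mat (lfr c) (lfr c') x 1 1 * trans_mat (afr c') (afr c) x b a * gen (CPU b) m)"
| "jet_change c c' x CP = (\<lambda>m. trans_mat (lfr c) (lfr c') x 1 1 * gen CP m)"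
| "jet_change c c' x (CPX i) = (\<lambda>m.
     (\<Sum>j\<in>UNIV. trans_mat (lfr c) (lfr c') x 1 1 *
         cpderiv c' i (\<lambda>y. cmap c y $ j) x * gen (CPX j) m) +
     cpderiv c' i (\<lambda>y. trans_mat (lfr c) (lfr c') y 1 1) x * gen CP m +
     (\<Sum>a\<in>UNIV. \<Sum>b\<in>UNIV. trans_mat (lfr c) (lfr c') x 1 1 *
         cpderiv c' i (\<lambda>y. trans_mat (afr c') (afr c) y b a) x *
         sp_mult (u_change c c' x a) (gen (CPU b)) m))"

text \<open>A function over \<open>W\<close> is given by its expressions in all adapted coordinates, as polynomials
  in the coordinates of positive degree with smooth coefficients, which are related by the
  coordinate changes. The expressions are set to 0 outside \<open>W \<inter> cdom c\<close>. As functions are finite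
  sums of homogeneous ones, the degree is bounded.\<close>

type_synonym ('m, 'n, 'r, 'v, 'w) jfun = "('m, 'n, 'r, 'v, 'w) achart \<Rightarrow> 'm \<Rightarrow> ('n, 'r) spoly"

definition jet_fun ::
  "('m::topological_space, 'n::{finite,linorder}) atlas \<Rightarrow> ('m, 'v, 'r::{finite,linorder}) vbundle \<Rightarrow>
   ('m, 'w) lbundle \<Rightarrow> 'm set \<Rightarrow> ('m, 'n, 'r, 'v, 'w) jfun set" where
  "jet_fun M A L W = {s. open W \<and>
     (\<forall>c x m. \<not> (adapted M A L c \<and> x \<in> W \<inter> cdom c) \<longrightarrow> s c x m = 0) \<and>
     (\<forall>c m. adapted M A L c \<longrightarrow> smooth_fun M (W \<inter> cdom c) (\<lambda>x. s c x m)) \<and>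
     (\<exists>k. \<forall>c x m. s c x m \<noteq> 0 \<longrightarrow> mono_degree m \<le> k) \<and>
     (\<forall>c c'. adapted M A L c \<and> adapted M A L c' \<longrightarrow>
        (\<forall>x\<in>W \<inter> cdom c \<inter> cdom c'. s c x = subst_sp (jet_change c c' x) (s c' x)))}"

definition jet_bidegree ::
  "('m::topological_space, 'n::{finite,linorder}) atlas \<Rightarrow> ('m, 'v, 'r::{finite,linorder}) vbundle \<Rightarrow>
   ('m, 'w) lbundle \<Rightarrow> 'm set \<Rightarrow> nat \<Rightarrow> nat \<Rightarrow> ('m, 'n, 'r, 'v, 'w) jfun set" where
  "jet_bidegree M A L W \<epsilon> \<delta> =
     {s \<in> jet_fun M A L W. \<forall>c x m. s c x m \<noteq> 0 \<longrightarrow> mono_bidegree m = (\<epsilon>, \<delta>)}"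

text \<open>The coefficient of the unit monomial is the same in all adapted coordinates around a point,
  so the choice in \<open>body\<close> is immaterial.\<close>

definition jet_manifold ::
  "('m::topological_space, 'n::{finite,linorder}) atlas \<Rightarrow> ('m, 'v, 'r::{finite,linorder}) vbundle \<Rightarrow>
   ('m, 'w) lbundle \<Rightarrow> ('m, ('m, 'n, 'r, 'v, 'w) jfun) nman" where
  "jet_manifold M A L = \<lparr>
     sect = jet_fun M A L,
     homog = (\<lambda>k W. {s \<in> jet_fun M A L W. \<forall>c x m. s c x m \<noteq> 0 \<longrightarrow> mono_degree m = k}),
     restr = (\<lambda>W s c x m. if x \<in> W then s c x m else 0),
     nadd = (\<lambda>s t c x m. s c x m + t c x m),
     nscale = (\<lambda>r s c x m. r * s c x m),
     nmult = (\<lambda>s t c x. sp_mult (s c x) (t c x)),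
     nunit = (\<lambda>W c x. if adapted M A L c \<and> x \<in> W \<inter> cdom c then single one_mono 1 else (\<lambda>_. 0)),
     body = (\<lambda>s x. s (SOME c. adapted M A L c \<and> x \<in> cdom c) x one_mono)\<rparr>"

definition local_coord ::
  "('m, 'n::finite, 'r::finite, 'v, 'w) achart \<Rightarrow> ('n, 'r) coord \<Rightarrow> 'm \<Rightarrow> ('n, 'r) spoly" where
  "local_coord c z x = (case z of CX i \<Rightarrow> single one_mono (cmap c x $ i) | _ \<Rightarrow> gen z)"

text \<open>The function over \<open>cdom c\<close> whose expression in the coordinates \<open>c\<close> is \<open>h\<close>.\<close>

definition jet_fun_of ::
  "('m::topological_space, 'n::{finite,linorder}) atlas \<Rightarrow> ('m, 'v, 'r::{finite,linorder}) vbundle \<Rightarrow>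
   ('m, 'w) lbundle \<Rightarrow> ('m, 'n, 'r, 'v, 'w) achart \<Rightarrow> ('m \<Rightarrow> ('n, 'r) spoly) \<Rightarrow>
   ('m, 'n, 'r, 'v, 'w) jfun" where
  "jet_fun_of M A L c h = (\<lambda>c' x. if adapted M A L c' \<and> x \<in> cdom c \<inter> cdom c'
     then subst_sp (jet_change c' c x) (h x) else (\<lambda>_. 0))"

definition coord_fun ::
  "('m::topological_space, 'n::{finite,linorder}) atlas \<Rightarrow> ('m, 'v, 'r::{finite,linorder}) vbundle \<Rightarrow>
   ('m, 'w) lbundle \<Rightarrow> ('m, 'n, 'r, 'v, 'w) achart \<Rightarrow> ('n, 'r) coord \<Rightarrow>
   ('m, 'n, 'r, 'v, 'w) jfun" where
  "coord_fun M A L c z = jet_fun_of M A L c (local_coord c z)"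


section \<open>The contact structure\<close>

text \<open>A 1-form \<open>\<Sum>\<^sub>z \<omega>\<^sub>z dz\<close> in the coordinates \<open>c\<close> is given by the coefficients \<open>\<omega>\<^sub>z\<close> (on the left).
  With signs by total degree, \<open>df = \<Sum>\<^sub>z dz \<partial>f/\<partial>z\<close> for the left derivatives, and moving \<open>dz\<close>, of degree
  \<open>\<bar>z\<bar> + 1\<close>, to the right produces a sign if \<open>z\<close> is even and \<open>\<partial>f/\<partial>z\<close> is odd. For instance
  \<open>d(u\<^sup>a p\<^sub>b) = p\<^sub>b du\<^sup>a - u\<^sup>a dp\<^sub>b\<close>. The coefficient of \<open>dz\<close> at \<open>x\<close> is \<open>sdiff c f z x\<close>.\<close>

definition parity_sign :: "('n, 'r) smono \<Rightarrow> real" where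
  "parity_sign m = (-1) ^ (card (mU m) + card (mPU m))"

fun sdiff ::
  "('m, 'n, 'r, 'v, 'w) achart \<Rightarrow> ('m \<Rightarrow> ('n::finite, 'r::{finite,linorder}) spoly) \<Rightarrow>
   ('n, 'r) coord \<Rightarrow> 'm \<Rightarrow> ('n, 'r) spoly" where
  "sdiff c f (CX i) x = (\<lambda>m. parity_sign m * cpderiv c i (\<lambda>y. f y m) x)"
| "sdiff c f (CU a) x = (\<lambda>m. if a \<in> mU m then 0
     else (-1) ^ card {b \<in> mU m. b < a} * f x (m\<lparr>mU := insert a (mU m)\<rparr>))"
| "sdiff c f (CPU a) x = (\<lambda>m. if a \<in> mPU m then 0
     else (-1) ^ (card (mU m) + card {b \<in> mPU m. b < a}) * f x (m\<lparr>mPU := insert a (mPU m)\<rparr>))"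
| "sdiff c f CP x = (\<lambda>m. parity_sign m * real (mP m + 1) * f x (m\<lparr>mP := mP m + 1\<rparr>))"
| "sdiff c f (CPX i) x = (\<lambda>m.
     parity_sign m * real (mPX m i + 1) * f x (m\<lparr>mPX := (mPX m)(i := mPX m i + 1)\<rparr>))"

text \<open>The component of the Cartan contact form with respect to \<open>\<mu>\<close>.\<close>

fun contact_form :: "('n, 'r) coord \<Rightarrow> ('n, 'r) spoly" where
  "contact_form CP = single one_mono 1"
| "contact_form (CX i) = (\<lambda>m. - gen (CPX i) m)"
| "contact_form (CU a) = (\<lambda>m. - gen (CPU a) m)"
| "contact_form (CPX i) = (\<lambda>_. 0)"
| "contact_form (CPU a) = (\<lambda>_. 0)"

text \<open>The expression in the coordinates \<open>c\<close> of \<open>F\<^sup>* \<omega> = \<Sum>\<^sub>w F\<^sup>* \<omega>\<^sub>w d(F\<^sup>* w)\<close>, for a 1-form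
  \<open>\<omega> = \<Sum>\<^sub>w \<omega>\<^sub>w dw\<close> in the coordinates \<open>d\<close> of the target \<open>J\<^sup>1[2]L\<^sub>B\<close>.\<close>

definition pull_form ::
  "('m::topological_space, 'n::{finite,linorder}) atlas \<Rightarrow> ('m, 'b, 'r::{finite,linorder}) vbundle \<Rightarrow>
   ('m, 'w) lbundle \<Rightarrow> ('m, ('m, 'n, 'r, 'v, 'w) jfun, ('m, 'n, 'r, 'b, 'w) jfun) nmor \<Rightarrow>
   ('m, 'n, 'r, 'b, 'w) achart \<Rightarrow> (('n, 'r) coord \<Rightarrow> 'm \<Rightarrow> ('n, 'r) spoly) \<Rightarrow>
   ('m, 'n, 'r, 'v, 'w) achart \<Rightarrow> ('n, 'r) coord \<Rightarrow> 'm \<Rightarrow> ('n, 'r) spoly" where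
  "pull_form M B L F d \<omega> c z x = (\<lambda>m. \<Sum>w\<in>UNIV. sp_mult
     (pull F (cdom d) (jet_fun_of M B L d (\<omega> w)) c x)
     (sdiff c (pull F (cdom d) (coord_fun M B L d w) c) z x) m)"

text \<open>The conformal factor, with respect to frames of \<open>L\<close>, is an invertible function; it is of
  degree 0 since \<open>F\<^sup>*\<close> preserves the degree.\<close>

definition contactomorphism ::
  "('m::topological_space, 'n::{finite,linorder}) atlas \<Rightarrow> ('m, 'v, 'r::{finite,linorder}) vbundle \<Rightarrow>
   ('m, 'b, 'r) vbundle \<Rightarrow> ('m, 'w) lbundle \<Rightarrow>
   ('m, ('m, 'n, 'r, 'v, 'w) jfun, ('m, 'n, 'r, 'b, 'w) jfun) nmor \<Rightarrow> bool" where
  "contactomorphism M A B L F \<longleftrightarrow>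
     ndiffeo (jet_manifold M A L) (jet_manifold M B L) F \<and>
     (\<forall>c d. adapted M A L c \<and> adapted M B L d \<longrightarrow>
        (\<exists>\<rho>. smooth_fun M (cdom c \<inter> base F -` cdom d) \<rho> \<and>
           (\<forall>x\<in>cdom c \<inter> base F -` cdom d. \<rho> x \<noteq> 0 \<and>
              (\<forall>z m. pull_form M B L F d (\<lambda>w _. contact_form w) c z x m = \<rho> x * contact_form z m))))"


section \<open>The two projections\<close>

text \<open>\<open>C\<^sup>\<infinity>(E[1])\<close> over \<open>W\<close>, i.e. sections of the exterior algebra of \<open>E\<^sup>*\<close>, as inhomogeneous
  alternating multilinear forms on the fibres: \<open>\<omega> x\<close> is evaluated at lists of vectors of
  any length.\<close>

definition ext_fun ::
  "('m::topological_space, 'n::finite) atlas \<Rightarrow> ('m, 'v, 'r::finite) vbundle \<Rightarrow> 'm set \<Rightarrow>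
   ('m \<Rightarrow> 'v list \<Rightarrow> real) set" where
  "ext_fun M E W = {\<omega>. open W \<and>
     (\<forall>x vs. \<not> (x \<in> W \<and> set vs \<subseteq> fibre E x) \<longrightarrow> \<omega> x vs = 0) \<and>
     (\<forall>x\<in>W. \<forall>us ws. set us \<subseteq> fibre E x \<and> set ws \<subseteq> fibre E x \<longrightarrow>
        (\<forall>v\<in>fibre E x.
          (\<forall>v'\<in>fibre E x. \<omega> x (us @ vadd E x v v' # ws) = \<omega> x (us @ v # ws) + \<omega> x (us @ v' # ws)) \<and>
          (\<forall>t. \<omega> x (us @ vscale E x t v # ws) = t * \<omega> x (us @ v # ws)))) \<and>
     (\<forall>x\<in>W. \<forall>vs. set vs \<subseteq> fibre E x \<and> \<not> distinct vs \<longrightarrow> \<omega> x vs = 0) \<and>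
     (\<forall>U \<psi>. local_triv M E U \<psi> \<longrightarrow>
        (\<forall>as. smooth_fun M (W \<inter> U) (\<lambda>x. \<omega> x (map (\<lambda>a. \<psi> x (axis a 1)) as))))}"

text \<open>\<open>\<pi>\<^sup>* \<omega> = \<Sum>\<^sub>I \<omega>(e\<^sub>I) u\<^sup>I\<close>.\<close>

definition pi_proj ::
  "('m::topological_space, 'n::{finite,linorder}) atlas \<Rightarrow> ('m, 'v, 'r::{finite,linorder}) vbundle \<Rightarrow>
   ('m, 'w) lbundle \<Rightarrow> ('m, ('m, 'n, 'r, 'v, 'w) jfun, 'm \<Rightarrow> 'v list \<Rightarrow> real) nmor" where
  "pi_proj M A L = \<lparr>base = id, pull = (\<lambda>W. \<lambda>\<omega>\<in>ext_fun M A W. \<lambda>c x m.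
     if adapted M A L c \<and> x \<in> W \<inter> cdom c \<and> m = one_mono\<lparr>mU := mU m\<rparr>
     then \<omega> x (map (\<lambda>a. afr c x (axis a 1)) (sorted_list_of_set (mU m))) else 0)\<rparr>"

text \<open>\<open>\<tau>\<^sup>* \<omega> = \<Sum>\<^sub>J \<omega>(e\<^sup>\<dagger>\<^sub>J) p\<^sub>J\<close> for the frame \<open>e\<^sup>\<dagger>\<^sub>a = e\<^sub>a\<^sup>* \<otimes> \<mu>\<close>; in particular \<open>\<tau>\<^sup>*\<close> maps the
  fibre coordinates of \<open>A\<^sup>\<dagger>[1]\<close> to \<open>p\<^sub>a\<close>.\<close>

definition tau_proj ::
  "('m::topological_space, 'n::{finite,linorder}) atlas \<Rightarrow> ('m, 'v, 'r::{finite,linorder}) vbundle \<Rightarrow>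
   ('m, 'w) lbundle \<Rightarrow> ('m, ('m, 'n, 'r, 'v, 'w) jfun, 'm \<Rightarrow> ('v \<Rightarrow> 'w) list \<Rightarrow> real) nmor" where
  "tau_proj M A L = \<lparr>base = id, pull = (\<lambda>W. \<lambda>\<omega>\<in>ext_fun M (dagger A L) W. \<lambda>c x m.
     if adapted M A L c \<and> x \<in> W \<inter> cdom c \<and> m = one_mono\<lparr>mPU := mPU m\<rparr>
     then \<omega> x (map (\<lambda>a. dual_triv A (afr c) (lfr c) x (axis a 1)) (sorted_list_of_set (mPU m)))
     else 0)\<rparr>"

text \<open>The isomorphism \<open>(A\<^sup>\<dagger>)\<^sup>\<dagger>[1] \<rightarrow> A[1]\<close> induced by \<open>bidual_ev\<close>, and the projection
  \<open>J\<^sup>1[2]L \<rightarrow> A[1]\<close> for the bundle \<open>A\<^sup>\<dagger>\<close> obtained from it.\<close>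

definition bidual_iso ::
  "('m::topological_space, 'n::finite) atlas \<Rightarrow> ('m, 'v, 'r::finite) vbundle \<Rightarrow> ('m, 'w) lbundle \<Rightarrow>
   ('m, 'm \<Rightarrow> (('v \<Rightarrow> 'w) \<Rightarrow> 'w) list \<Rightarrow> real, 'm \<Rightarrow> 'v list \<Rightarrow> real) nmor" where
  "bidual_iso M A L = \<lparr>base = id, pull = (\<lambda>W. \<lambda>\<omega>\<in>ext_fun M A W. \<lambda>x \<xi>s.
     if set \<xi>s \<subseteq> fibre (dagger (dagger A L) L) x
     then \<omega> x (map (inv_into (fibre A x) (bidual_ev A L x)) \<xi>s) else 0)\<rparr>"

definition tau_tilde ::
  "('m::topological_space, 'n::{finite,linorder}) atlas \<Rightarrow> ('m, 'v, 'r::{finite,linorder}) vbundle \<Rightarrow>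
   ('m, 'w) lbundle \<Rightarrow> ('m, ('m, 'n, 'r, 'v \<Rightarrow> 'w, 'w) jfun, 'm \<Rightarrow> 'v list \<Rightarrow> real) nmor" where
  "tau_tilde M A L = ncomp (ext_fun M A) (bidual_iso M A L) (tau_proj M (dagger A L) L)"


section \<open>The contact Legendre transform\<close>

definition swaps_bidegree ::
  "('m::topological_space, 'n::{finite,linorder}) atlas \<Rightarrow> ('m, 'v, 'r::{finite,linorder}) vbundle \<Rightarrow>
   ('m, 'b, 'r) vbundle \<Rightarrow> ('m, 'w) lbundle \<Rightarrow>
   ('m, ('m, 'n, 'r, 'v, 'w) jfun, ('m, 'n, 'r, 'b, 'w) jfun) nmor \<Rightarrow> bool" where
  "swaps_bidegree M A B L F \<longleftrightarrow>
     (\<forall>\<epsilon> \<delta>. pull F UNIV ` jet_bidegree M B L UNIV \<epsilon> \<delta> = jet_bidegree M A L UNIV \<delta> \<epsilon>)"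

definition contact_legendre ::
  "('m::topological_space, 'n::{finite,linorder}) atlas \<Rightarrow> ('m, 'v, 'r::{finite,linorder}) vbundle \<Rightarrow>
   ('m, 'w) lbundle \<Rightarrow>
   ('m, ('m, 'n, 'r, 'v, 'w) jfun, ('m, 'n, 'r, 'v \<Rightarrow> 'w, 'w) jfun) nmor \<Rightarrow> bool" where
  "contact_legendre M A L F \<longleftrightarrow>
     contactomorphism M A (dagger A L) L F \<and>
     swaps_bidegree M A (dagger A L) L F \<and>
     ncomp (ext_fun M A) (tau_tilde M A L) F = pi_proj M A L \<and>
     ncomp (ext_fun M (dagger A L)) (pi_proj M (dagger A L) L) F = tau_proj M A L"

text \<open>The adapted coordinates of \<open>A\<^sup>\<dagger>\<close> corresponding to \<open>c\<close>.\<close>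

definition dual_chart ::
  "('m, 'v, 'r::finite) vbundle \<Rightarrow> ('m, 'n::finite, 'r, 'v, 'w) achart \<Rightarrow> ('m, 'n, 'r, 'v \<Rightarrow> 'w, 'w) achart" where
  "dual_chart A c = \<lparr>cdom = cdom c, cmap = cmap c, afr = dual_triv A (afr c) (lfr c), lfr = lfr c\<rparr>"

end

theory Submission
  imports Defs "HOL-Combinatorics.Multiset_Permutations"
begin

text \<open>In adapted coordinates put \<open>\<Lambda> u\<^sup>a = p\<^sub>a\<close>, \<open>\<Lambda> p\<^sub>a = u\<^sup>a\<close>, \<open>\<Lambda> p = p - u\<^sup>a p\<^sub>a\<close>, \<open>\<Lambda> p\<^sub>i = p\<^sub>i\<close>. This substitution
  is an involution, and it intertwines the coordinate changes of \<open>J\<^sup>1[2]L\<^sub>A\<close> with those of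
  \<open>J\<^sup>1[2]L\<close> for \<open>A\<^sup>\<dagger>\<close>: the derivative of \<open>l\<close> in the change of \<open>p\<^sub>i\<close> is what the derivatives of the dual
  frames \<open>l g\<^sup>-\<^sup>1\<close> compensate. Hence the local substitutions glue to a diffeomorphism, for which the remaining
  properties are checked in coordinates.

  For uniqueness, the projections determine the pull-backs of \<open>x\<^sup>i, u\<^sup>a, p\<^sub>a\<close>. If \<open>P\<close> is the pull-back of
  \<open>p\<close> and \<open>\<rho>\<close> the conformal factor, the contact condition prescribes all derivatives of \<open>P\<close> in the
  directions of positive degree: \<open>\<partial>P/\<partial>p = \<rho>\<close>, \<open>\<partial>P/\<partial>p\<^sub>i = 0\<close>, \<open>\<partial>P/\<partial>u\<^sup>a = -\<rho> p\<^sub>a\<close> and \<open>\<partial>P/\<partial>p\<^sub>a = u\<^sup>a\<close> (in the sign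
  conventions for left coefficients). The mixed second derivative gives \<open>\<rho> = 1\<close>, so
  \<open>P = p - u\<^sup>a p\<^sub>a\<close>, and the coefficient of \<open>dx\<^sup>i\<close> then gives the pull-back of \<open>p\<^sub>i\<close>.\<close>

section \<open>The superalgebra of polynomials\<close>

text \<open>A function on the jet manifold is a family of expressions, one for each adapted chart,
  so a morphism has to be given in all charts at once. Each chart of \<open>A\<close> has a dual
  one, but the inverse and the contact condition start from an arbitrary chart of
  \<open>dagger A L\<close>; such a chart is dual to a chart of \<open>A\<close> only by way of the
  bidual, so frames of \<open>A\<close> and of its bidual must be compared. The quadratic term of
  \<Lambda> comes from the Leibniz rule d(u^a p_a) = p_a du^a - u^a dp_a: it turns dp - p_a du^a
  into d(p - u^a p_a) - u^a dp_a, so that the contact forms of corresponding charts agree exactly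
  and the conformal factor is only a change of frame of \<open>L\<close>. Passing from coordinates
  to all functions takes no Taylor expansion: bounded degree makes a function over a chart a finite
  sum of monomials with smooth coefficients, and these coefficients, being functions of the base,
  are themselves pulled back along the projections. Substitution sums over the support of a
  polynomial, and a sum over an infinite set is 0 by convention, so finiteness of supports is
  carried along throughout.\<close>

lemma inversions_Un_left:
  fixes S S' T :: "'r::{finite,linorder} set"
  assumes "S \<inter> S' = {}"
  shows "inversions (S \<union> S') T = inversions S T + inversions S' T"
proof -
  have "{(s, t). s \<in> S \<union> S' \<and> t \<in> T \<and> t < s} =
      {(s, t). s \<in> S \<and> t \<in> T \<and> t < s} \<union> {(s, t). s \<in> S' \<and> t \<in> T \<and> t < s}"
    by auto
  then show ?thesis
    unfolding inversions_def using assms by (subst card_Un_disjoint[symmetric]) (auto intro: finite)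
qed

lemma inversions_Un_right:
  fixes S T T' :: "'r::{finite,linorder} set"
  assumes "T \<inter> T' = {}"
  shows "inversions S (T \<union> T') = inversions S T + inversions S T'"
proof -
  have "{(s, t). s \<in> S \<and> t \<in> T \<union> T' \<and> t < s} =
      {(s, t). s \<in> S \<and> t \<in> T \<and> t < s} \<union> {(s, t). s \<in> S \<and> t \<in> T' \<and> t < s}"
    by auto
  then show ?thesis
    unfolding inversions_def using assms by (subst card_Un_disjoint[symmetric]) (auto intro: finite)
qed

text \<open>Disjointness excludes ties, so each pair in \<open>S \<times> T\<close> is counted by
  exactly one of the two numbers. This is where the sign of supercommutation comes from.\<close>

lemma inversions_add_commute:
  fixes S T :: "'r::{finite,linorder} set"
  assumes "S \<inter> T = {}"
  shows "inversions S T + inversions T S = card S * card T"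
proof -
  let ?A = "{(s, t). s \<in> S \<and> t \<in> T \<and> t < s}" and ?B = "{(t, s). t \<in> T \<and> s \<in> S \<and> s < t}"
  have "S \<times> T = ?A \<union> prod.swap ` ?B"
    using assms by (auto simp: image_iff)
  moreover have "?A \<inter> prod.swap ` ?B = {}"
    by auto
  ultimately have "card (S \<times> T) = card ?A + card (prod.swap ` ?B)"
    by (simp add: card_Un_disjoint finite)
  also have "card (prod.swap ` ?B) = card ?B"
    by (rule card_image) (auto simp: inj_on_def)
  finally show ?thesis
    by (simp add: inversions_def card_cartesian_product)
qed

lemma inversions_empty [simp]: "inversions {} T = 0" "inversions S {} = 0"
  by (simp_all add: inversions_def)

lemma inversions_singleton:
  "inversions {s} T = card {t \<in> T. t < s}"
proof -
  have "{(s', t). s' \<in> {s} \<and> t \<in> T \<and> t < s'} = Pair s ` {t \<in> T. t < s}" by auto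
  then show ?thesis unfolding inversions_def by (simp add: card_image inj_on_def)
qed

text \<open>The product of monomials without its sign. If an odd factor is repeated the union is
  meaningless, and \<open>msgn\<close> suppresses it.\<close>

definition madd :: "('n, 'r) smono \<Rightarrow> ('n, 'r) smono \<Rightarrow> ('n, 'r) smono" where
  "madd a b = \<lparr>mU = mU a \<union> mU b, mPU = mPU a \<union> mPU b,
     mP = mP a + mP b, mPX = (\<lambda>i. mPX a i + mPX b i)\<rparr>"

text \<open>Extending the sign by 0 to repeated odd factors lets the product run over all
  factorisations \<open>madd a b = m\<close>, so that associativity becomes an identity for
  signs.\<close>

definition msgn :: "('n, 'r::linorder) smono \<Rightarrow> ('n, 'r) smono \<Rightarrow> real" where
  "msgn a b = (if mU a \<inter> mU b = {} \<and> mPU a \<inter> mPU b = {} then mono_sign a b else 0)"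

lemma madd_sel [simp]:
  "mU (madd a b) = mU a \<union> mU b" "mPU (madd a b) = mPU a \<union> mPU b"
  "mP (madd a b) = mP a + mP b" "mPX (madd a b) = (\<lambda>i. mPX a i + mPX b i)"
  by (simp_all add: madd_def)

lemma madd_assoc: "madd (madd a b) c = madd a (madd b c)"
  by (simp add: madd_def Un_assoc add.assoc)

lemma madd_commute: "madd a b = madd b a"
  by (simp add: madd_def Un_commute add.commute)

lemma madd_one [simp]: "madd one_mono a = a" "madd a one_mono = a"
  by (simp_all add: madd_def one_mono_def)

lemma one_mono_sel [simp]:
  "mU one_mono = {}" "mPU one_mono = {}" "mP one_mono = 0" "mPX one_mono = (\<lambda>_. 0)"
  by (simp_all add: one_mono_def)

lemma msgn_one [simp]: "msgn one_mono a = 1" "msgn a one_mono = 1"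
  by (simp_all add: msgn_def mono_sign_def)

text \<open>The 2-cocycle condition behind associativity. Cardinalities and inversion numbers are
  additive over disjoint unions, so both exponents are the same sum; if two of the three monomials
  share an odd factor, both sides vanish.\<close>

lemma msgn_cocycle:
  fixes a b c :: "('n, 'r::{finite,linorder}) smono"
  shows "msgn a b * msgn (madd a b) c = msgn b c * msgn a (madd b c)"
proof (cases "mU a \<inter> mU b = {} \<and> mU a \<inter> mU c = {} \<and> mU b \<inter> mU c = {} \<and>
    mPU a \<inter> mPU b = {} \<and> mPU a \<inter> mPU c = {} \<and> mPU b \<inter> mPU c = {}")
  case True
  then have "card (mU b \<union> mU c) = card (mU b) + card (mU c)"
    "card (mPU a \<union> mPU b) = card (mPU a) + card (mPU b)"
    by (simp_all add: card_Un_disjoint)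
  note cards = this
  have inv: "inversions (mU a \<union> mU b) (mU c) = inversions (mU a) (mU c) + inversions (mU b) (mU c)"
    "inversions (mPU a \<union> mPU b) (mPU c) = inversions (mPU a) (mPU c) + inversions (mPU b) (mPU c)"
    "inversions (mU a) (mU b \<union> mU c) = inversions (mU a) (mU b) + inversions (mU a) (mU c)"
    "inversions (mPU a) (mPU b \<union> mPU c) = inversions (mPU a) (mPU b) + inversions (mPU a) (mPU c)"
    using True by (blast intro: inversions_Un_left inversions_Un_right)+
  have "mono_sign a b * mono_sign (madd a b) c = mono_sign b c * mono_sign a (madd b c)"
    unfolding mono_sign_def madd_sel power_add[symmetric] cards inv add_mult_distrib add_mult_distrib2
    by (simp only: add_ac)
  moreover have "(mU a \<union> mU b) \<inter> mU c = {}" "(mPU a \<union> mPU b) \<inter> mPU c = {}"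
    "mU a \<inter> (mU b \<union> mU c) = {}" "mPU a \<inter> (mPU b \<union> mPU c) = {}"
    using True by auto
  ultimately show ?thesis
    using True by (simp add: msgn_def)
next
  case False
  then have "\<not> (mU a \<inter> mU b = {} \<and> mPU a \<inter> mPU b = {} \<and>
      (mU a \<union> mU b) \<inter> mU c = {} \<and> (mPU a \<union> mPU b) \<inter> mPU c = {})"
    "\<not> (mU b \<inter> mU c = {} \<and> mPU b \<inter> mPU c = {} \<and>
      mU a \<inter> (mU b \<union> mU c) = {} \<and> mPU a \<inter> (mPU b \<union> mPU c) = {})"
    by blast+
  then show ?thesis
    by (simp add: msgn_def) metis
qed

text \<open>The exponents of a factor are bounded by those of \<open>m\<close>, and only finitely
  many sets of odd indices exist. Hence the product is meaningful even for polynomials of infinite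
  support, which the type allows.\<close>

lemma finite_madd_fibre:
  "finite {(a, b). madd a b = (m :: ('n::finite, 'r::finite) smono)}"
proof -
  let ?F = "\<lambda>(U, P, k, X). \<lparr>mU = U, mPU = P, mP = k, mPX = X\<rparr> :: ('n, 'r) smono"
  let ?X = "PiE UNIV (\<lambda>i. {..mPX m i})"
  let ?D = "?F ` (UNIV \<times> UNIV \<times> {..mP m} \<times> ?X)"
  have "a \<in> ?D" if "mP a \<le> mP m" "\<And>i. mPX a i \<le> mPX m i" for a :: "('n, 'r) smono"
    using that by (intro image_eqI[of _ _ "(mU a, mPU a, mP a, mPX a)"]) (auto simp: PiE_def)
  then have "{(a, b). madd a b = m} \<subseteq> ?D \<times> ?D"
    by (auto simp: madd_def)
  moreover have "finite (?D \<times> ?D)"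
    by (intro finite_cartesian_product finite_imageI finite_PiE) auto
  ultimately show ?thesis by (rule finite_subset)
qed

lemma sp_mult_eq:
  "sp_mult f g m = (\<Sum>(a, b) | madd a b = m. msgn a b * f a * g b)"
  unfolding sp_mult_def
  by (rule sum.mono_neutral_cong_left[OF finite_madd_fibre]) (auto simp: msgn_def madd_def split: if_splits)

lemma finite_madd_fibre':
  "finite {p. madd (fst p) (snd p) = (m :: ('n::finite, 'r::finite) smono)}"
  using finite_madd_fibre[of m] by (simp add: split_def)

text \<open>Both sides run over the ordered factorisations of \<open>m\<close> into three
  monomials.\<close>

lemma madd_triple_sum:
  fixes F :: "('n::finite, 'r::finite) smono \<Rightarrow> ('n, 'r) smono \<Rightarrow> ('n, 'r) smono \<Rightarrow> real"
  shows "(\<Sum>(d, c) | madd d c = m. \<Sum>(a, b) | madd a b = d. F a b c) =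
         (\<Sum>(a, d) | madd a d = m. \<Sum>(b, c) | madd b c = d. F a b c)"
proof -
  have "(\<Sum>(d, c) | madd d c = m. \<Sum>(a, b) | madd a b = d. F a b c) =
      (\<Sum>((d, c), (a, b)) \<in> Sigma {(d, c). madd d c = m} (\<lambda>(d, c). {(a, b). madd a b = d}). F a b c)"
    by (subst sum.Sigma[symmetric]) (auto simp: finite_madd_fibre' split_def)
  also have "\<dots> = (\<Sum>((a, d), (b, c)) \<in> Sigma {(a, d). madd a d = m} (\<lambda>(a, d). {(b, c). madd b c = d}). F a b c)"
    by (rule sum.reindex_bij_witness[where i = "\<lambda>((a, d), (b, c)). ((madd a b, c), (a, b))"
          and j = "\<lambda>((d, c), (a, b)). ((a, madd b c), (b, c))"]) (auto simp: madd_assoc)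
  also have "\<dots> = (\<Sum>(a, d) | madd a d = m. \<Sum>(b, c) | madd b c = d. F a b c)"
    by (subst sum.Sigma[symmetric]) (auto simp: finite_madd_fibre' split_def)
  finally show ?thesis .
qed

lemma sp_mult_assoc: "sp_mult (sp_mult f g) h = sp_mult f (sp_mult g h)"
proof
  fix m
  have "sp_mult (sp_mult f g) h m =
      (\<Sum>(d, c) | madd d c = m. \<Sum>(a, b) | madd a b = d. (msgn a b * msgn (madd a b) c) * (f a * g b * h c))"
    unfolding sp_mult_eq
    by (intro sum.cong refl) (auto simp: sum_distrib_left sum_distrib_right split_def mult_ac intro!: sum.cong)
  also have "\<dots> = (\<Sum>(a, d) | madd a d = m. \<Sum>(b, c) | madd b c = d. (msgn a b * msgn (madd a b) c) * (f a * g b * h c))"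
    by (rule madd_triple_sum)
  also have "\<dots> = sp_mult f (sp_mult g h) m"
    unfolding sp_mult_eq msgn_cocycle
    by (intro sum.cong refl) (auto simp: sum_distrib_left sum_distrib_right split_def mult_ac intro!: sum.cong)
  finally show "sp_mult (sp_mult f g) h m = sp_mult f (sp_mult g h) m" .
qed

lemma sp_mult_single:
  "sp_mult (single a r) (single b s) = (\<lambda>m. r * s * msgn a b * single (madd a b) 1 m)"
proof
  fix m
  have "sp_mult (single a r) (single b s) m =
      (\<Sum>p | madd (fst p) (snd p) = m. if p = (a, b) then r * s * msgn a b else 0)"
    unfolding sp_mult_eq by (auto simp: single_def split_def intro!: sum.cong)
  also have "\<dots> = r * s * msgn a b * single (madd a b) 1 m"
    using finite_madd_fibre'[of m] by (auto simp: single_def split_def sum.delta)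
  finally show "sp_mult (single a r) (single b s) m = \<dots>" .
qed

lemma sp_mult_one: "sp_mult (single one_mono 1) f = f" "sp_mult f (single one_mono 1) = f"
proof -
  have 1: "sp_mult (single one_mono 1) f m = f m" for m
  proof -
    have "sp_mult (single one_mono 1) f m =
        (\<Sum>p | madd (fst p) (snd p) = m. if p = (one_mono, m) then f m else 0)"
      unfolding sp_mult_eq by (auto simp: single_def split_def prod_eq_iff intro!: sum.cong)
    then show ?thesis
      using finite_madd_fibre'[of m] by (auto simp: split_def sum.delta)
  qed
  have 2: "sp_mult f (single one_mono 1) m = f m" for m
  proof -
    have "sp_mult f (single one_mono 1) m =
        (\<Sum>p | madd (fst p) (snd p) = m. if p = (m, one_mono) then f m else 0)"
      unfolding sp_mult_eq by (auto simp: single_def split_def prod_eq_iff intro!: sum.cong)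
    then show ?thesis
      using finite_madd_fibre'[of m] by (auto simp: split_def sum.delta)
  qed
  show "sp_mult (single one_mono 1) f = f" "sp_mult f (single one_mono 1) = f"
    using 1 2 by auto
qed

lemma sp_mult_add:
  "sp_mult (\<lambda>m. f m + g m) h = (\<lambda>m. sp_mult f h m + sp_mult g h m)"
  "sp_mult h (\<lambda>m. f m + g m) = (\<lambda>m. sp_mult h f m + sp_mult h g m)"
  by (auto simp: sp_mult_eq fun_eq_iff sum.distrib[symmetric] distrib_left distrib_right intro!: sum.cong)

lemma sp_mult_scale:
  "sp_mult (\<lambda>m. r * f m) h = (\<lambda>m. r * sp_mult f h m)"
  "sp_mult h (\<lambda>m. r * f m) = (\<lambda>m. r * sp_mult h f m)"
  by (auto simp: sp_mult_eq fun_eq_iff sum_distrib_left intro!: sum.cong)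

text \<open>A copy of \<open>spoly\<close>, so that \<open>sp_mult\<close> can be made the multiplication of a type class algebra.\<close>

typedef ('n, 'r) sp = "UNIV :: ('n, 'r) spoly set"
  morphisms coef Sp by auto

lemma coef_Sp [simp]: "coef (Sp f) = f"
  by (simp add: Sp_inverse)

lemma Sp_coef [simp]: "Sp (coef p) = p"
  by (rule coef_inverse)

lemma Sp_eq_iff: "Sp f = Sp g \<longleftrightarrow> f = g"
  by (metis coef_Sp)

lemma sp_eqI: "(\<And>m. coef p m = coef q m) \<Longrightarrow> p = q"
  by (metis coef_inject ext)

instantiation sp :: (finite, "{finite,linorder}") real_algebra_1
begin

definition zero_sp :: "('a, 'b) sp" where "zero_sp = Sp (\<lambda>_. 0)"
definition one_sp :: "('a, 'b) sp" where "one_sp = Sp (single one_mono 1)"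
definition plus_sp :: "('a, 'b) sp \<Rightarrow> ('a, 'b) sp \<Rightarrow> ('a, 'b) sp" where
  "plus_sp p q = Sp (\<lambda>m. coef p m + coef q m)"
definition minus_sp :: "('a, 'b) sp \<Rightarrow> ('a, 'b) sp \<Rightarrow> ('a, 'b) sp" where
  "minus_sp p q = Sp (\<lambda>m. coef p m - coef q m)"
definition uminus_sp :: "('a, 'b) sp \<Rightarrow> ('a, 'b) sp" where
  "uminus_sp p = Sp (\<lambda>m. - coef p m)"
definition scaleR_sp :: "real \<Rightarrow> ('a, 'b) sp \<Rightarrow> ('a, 'b) sp" where
  "scaleR_sp r p = Sp (\<lambda>m. r * coef p m)"
definition times_sp :: "('a, 'b) sp \<Rightarrow> ('a, 'b) sp \<Rightarrow> ('a, 'b) sp" where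
  "times_sp p q = Sp (sp_mult (coef p) (coef q))"

lemma coef_simps [simp]:
  "coef (0 :: ('a, 'b) sp) m = 0" "coef (1 :: ('a, 'b) sp) m = single one_mono 1 m"
  "coef (p + q :: ('a, 'b) sp) m = coef p m + coef q m" "coef (p - q :: ('a, 'b) sp) m = coef p m - coef q m"
  "coef (- p :: ('a, 'b) sp) m = - coef p m" "coef (r *\<^sub>R p :: ('a, 'b) sp) m = r * coef p m"
  by (simp_all add: zero_sp_def one_sp_def plus_sp_def minus_sp_def uminus_sp_def scaleR_sp_def)

instance
proof
  fix p q r :: "('a, 'b) sp" and s t :: real
  show "p * q * r = p * (q * r)" by (simp add: times_sp_def sp_mult_assoc)
  show "1 * p = p" "p * 1 = p" by (simp_all add: times_sp_def one_sp_def sp_mult_one)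
  show "(p + q) * r = p * r + q * r" "p * (q + r) = p * q + p * r"
    by (simp_all add: times_sp_def plus_sp_def sp_mult_add)
  show "s *\<^sub>R p * q = s *\<^sub>R (p * q)" "p * s *\<^sub>R q = s *\<^sub>R (p * q)"
    by (simp_all add: times_sp_def scaleR_sp_def sp_mult_scale)
  have "coef (0 :: ('a, 'b) sp) one_mono \<noteq> coef 1 one_mono" by (simp add: single_def)
  then show "(0 :: ('a, 'b) sp) \<noteq> 1" by metis
qed (rule sp_eqI; simp add: algebra_simps)+

end

lemma coef_sum [simp]: "coef (sum f A) m = (\<Sum>a\<in>A. coef (f a) m)"
  by (induction A rule: infinite_finite_induct) auto

lemma coef_mult: "coef (p * q) = sp_mult (coef p) (coef q)"
  by (simp add: times_sp_def)

lemma Sp_simps: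
  "Sp (sp_mult f g) = Sp f * Sp g" "Sp (\<lambda>m. f m + g m) = Sp f + Sp g" "Sp (\<lambda>m. f m - g m) = Sp f - Sp g"
  "Sp (\<lambda>m. - f m) = - Sp f" "Sp (\<lambda>m. r * f m) = r *\<^sub>R Sp f" "Sp (\<lambda>_. 0) = 0"
  "Sp (single one_mono 1) = 1"
  by (simp_all add: zero_sp_def one_sp_def plus_sp_def minus_sp_def uminus_sp_def scaleR_sp_def times_sp_def)

lemma Sp_sum: "Sp (\<lambda>m. \<Sum>a\<in>A. f a m) = (\<Sum>a\<in>A. Sp (f a))"
  by (rule sp_eqI) simp

definition mon :: "('n, 'r) smono \<Rightarrow> ('n::finite, 'r::{finite,linorder}) sp" where
  "mon m = Sp (single m 1)"

lemma coef_mon: "coef (mon m) m' = (if m' = m then 1 else 0)"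
  by (simp add: mon_def single_def)

lemma mon_mult: "mon a * mon b = msgn a b *\<^sub>R mon (madd a b)"
  by (simp add: mon_def times_sp_def sp_mult_single scaleR_sp_def)

lemma mon_one: "mon one_mono = 1"
  by (simp add: mon_def one_sp_def)

section \<open>Ordered products of anticommuting elements\<close>

definition oprod :: "('r::linorder \<Rightarrow> 'a::monoid_mult) \<Rightarrow> 'r set \<Rightarrow> 'a" where
  "oprod \<theta> S = prod_list (map \<theta> (sorted_list_of_set S))"

lemma oprod_empty [simp]: "oprod \<theta> {} = 1"
  by (simp add: oprod_def)

lemma sorted_list_of_set_insert_min:
  assumes "finite S" "\<And>s. s \<in> S \<Longrightarrow> a < s"
  shows "sorted_list_of_set (insert a S) = a # sorted_list_of_set S"
proof -
  have "S - {a} = S" using assms by auto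
  then show ?thesis
    using assms by (simp add: insort_is_Cons less_imp_le)
qed

lemma oprod_insert_min:
  "finite S \<Longrightarrow> (\<And>s. s \<in> S \<Longrightarrow> a < s) \<Longrightarrow> oprod \<theta> (insert a S) = \<theta> a * oprod \<theta> S"
  by (simp add: oprod_def sorted_list_of_set_insert_min del: sorted_list_of_set_insert_remove)

context
  fixes \<theta> :: "'r::{finite,linorder} \<Rightarrow> 'a::real_algebra_1"
  assumes anti: "\<theta> a * \<theta> b = - (\<theta> b * \<theta> a)"
begin

lemma anticommuting_square: "\<theta> a * \<theta> a = 0"
proof -
  have "2 *\<^sub>R (\<theta> a * \<theta> a) = 0"
    using anti[of a a] by (simp add: scaleR_2 eq_neg_iff_add_eq_0)
  then show ?thesis by simp
qed

text \<open>The factor \<open>\<theta> s\<close> moves to its place past the smaller elements of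
  \<open>T\<close>, with one sign for each; if \<open>s\<close> is already present it meets itself,
  and its square is zero.\<close>

lemma mult_oprod:
  fixes T :: "'r set"
  assumes "finite T"
  shows "\<theta> s * oprod \<theta> T =
    (if s \<in> T then 0 else (-1) ^ card {t \<in> T. t < s} *\<^sub>R oprod \<theta> (insert s T))"
  using assms
proof (induction T rule: finite_linorder_min_induct)
  case empty
  then show ?case using oprod_insert_min[of "{}" s \<theta>] by simp
next
  case (insert b A)
  have ob: "oprod \<theta> (insert b A) = \<theta> b * oprod \<theta> A"
    using insert by (intro oprod_insert_min) auto
  consider "s < b" | "s = b" | "b < s" by (meson linorder_neqE)
  then show ?case
  proof cases
    case 1
    then have "s \<notin> insert b A" "{t \<in> insert b A. t < s} = {}" using insert by fastforce+
    moreover have "oprod \<theta> (insert s (insert b A)) = \<theta> s * oprod \<theta> (insert b A)"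
      using insert 1 by (intro oprod_insert_min) (auto simp: less_trans)
    ultimately show ?thesis by (simp only: card.empty if_False power_0 scaleR_one)
  next
    case 2
    then show ?thesis using anticommuting_square[of b] by (simp add: ob mult.assoc[symmetric])
  next
    case 3
    have "\<theta> s * oprod \<theta> (insert b A) = - (\<theta> b * (\<theta> s * oprod \<theta> A))"
      unfolding ob mult.assoc[symmetric] by (subst anti) simp
    also have "\<dots> = (if s \<in> A then 0 else - ((-1) ^ card {t \<in> A. t < s} *\<^sub>R (\<theta> b * oprod \<theta> (insert s A))))"
      by (simp add: insert.IH)
    also have "\<theta> b * oprod \<theta> (insert s A) = oprod \<theta> (insert s (insert b A))"
      using insert 3 by (subst insert_commute, subst oprod_insert_min) auto
    also have "{t \<in> insert b A. t < s} = insert b {t \<in> A. t < s}" using 3 by auto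
    then have "card {t \<in> insert b A. t < s} = Suc (card {t \<in> A. t < s})"
      using insert by (auto simp: card_insert_if)
    moreover have "s \<noteq> b" using 3 by auto
    ultimately show ?thesis by simp
  qed
qed

lemma oprod_mult:
  fixes S T :: "'r set"
  shows "oprod \<theta> S * oprod \<theta> T =
    (if S \<inter> T = {} then (-1) ^ inversions S T *\<^sub>R oprod \<theta> (S \<union> T) else 0)"
  using finite[of S]
proof (induction S rule: finite_linorder_min_induct)
  case empty
  then show ?case by simp
next
  case (insert b A)
  have nb: "b \<notin> A" using insert by auto
  have "oprod \<theta> (insert b A) * oprod \<theta> T = \<theta> b * (oprod \<theta> A * oprod \<theta> T)"
    using insert by (simp add: oprod_insert_min mult.assoc)
  also have "\<dots> = (if A \<inter> T = {} then (-1) ^ inversions A T *\<^sub>R (\<theta> b * oprod \<theta> (A \<union> T)) else 0)"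
    by (simp add: insert.IH)
  also have "\<theta> b * oprod \<theta> (A \<union> T) =
      (if b \<in> T then 0 else (-1) ^ card {t \<in> A \<union> T. t < b} *\<^sub>R oprod \<theta> (insert b A \<union> T))"
    using nb by (subst mult_oprod) (auto simp: finite)
  also have "{t \<in> A \<union> T. t < b} = {t \<in> T. t < b}" using insert by auto
  also have "inversions (insert b A) T = inversions {b} T + inversions A T"
    using inversions_Un_left[of "{b}" A T] nb by simp
  then have "card {t \<in> T. t < b} + inversions A T = inversions (insert b A) T"
    by (simp add: inversions_singleton)
  ultimately show ?case
    by (auto simp: power_add[symmetric] add.commute)
qed

end

lemma prod_list_anticommute:
  fixes xs ys :: "'a::real_algebra_1 list"
  assumes "\<And>x y. x \<in> set xs \<Longrightarrow> y \<in> set ys \<Longrightarrow> x * y = - (y * x)"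
  shows "prod_list xs * prod_list ys = (-1) ^ (length xs * length ys) *\<^sub>R (prod_list ys * prod_list xs)"
proof -
  have 1: "x * prod_list ys = (-1) ^ length ys *\<^sub>R (prod_list ys * x)"
    if "\<And>y. y \<in> set ys \<Longrightarrow> x * y = - (y * x)" for x :: 'a and ys
    using that
  proof (induction ys)
    case (Cons y ys)
    have "x * prod_list (y # ys) = - (y * (x * prod_list ys))"
      using Cons.prems[of y] by (simp add: mult.assoc[symmetric])
    then show ?case using Cons by (simp add: mult.assoc)
  qed simp
  show ?thesis using assms
  proof (induction xs)
    case (Cons x xs)
    have "prod_list (x # xs) * prod_list ys = x * (prod_list xs * prod_list ys)" by (simp add: mult.assoc)
    also have "\<dots> = (-1) ^ (length xs * length ys) *\<^sub>R (x * prod_list ys * prod_list xs)"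
      using Cons by (simp add: mult.assoc)
    also have "x * prod_list ys = (-1) ^ length ys *\<^sub>R (prod_list ys * x)"
      using Cons.prems by (intro 1) auto
    finally show ?case by (simp add: power_add mult.assoc)
  qed simp
qed

lemma prod_list_central:
  fixes f g :: "'i \<Rightarrow> 'a::monoid_mult"
  assumes "\<And>i x. f i * x = x * f i"
  shows "x * prod_list (map f is) = prod_list (map f is) * x"
    "prod_list (map (\<lambda>i. f i * g i) is) = prod_list (map f is) * prod_list (map g is)"
proof -
  show *: "x * prod_list (map f is) = prod_list (map f is) * x" for x "is"
    by (induction "is" arbitrary: x) (simp_all add: mult.assoc, metis assms mult.assoc)
  show "prod_list (map (\<lambda>i. f i * g i) is) = prod_list (map f is) * prod_list (map g is)"
  proof (induction "is")
    case (Cons i "is")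
    then show ?case by simp (metis * mult.assoc)
  qed simp
qed

text \<open>The weights of the generators are left open: \<open>cdeg\<close> gives the total degree,
  \<open>cdeg1\<close> and \<open>cdeg2\<close> the two components of the bidegree, so homogeneity
  is treated once for all three.\<close>

definition wt :: "(('n, 'r) coord \<Rightarrow> nat) \<Rightarrow> ('n::finite, 'r) smono \<Rightarrow> nat" where
  "wt \<omega> m = (\<Sum>a\<in>mU m. \<omega> (CU a)) + (\<Sum>a\<in>mPU m. \<omega> (CPU a)) + mP m * \<omega> CP + (\<Sum>i\<in>UNIV. mPX m i * \<omega> (CPX i))"

definition graded :: "(('n, 'r) coord \<Rightarrow> nat) \<Rightarrow> nat \<Rightarrow> ('n::finite, 'r) sp \<Rightarrow> bool" where
  "graded \<omega> k p \<longleftrightarrow> (\<forall>m. coef p m \<noteq> 0 \<longrightarrow> wt \<omega> m = k)"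

fun cdeg :: "('n, 'r) coord \<Rightarrow> nat" where
  "cdeg (CX i) = 0" | "cdeg (CU a) = 1" | "cdeg (CPU a) = 1" | "cdeg CP = 2" | "cdeg (CPX i) = 2"

fun cdeg1 :: "('n, 'r) coord \<Rightarrow> nat" where
  "cdeg1 (CX i) = 0" | "cdeg1 (CU a) = 0" | "cdeg1 (CPU a) = 1" | "cdeg1 CP = 1" | "cdeg1 (CPX i) = 1"

fun cdeg2 :: "('n, 'r) coord \<Rightarrow> nat" where
  "cdeg2 (CX i) = 0" | "cdeg2 (CU a) = 1" | "cdeg2 (CPU a) = 0" | "cdeg2 CP = 1" | "cdeg2 (CPX i) = 1"

lemma mono_degree_wt: "mono_degree m = wt cdeg m"
  by (simp add: mono_degree_def wt_def sum_distrib_right[symmetric])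

lemma mono_bidegree_wt: "mono_bidegree m = (wt cdeg1 m, wt cdeg2 m)"
  by (simp add: mono_bidegree_def wt_def Let_def)

text \<open>A nonzero sign means disjoint odd factors; otherwise the union would lose
  weight.\<close>

lemma wt_madd:
  fixes a b :: "('n::finite, 'r::{finite,linorder}) smono"
  shows "msgn a b \<noteq> 0 \<Longrightarrow> wt \<omega> (madd a b) = wt \<omega> a + wt \<omega> b"
  by (auto simp: wt_def msgn_def sum.union_disjoint add_mult_distrib sum.distrib split: if_splits)

lemma wt_one [simp]: "wt \<omega> one_mono = 0"
  by (simp add: wt_def)

lemma graded_0 [simp]: "graded \<omega> k 0" and graded_1 [simp]: "graded \<omega> 0 1"
  by (auto simp: graded_def single_def)

lemma graded_add: "graded \<omega> k p \<Longrightarrow> graded \<omega> k q \<Longrightarrow> graded \<omega> k (p + q)"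
  and graded_diff: "graded \<omega> k p \<Longrightarrow> graded \<omega> k q \<Longrightarrow> graded \<omega> k (p - q)"
  and graded_scaleR: "graded \<omega> k p \<Longrightarrow> graded \<omega> k (r *\<^sub>R p)"
  for p q :: "('n::finite, 'r::{finite,linorder}) sp"
  unfolding graded_def coef_simps by (metis add_0 diff_0_right mult_zero_right)+

lemma graded_sum:
  fixes f :: "'i \<Rightarrow> ('n::finite, 'r::{finite,linorder}) sp"
  shows "(\<And>i. i \<in> A \<Longrightarrow> graded \<omega> k (f i)) \<Longrightarrow> graded \<omega> k (sum f A)"
  by (induction A rule: infinite_finite_induct) (auto intro: graded_add)

lemma graded_mult:
  fixes p q :: "('n::finite, 'r::{finite,linorder}) sp"
  assumes "graded \<omega> k p" "graded \<omega> l q"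
  shows "graded \<omega> (k + l) (p * q)"
  unfolding graded_def
proof (intro allI impI)
  fix m assume "coef (p * q) m \<noteq> 0"
  then obtain a b where "madd a b = m" "msgn a b * coef p a * coef q b \<noteq> 0"
    by (auto simp: coef_mult sp_mult_eq elim!: sum.not_neutral_contains_not_neutral)
  then show "wt \<omega> m = k + l"
    using assms by (auto simp: graded_def wt_madd)
qed

lemma graded_mon: "graded \<omega> (wt \<omega> m) (mon m)"
  by (simp add: graded_def coef_mon)

text \<open>\<open>spoly\<close> admits infinite supports, for which \<open>evalp\<close> collapses
  to 0 by the convention on infinite sums. Linearity and multiplicativity of substitution are
  therefore stated for finite supports.\<close>

definition fins :: "('n, 'r) sp \<Rightarrow> bool" where
  "fins p \<longleftrightarrow> finite {m. coef p m \<noteq> 0}"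

lemma fins_0 [simp]: "fins 0" and fins_1 [simp]: "fins 1"
  by (auto simp: fins_def single_def)

lemma fins_add: "fins p \<Longrightarrow> fins q \<Longrightarrow> fins (p + q)"
  for p q :: "('n::finite, 'r::{finite,linorder}) sp"
  unfolding fins_def by (rule finite_subset[of _ "{m. coef p m \<noteq> 0} \<union> {m. coef q m \<noteq> 0}"]; auto)

lemma fins_scaleR: "fins p \<Longrightarrow> fins (r *\<^sub>R p)"
  for p :: "('n::finite, 'r::{finite,linorder}) sp"
  unfolding fins_def by (rule finite_subset[of _ "{m. coef p m \<noteq> 0}"]; auto)

lemma fins_sum:
  fixes f :: "'i \<Rightarrow> ('n::finite, 'r::{finite,linorder}) sp"
  shows "(\<And>i. i \<in> A \<Longrightarrow> fins (f i)) \<Longrightarrow> fins (sum f A)"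
  by (induction A rule: infinite_finite_induct) (auto intro: fins_add)

lemma fins_mult:
  fixes p q :: "('n::finite, 'r::{finite,linorder}) sp"
  assumes "fins p" "fins q"
  shows "fins (p * q)"
proof -
  have "m \<in> (\<lambda>(a, b). madd a b) ` ({m. coef p m \<noteq> 0} \<times> {m. coef q m \<noteq> 0})"
    if "coef (p * q) m \<noteq> 0" for m
  proof -
    obtain a b where "madd a b = m" "msgn a b * coef p a * coef q b \<noteq> 0"
      using \<open>coef (p * q) m \<noteq> 0\<close> by (auto simp: coef_mult sp_mult_eq elim!: sum.not_neutral_contains_not_neutral)
    then show ?thesis by auto
  qed
  then have "{m. coef (p * q) m \<noteq> 0} \<subseteq> (\<lambda>(a, b). madd a b) ` ({m. coef p m \<noteq> 0} \<times> {m. coef q m \<noteq> 0})"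
    by blast
  moreover have "finite ((\<lambda>(a, b). madd a b) ` ({m. coef p m \<noteq> 0} \<times> {m. coef q m \<noteq> 0}))"
    using assms unfolding fins_def by simp
  ultimately show ?thesis
    unfolding fins_def by (rule finite_subset)
qed

lemma fins_prod_list:
  fixes ps :: "('n::finite, 'r::{finite,linorder}) sp list"
  shows "(\<And>p. p \<in> set ps \<Longrightarrow> fins p) \<Longrightarrow> fins (prod_list ps)"
  by (induction ps) (auto intro: fins_mult)

lemma fins_mon [simp]: "fins (mon m)"
  by (simp add: fins_def coef_mon)

text \<open>There are finitely many generators, all of positive degree. This turns the degree bound
  in \<open>jet_fun\<close> into finite support at every point.\<close>

lemma finite_degree_le:
  "finite {m :: ('n::finite, 'r::finite) smono. mono_degree m \<le> k}"
proof -
  let ?F = "\<lambda>(U, P, k, X). \<lparr>mU = U, mPU = P, mP = k, mPX = X\<rparr> :: ('n, 'r) smono"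
  let ?X = "PiE UNIV (\<lambda>i. {..k})"
  have "m \<in> ?F ` (UNIV \<times> UNIV \<times> {..k} \<times> ?X)" if "mono_degree m \<le> k" for m :: "('n, 'r) smono"
  proof (intro image_eqI[of _ _ "(mU m, mPU m, mP m, mPX m)"])
    have "mPX m i \<le> (\<Sum>i\<in>UNIV. mPX m i)" for i by (rule member_le_sum) auto
    then have "mPX m i \<le> k" for i
      using that[unfolded mono_degree_def] order_trans[of "mPX m i" "\<Sum>i\<in>UNIV. mPX m i" k] by simp
    then show "(mU m, mPU m, mP m, mPX m) \<in> UNIV \<times> UNIV \<times> {..k} \<times> ?X"
      using that by (auto simp: mono_degree_def)
  qed simp
  then have "{m. mono_degree m \<le> k} \<subseteq> ?F ` (UNIV \<times> UNIV \<times> {..k} \<times> ?X)" by blast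
  then show ?thesis
    by (rule finite_subset) (intro finite_imageI finite_cartesian_product finite_PiE; simp)
qed

lemma fins_degree_le:
  fixes p :: "('n::finite, 'r::finite) sp"
  shows "(\<And>m. coef p m \<noteq> 0 \<Longrightarrow> mono_degree m \<le> k) \<Longrightarrow> fins p"
  unfolding fins_def by (rule finite_subset[OF _ finite_degree_le[of k]]) auto

lemma fins_graded: "graded cdeg k p \<Longrightarrow> fins p" for p :: "('n::finite, 'r::finite) sp"
  by (rule fins_degree_le[of _ k]) (simp add: graded_def mono_degree_wt)

text \<open>Modulo 2 the degrees count the odd factors only. In the product of these counts, the two
  inversion numbers of each kind account for the u-u and p-p pairs, and the terms
  \<open>card (mPU _) * card (mU _)\<close> of the two signs for the mixed pairs.\<close>

lemma msgn_commute:
  fixes a b :: "('n::finite, 'r::{finite,linorder}) smono"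
  shows "msgn b a = (-1) ^ (wt cdeg a * wt cdeg b) * msgn a b"
proof (cases "mU a \<inter> mU b = {} \<and> mPU a \<inter> mPU b = {}")
  case True
  let ?u = "card (mU a)" and ?p = "card (mPU a)" and ?u' = "card (mU b)" and ?p' = "card (mPU b)"
  have *: "inversions (mU a) (mU b) + inversions (mU b) (mU a) = ?u * ?u'"
    "inversions (mPU a) (mPU b) + inversions (mPU b) (mPU a) = ?p * ?p'"
    using True by (simp_all add: inversions_add_commute)
  have 1: "(-1 :: real) ^ (wt cdeg a * wt cdeg b) = (-1) ^ ((?u + ?p) * (?u' + ?p'))"
    by (simp add: mono_degree_wt[symmetric] mono_degree_def minus_one_power_iff)
  have "mono_sign b a = (-1) ^ ((?u + ?p) * (?u' + ?p')) * mono_sign a b"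
  proof -
    have "(?p' * ?u + inversions (mU b) (mU a) + inversions (mPU b) (mPU a)) +
        (?p * ?u' + inversions (mU a) (mU b) + inversions (mPU a) (mPU b)) = (?u + ?p) * (?u' + ?p')"
      using * by (simp add: algebra_simps)
    then have "mono_sign b a * mono_sign a b = (-1) ^ ((?u + ?p) * (?u' + ?p'))"
      by (simp add: mono_sign_def power_add[symmetric])
    moreover have "mono_sign a b * mono_sign a b = 1"
      by (simp add: mono_sign_def power_add[symmetric])
    ultimately show ?thesis by (metis mult.assoc mult.right_neutral)
  qed
  moreover have "mU b \<inter> mU a = {}" "mPU b \<inter> mPU a = {}" using True by auto
  ultimately show ?thesis
    using True 1 by (simp add: msgn_def)
next
  case False
  then have "\<not> (mU b \<inter> mU a = {} \<and> mPU b \<inter> mPU a = {})" by auto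
  with False show ?thesis by (simp add: msgn_def) metis
qed

definition parity_graded :: "bool \<Rightarrow> ('n::finite, 'r) sp \<Rightarrow> bool" where
  "parity_graded e p \<longleftrightarrow> (\<forall>m. coef p m \<noteq> 0 \<longrightarrow> even (wt cdeg m) = e)"

lemma graded_parity: "graded cdeg k p \<Longrightarrow> parity_graded (even k) p"
  by (simp add: graded_def parity_graded_def)

text \<open>The hypothesis fixes the parity of the product of degrees for all monomials that occur,
  which covers an even factor with an arbitrary partner as well as two odd factors.\<close>

lemma supercommute:
  fixes p q :: "('n::finite, 'r::{finite,linorder}) sp"
  assumes "\<And>a b. coef p a \<noteq> 0 \<Longrightarrow> coef q b \<noteq> 0 \<Longrightarrow> even (wt cdeg a * wt cdeg b) = e"
  shows "q * p = (if e then p * q else - (p * q))"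
proof (rule sp_eqI)
  fix m
  have "coef (q * p) m = (\<Sum>(a, b) | madd a b = m. msgn a b * coef q a * coef p b)"
    by (simp add: coef_mult sp_mult_eq)
  also have "\<dots> = (\<Sum>(a, b) | madd a b = m. msgn b a * coef q b * coef p a)"
    by (rule sum.reindex_bij_witness[where i = prod.swap and j = prod.swap]) (auto simp: madd_commute)
  also have "\<dots> = (\<Sum>(a, b) | madd a b = m. (if e then 1 else -1) * (msgn a b * coef p a * coef q b))"
  proof (intro sum.cong refl, clarify)
    fix a b
    have "coef p a \<noteq> 0 \<Longrightarrow> coef q b \<noteq> 0 \<Longrightarrow> (-1 :: real) ^ (wt cdeg a * wt cdeg b) = (if e then 1 else -1)"
      using assms[of a b] by (simp add: minus_one_power_iff)
    then show "msgn b a * coef q b * coef p a = (if e then 1 else -1) * (msgn a b * coef p a * coef q b)"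
      unfolding msgn_commute[of b a] by (cases "coef p a = 0 \<or> coef q b = 0") auto
  qed
  also have "\<dots> = (if e then 1 else -1) * coef (p * q) m"
    by (simp add: coef_mult sp_mult_eq sum_distrib_left split_def)
  finally show "coef (q * p) m = coef (if e then p * q else - (p * q)) m" by simp
qed

lemma even_commute: "parity_graded True p \<Longrightarrow> p * q = q * p"
  for p q :: "('n::finite, 'r::{finite,linorder}) sp"
  using supercommute[of p q True] by (auto simp: parity_graded_def)

lemma odd_anticommute: "parity_graded False p \<Longrightarrow> parity_graded False q \<Longrightarrow> p * q = - (q * p)"
  for p q :: "('n::finite, 'r::{finite,linorder}) sp"
  using supercommute[of q p False] by (auto simp: parity_graded_def)

section \<open>Substitutions and their homomorphism property\<close>

definition evalm :: "(('n, 'r) coord \<Rightarrow> ('n, 'r) sp) \<Rightarrow> ('n::{finite,linorder}, 'r::{finite,linorder}) smono \<Rightarrow> ('n, 'r) sp" where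
  "evalm T m = prod_list (map T (mono_factors m))"

definition evalp :: "(('n, 'r) coord \<Rightarrow> ('n, 'r) sp) \<Rightarrow> ('n::{finite,linorder}, 'r::{finite,linorder}) sp \<Rightarrow> ('n, 'r) sp" where
  "evalp T p = (\<Sum>m | coef p m \<noteq> 0. coef p m *\<^sub>R evalm T m)"

lemma Sp_foldr_mult: "Sp (foldr sp_mult (map T zs) (single one_mono 1)) = prod_list (map (\<lambda>z. Sp (T z)) zs)"
  by (induction zs) (simp_all add: Sp_simps)

lemma Sp_subst: "Sp (subst_sp T f) = evalp (\<lambda>z. Sp (T z)) (Sp f)"
  unfolding subst_sp_def evalp_def evalm_def coef_Sp
  by (simp add: Sp_sum Sp_simps Sp_foldr_mult)

lemma evalp_superset:
  assumes "finite S" "{m. coef p m \<noteq> 0} \<subseteq> S"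
  shows "evalp T p = (\<Sum>m\<in>S. coef p m *\<^sub>R evalm T m)"
  unfolding evalp_def using assms by (intro sum.mono_neutral_left) auto

lemma evalp_add: "fins p \<Longrightarrow> fins q \<Longrightarrow> evalp T (p + q) = evalp T p + evalp T q"
  by (subst (1 2 3) evalp_superset[of "{m. coef p m \<noteq> 0} \<union> {m. coef q m \<noteq> 0}"])
    (auto simp: fins_def sum.distrib scaleR_left_distrib)

lemma evalp_scaleR: "evalp T (r *\<^sub>R p) = r *\<^sub>R evalp T p"
  by (cases "r = 0") (simp_all add: evalp_def scaleR_sum_right)

lemma evalp_0 [simp]: "evalp T 0 = 0"
  by (simp add: evalp_def)

lemma evalp_minus: "evalp T (- p) = - evalp T p"
  using evalp_scaleR[of T "-1" p] by simp

lemma evalp_diff: "fins p \<Longrightarrow> fins q \<Longrightarrow> evalp T (p - q) = evalp T p - evalp T q"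
  using evalp_add[of p "- q" T] fins_scaleR[of q "-1"] by (simp add: evalp_minus)

lemma evalp_sum: "(\<And>i. i \<in> A \<Longrightarrow> fins (f i)) \<Longrightarrow> evalp T (sum f A) = (\<Sum>i\<in>A. evalp T (f i))"
  by (induction A rule: infinite_finite_induct) (auto simp: evalp_add fins_sum)

lemma evalp_mon: "evalp T (mon m) = evalm T m"
  by (subst evalp_superset[of "{m}"]) (auto simp: coef_mon)

lemma concat_map_Nil: "concat (map (\<lambda>_. []) xs) = []"
  by (induction xs) auto

lemma concat_map_replicate_delta:
  "distinct xs \<Longrightarrow> concat (map (\<lambda>j. replicate (if j = i then 1 else 0) (f j)) xs) = (if i \<in> set xs then [f i] else [])"
  by (induction xs) auto

lemma evalm_one [simp]: "evalm T one_mono = 1"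
  by (simp add: evalm_def mono_factors_def concat_map_Nil)

lemma evalp_1 [simp]: "evalp T 1 = 1"
  using evalp_mon[of T one_mono] by (simp add: mon_one)

lemma set_mono_factors: "set (mono_factors m) \<subseteq> range CU \<union> range CPU \<union> {CP} \<union> range CPX"
  by (auto simp: mono_factors_def)

lemma evalm_cong:
  assumes "\<And>a. T (CU a) = T' (CU a)" "\<And>a. T (CPU a) = T' (CPU a)" "T CP = T' CP" "\<And>i. T (CPX i) = T' (CPX i)"
  shows "evalm T m = evalm T' m"
  unfolding evalm_def using set_mono_factors[of m] assms
  by (intro arg_cong[of _ _ prod_list] map_cong) auto

lemma evalp_cong:
  assumes "\<And>a. T (CU a) = T' (CU a)" "\<And>a. T (CPU a) = T' (CPU a)" "T CP = T' CP" "\<And>i. T (CPX i) = T' (CPX i)"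
  shows "evalp T p = evalp T' p"
  unfolding evalp_def using assms by (intro sum.cong arg_cong2[of _ _ _ _ scaleR] evalm_cong) auto

text \<open>Preserving the degree forces images of odd generators to anticommute and images of even
  ones to be central, which are the relations needed for a homomorphism. \<open>CX\<close> is absent
  because it never occurs in \<open>mono_factors\<close>.\<close>

definition deg_hom :: "(('n, 'r) coord \<Rightarrow> ('n::{finite,linorder}, 'r::{finite,linorder}) sp) \<Rightarrow> bool" where
  "deg_hom T \<longleftrightarrow> (\<forall>a. graded cdeg 1 (T (CU a))) \<and> (\<forall>a. graded cdeg 1 (T (CPU a))) \<and>
     graded cdeg 2 (T CP) \<and> (\<forall>i. graded cdeg 2 (T (CPX i)))"

lemma sum_list_mono_factors:
  "sum_list (map \<omega> (mono_factors m)) = (wt \<omega> m :: nat)"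
proof -
  have "sum_list (map \<omega> (concat (map (\<lambda>i. replicate (mPX m i) (CPX i)) xs))) =
      sum_list (map (\<lambda>i. mPX m i * \<omega> (CPX i)) xs)" for xs
    by (induction xs) (auto simp: sum_list_replicate)
  then show ?thesis
    by (simp add: mono_factors_def wt_def sum_list_replicate o_def sum_list_distinct_conv_sum_set)
qed

lemma graded_prod_list:
  "(\<And>z. z \<in> set zs \<Longrightarrow> graded \<omega> (\<omega>' z) (T z)) \<Longrightarrow> graded \<omega> (sum_list (map \<omega>' zs)) (prod_list (map T zs))"
  by (induction zs) (auto intro: graded_mult)

lemma graded_evalm:
  assumes "\<And>z. z \<in> range CU \<union> range CPU \<union> {CP} \<union> range CPX \<Longrightarrow> graded \<omega> (\<omega>' z) (T z)"
  shows "graded \<omega> (wt \<omega>' m) (evalm T m)"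
  unfolding evalm_def sum_list_mono_factors[symmetric]
  using set_mono_factors[of m] assms by (intro graded_prod_list) blast

text \<open>The weight \<open>\<omega>\<close> of the result and the weight \<open>\<omega>'\<close>
  of the source may differ. Taking the two components of the bidegree for them is what yields the
  swap of bidegrees.\<close>

lemma coef_evalp_nonzero:
  assumes "\<And>z. z \<in> range CU \<union> range CPU \<union> {CP} \<union> range CPX \<Longrightarrow> graded \<omega> (\<omega>' z) (T z)"
    and "coef (evalp T p) m \<noteq> 0"
  shows "\<exists>m'. coef p m' \<noteq> 0 \<and> wt \<omega> m = wt \<omega>' m'"
proof -
  obtain m' where "coef p m' \<noteq> 0" "coef (coef p m' *\<^sub>R evalm T m') m \<noteq> 0"
    using assms(2) by (auto simp: evalp_def elim!: sum.not_neutral_contains_not_neutral)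
  moreover from this have "wt \<omega> m = wt \<omega>' m'"
    using graded_evalm[OF assms(1), where m = m'] by (auto simp: graded_def)
  ultimately show ?thesis by blast
qed

lemma deg_hom_graded:
  assumes "deg_hom T"
  shows "z \<in> range CU \<union> range CPU \<union> {CP} \<union> range CPX \<Longrightarrow> graded cdeg (cdeg z) (T z)"
  using assms by (auto simp: deg_hom_def)

lemma coef_evalp_degree:
  "deg_hom T \<Longrightarrow> coef (evalp T p) m \<noteq> 0 \<Longrightarrow> \<exists>m'. coef p m' \<noteq> 0 \<and> mono_degree m = mono_degree m'"
  unfolding mono_degree_wt by (rule coef_evalp_nonzero) (auto intro: deg_hom_graded)

lemma graded_evalp: "deg_hom T \<Longrightarrow> graded cdeg k p \<Longrightarrow> graded cdeg k (evalp T p)"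
  using coef_evalp_degree by (fastforce simp: graded_def mono_degree_wt)

lemma fins_evalm: "deg_hom T \<Longrightarrow> fins (evalm T m)"
  using graded_evalm[of cdeg cdeg T m] deg_hom_graded[of T] fins_graded by blast

lemma fins_evalp: "deg_hom T \<Longrightarrow> fins (evalp T p)"
  unfolding evalp_def by (intro fins_sum fins_scaleR fins_evalm)

lemma degree_eq_0_iff: "mono_degree m = 0 \<longleftrightarrow> m = (one_mono :: ('n::finite, 'r::finite) smono)"
  by (cases m) (auto simp: mono_degree_def one_mono_def fun_eq_iff)

text \<open>All substituted generators have positive degree, so only the constant term produces a
  constant term. This makes values at points of the base invariant under coordinate changes and
  under \<open>leg\<close>.\<close>

lemma coef_evalp_one_mono:
  assumes "deg_hom T" "fins p"
  shows "coef (evalp T p) one_mono = coef p one_mono"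
proof -
  have *: "coef (evalm T m) one_mono = (if m = one_mono then 1 else 0)" for m
  proof (cases "m = one_mono")
    case False
    then have "mono_degree m \<noteq> 0" by (simp add: degree_eq_0_iff)
    then show ?thesis
      using graded_evalm[of cdeg cdeg T m, OF deg_hom_graded[OF assms(1)]] False
      by (auto simp: graded_def mono_degree_wt)
  qed (simp add: single_def)
  have "coef (evalp T p) one_mono = (\<Sum>m | coef p m \<noteq> 0. if m = one_mono then coef p one_mono else 0)"
    by (auto simp: evalp_def * intro!: sum.cong)
  also have "\<dots> = coef p one_mono"
    using assms(2) by (simp add: fins_def)
  finally show ?thesis .
qed

lemma evalm_eq:
  "evalm T m = oprod (\<lambda>a. T (CU a)) (mU m) * oprod (\<lambda>a. T (CPU a)) (mPU m) * T CP ^ mP m *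
     prod_list (map (\<lambda>i. T (CPX i) ^ mPX m i) (sorted_list_of_set UNIV))"
proof -
  have 1: "prod_list (map T (concat (map (\<lambda>i. replicate (mPX m i) (CPX i)) xs))) =
      prod_list (map (\<lambda>i. T (CPX i) ^ mPX m i) xs)" for xs
    by (induction xs) (simp_all add: prod_list_replicate map_replicate)
  show ?thesis
    unfolding evalm_def mono_factors_def oprod_def map_append prod_list.append 1 map_replicate
      prod_list_replicate map_map o_def by (simp only: mult.assoc)
qed

lemma even_power_commute: "parity_graded True p \<Longrightarrow> p ^ k * q = q * p ^ k"
  for p q :: "('n::finite, 'r::{finite,linorder}) sp"
proof (induction k)
  case (Suc k)
  have "p ^ Suc k * q = p * (p ^ k * q)" by (simp add: mult.assoc)
  also have "\<dots> = p * q * p ^ k" using Suc by (simp add: mult.assoc)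
  also have "p * q = q * p" using Suc.prems by (rule even_commute)
  finally show ?case by (simp add: mult.assoc)
qed simp

lemma central_mult:
  fixes a b x :: "'a::semigroup_mult"
  assumes "\<And>y. a * y = y * a" "\<And>y. b * y = y * b"
  shows "a * b * x = x * (a * b)"
  by (metis assms mult.assoc)

lemma mult_central_swap:
  fixes a b c d :: "'a::semigroup_mult"
  assumes "\<And>y. c * y = y * c"
  shows "a * b * (c * d) = a * c * (b * d)"
  by (metis assms mult.assoc)

text \<open>The images have the parities of the generators, so reordering costs the same signs:
  moving the p-block of \<open>a\<close> past the u-block of \<open>b\<close> gives the product of
  cardinalities, merging equal blocks gives the inversions, and the even part \<open>e\<close> is
  central.\<close>

lemma evalm_mult:
  assumes "deg_hom T"
  shows "evalm T a * evalm T b = msgn a b *\<^sub>R evalm T (madd a b)"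
proof -
  have odd: "parity_graded False (T (CU x))" "parity_graded False (T (CPU x))" for x
    using assms graded_parity[of 1] by (auto simp: deg_hom_def)
  have even: "parity_graded True (T CP)" "parity_graded True (T (CPX i))" for i
    using assms graded_parity[of 2] by (auto simp: deg_hom_def)
  define u v where "u = oprod (\<lambda>a. T (CU a))" and "v = oprod (\<lambda>a. T (CPU a))"
  define e where "e m = T CP ^ mP m * prod_list (map (\<lambda>i. T (CPX i) ^ mPX m i) (sorted_list_of_set UNIV))" for m :: "('a, 'b) smono"
  have ev: "evalm T m = u (mU m) * v (mPU m) * e m" for m
    by (simp add: evalm_eq u_def v_def e_def mult.assoc)
  note central = even_power_commute[OF even(1)] prod_list_central(1)[OF even_power_commute[OF even(2)]]
  have e_central: "e m * x = x * e m" for m x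
    unfolding e_def by (intro central_mult central(1)) (rule central(2)[symmetric])
  have e_add: "e a * e b = e (madd a b)"
    unfolding e_def madd_sel power_add prod_list_central(2)[OF even_power_commute[OF even(2)]]
    by (rule mult_central_swap) (rule central(1))
  have vu: "v J * u I = (-1) ^ (card J * card I) *\<^sub>R (u I * v J)" for I J
  proof -
    have "prod_list (map (\<lambda>a. T (CPU a)) (sorted_list_of_set J)) * prod_list (map (\<lambda>a. T (CU a)) (sorted_list_of_set I)) =
      (-1) ^ (length (map (\<lambda>a. T (CPU a)) (sorted_list_of_set J)) * length (map (\<lambda>a. T (CU a)) (sorted_list_of_set I))) *\<^sub>R
      (prod_list (map (\<lambda>a. T (CU a)) (sorted_list_of_set I)) * prod_list (map (\<lambda>a. T (CPU a)) (sorted_list_of_set J)))"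
      by (rule prod_list_anticommute) (auto intro: odd_anticommute odd)
    then show ?thesis by (simp add: u_def v_def oprod_def)
  qed
  have uu: "u I * u J = (if I \<inter> J = {} then (-1) ^ inversions I J *\<^sub>R u (I \<union> J) else 0)" for I J
    unfolding u_def by (rule oprod_mult) (intro odd_anticommute odd)
  have vv: "v I * v J = (if I \<inter> J = {} then (-1) ^ inversions I J *\<^sub>R v (I \<union> J) else 0)" for I J
    unfolding v_def by (rule oprod_mult) (intro odd_anticommute odd)
  have "evalm T a * evalm T b = u (mU a) * (v (mPU a) * u (mU b)) * v (mPU b) * (e a * e b)"
    unfolding ev mult.assoc[symmetric]
    by (simp only: mult.assoc e_central[of a "u (mU b) * (v (mPU b) * e b)"])
      (simp only: e_central[of b "e a"])
  also have "\<dots> = (-1) ^ (card (mPU a) * card (mU b)) *\<^sub>R ((u (mU a) * u (mU b)) * (v (mPU a) * v (mPU b)) * e (madd a b))"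
    unfolding vu e_add by (simp add: mult.assoc)
  also have "\<dots> = msgn a b *\<^sub>R evalm T (madd a b)"
    by (simp add: ev uu vv msgn_def mono_sign_def power_add mult_ac)
  finally show ?thesis .
qed

lemma evalp_mult:
  assumes "deg_hom T" "fins p" "fins q"
  shows "evalp T (p * q) = evalp T p * evalp T q"
proof -
  define A B where "A = {m. coef p m \<noteq> 0}" and "B = {m. coef q m \<noteq> 0}"
  define C where "C = (\<lambda>(a, b). madd a b) ` (A \<times> B)"
  have fin: "finite A" "finite B" "finite C"
    using assms by (auto simp: A_def B_def C_def fins_def)
  have coef: "coef (p * q) m = (\<Sum>(a, b) \<in> {x \<in> A \<times> B. (\<lambda>(a, b). madd a b) x = m}. msgn a b * coef p a * coef q b)" for m
    unfolding coef_mult sp_mult_eq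
    by (rule sum.mono_neutral_right[OF finite_madd_fibre]) (auto simp: A_def B_def)
  have "{m. coef (p * q) m \<noteq> 0} \<subseteq> C"
  proof
    fix m assume "m \<in> {m. coef (p * q) m \<noteq> 0}"
    then obtain x where "x \<in> {x \<in> A \<times> B. (\<lambda>(a, b). madd a b) x = m}"
      by (auto simp: coef elim!: sum.not_neutral_contains_not_neutral)
    then show "m \<in> C" by (auto simp: C_def)
  qed
  then have "evalp T (p * q) = (\<Sum>m\<in>C. coef (p * q) m *\<^sub>R evalm T m)"
    by (rule evalp_superset[OF fin(3)])
  also have "\<dots> = (\<Sum>m\<in>C. \<Sum>x \<in> {x \<in> A \<times> B. (\<lambda>(a, b). madd a b) x = m}.
      (msgn (fst x) (snd x) * coef p (fst x) * coef q (snd x)) *\<^sub>R evalm T (madd (fst x) (snd x)))"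
    unfolding coef scaleR_sum_left by (intro sum.cong refl) (auto simp: split_def)
  also have "\<dots> = (\<Sum>x \<in> A \<times> B. (msgn (fst x) (snd x) * coef p (fst x) * coef q (snd x)) *\<^sub>R evalm T (madd (fst x) (snd x)))"
    using fin by (intro sum.group) (auto simp: C_def)
  also have "\<dots> = (\<Sum>a\<in>A. \<Sum>b\<in>B. (coef p a *\<^sub>R evalm T a) * (coef q b *\<^sub>R evalm T b))"
    unfolding sum.cartesian_product by (intro sum.cong refl) (auto simp: evalm_mult[OF assms(1)] mult_ac)
  also have "\<dots> = evalp T p * evalp T q"
    by (simp add: evalp_def A_def B_def sum_product)
  finally show ?thesis .
qed

lemma evalp_prod_list:
  assumes "deg_hom T" "\<And>p. p \<in> set ps \<Longrightarrow> fins p"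
  shows "evalp T (prod_list ps) = prod_list (map (evalp T) ps)"
  using assms(2) by (induction ps) (auto simp: evalp_mult[OF assms(1)] fins_prod_list)

lemma deg_hom_fins: "deg_hom T \<Longrightarrow> z \<in> range CU \<union> range CPU \<union> {CP} \<union> range CPX \<Longrightarrow> fins (T z)"
  using deg_hom_graded fins_graded by blast

text \<open>This reduces every identity between composite substitutions to the generators.\<close>

lemma evalp_evalp:
  assumes "deg_hom T" "deg_hom T'"
  shows "evalp T (evalp T' p) = evalp (\<lambda>z. evalp T (T' z)) p"
proof -
  have "evalp T (evalm T' m) = evalm (\<lambda>z. evalp T (T' z)) m" for m
    unfolding evalm_def using set_mono_factors[of m] deg_hom_fins[OF assms(2)]
    by (subst evalp_prod_list[OF assms(1)]) (auto simp: o_def)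
  then show ?thesis
    unfolding evalp_def[of T'] evalp_def[of "\<lambda>z. evalp T (T' z)"]
    by (simp add: evalp_sum fins_scaleR fins_evalm[OF assms(2)] evalp_scaleR)
qed

abbreviation G :: "('n, 'r) coord \<Rightarrow> ('n::finite, 'r::{finite,linorder}) sp" where
  "G z \<equiv> Sp (gen z)"

lemma G_mon:
  "G (CU a) = mon (one_mono\<lparr>mU := {a}\<rparr>)" "G (CPU a) = mon (one_mono\<lparr>mPU := {a}\<rparr>)"
  "G CP = mon (one_mono\<lparr>mP := 1\<rparr>)" "G (CPX i) = mon (one_mono\<lparr>mPX := (\<lambda>j. if j = i then 1 else 0)\<rparr>)"
  by (simp_all add: mon_def)

lemma wt_gen:
  "wt \<omega> (one_mono\<lparr>mU := {a}\<rparr>) = \<omega> (CU a)" "wt \<omega> (one_mono\<lparr>mPU := {a}\<rparr>) = \<omega> (CPU a)"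
  "wt \<omega> (one_mono\<lparr>mP := 1\<rparr>) = \<omega> CP" "wt \<omega> (one_mono\<lparr>mPX := (\<lambda>j. if j = i then 1 else 0)\<rparr>) = \<omega> (CPX i)"
proof -
  have "(\<Sum>j\<in>UNIV. (if j = i then 1 else 0) * \<omega> (CPX j)) = (\<Sum>j\<in>UNIV. if j = i then \<omega> (CPX j) else 0)"
    by (intro sum.cong) auto
  then show "wt \<omega> (one_mono\<lparr>mPX := (\<lambda>j. if j = i then 1 else 0)\<rparr>) = \<omega> (CPX i)"
    by (simp add: wt_def)
qed (simp_all add: wt_def)

lemma graded_G:
  "graded \<omega> (\<omega> (CU a)) (G (CU a))" "graded \<omega> (\<omega> (CPU a)) (G (CPU a))"
  "graded \<omega> (\<omega> CP) (G CP)" "graded \<omega> (\<omega> (CPX i)) (G (CPX i))"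
  unfolding G_mon by (metis graded_mon wt_gen)+

lemma deg_hom_G: "deg_hom G"
  using graded_G[of cdeg] unfolding deg_hom_def cdeg.simps by blast

text \<open>No sign appears because \<open>mono_factors\<close> lists the odd factors in the
  increasing order that defines the monomial.\<close>

lemma evalm_G: "evalm G m = mon m"
proof -
  have U: "oprod (\<lambda>a. G (CU a)) S = (mon (one_mono\<lparr>mU := S\<rparr>) :: ('a, 'b) sp)" for S
    using finite[of S]
  proof (induction S rule: finite_linorder_min_induct)
    case (insert b A)
    have "inversions {b} A = 0" using insert by (auto simp: inversions_singleton)
    then show ?case
      using insert by (auto simp: oprod_insert_min G_mon mon_mult msgn_def mono_sign_def madd_def one_mono_def simp del: gen.simps)
  qed (simp add: mon_one[symmetric] one_mono_def)
  have PU: "oprod (\<lambda>a. G (CPU a)) S = (mon (one_mono\<lparr>mPU := S\<rparr>) :: ('a, 'b) sp)" for S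
    using finite[of S]
  proof (induction S rule: finite_linorder_min_induct)
    case (insert b A)
    have "inversions {b} A = 0" using insert by (auto simp: inversions_singleton)
    then show ?case
      using insert by (auto simp: oprod_insert_min G_mon mon_mult msgn_def mono_sign_def madd_def one_mono_def simp del: gen.simps)
  qed (simp add: mon_one[symmetric] one_mono_def)
  have P: "G CP ^ k = (mon (one_mono\<lparr>mP := k\<rparr>) :: ('a, 'b) sp)" for k
    by (induction k) (auto simp: G_mon mon_mult msgn_def mono_sign_def madd_def one_mono_def mon_one[symmetric] simp del: gen.simps)
  have PX1: "G (CPX i) ^ k = (mon (one_mono\<lparr>mPX := (\<lambda>j. if j = i then k else 0)\<rparr>) :: ('a, 'b) sp)" for i k
    by (induction k) (auto simp: G_mon mon_mult msgn_def mono_sign_def madd_def one_mono_def mon_one[symmetric]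
        fun_eq_iff simp del: gen.simps intro!: arg_cong[of _ _ mon])
  have PX: "prod_list (map (\<lambda>i. G (CPX i) ^ K i) xs) = (mon (one_mono\<lparr>mPX := (\<lambda>j. if j \<in> set xs then K j else 0)\<rparr>) :: ('a, 'b) sp)"
    if "distinct xs" for K xs
    using that
    by (induction xs) (auto simp: PX1 mon_mult msgn_def mono_sign_def madd_def one_mono_def mon_one[symmetric]
        fun_eq_iff simp del: gen.simps intro!: arg_cong[of _ _ mon])
  show ?thesis
    unfolding evalm_eq U PU P PX[OF distinct_sorted_list_of_set]
    by (cases m) (simp add: mon_mult msgn_def mono_sign_def madd_def one_mono_def)
qed

lemma evalp_G: "fins p \<Longrightarrow> evalp G p = p"
  by (rule sp_eqI) (simp add: evalp_def evalm_G coef_mon fins_def if_distrib[of "(*) _"] cong: if_cong)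

lemma evalp_gen:
  "evalp T (G (CU a)) = T (CU a)" "evalp T (G (CPU a)) = T (CPU a)" "evalp T (G CP) = T CP"
  "evalp T (G (CPX i)) = T (CPX i)"
  unfolding G_mon evalp_mon
  by (simp_all add: evalm_def mono_factors_def concat_map_Nil concat_map_replicate_delta)

section \<open>Smooth functions\<close>

lemma Ck_on_cong:
  assumes "open S" "\<And>x. x \<in> S \<Longrightarrow> f x = g x" "Ck_on k S f"
  shows "Ck_on k S g"
  using assms
proof (induction k arbitrary: f g)
  case 0
  then show ?case by (simp cong: continuous_on_cong)
next
  case (Suc k)
  have d: "f differentiable (at x)" if "x \<in> S" for x using Suc.prems that by simp
  have eq: "frechet_derivative f (at x) = frechet_derivative g (at x)" if "x \<in> S" for x
    using frechet_derivative_transform_within_open[OF d \<open>open S\<close>, of x g] that Suc.prems(2) by auto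
  have "g differentiable (at x)" if "x \<in> S" for x
    using d[OF that] Suc.prems(1,2) that
    unfolding differentiable_def by (metis has_derivative_transform_within_open)
  moreover have "Ck_on k S (\<lambda>x. frechet_derivative g (at x) b)" if "b \<in> Basis" for b
    using Suc.IH[of "\<lambda>x. frechet_derivative f (at x) b" "\<lambda>x. frechet_derivative g (at x) b"]
      Suc.prems that eq by auto
  ultimately show ?case by simp
qed

lemma Ck_on_subset: "Ck_on k S f \<Longrightarrow> T \<subseteq> S \<Longrightarrow> Ck_on k T f"
  by (induction k arbitrary: f) (auto intro: continuous_on_subset)

lemma Ck_on_local:
  assumes "\<And>x. x \<in> S \<Longrightarrow> \<exists>T. open T \<and> x \<in> T \<and> Ck_on k T f"
  shows "Ck_on k S f"
  using assms
proof (induction k arbitrary: f)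
  case 0
  have "continuous (at x) f" if "x \<in> S" for x
    using 0[OF that] by (auto simp: continuous_on_eq_continuous_at)
  then show ?case by (simp add: continuous_at_imp_continuous_on)
next
  case (Suc k)
  then have "f differentiable at x" if "x \<in> S" for x using that by fastforce
  moreover have "Ck_on k S (\<lambda>x. frechet_derivative f (at x) b)" if "b \<in> Basis" for b
    using Suc.prems that by (intro Suc.IH) fastforce
  ultimately show ?case by simp
qed

lemma Ck_on_Suc_imp: "Ck_on (Suc k) S f \<Longrightarrow> Ck_on k S f"
proof (induction k arbitrary: f)
  case 0
  then show ?case by (auto intro!: continuous_at_imp_continuous_on differentiable_imp_continuous_within)
next
  case (Suc k)
  then show ?case by auto
qed

lemma Ck_on_const: "Ck_on k S (\<lambda>_. c)"
proof (induction k arbitrary: c)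
  case (Suc k)
  have "frechet_derivative (\<lambda>_. c) (at x) = (\<lambda>_. 0)" for x :: 'a
    using frechet_derivative_at[OF has_derivative_const, of c x] by simp
  then show ?case using Suc by simp
qed simp

lemma Ck_on_linear:
  assumes "bounded_linear h" "open S" "Ck_on k S f"
  shows "Ck_on k S (\<lambda>x. h (f x))"
  using assms(3)
proof (induction k arbitrary: f)
  case 0
  then show ?case using assms(1) by (simp add: bounded_linear.continuous_on)
next
  case (Suc k)
  have hd: "((\<lambda>x. h (f x)) has_derivative (\<lambda>v. h (frechet_derivative f (at x) v))) (at x)" if "x \<in> S" for x
    using Suc.prems that assms(1) frechet_derivative_works[of f "at x"]
    by (auto intro: bounded_linear.has_derivative)
  have eq: "frechet_derivative (\<lambda>x. h (f x)) (at x) = (\<lambda>v. h (frechet_derivative f (at x) v))" if "x \<in> S" for x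
    by (rule frechet_derivative_at[OF hd[OF that], symmetric])
  have "Ck_on k S (\<lambda>x. frechet_derivative (\<lambda>x. h (f x)) (at x) b)" if "b \<in> Basis" for b
  proof (rule Ck_on_cong[OF assms(2)])
    show "Ck_on k S (\<lambda>x. h (frechet_derivative f (at x) b))" using Suc that by auto
  qed (simp add: eq)
  moreover have "(\<lambda>x. h (f x)) differentiable at x" if "x \<in> S" for x
    using hd[OF that] by (auto simp: differentiable_def)
  ultimately show ?case by simp
qed

lemma Ck_on_add:
  assumes "open S" "Ck_on k S f" "Ck_on k S g"
  shows "Ck_on k S (\<lambda>x. f x + g x)"
  using assms(2,3)
proof (induction k arbitrary: f g)
  case 0
  then show ?case by (simp add: continuous_on_add)
next
  case (Suc k)
  have hd: "((\<lambda>x. f x + g x) has_derivative (\<lambda>v. frechet_derivative f (at x) v + frechet_derivative g (at x) v)) (at x)"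
    if "x \<in> S" for x
    using Suc.prems that frechet_derivative_works[of f "at x"] frechet_derivative_works[of g "at x"]
    by (auto intro: has_derivative_add)
  have eq: "frechet_derivative (\<lambda>x. f x + g x) (at x) =
      (\<lambda>v. frechet_derivative f (at x) v + frechet_derivative g (at x) v)" if "x \<in> S" for x
    by (rule frechet_derivative_at[OF hd[OF that], symmetric])
  have "Ck_on k S (\<lambda>x. frechet_derivative (\<lambda>x. f x + g x) (at x) b)" if "b \<in> Basis" for b
  proof (rule Ck_on_cong[OF assms(1)])
    show "Ck_on k S (\<lambda>x. frechet_derivative f (at x) b + frechet_derivative g (at x) b)" using Suc that by auto
  qed (simp add: eq)
  moreover have "(\<lambda>x. f x + g x) differentiable at x" if "x \<in> S" for x
    using hd[OF that] by (auto simp: differentiable_def)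
  ultimately show ?case by simp
qed

lemma Ck_on_mult:
  fixes f g :: "'a::euclidean_space \<Rightarrow> real"
  assumes "open S" "Ck_on k S f" "Ck_on k S g"
  shows "Ck_on k S (\<lambda>x. f x * g x)"
  using assms(2,3)
proof (induction k arbitrary: f g)
  case 0
  then show ?case by (simp add: continuous_on_mult)
next
  case (Suc k)
  have hd: "((\<lambda>x. f x * g x) has_derivative (\<lambda>v. f x * frechet_derivative g (at x) v + frechet_derivative f (at x) v * g x)) (at x)"
    if "x \<in> S" for x
    using Suc.prems that by (intro has_derivative_mult) (simp_all add: frechet_derivative_works[symmetric])
  have eq: "frechet_derivative (\<lambda>x. f x * g x) (at x) =
      (\<lambda>v. f x * frechet_derivative g (at x) v + frechet_derivative f (at x) v * g x)" if "x \<in> S" for x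
    by (rule frechet_derivative_at[OF hd[OF that], symmetric])
  have "Ck_on k S (\<lambda>x. frechet_derivative (\<lambda>x. f x * g x) (at x) b)" if "b \<in> Basis" for b
  proof (rule Ck_on_cong[OF assms(1)])
    show "Ck_on k S (\<lambda>x. f x * frechet_derivative g (at x) b + frechet_derivative f (at x) b * g x)"
      using Suc.prems that Ck_on_Suc_imp[of k S f] Ck_on_Suc_imp[of k S g]
      by (intro Ck_on_add[OF assms(1)] Suc.IH) auto
  qed (simp add: eq)
  moreover have "(\<lambda>x. f x * g x) differentiable at x" if "x \<in> S" for x
    using hd[OF that] by (auto simp: differentiable_def)
  ultimately show ?case by simp
qed

lemma Ck_on_sum:
  assumes "open S" "\<And>i. i \<in> I \<Longrightarrow> Ck_on k S (f i)"
  shows "Ck_on k S (\<lambda>x. \<Sum>i\<in>I. f i x)"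
  using assms(2) by (induction I rule: infinite_finite_induct) (auto intro: Ck_on_const Ck_on_add[OF assms(1)])

lemma Ck_on_compose:
  fixes f :: "'a::euclidean_space \<Rightarrow> 'b::euclidean_space" and g :: "'b \<Rightarrow> 'c::euclidean_space"
  assumes "open S" "open T" "f ` S \<subseteq> T" "Ck_on k S f" "Ck_on k T g"
  shows "Ck_on k S (g \<circ> f)"
  using assms(4,5)
proof (induction k arbitrary: g)
  case 0
  then show ?case using assms(3) by (auto simp: o_def intro: continuous_on_compose2[of T g])
next
  case (Suc k)
  have hd: "((g \<circ> f) has_derivative (\<lambda>v. frechet_derivative g (at (f x)) (frechet_derivative f (at x) v))) (at x)"
    if "x \<in> S" for x
  proof -
    have "f x \<in> T" using assms(3) that by auto
    then have "(g has_derivative frechet_derivative g (at (f x))) (at (f x))"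
      using Suc.prems by (auto simp: frechet_derivative_works[symmetric])
    moreover have "(f has_derivative frechet_derivative f (at x)) (at x)"
      using Suc.prems that by (auto simp: frechet_derivative_works[symmetric])
    ultimately show ?thesis using diff_chain_at by (fastforce simp: o_def)
  qed
  have lin: "linear (frechet_derivative g (at (f x)))" if "x \<in> S" for x
    using assms(3) that Suc.prems by (intro linear_frechet_derivative) auto
  \<comment> \<open>\<open>Ck_on\<close> controls the derivatives of \<open>g\<close> only along
    basis vectors, so the image vector of the chain rule is expanded in coordinates.\<close>
  have eq: "frechet_derivative (g \<circ> f) (at x) v =
      (\<Sum>j\<in>Basis. (frechet_derivative f (at x) v \<bullet> j) *\<^sub>R frechet_derivative g (at (f x)) j)" if "x \<in> S" for x v
  proof -
    have "frechet_derivative (g \<circ> f) (at x) v = frechet_derivative g (at (f x)) (frechet_derivative f (at x) v)"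
      using frechet_derivative_at[OF hd[OF that]] by metis
    also have "\<dots> = frechet_derivative g (at (f x)) (\<Sum>j\<in>Basis. (frechet_derivative f (at x) v \<bullet> j) *\<^sub>R j)"
      by (simp add: euclidean_representation)
    also have "\<dots> = (\<Sum>j\<in>Basis. (frechet_derivative f (at x) v \<bullet> j) *\<^sub>R frechet_derivative g (at (f x)) j)"
      by (simp add: linear_sum[OF lin[OF that]] linear_scale[OF lin[OF that]])
    finally show ?thesis .
  qed
  \<comment> \<open>Scalar multiples are reduced componentwise to the product rule for real
    functions.\<close>
  have scale: "Ck_on k S (\<lambda>x. (h x :: real) *\<^sub>R (q x :: 'c))" if "Ck_on k S h" "Ck_on k S q" for h q
  proof -
    have "Ck_on k S (\<lambda>x. \<Sum>i\<in>Basis. (h x * (q x \<bullet> i)) *\<^sub>R i)"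
      using that assms(1)
      by (intro Ck_on_sum Ck_on_linear[OF bounded_linear_scaleR_left] Ck_on_mult
          Ck_on_linear[OF bounded_linear_inner_left]) auto
    then show ?thesis
      by (rule Ck_on_cong[OF assms(1), rotated])
        (simp add: scaleR_scaleR[symmetric] scaleR_sum_right[symmetric] euclidean_representation del: scaleR_scaleR)
  qed
  have "Ck_on k S (\<lambda>x. frechet_derivative (g \<circ> f) (at x) b)" if "b \<in> Basis" for b
  proof (rule Ck_on_cong[OF assms(1)])
    have "Ck_on k S ((\<lambda>y. frechet_derivative g (at y) j) \<circ> f)" if "j \<in> Basis" for j
      using Suc.prems that Ck_on_Suc_imp[of k S f] by (intro Suc.IH) auto
    then show "Ck_on k S (\<lambda>x. \<Sum>j\<in>Basis. (frechet_derivative f (at x) b \<bullet> j) *\<^sub>R frechet_derivative g (at (f x)) j)"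
      using Suc.prems \<open>b \<in> Basis\<close> assms(1)
      by (intro Ck_on_sum scale Ck_on_linear[OF bounded_linear_inner_left]) (auto simp: o_def)
  qed (simp add: eq)
  moreover have "(g \<circ> f) differentiable at x" if "x \<in> S" for x
    using hd[OF that] by (auto simp: differentiable_def)
  ultimately show ?case unfolding Ck_on.simps by blast
qed

lemma smooth_on_frechet_derivative:
  "smooth_on S f \<Longrightarrow> b \<in> Basis \<Longrightarrow> smooth_on S (\<lambda>x. frechet_derivative f (at x) b)"
  unfolding smooth_on_def by (metis Ck_on.simps(2))

lemma smooth_on_differentiable: "smooth_on S f \<Longrightarrow> x \<in> S \<Longrightarrow> f differentiable at x"
  unfolding smooth_on_def by (metis Ck_on.simps(2))

lemma smooth_on_compose:
  fixes f :: "'a::euclidean_space \<Rightarrow> 'b::euclidean_space" and g :: "'b \<Rightarrow> 'c::euclidean_space"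
  shows "open S \<Longrightarrow> open T \<Longrightarrow> f ` S \<subseteq> T \<Longrightarrow> smooth_on S f \<Longrightarrow> smooth_on T g \<Longrightarrow> smooth_on S (g \<circ> f)"
  by (simp add: smooth_on_def Ck_on_compose)

lemma smooth_on_cong: "open S \<Longrightarrow> smooth_on S f \<Longrightarrow> (\<And>x. x \<in> S \<Longrightarrow> f x = g x) \<Longrightarrow> smooth_on S g"
  unfolding smooth_on_def using Ck_on_cong by blast

lemma smooth_on_subset: "smooth_on S f \<Longrightarrow> T \<subseteq> S \<Longrightarrow> smooth_on T f"
  unfolding smooth_on_def using Ck_on_subset by blast

lemma smooth_on_local: "(\<And>x. x \<in> S \<Longrightarrow> \<exists>T. open T \<and> x \<in> T \<and> smooth_on T f) \<Longrightarrow> smooth_on S f"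
  unfolding smooth_on_def by (intro allI Ck_on_local) blast

section \<open>Charts and coordinate derivatives\<close>

lemma coord_system_inj: "coord_system U \<phi> \<Longrightarrow> inj_on \<phi> U"
  unfolding coord_system_def homeomorphism_def by (metis inj_on_inverseI)

lemma coord_system_inv: "coord_system U \<phi> \<Longrightarrow> x \<in> U \<Longrightarrow> inv_into U \<phi> (\<phi> x) = x"
  by (simp add: coord_system_inj)

lemma coord_system_open_image:
  assumes "coord_system U \<phi>" "open X"
  shows "open (\<phi> ` (U \<inter> X))"
proof -
  have h: "homeomorphism U (\<phi> ` U) \<phi> (inv_into U \<phi>)" and o: "open (\<phi> ` U)"
    using assms(1) by (auto simp: coord_system_def)
  have "openin (top_of_set U) (U \<inter> X)" using assms(2) by auto
  then have "openin (top_of_set (\<phi> ` U)) (\<phi> ` (U \<inter> X))"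
    using homeomorphism_imp_open_map[OF h] by blast
  then show ?thesis using o openin_open_trans by blast
qed

lemma is_chart_coord_system: "is_chart M U \<phi> \<Longrightarrow> coord_system U \<phi>"
  by (simp add: is_chart_def)

lemma is_chart_open: "is_chart M U \<phi> \<Longrightarrow> open U"
  by (simp add: is_chart_def coord_system_def)

lemma atlas_is_chart: "smooth_manifold M \<Longrightarrow> (U, \<phi>) \<in> M \<Longrightarrow> is_chart M U \<phi>"
  unfolding smooth_manifold_def is_chart_def by blast

lemma atlas_covers:
  assumes "smooth_manifold M"
  obtains U \<phi> where "(U, \<phi>) \<in> M" "x \<in> U"
proof -
  have "x \<in> (\<Union>(U, \<phi>)\<in>M. U)" using assms by (simp add: smooth_manifold_def)
  then show ?thesis using that by auto
qed

text \<open>\<open>is_chart\<close> compares a chart only with those of the atlas, so near each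
  point the transition is factored through an atlas chart.\<close>

lemma chart_transition_smooth:
  assumes M: "smooth_manifold M" and U: "is_chart M U \<phi>" and V: "is_chart M V \<psi>"
  shows "smooth_on (\<phi> ` (U \<inter> V)) (\<psi> \<circ> inv_into U \<phi>)"
proof (rule smooth_on_local)
  fix y assume "y \<in> \<phi> ` (U \<inter> V)"
  then obtain x where x: "x \<in> U" "x \<in> V" "y = \<phi> x" by auto
  obtain W \<kappa> where W: "(W, \<kappa>) \<in> M" "x \<in> W" using atlas_covers[OF M] .
  note cs = is_chart_coord_system[OF U] is_chart_coord_system[OF V] is_chart_coord_system[OF atlas_is_chart[OF M W(1)]]
  note op = is_chart_open[OF U] is_chart_open[OF V] is_chart_open[OF atlas_is_chart[OF M W(1)]]
  let ?S = "\<phi> ` (U \<inter> (V \<inter> W))" and ?T = "\<kappa> ` (W \<inter> V)"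
  have oS: "open ?S" using cs(1) op by (intro coord_system_open_image) auto
  have oT: "open ?T" using cs(3) op by (intro coord_system_open_image) auto
  have "smooth_on (\<phi> ` (U \<inter> W)) (\<kappa> \<circ> inv_into U \<phi>)"
    using U W(1) unfolding is_chart_def coord_compatible_def by blast
  then have 1: "smooth_on ?S (\<kappa> \<circ> inv_into U \<phi>)" by (rule smooth_on_subset) auto
  have "smooth_on (\<kappa> ` (V \<inter> W)) (\<psi> \<circ> inv_into W \<kappa>)"
    using V W(1) unfolding is_chart_def coord_compatible_def by blast
  then have 2: "smooth_on ?T (\<psi> \<circ> inv_into W \<kappa>)" by (rule smooth_on_subset) auto
  have "smooth_on ?S ((\<psi> \<circ> inv_into W \<kappa>) \<circ> (\<kappa> \<circ> inv_into U \<phi>))"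
    using cs by (intro smooth_on_compose[OF oS oT _ 1 2]) (auto simp: coord_system_inv)
  then have "smooth_on ?S (\<psi> \<circ> inv_into U \<phi>)"
    by (rule smooth_on_cong[OF oS]) (use cs in \<open>auto simp: coord_system_inv\<close>)
  then show "\<exists>T. open T \<and> y \<in> T \<and> smooth_on T (\<psi> \<circ> inv_into U \<phi>)"
    using oS x W by blast
qed

lemma smooth_fun_chart:
  assumes M: "smooth_manifold M" and U: "is_chart M U \<phi>" and W: "open W" and f: "smooth_fun M W f"
  shows "smooth_on (\<phi> ` (U \<inter> W)) (f \<circ> inv_into U \<phi>)"
proof (rule smooth_on_local)
  fix y assume "y \<in> \<phi> ` (U \<inter> W)"
  then obtain x where x: "x \<in> U" "x \<in> W" "y = \<phi> x" by auto
  obtain V \<kappa> where V: "(V, \<kappa>) \<in> M" "x \<in> V" using atlas_covers[OF M] .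
  note cV = atlas_is_chart[OF M V(1)]
  note cs = is_chart_coord_system[OF U] is_chart_coord_system[OF cV]
  note op = is_chart_open[OF U] is_chart_open[OF cV]
  let ?S = "\<phi> ` (U \<inter> (V \<inter> W))" and ?T = "\<kappa> ` (V \<inter> W)"
  have oS: "open ?S" using cs(1) op W by (intro coord_system_open_image) auto
  have oT: "open ?T" using cs(2) op W by (intro coord_system_open_image) auto
  have 1: "smooth_on ?S (\<kappa> \<circ> inv_into U \<phi>)"
    using chart_transition_smooth[OF M U cV] by (rule smooth_on_subset) auto
  have 2: "smooth_on ?T (f \<circ> inv_into V \<kappa>)"
    using f V(1) unfolding smooth_fun_def by blast
  have "smooth_on ?S ((f \<circ> inv_into V \<kappa>) \<circ> (\<kappa> \<circ> inv_into U \<phi>))"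
    using cs by (intro smooth_on_compose[OF oS oT _ 1 2]) (auto simp: coord_system_inv)
  then have "smooth_on ?S (f \<circ> inv_into U \<phi>)"
    by (rule smooth_on_cong[OF oS]) (use cs in \<open>auto simp: coord_system_inv\<close>)
  then show "\<exists>T. open T \<and> y \<in> T \<and> smooth_on T (f \<circ> inv_into U \<phi>)"
    using oS x V by blast
qed

lemma smooth_fun_of_chart:
  assumes M: "smooth_manifold M" and U: "is_chart M U \<phi>" and W: "open W" "W \<subseteq> U"
    and f: "smooth_on (\<phi> ` W) (f \<circ> inv_into U \<phi>)"
  shows "smooth_fun M W f"
  unfolding smooth_fun_def
proof clarify
  fix V \<kappa> assume V: "(V, \<kappa>) \<in> M"
  note cV = atlas_is_chart[OF M V]
  note cs = is_chart_coord_system[OF U] is_chart_coord_system[OF cV]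
  have oS: "open (\<kappa> ` (V \<inter> W))" using cs(2) W by (intro coord_system_open_image) auto
  have "open (\<phi> ` (U \<inter> W))" using cs(1) W by (intro coord_system_open_image) auto
  then have oT: "open (\<phi> ` W)" using W by (simp add: Int_absorb1)
  have 1: "smooth_on (\<kappa> ` (V \<inter> W)) (\<phi> \<circ> inv_into V \<kappa>)"
    using chart_transition_smooth[OF M cV U] by (rule smooth_on_subset) (use W in auto)
  have "smooth_on (\<kappa> ` (V \<inter> W)) ((f \<circ> inv_into U \<phi>) \<circ> (\<phi> \<circ> inv_into V \<kappa>))"
    using cs by (intro smooth_on_compose[OF oS oT _ 1 f]) (auto simp: coord_system_inv)
  then show "smooth_on (\<kappa> ` (V \<inter> W)) (f \<circ> inv_into V \<kappa>)"
    by (rule smooth_on_cong[OF oS]) (use cs W in \<open>auto simp: coord_system_inv subset_iff\<close>)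
qed

lemma smooth_fun_subset: "smooth_fun M W f \<Longrightarrow> V \<subseteq> W \<Longrightarrow> smooth_fun M V f"
  unfolding smooth_fun_def by (fastforce intro: smooth_on_subset)

lemma atlas_open_image:
  assumes "smooth_manifold M" "(U, \<phi>) \<in> M" "open W"
  shows "open (\<phi> ` (U \<inter> W))"
  using assms atlas_is_chart is_chart_coord_system coord_system_open_image by blast

lemma smooth_fun_local:
  assumes "smooth_manifold M" "\<And>x. x \<in> W \<Longrightarrow> \<exists>V. open V \<and> x \<in> V \<and> smooth_fun M V f"
  shows "smooth_fun M W f"
  unfolding smooth_fun_def
proof clarify
  fix U \<phi> assume U: "(U, \<phi>) \<in> M"
  show "smooth_on (\<phi> ` (U \<inter> W)) (f \<circ> inv_into U \<phi>)"
  proof (rule smooth_on_local)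
    fix y assume "y \<in> \<phi> ` (U \<inter> W)"
    then obtain x where x: "x \<in> U" "x \<in> W" "y = \<phi> x" by auto
    then obtain V where V: "open V" "x \<in> V" "smooth_fun M V f" using assms(2) by blast
    then have "smooth_on (\<phi> ` (U \<inter> V)) (f \<circ> inv_into U \<phi>)" using U by (auto simp: smooth_fun_def)
    then show "\<exists>T. open T \<and> y \<in> T \<and> smooth_on T (f \<circ> inv_into U \<phi>)"
      using atlas_open_image[OF assms(1) U V(1)] x V by blast
  qed
qed

lemma smooth_fun_cong:
  assumes "smooth_manifold M" "open W" "smooth_fun M W f" "\<And>x. x \<in> W \<Longrightarrow> f x = g x"
  shows "smooth_fun M W g"
  unfolding smooth_fun_def
proof clarify
  fix U \<phi> assume U: "(U, \<phi>) \<in> M"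
  have cs: "coord_system U \<phi>" using assms(1) U atlas_is_chart is_chart_coord_system by blast
  have "smooth_on (\<phi> ` (U \<inter> W)) (f \<circ> inv_into U \<phi>)" using assms(3) U by (auto simp: smooth_fun_def)
  then show "smooth_on (\<phi> ` (U \<inter> W)) (g \<circ> inv_into U \<phi>)"
    by (rule smooth_on_cong[OF atlas_open_image[OF assms(1) U assms(2)]])
      (use cs assms(4) in \<open>auto simp: coord_system_inv\<close>)
qed

lemma smooth_fun_const: "smooth_fun M W (\<lambda>_. c)"
  by (auto simp: smooth_fun_def smooth_on_def o_def intro: Ck_on_const)

lemma smooth_fun_iff:
  "smooth_fun M W f \<longleftrightarrow> (\<forall>U \<phi>. (U, \<phi>) \<in> M \<longrightarrow> smooth_on (\<phi> ` (U \<inter> W)) (\<lambda>y. f (inv_into U \<phi> y)))"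
  by (auto simp: smooth_fun_def o_def)

lemma smooth_fun_add:
  assumes "smooth_manifold M" "open W" "smooth_fun M W f" "smooth_fun M W g"
  shows "smooth_fun M W (\<lambda>x. f x + g x)"
  using assms(3,4) atlas_open_image[OF assms(1) _ assms(2)]
  unfolding smooth_fun_iff smooth_on_def by (simp add: Ck_on_add)

lemma smooth_fun_mult:
  assumes "smooth_manifold M" "open W" "smooth_fun M W f" "smooth_fun M W g"
  shows "smooth_fun M W (\<lambda>x. f x * g x)"
  using assms(3,4) atlas_open_image[OF assms(1) _ assms(2)]
  unfolding smooth_fun_iff smooth_on_def by (simp add: Ck_on_mult)

lemma smooth_fun_sum:
  assumes "smooth_manifold M" "open W" "\<And>i. i \<in> I \<Longrightarrow> smooth_fun M W (f i)"
  shows "smooth_fun M W (\<lambda>x. \<Sum>i\<in>I. f i x)"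
  using assms(3)
  by (induction I rule: infinite_finite_induct) (auto intro: smooth_fun_const smooth_fun_add[OF assms(1,2)])

lemma smooth_fun_coordinate:
  assumes M: "smooth_manifold M" and U: "is_chart M U \<phi>"
  shows "smooth_fun M U (\<lambda>x. \<phi> x $ j)"
proof -
  have cs: "coord_system U \<phi>" and o: "open (\<phi> ` U)"
    using U by (auto simp: is_chart_def coord_system_def)
  have "smooth_on (\<phi> ` U) (\<phi> \<circ> inv_into U \<phi>)" using chart_transition_smooth[OF M U U] by simp
  then have "smooth_on (\<phi> ` U) (\<lambda>y. (\<phi> \<circ> inv_into U \<phi>) y $ j)"
    using o unfolding smooth_on_def by (intro allI Ck_on_linear[OF bounded_linear_vec_nth]) blast+
  then show ?thesis
    by (intro smooth_fun_of_chart[OF M U is_chart_open[OF U]]) (auto simp: o_def)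
qed

lemma smooth_fun_chart_differentiable:
  assumes "smooth_manifold M" "is_chart M U \<phi>" "open W" "smooth_fun M W f" "x \<in> U" "x \<in> W"
  shows "(f \<circ> inv_into U \<phi>) differentiable at (\<phi> x)"
  using smooth_fun_chart[OF assms(1-4)] assms(5,6) by (auto intro: smooth_on_differentiable)

lemma smooth_fun_pderiv:
  assumes M: "smooth_manifold M" and U: "is_chart M U \<phi>" and W: "open W" and f: "smooth_fun M W f"
  shows "smooth_fun M (U \<inter> W) (pderiv_chart U \<phi> i f)"
proof -
  note cs = is_chart_coord_system[OF U]
  have o: "open (\<phi> ` (U \<inter> W))" using cs W by (rule coord_system_open_image)
  have "smooth_on (\<phi> ` (U \<inter> W)) (\<lambda>y. frechet_derivative (f \<circ> inv_into U \<phi>) (at y) (axis i 1))"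
    by (intro smooth_on_frechet_derivative smooth_fun_chart[OF M U W f]) (auto simp: Basis_vec_def)
  then have "smooth_on (\<phi> ` (U \<inter> W)) (pderiv_chart U \<phi> i f \<circ> inv_into U \<phi>)"
    by (rule smooth_on_cong[OF o]) (use cs in \<open>auto simp: pderiv_chart_def coord_system_inv\<close>)
  then show ?thesis
    using is_chart_open[OF U] W by (intro smooth_fun_of_chart[OF M U]) auto
qed

text \<open>The two local representatives have the same derivatives at the point, if any, and
  \<open>frechet_derivative\<close> chooses among these; so only the germ of the function
  matters.\<close>

lemma pderiv_chart_cong:
  assumes U: "is_chart M U \<phi>" and W: "open W" "x \<in> W" "x \<in> U" and eq: "\<And>y. y \<in> W \<Longrightarrow> f y = g y"
  shows "pderiv_chart U \<phi> i f x = pderiv_chart U \<phi> i g x"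
proof -
  note cs = is_chart_coord_system[OF U]
  have o: "open (\<phi> ` (U \<inter> W))" using cs W(1) by (rule coord_system_open_image)
  have eq': "(f \<circ> inv_into U \<phi>) y = (g \<circ> inv_into U \<phi>) y" if "y \<in> \<phi> ` (U \<inter> W)" for y
    using that cs eq by (auto simp: coord_system_inv)
  have px: "\<phi> x \<in> \<phi> ` (U \<inter> W)" using W by blast
  have "((f \<circ> inv_into U \<phi>) has_derivative D) (at (\<phi> x)) \<longleftrightarrow> ((g \<circ> inv_into U \<phi>) has_derivative D) (at (\<phi> x))" for D
    using has_derivative_transform_within_open[OF _ o px] eq' by (metis (no_types))
  then show ?thesis
    by (simp add: pderiv_chart_def frechet_derivative_def)
qed

lemma axis_nth_if: "axis i c $ j = (if i = j then c else 0)"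
  by (auto simp: axis_def)

section \<open>Rules for partial derivatives at a point of a chart\<close>

context
  fixes M :: "('m::{t2_space,second_countable_topology}, 'n::finite) atlas" and U \<phi> W x
  assumes M: "smooth_manifold M" and U: "is_chart M U \<phi>" and W: "open W" and x: "x \<in> U" "x \<in> W"
begin

lemma pderiv_chart_const: "pderiv_chart U \<phi> i (\<lambda>_. c) x = 0"
  unfolding pderiv_chart_def o_def by simp

lemma pderiv_chart_add:
  assumes "smooth_fun M W f" "smooth_fun M W g"
  shows "pderiv_chart U \<phi> i (\<lambda>y. f y + g y) x = pderiv_chart U \<phi> i f x + pderiv_chart U \<phi> i g x"
proof -
  let ?f = "f \<circ> inv_into U \<phi>" and ?g = "g \<circ> inv_into U \<phi>"
  have "(?f has_derivative frechet_derivative ?f (at (\<phi> x))) (at (\<phi> x))"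
    "(?g has_derivative frechet_derivative ?g (at (\<phi> x))) (at (\<phi> x))"
    using smooth_fun_chart_differentiable[OF M U W _ x] assms by (simp_all add: frechet_derivative_works[symmetric])
  from fun_cong[OF frechet_derivative_at[OF has_derivative_add[OF this]], of "axis i 1"]
  show ?thesis by (simp add: pderiv_chart_def o_def)
qed

lemma pderiv_chart_mult:
  assumes "smooth_fun M W f" "smooth_fun M W g"
  shows "pderiv_chart U \<phi> i (\<lambda>y. f y * g y) x = f x * pderiv_chart U \<phi> i g x + pderiv_chart U \<phi> i f x * g x"
proof -
  let ?f = "f \<circ> inv_into U \<phi>" and ?g = "g \<circ> inv_into U \<phi>"
  have "(?f has_derivative frechet_derivative ?f (at (\<phi> x))) (at (\<phi> x))"
    "(?g has_derivative frechet_derivative ?g (at (\<phi> x))) (at (\<phi> x))"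
    using smooth_fun_chart_differentiable[OF M U W _ x] assms by (simp_all add: frechet_derivative_works[symmetric])
  from fun_cong[OF frechet_derivative_at[OF has_derivative_mult[OF this]], of "axis i 1"]
  show ?thesis
    using x coord_system_inv[OF is_chart_coord_system[OF U]] by (simp add: pderiv_chart_def o_def)
qed

lemma pderiv_chart_sum:
  assumes "\<And>j. j \<in> J \<Longrightarrow> smooth_fun M W (f j)"
  shows "pderiv_chart U \<phi> i (\<lambda>y. \<Sum>j\<in>J. f j y) x = (\<Sum>j\<in>J. pderiv_chart U \<phi> i (f j) x)"
  using assms
proof (induction J rule: infinite_finite_induct)
  case (insert j J)
  then show ?case
    using pderiv_chart_add[of "f j" "\<lambda>y. \<Sum>j\<in>J. f j y"] smooth_fun_sum[OF M W, of J f] by simp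
qed (simp_all add: pderiv_chart_const)

lemma pderiv_chart_cmult:
  "smooth_fun M W f \<Longrightarrow> pderiv_chart U \<phi> i (\<lambda>y. c * f y) x = c * pderiv_chart U \<phi> i f x"
  using pderiv_chart_mult[OF smooth_fun_const, of f] by (simp add: pderiv_chart_const)

lemma pderiv_chart_coordinate: "pderiv_chart U \<phi> i (\<lambda>y. \<phi> y $ j) x = (if i = j then 1 else 0)"
proof -
  note cs = is_chart_coord_system[OF U]
  have o: "open (\<phi> ` U)" using cs by (simp add: coord_system_def)
  have "((\<lambda>y. y $ j) has_derivative (\<lambda>v. v $ j)) (at (\<phi> x))"
    by (intro bounded_linear_imp_has_derivative bounded_linear_vec_nth)
  then have "(((\<lambda>y. \<phi> y $ j) \<circ> inv_into U \<phi>) has_derivative (\<lambda>v. v $ j)) (at (\<phi> x))"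
    by (rule has_derivative_transform_within_open[OF _ o]) (use x in \<open>auto simp: f_inv_into_f\<close>)
  from fun_cong[OF frechet_derivative_at[OF this], of "axis i 1"]
  show ?thesis unfolding pderiv_chart_def by (simp add: axis_nth_if)
qed

lemma pderiv_chart_chain:
  assumes V: "is_chart M V \<psi>" "x \<in> V" and f: "smooth_fun M W f"
  shows "pderiv_chart U \<phi> i f x = (\<Sum>j\<in>UNIV. pderiv_chart U \<phi> i (\<lambda>y. \<psi> y $ j) x * pderiv_chart V \<psi> j f x)"
proof -
  note cs = is_chart_coord_system[OF U] is_chart_coord_system[OF V(1)]
  let ?t = "\<psi> \<circ> inv_into U \<phi>" and ?g = "f \<circ> inv_into V \<psi>"
  have o: "open (\<phi> ` (U \<inter> (V \<inter> W)))"
    using is_chart_open[OF V(1)] W by (intro coord_system_open_image[OF cs(1)]) auto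
  have tx: "?t (\<phi> x) = \<psi> x" using x coord_system_inv[OF cs(1)] by simp
  have dt: "(?t has_derivative frechet_derivative ?t (at (\<phi> x))) (at (\<phi> x))"
    using smooth_on_differentiable[OF chart_transition_smooth[OF M U V(1)], of "\<phi> x"] x V
    by (simp add: frechet_derivative_works[symmetric])
  have dg: "(?g has_derivative frechet_derivative ?g (at (\<psi> x))) (at (?t (\<phi> x)))"
    unfolding tx using smooth_fun_chart_differentiable[OF M V(1) W f V(2) x(2)]
    by (simp add: frechet_derivative_works[symmetric])
  have "((\<lambda>y. ?g (?t y)) has_derivative (\<lambda>v. frechet_derivative ?g (at (\<psi> x)) (frechet_derivative ?t (at (\<phi> x)) v))) (at (\<phi> x))"
    using has_derivative_compose[OF dt dg] .
  then have "((f \<circ> inv_into U \<phi>) has_derivative (\<lambda>v. frechet_derivative ?g (at (\<psi> x)) (frechet_derivative ?t (at (\<phi> x)) v))) (at (\<phi> x))"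
    by (rule has_derivative_transform_within_open[OF _ o]) (use x V cs in \<open>auto simp: coord_system_inv\<close>)
  from fun_cong[OF frechet_derivative_at[OF this], of "axis i 1"]
  have 1: "pderiv_chart U \<phi> i f x = frechet_derivative ?g (at (\<psi> x)) (frechet_derivative ?t (at (\<phi> x)) (axis i 1))"
    unfolding pderiv_chart_def by (rule sym)
  have 2: "frechet_derivative ?t (at (\<phi> x)) (axis i 1) $ j = pderiv_chart U \<phi> i (\<lambda>y. \<psi> y $ j) x" for j
  proof -
    have "((\<lambda>y. ?t y $ j) has_derivative (\<lambda>v. frechet_derivative ?t (at (\<phi> x)) v $ j)) (at (\<phi> x))"
      by (rule bounded_linear.has_derivative[OF bounded_linear_vec_nth dt])
    from fun_cong[OF frechet_derivative_at[OF this], of "axis i 1"] show ?thesis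
      by (simp add: pderiv_chart_def o_def)
  qed
  have lin: "linear (frechet_derivative ?g (at (\<psi> x)))"
    using dg has_derivative_linear by blast
  have "frechet_derivative ?t (at (\<phi> x)) (axis i 1) = (\<Sum>j\<in>UNIV. pderiv_chart U \<phi> i (\<lambda>y. \<psi> y $ j) x *\<^sub>R axis j 1)"
    unfolding 2[symmetric] by (simp add: vec_eq_iff axis_def if_distrib cong: if_cong)
  then have "pderiv_chart U \<phi> i f x = (\<Sum>j\<in>UNIV. pderiv_chart U \<phi> i (\<lambda>y. \<psi> y $ j) x *\<^sub>R frechet_derivative ?g (at (\<psi> x)) (axis j 1))"
    unfolding 1 by (simp add: linear_sum[OF lin] linear_scale[OF lin])
  then show ?thesis by (simp add: pderiv_chart_def)
qed

end

section \<open>Vector bundles, duals and biduals\<close>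

lemma triv_inv: "trivialisation E U \<psi> \<Longrightarrow> x \<in> U \<Longrightarrow> inv (\<psi> x) (\<psi> x v) = v"
  unfolding trivialisation_def bij_betw_def by (simp add: inv_f_f)

lemma triv_inv_right: "trivialisation E U \<psi> \<Longrightarrow> x \<in> U \<Longrightarrow> v \<in> fibre E x \<Longrightarrow> \<psi> x (inv (\<psi> x) v) = v"
  unfolding trivialisation_def bij_betw_def by (metis f_inv_into_f)

lemma triv_fibre: "trivialisation E U \<psi> \<Longrightarrow> x \<in> U \<Longrightarrow> \<psi> x v \<in> fibre E x"
  unfolding trivialisation_def bij_betw_def by blast

lemma triv_add: "trivialisation E U \<psi> \<Longrightarrow> x \<in> U \<Longrightarrow> \<psi> x (v + w) = vadd E x (\<psi> x v) (\<psi> x w)"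
  unfolding trivialisation_def by blast

lemma triv_scale: "trivialisation E U \<psi> \<Longrightarrow> x \<in> U \<Longrightarrow> \<psi> x (t *\<^sub>R v) = vscale E x t (\<psi> x v)"
  unfolding trivialisation_def by blast

lemma triv_open: "trivialisation E U \<psi> \<Longrightarrow> open U"
  unfolding trivialisation_def by blast

lemma triv_coord_add:
  "trivialisation E U \<psi> \<Longrightarrow> x \<in> U \<Longrightarrow> v \<in> fibre E x \<Longrightarrow> w \<in> fibre E x \<Longrightarrow>
    inv (\<psi> x) (vadd E x v w) = inv (\<psi> x) v + inv (\<psi> x) w"
  using triv_inv[of E U \<psi> x "inv (\<psi> x) v + inv (\<psi> x) w"] by (simp add: triv_add triv_inv_right)

lemma triv_coord_scale:
  "trivialisation E U \<psi> \<Longrightarrow> x \<in> U \<Longrightarrow> v \<in> fibre E x \<Longrightarrow>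
    inv (\<psi> x) (vscale E x t v) = t *\<^sub>R inv (\<psi> x) v"
  using triv_inv[of E U \<psi> x "t *\<^sub>R inv (\<psi> x) v"] by (simp add: triv_scale triv_inv_right)

lemma triv_change_linear:
  assumes "trivialisation E U \<psi>" "trivialisation E V \<eta>" "x \<in> U" "x \<in> V"
  shows "linear (\<lambda>v. inv (\<eta> x) (\<psi> x v))"
  using assms by (intro linearI) (simp_all add: triv_add triv_scale triv_coord_add triv_coord_scale triv_fibre)

lemma vec_axis_sum: "(v :: real^'r) = (\<Sum>b\<in>UNIV. v $ b *\<^sub>R axis b 1)"
  by (simp add: vec_eq_iff axis_nth_if if_distrib cong: if_cong)

lemma trans_mat_apply:
  assumes "trivialisation E U \<psi>" "trivialisation E V \<eta>" "x \<in> U" "x \<in> V"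
  shows "inv (\<eta> x) (\<psi> x v) $ a = (\<Sum>b\<in>UNIV. trans_mat \<psi> \<eta> x a b * v $ b)"
proof -
  note lin = triv_change_linear[OF assms]
  have "inv (\<eta> x) (\<psi> x v) = (\<Sum>b\<in>UNIV. v $ b *\<^sub>R inv (\<eta> x) (\<psi> x (axis b 1)))"
    by (subst vec_axis_sum[of v]) (simp add: linear_sum[OF lin] linear_scale[OF lin])
  then show ?thesis by (simp add: trans_mat_def mult.commute)
qed

lemma trans_mat_cocycle:
  assumes "trivialisation E U \<psi>" "trivialisation E V \<eta>" "trivialisation E W \<zeta>" "x \<in> U" "x \<in> V" "x \<in> W"
  shows "trans_mat \<psi> \<zeta> x a c = (\<Sum>b\<in>UNIV. trans_mat \<eta> \<zeta> x a b * trans_mat \<psi> \<eta> x b c)"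
proof -
  have "trans_mat \<psi> \<zeta> x a c = inv (\<zeta> x) (\<eta> x (inv (\<eta> x) (\<psi> x (axis c 1)))) $ a"
    using assms by (simp add: trans_mat_def triv_inv_right triv_fibre)
  then show ?thesis
    using assms by (simp add: trans_mat_apply[of E V \<eta> W \<zeta>] trans_mat_def)
qed

lemma trans_mat_self: "trivialisation E U \<psi> \<Longrightarrow> x \<in> U \<Longrightarrow> trans_mat \<psi> \<psi> x a b = (if a = b then 1 else 0)"
  by (auto simp: trans_mat_def triv_inv axis_nth_if)

lemma local_triv_triv: "local_triv M E U \<psi> \<Longrightarrow> trivialisation E U \<psi>"
  by (simp add: local_triv_def)

lemma bundle_local_triv: "vector_bundle M E \<Longrightarrow> (U, \<psi>) \<in> trivs E \<Longrightarrow> local_triv M E U \<psi>"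
  unfolding vector_bundle_def local_triv_def by blast

lemma bundle_covers:
  assumes "vector_bundle M E"
  obtains U \<psi> where "(U, \<psi>) \<in> trivs E" "x \<in> U"
proof -
  have "x \<in> (\<Union>(U, \<psi>)\<in>trivs E. U)" using assms by (simp add: vector_bundle_def)
  then show ?thesis using that by auto
qed

text \<open>Near each point the change of frame is a product of two smooth ones through an
  intermediate frame, which may depend on the point.\<close>

lemma trans_mat_smooth_local:
  assumes M: "smooth_manifold M" and tr: "trivialisation E U \<psi>" "trivialisation E V \<eta>"
    and loc: "\<And>x. x \<in> U \<Longrightarrow> x \<in> V \<Longrightarrow> \<exists>W \<zeta>. trivialisation E W \<zeta> \<and> x \<in> W \<and>
      (\<forall>a b. smooth_fun M (U \<inter> W) (\<lambda>x. trans_mat \<psi> \<zeta> x a b)) \<and>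
      (\<forall>a b. smooth_fun M (W \<inter> V) (\<lambda>x. trans_mat \<zeta> \<eta> x a b))"
  shows "smooth_fun M (U \<inter> V) (\<lambda>x. trans_mat \<psi> \<eta> x a b)"
proof (rule smooth_fun_local[OF M])
  fix x assume "x \<in> U \<inter> V"
  then obtain W \<zeta> where W: "trivialisation E W \<zeta>" "x \<in> W"
    and s: "\<And>a b. smooth_fun M (U \<inter> W) (\<lambda>x. trans_mat \<psi> \<zeta> x a b)"
      "\<And>a b. smooth_fun M (W \<inter> V) (\<lambda>x. trans_mat \<zeta> \<eta> x a b)"
    using loc by blast
  have o: "open (U \<inter> V \<inter> W)" using tr W by (auto dest: triv_open)
  have "smooth_fun M (U \<inter> V \<inter> W) (\<lambda>x. \<Sum>c\<in>UNIV. trans_mat \<zeta> \<eta> x a c * trans_mat \<psi> \<zeta> x c b)"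
    by (intro smooth_fun_sum[OF M o] smooth_fun_mult[OF M o]) (auto intro: smooth_fun_subset[OF s(1)] smooth_fun_subset[OF s(2)])
  then have "smooth_fun M (U \<inter> V \<inter> W) (\<lambda>x. trans_mat \<psi> \<eta> x a b)"
    by (rule smooth_fun_cong[OF M o]) (use trans_mat_cocycle[OF tr(1) W(1) tr(2)] in auto)
  then show "\<exists>V'. open V' \<and> x \<in> V' \<and> smooth_fun M V' (\<lambda>x. trans_mat \<psi> \<eta> x a b)"
    using o \<open>x \<in> U \<inter> V\<close> W by blast
qed

lemma trans_mat_smooth:
  assumes M: "smooth_manifold M" and E: "vector_bundle M E"
    and tr: "local_triv M E U \<psi>" "local_triv M E V \<eta>"
  shows "smooth_fun M (U \<inter> V) (\<lambda>x. trans_mat \<psi> \<eta> x a b)"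
proof (rule trans_mat_smooth_local[OF M])
  fix x assume "x \<in> U" "x \<in> V"
  obtain W \<zeta> where W: "(W, \<zeta>) \<in> trivs E" "x \<in> W" using bundle_covers[OF E] .
  then have "triv_compatible M U \<psi> W \<zeta>" "triv_compatible M V \<eta> W \<zeta>"
    using tr by (auto simp: local_triv_def)
  then have "\<forall>a b. smooth_fun M (U \<inter> W) (\<lambda>x. trans_mat \<psi> \<zeta> x a b)"
    "\<forall>a b. smooth_fun M (W \<inter> V) (\<lambda>x. trans_mat \<zeta> \<eta> x a b)"
    unfolding triv_compatible_def Int_commute[of W V] by blast+
  then show "\<exists>W \<zeta>. trivialisation E W \<zeta> \<and> x \<in> W \<and>
      (\<forall>a b. smooth_fun M (U \<inter> W) (\<lambda>x. trans_mat \<psi> \<zeta> x a b)) \<and>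
      (\<forall>a b. smooth_fun M (W \<inter> V) (\<lambda>x. trans_mat \<zeta> \<eta> x a b))"
    using local_triv_triv[OF bundle_local_triv[OF E W(1)]] W(2) by blast
qed (use tr in \<open>auto dest: local_triv_triv\<close>)

text \<open>Compatibility need only be tested against one convenient frame near each point, because
  that frame is smoothly related to all of \<open>trivs E\<close>. It serves for frames carried back
  from the bidual.\<close>

lemma local_trivI:
  assumes M: "smooth_manifold M" and E: "vector_bundle M E" and tr: "trivialisation E U \<psi>"
    and loc: "\<And>x. x \<in> U \<Longrightarrow> \<exists>W \<zeta>. local_triv M E W \<zeta> \<and> x \<in> W \<and>
      (\<forall>a b. smooth_fun M (U \<inter> W) (\<lambda>x. trans_mat \<psi> \<zeta> x a b)) \<and>
      (\<forall>a b. smooth_fun M (U \<inter> W) (\<lambda>x. trans_mat \<zeta> \<psi> x a b))"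
  shows "local_triv M E U \<psi>"
  unfolding local_triv_def triv_compatible_def
proof (intro conjI tr, clarify, intro allI conjI)
  fix V \<eta> a b assume "(V, \<eta>) \<in> trivs E"
  then have V: "local_triv M E V \<eta>" using E by (rule bundle_local_triv[rotated])
  note tV = local_triv_triv[OF V]
  show "smooth_fun M (U \<inter> V) (\<lambda>x. trans_mat \<psi> \<eta> x a b)"
  proof (rule trans_mat_smooth_local[OF M tr tV])
    fix x assume "x \<in> U" "x \<in> V"
    then obtain W \<zeta> where W: "local_triv M E W \<zeta>" "x \<in> W"
      "\<And>a b. smooth_fun M (U \<inter> W) (\<lambda>x. trans_mat \<psi> \<zeta> x a b)" using loc by blast
    then show "\<exists>W \<zeta>. trivialisation E W \<zeta> \<and> x \<in> W \<and>
      (\<forall>a b. smooth_fun M (U \<inter> W) (\<lambda>x. trans_mat \<psi> \<zeta> x a b)) \<and>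
      (\<forall>a b. smooth_fun M (W \<inter> V) (\<lambda>x. trans_mat \<zeta> \<eta> x a b))"
      using local_triv_triv trans_mat_smooth[OF M E _ V] by blast
  qed
  have "smooth_fun M (V \<inter> U) (\<lambda>x. trans_mat \<eta> \<psi> x a b)"
  proof (rule trans_mat_smooth_local[OF M tV tr])
    fix x assume "x \<in> V" "x \<in> U"
    then obtain W \<zeta> where W: "local_triv M E W \<zeta>" "x \<in> W"
      "\<And>a b. smooth_fun M (W \<inter> U) (\<lambda>x. trans_mat \<zeta> \<psi> x a b)" using loc by (metis Int_commute)
    then show "\<exists>W \<zeta>. trivialisation E W \<zeta> \<and> x \<in> W \<and>
      (\<forall>a b. smooth_fun M (V \<inter> W) (\<lambda>x. trans_mat \<eta> \<zeta> x a b)) \<and>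
      (\<forall>a b. smooth_fun M (W \<inter> U) (\<lambda>x. trans_mat \<zeta> \<psi> x a b))"
      using local_triv_triv trans_mat_smooth[OF M E V] by blast
  qed
  then show "smooth_fun M (U \<inter> V) (\<lambda>x. trans_mat \<eta> \<psi> x a b)" by (simp add: Int_commute)
qed

section \<open>The dual bundle \<open>dagger A L\<close> and its frames\<close>

definition vec1 :: "real \<Rightarrow> real^1" where "vec1 r = (\<chi> _. r)"

lemma vec1_nth [simp]: "vec1 r $ i = r" and vec1_eta [simp]: "vec1 (v $ 1) = v"
  and vec1_add: "vec1 (r + s) = vec1 r + vec1 s" and vec1_scale: "vec1 (t * r) = t *\<^sub>R vec1 r"
  by (simp_all add: vec1_def vec_eq_iff)

lemma dual_triv_apply:
  "v \<in> fibre A x \<Longrightarrow> dual_triv A \<psi> \<mu> x c v = \<mu> x (vec1 (\<Sum>a\<in>UNIV. c $ a * inv (\<psi> x) v $ a))"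
  by (simp add: dual_triv_def vec1_def)

lemma dagger_simps:
  "fibre (dagger A L) x = {f \<in> fibre A x \<rightarrow>\<^sub>E fibre L x.
        (\<forall>v\<in>fibre A x. \<forall>w\<in>fibre A x. f (vadd A x v w) = vadd L x (f v) (f w)) \<and>
        (\<forall>t. \<forall>v\<in>fibre A x. f (vscale A x t v) = vscale L x t (f v))}"
  "vadd (dagger A L) x f g = (\<lambda>v\<in>fibre A x. vadd L x (f v) (g v))"
  "vscale (dagger A L) x t f = (\<lambda>v\<in>fibre A x. vscale L x t (f v))"
  "trivs (dagger A L) = {(U \<inter> V, dual_triv A \<psi> \<mu>) | U \<psi> V \<mu>. (U, \<psi>) \<in> trivs A \<and> (V, \<mu>) \<in> trivs L}"
  by (simp_all add: dagger_def)

context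
  fixes A :: "('m::topological_space, 'v, 'r::finite) vbundle" and L :: "('m, 'w) lbundle"
    and U \<psi> V \<mu> and x
  assumes tA: "trivialisation A U \<psi>" and tL: "trivialisation L V \<mu>" and xU: "x \<in> U" and xV: "x \<in> V"
begin

lemma dual_triv_frame: "dual_triv A \<psi> \<mu> x c (\<psi> x d) = \<mu> x (vec1 (\<Sum>a\<in>UNIV. c $ a * d $ a))"
  using tA xU by (simp add: dual_triv_apply triv_fibre triv_inv)

lemma vadd_fibre: "v \<in> fibre A x \<Longrightarrow> w \<in> fibre A x \<Longrightarrow> vadd A x v w \<in> fibre A x"
  using triv_fibre[OF tA xU, of "inv (\<psi> x) v + inv (\<psi> x) w"] by (simp add: triv_add[OF tA xU] triv_inv_right[OF tA xU])

lemma vscale_fibre: "v \<in> fibre A x \<Longrightarrow> vscale A x t v \<in> fibre A x"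
  using triv_fibre[OF tA xU, of "t *\<^sub>R inv (\<psi> x) v"] by (simp add: triv_scale[OF tA xU] triv_inv_right[OF tA xU])

lemma dual_triv_fibre: "dual_triv A \<psi> \<mu> x c \<in> fibre (dagger A L) x"
proof -
  have "dual_triv A \<psi> \<mu> x c \<in> fibre A x \<rightarrow>\<^sub>E fibre L x"
    using tL xV by (auto simp: dual_triv_def intro: triv_fibre)
  moreover have "dual_triv A \<psi> \<mu> x c (vadd A x v w) = vadd L x (dual_triv A \<psi> \<mu> x c v) (dual_triv A \<psi> \<mu> x c w)"
    if "v \<in> fibre A x" "w \<in> fibre A x" for v w
    using that tA tL xU xV
    by (simp add: dual_triv_apply vadd_fibre triv_coord_add triv_add[symmetric] vec1_add[symmetric]
        distrib_left sum.distrib)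
  moreover have "dual_triv A \<psi> \<mu> x c (vscale A x t v) = vscale L x t (dual_triv A \<psi> \<mu> x c v)"
    if "v \<in> fibre A x" for v t
    using that tA tL xU xV
    by (simp add: dual_triv_apply vscale_fibre triv_coord_scale triv_scale[symmetric] vec1_scale[symmetric]
        sum_distrib_left mult_ac)
  ultimately show ?thesis by (simp add: dagger_simps)
qed

lemma dual_triv_eqI:
  assumes "f \<in> fibre (dagger A L) x" "g \<in> fibre (dagger A L) x" "\<And>d. f (\<psi> x d) = g (\<psi> x d)"
  shows "f = g"
proof
  fix v
  show "f v = g v"
  proof (cases "v \<in> fibre A x")
    case True
    then show ?thesis using assms(3)[of "inv (\<psi> x) v"] tA xU by (simp add: triv_inv_right)
  next
    case False
    then show ?thesis using assms(1,2) by (auto simp: dagger_simps PiE_def extensional_def)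
  qed
qed

lemma fibre_dagger_linear:
  assumes f: "f \<in> fibre (dagger A L) x"
  shows "linear (\<lambda>d. inv (\<mu> x) (f (\<psi> x d)))"
proof -
  have "f v \<in> fibre L x" if "v \<in> fibre A x" for v
    using f that by (auto simp: dagger_simps)
  moreover have "f (vadd A x v w) = vadd L x (f v) (f w)"
    if "v \<in> fibre A x" "w \<in> fibre A x" for v w
    using f that by (auto simp: dagger_simps)
  moreover have "f (vscale A x t v) = vscale L x t (f v)" if "v \<in> fibre A x" for v t
    using f that by (auto simp: dagger_simps)
  ultimately show ?thesis
    using tA tL xU xV by (intro linearI) (simp_all add: triv_add triv_scale triv_fibre triv_coord_add triv_coord_scale)
qed

text \<open>The coordinates of \<open>f\<close> are its components on the frame
  \<open>\<psi>\<close>, measured with \<open>\<mu>\<close>; by linearity they determine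
  \<open>f\<close> on the fibre, and extensionality determines it elsewhere.\<close>

lemma dual_triv_surj:
  assumes f: "f \<in> fibre (dagger A L) x"
  shows "f = dual_triv A \<psi> \<mu> x (\<chi> a. inv (\<mu> x) (f (\<psi> x (axis a 1))) $ 1)"
proof (rule dual_triv_eqI[OF f dual_triv_fibre])
  fix d
  note lin = fibre_dagger_linear[OF f]
  have "inv (\<mu> x) (f (\<psi> x d)) = (\<Sum>b\<in>UNIV. d $ b *\<^sub>R inv (\<mu> x) (f (\<psi> x (axis b 1))))"
    by (subst vec_axis_sum[of d]) (simp add: linear_sum[OF lin] linear_scale[OF lin])
  then have "inv (\<mu> x) (f (\<psi> x d)) = vec1 (\<Sum>a\<in>UNIV. inv (\<mu> x) (f (\<psi> x (axis a 1))) $ 1 * d $ a)"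
    by (simp add: vec_eq_iff forall_1 mult.commute)
  moreover have "f (\<psi> x d) \<in> fibre L x"
    using f tA xU triv_fibre by (fastforce simp: dagger_simps)
  ultimately have "f (\<psi> x d) = \<mu> x (vec1 (\<Sum>a\<in>UNIV. inv (\<mu> x) (f (\<psi> x (axis a 1))) $ 1 * d $ a))"
    using triv_inv_right[OF tL xV] by metis
  then show "f (\<psi> x d) = dual_triv A \<psi> \<mu> x (\<chi> a. inv (\<mu> x) (f (\<psi> x (axis a 1))) $ 1) (\<psi> x d)"
    by (simp add: dual_triv_frame)
qed

lemma dual_triv_coord: "inv (\<mu> x) (dual_triv A \<psi> \<mu> x c (\<psi> x (axis a 1))) $ 1 = c $ a"
  using tL xV by (simp add: dual_triv_frame triv_inv axis_nth_if if_distrib cong: if_cong)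

lemma dual_triv_bij: "bij_betw (dual_triv A \<psi> \<mu> x) UNIV (fibre (dagger A L) x)"
proof (rule bij_betwI')
  show "(dual_triv A \<psi> \<mu> x c = dual_triv A \<psi> \<mu> x d) = (c = d)" for c d
  proof
    assume eq: "dual_triv A \<psi> \<mu> x c = dual_triv A \<psi> \<mu> x d"
    have "c $ a = d $ a" for a using dual_triv_coord[of c a] dual_triv_coord[of d a] eq by simp
    then show "c = d" by (simp add: vec_eq_iff)
  qed simp
qed (use dual_triv_fibre dual_triv_surj in blast)+

lemma dual_triv_inv:
  assumes "f \<in> fibre (dagger A L) x"
  shows "inv (dual_triv A \<psi> \<mu> x) f $ a = inv (\<mu> x) (f (\<psi> x (axis a 1))) $ 1"
proof -
  have "inj (dual_triv A \<psi> \<mu> x)" using dual_triv_bij by (simp add: bij_betw_def)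
  then have "inv (dual_triv A \<psi> \<mu> x) f = (\<chi> a. inv (\<mu> x) (f (\<psi> x (axis a 1))) $ 1)"
    by (subst dual_triv_surj[OF assms]) (rule inv_f_f)
  then show ?thesis by simp
qed

end

lemma dual_trivialisation:
  assumes tA: "trivialisation A U \<psi>" and tL: "trivialisation L V \<mu>"
  shows "trivialisation (dagger A L) (U \<inter> V) (dual_triv A \<psi> \<mu>)"
  unfolding trivialisation_def
proof (intro conjI ballI)
  show "open (U \<inter> V)" using assms by (auto dest: triv_open)
  fix x assume "x \<in> U \<inter> V"
  then have x: "x \<in> U" "x \<in> V" by auto
  show "bij_betw (dual_triv A \<psi> \<mu> x) UNIV (fibre (dagger A L) x)" by (rule dual_triv_bij[OF assms x])
  show "\<forall>a b. dual_triv A \<psi> \<mu> x (a + b) = vadd (dagger A L) x (dual_triv A \<psi> \<mu> x a) (dual_triv A \<psi> \<mu> x b)"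
    using x by (auto simp: dagger_simps fun_eq_iff dual_triv_def[of A] triv_add[OF tL, symmetric] vec1_def[symmetric]
        vec1_add[symmetric] distrib_right sum.distrib)
  show "\<forall>t a. dual_triv A \<psi> \<mu> x (t *\<^sub>R a) = vscale (dagger A L) x t (dual_triv A \<psi> \<mu> x a)"
    using x by (auto simp: dagger_simps fun_eq_iff dual_triv_def[of A] triv_scale[OF tL, symmetric] vec1_def[symmetric]
        vec1_scale[symmetric] sum_distrib_left mult_ac)
qed

text \<open>Covectors change by the transposed inverse matrix, and values in \<open>L\<close>
  contribute the factor of the line bundle. This is the coefficient with which p_a changes, so the
  fibre coordinates of \<open>dagger A L\<close> and the p_a transform alike.\<close>

lemma trans_mat_dual:
  assumes "trivialisation A U \<psi>" "trivialisation L V \<mu>" "trivialisation A U' \<psi>'" "trivialisation L V' \<mu>'"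
    "x \<in> U" "x \<in> V" "x \<in> U'" "x \<in> V'"
  shows "trans_mat (dual_triv A \<psi> \<mu>) (dual_triv A \<psi>' \<mu>') x a b =
    trans_mat \<mu> \<mu>' x 1 1 * trans_mat \<psi>' \<psi> x b a"
proof -
  have "trans_mat (dual_triv A \<psi> \<mu>) (dual_triv A \<psi>' \<mu>') x a b =
      inv (\<mu>' x) (dual_triv A \<psi> \<mu> x (axis b 1) (\<psi>' x (axis a 1))) $ 1"
    unfolding trans_mat_def using assms by (intro dual_triv_inv dual_triv_fibre)
  also have "\<dots> = inv (\<mu>' x) (\<mu> x (vec1 (inv (\<psi> x) (\<psi>' x (axis a 1)) $ b))) $ 1"
    using assms by (simp add: dual_triv_apply triv_fibre axis_nth_if if_distribR if_distrib[of "\<lambda>r. r * _"] cong: if_cong)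
  also have "\<dots> = trans_mat \<mu> \<mu>' x 1 1 * trans_mat \<psi>' \<psi> x b a"
    using assms by (simp add: trans_mat_apply[of L V \<mu> V' \<mu>'] trans_mat_def[of \<psi>'] UNIV_1)
  finally show ?thesis .
qed

lemma trans_mat_dual_smooth:
  assumes M: "smooth_manifold M" and A: "vector_bundle M A" and L: "vector_bundle M L"
    and "local_triv M A U \<psi>" "local_triv M L V \<mu>" "local_triv M A U' \<psi>'" "local_triv M L V' \<mu>'"
  shows "smooth_fun M ((U \<inter> V) \<inter> (U' \<inter> V')) (\<lambda>x. trans_mat (dual_triv A \<psi> \<mu>) (dual_triv A \<psi>' \<mu>') x a b)"
proof (rule smooth_fun_cong[OF M])
  show o: "open ((U \<inter> V) \<inter> (U' \<inter> V'))"
    using assms(4-7) by (auto dest!: local_triv_triv triv_open)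
  show "smooth_fun M ((U \<inter> V) \<inter> (U' \<inter> V')) (\<lambda>x. trans_mat \<mu> \<mu>' x 1 1 * trans_mat \<psi>' \<psi> x b a)"
    by (intro smooth_fun_mult[OF M o] smooth_fun_subset[OF trans_mat_smooth[OF M L assms(5,7)]]
        smooth_fun_subset[OF trans_mat_smooth[OF M A assms(6,4)]]) auto
  show "trans_mat \<mu> \<mu>' x 1 1 * trans_mat \<psi>' \<psi> x b a = trans_mat (dual_triv A \<psi> \<mu>) (dual_triv A \<psi>' \<mu>') x a b"
    if "x \<in> (U \<inter> V) \<inter> (U' \<inter> V')" for x
    using that by (intro trans_mat_dual[symmetric, OF assms(4-7)[THEN local_triv_triv]]) auto
qed

lemma triv_compatible_dual:
  assumes "smooth_manifold M" "vector_bundle M A" "vector_bundle M L"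
    and "local_triv M A U \<psi>" "local_triv M L V \<mu>" "local_triv M A U' \<psi>'" "local_triv M L V' \<mu>'"
  shows "triv_compatible M (U \<inter> V) (dual_triv A \<psi> \<mu>) (U' \<inter> V') (dual_triv A \<psi>' \<mu>')"
  unfolding triv_compatible_def
  using trans_mat_dual_smooth[OF assms] trans_mat_dual_smooth[OF assms(1-3,6,7,4,5)]
  by (simp add: Int_commute)

lemma vector_bundle_dagger:
  assumes M: "smooth_manifold M" and A: "vector_bundle M A" and L: "vector_bundle M L"
  shows "vector_bundle M (dagger A L)"
  unfolding vector_bundle_def
proof (intro conjI)
  show "\<forall>(U, \<psi>)\<in>trivs (dagger A L). trivialisation (dagger A L) U \<psi>"
    using A L by (auto simp: dagger_simps intro!: dual_trivialisation dest: bundle_local_triv local_triv_triv)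
  show "\<forall>(U, \<psi>)\<in>trivs (dagger A L). \<forall>(V, \<eta>)\<in>trivs (dagger A L). triv_compatible M U \<psi> V \<eta>"
    unfolding dagger_simps using bundle_local_triv[OF A] bundle_local_triv[OF L]
    by (auto intro!: triv_compatible_dual[OF M A L])
  have "x \<in> (\<Union>(U, \<psi>)\<in>trivs (dagger A L). U)" for x
  proof -
    obtain U \<psi> V \<mu> where "(U, \<psi>) \<in> trivs A" "x \<in> U" "(V, \<mu>) \<in> trivs L" "x \<in> V"
      using bundle_covers[OF A] bundle_covers[OF L] by metis
    then show ?thesis
      by (intro UN_I[of "(U \<inter> V, dual_triv A \<psi> \<mu>)"]) (auto simp: dagger_simps)
  qed
  then show "(\<Union>(U, \<psi>)\<in>trivs (dagger A L). U) = UNIV" by blast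
qed

lemma local_triv_dual:
  assumes M: "smooth_manifold M" and A: "vector_bundle M A" and L: "vector_bundle M L"
    and "local_triv M A U \<psi>" "local_triv M L V \<mu>"
  shows "local_triv M (dagger A L) (U \<inter> V) (dual_triv A \<psi> \<mu>)"
  unfolding local_triv_def
proof (intro conjI dual_trivialisation local_triv_triv[OF assms(4)] local_triv_triv[OF assms(5)], clarify)
  fix W \<eta> assume "(W, \<eta>) \<in> trivs (dagger A L)"
  then obtain U' \<psi>' V' \<mu>' where W: "W = U' \<inter> V'" "\<eta> = dual_triv A \<psi>' \<mu>'" "(U', \<psi>') \<in> trivs A" "(V', \<mu>') \<in> trivs L"
    by (auto simp: dagger_simps)
  note t = bundle_local_triv[OF A W(3)] bundle_local_triv[OF L W(4)]
  show "triv_compatible M (U \<inter> V) (dual_triv A \<psi> \<mu>) W \<eta>"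
    unfolding W(1,2) by (rule triv_compatible_dual[OF assms t])
qed

section \<open>The bidual and its identification with \<open>A\<close>\<close>

abbreviation ev_inv :: "('m, 'v, 'r::finite) vbundle \<Rightarrow> ('m, 'w) lbundle \<Rightarrow> 'm \<Rightarrow> (('v \<Rightarrow> 'w) \<Rightarrow> 'w) \<Rightarrow> 'v" where
  "ev_inv A L x \<equiv> inv_into (fibre A x) (bidual_ev A L x)"

context
  fixes A :: "('m::topological_space, 'v, 'r::finite) vbundle" and L :: "('m, 'w) lbundle"
    and U \<psi> V \<mu> and x
  assumes tA: "trivialisation A U \<psi>" and tL: "trivialisation L V \<mu>" and xU: "x \<in> U" and xV: "x \<in> V"
begin

text \<open>In coordinates the pairing is the sum of the products of components, which is symmetric
  in vector and covector. Evaluation therefore takes the frame of \<open>A\<close> to the double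
  dual frame.\<close>

lemma bidual_ev_frame:
  "bidual_ev A L x (\<psi> x c) = dual_triv (dagger A L) (dual_triv A \<psi> \<mu>) \<mu> x c"
proof
  fix f
  show "bidual_ev A L x (\<psi> x c) f = dual_triv (dagger A L) (dual_triv A \<psi> \<mu>) \<mu> x c f"
  proof (cases "f \<in> fibre (dagger A L) x")
    case True
    then obtain d where d: "f = dual_triv A \<psi> \<mu> x d"
      using dual_triv_surj[OF tA tL xU xV] by blast
    have "dual_triv (dagger A L) (dual_triv A \<psi> \<mu>) \<mu> x c f = \<mu> x (vec1 (\<Sum>a\<in>UNIV. c $ a * d $ a))"
      using dual_triv_frame[OF dual_trivialisation[OF tA tL] tL, of x] xU xV by (simp add: d)
    moreover have "bidual_ev A L x (\<psi> x c) f = \<mu> x (vec1 (\<Sum>a\<in>UNIV. c $ a * d $ a))"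
      using True by (simp add: bidual_ev_def d dual_triv_frame[OF tA tL xU xV] mult.commute)
    ultimately show ?thesis by simp
  next
    case False
    then show ?thesis by (simp add: bidual_ev_def dual_triv_def)
  qed
qed

lemma bidual_ev_inj: "inj_on (bidual_ev A L x) (fibre A x)"
proof (rule inj_onI)
  fix v w assume vw: "v \<in> fibre A x" "w \<in> fibre A x" "bidual_ev A L x v = bidual_ev A L x w"
  then have "bidual_ev A L x (\<psi> x (inv (\<psi> x) v)) = bidual_ev A L x (\<psi> x (inv (\<psi> x) w))"
    using tA xU by (simp add: triv_inv_right)
  then have "inv (\<psi> x) v = inv (\<psi> x) w"
    unfolding bidual_ev_frame
    using triv_inv[OF dual_trivialisation[OF dual_trivialisation[OF tA tL] tL], of x] xU xV by (metis Int_iff)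
  then show "v = w" using vw tA xU by (metis triv_inv_right)
qed

lemma ev_inv_frame: "ev_inv A L x (dual_triv (dagger A L) (dual_triv A \<psi> \<mu>) \<mu> x c) = \<psi> x c"
  unfolding bidual_ev_frame[symmetric] using tA xU by (simp add: bidual_ev_inj triv_fibre)

lemma ev_inv_triv:
  assumes t: "trivialisation (dagger (dagger A L) L) W \<zeta>" and xW: "x \<in> W"
  shows "ev_inv A L x (\<zeta> x c) = \<psi> x (inv (dual_triv (dagger A L) (dual_triv A \<psi> \<mu>) \<mu> x) (\<zeta> x c))"
proof -
  let ?dd = "dual_triv (dagger A L) (dual_triv A \<psi> \<mu>) \<mu>"
  have "?dd x (inv (?dd x) (\<zeta> x c)) = \<zeta> x c"
    using xU xV t xW
    by (intro triv_inv_right[OF dual_trivialisation[OF dual_trivialisation[OF tA tL] tL]]) (auto intro: triv_fibre)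
  then show ?thesis by (metis ev_inv_frame)
qed

end

text \<open>Evaluation identifies a frame \<open>\<psi>\<close> with its double dual, so the frame
  carried back from \<open>\<zeta>\<close> is related to \<open>\<psi>\<close> by the same matrix as
  \<open>\<zeta>\<close> to that double dual, and smoothness is inherited. Frames of
  \<open>A\<close> underlying given frames of \<open>dagger A L\<close> arise in this way.\<close>

lemma local_triv_ev_inv:
  assumes M: "smooth_manifold M" and A: "vector_bundle M A" and L: "vector_bundle M L"
    and \<zeta>: "local_triv M (dagger (dagger A L) L) W \<zeta>"
  shows "local_triv M A W (\<lambda>x c. ev_inv A L x (\<zeta> x c))"
proof -
  let ?C = "dagger (dagger A L) L"
  let ?dd = "\<lambda>\<psi> \<mu>. dual_triv (dagger A L) (dual_triv A \<psi> \<mu>) \<mu>"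
  let ?e = "\<lambda>x c. ev_inv A L x (\<zeta> x c)"
  have t\<zeta>: "trivialisation ?C W \<zeta>" using \<zeta> by (rule local_triv_triv)
  have loc: "bij_betw (?e x) UNIV (fibre A x) \<and> (\<forall>a b. ?e x (a + b) = vadd A x (?e x a) (?e x b)) \<and>
      (\<forall>t a. ?e x (t *\<^sub>R a) = vscale A x t (?e x a)) \<and>
      (\<forall>a b. trans_mat ?e \<psi> x a b = trans_mat \<zeta> (?dd \<psi> \<mu>) x a b \<and> trans_mat \<psi> ?e x a b = trans_mat (?dd \<psi> \<mu>) \<zeta> x a b)"
    if x: "x \<in> W" "x \<in> U" "x \<in> V" and tA: "trivialisation A U \<psi>" and tL: "trivialisation L V \<mu>" for x U \<psi> V \<mu>
  proof -
    have tdd: "trivialisation ?C (U \<inter> V) (?dd \<psi> \<mu>)"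
      using dual_trivialisation[OF dual_trivialisation[OF tA tL] tL] by (simp add: Int_assoc)
    have xUV: "x \<in> U \<inter> V" using x by simp
    define g where "g = (\<lambda>c. inv (?dd \<psi> \<mu> x) (\<zeta> x c))"
    define h where "h = (\<lambda>c. inv (\<zeta> x) (?dd \<psi> \<mu> x c))"
    have e: "?e x = (\<lambda>c. \<psi> x (g c))"
      using ev_inv_triv[OF tA tL x(2,3) t\<zeta> x(1)] by (simp add: g_def)
    have e': "ev_inv A L x (\<zeta> x c) = \<psi> x (g c)" for c using fun_cong[OF e] .
    have lin: "linear g" unfolding g_def by (rule triv_change_linear[OF t\<zeta> tdd x(1) xUV])
    have gh: "g (h c) = c" "h (g c) = c" for c
      by (simp_all add: g_def h_def triv_inv_right[OF t\<zeta> x(1)] triv_inv_right[OF tdd xUV]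
          triv_fibre[OF t\<zeta> x(1)] triv_fibre[OF tdd xUV] triv_inv[OF t\<zeta> x(1)] triv_inv[OF tdd xUV])
    have "bij g" by (rule o_bij[of h]) (auto simp: gh)
    then have bij: "bij_betw (?e x) UNIV (fibre A x)"
      using tA x(2) bij_betw_trans[of g UNIV UNIV "\<psi> x" "fibre A x"] unfolding e trivialisation_def by (auto simp: o_def)
    have "inv (?e x) (\<psi> x v) = h v" for v
      using bij inv_f_f[of "?e x" "h v"] unfolding bij_betw_def by (simp add: e' gh)
    then have "trans_mat \<psi> ?e x a b = trans_mat (?dd \<psi> \<mu>) \<zeta> x a b" for a b
      by (simp add: trans_mat_def h_def)
    moreover have "trans_mat ?e \<psi> x a b = trans_mat \<zeta> (?dd \<psi> \<mu>) x a b" for a b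
      using tA x(2) unfolding trans_mat_def e by (simp add: triv_inv g_def)
    moreover have "?e x (a + b) = vadd A x (?e x a) (?e x b)" "?e x (t *\<^sub>R a) = vscale A x t (?e x a)" for a b t
      using tA x(2) unfolding e' by (simp_all add: linear_add[OF lin] linear_scale[OF lin] triv_add triv_scale)
    ultimately show ?thesis using bij by blast
  qed
  show ?thesis
  proof (rule local_trivI[OF M A])
    show "trivialisation A W ?e"
      unfolding trivialisation_def
    proof (intro conjI ballI)
      show "open W" using t\<zeta> by (rule triv_open)
      fix x assume x: "x \<in> W"
      obtain U \<psi> V \<mu> where t: "(U, \<psi>) \<in> trivs A" "x \<in> U" "(V, \<mu>) \<in> trivs L" "x \<in> V"
        using bundle_covers[OF A] bundle_covers[OF L] by metis
      note * = loc[OF x t(2,4) local_triv_triv[OF bundle_local_triv[OF A t(1)]] local_triv_triv[OF bundle_local_triv[OF L t(3)]]]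
      show "bij_betw (?e x) UNIV (fibre A x)" "\<forall>a b. ?e x (a + b) = vadd A x (?e x a) (?e x b)"
        "\<forall>t a. ?e x (t *\<^sub>R a) = vscale A x t (?e x a)"
        using * by blast+
    qed
  next
    fix x assume x: "x \<in> W"
    obtain U \<psi> V \<mu> where t: "(U, \<psi>) \<in> trivs A" "x \<in> U" "(V, \<mu>) \<in> trivs L" "x \<in> V"
      using bundle_covers[OF A] bundle_covers[OF L] by metis
    note tA = bundle_local_triv[OF A t(1)] and tL = bundle_local_triv[OF L t(3)]
    note ttA = local_triv_triv[OF tA] and ttL = local_triv_triv[OF tL]
    let ?U = "U \<inter> V"
    have o: "open ?U" using ttA ttL by (auto dest: triv_open)
    have oW: "open (W \<inter> ?U)" using o triv_open[OF t\<zeta>] by auto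
    have B: "vector_bundle M (dagger A L)" by (rule vector_bundle_dagger[OF M A L])
    have C: "vector_bundle M ?C" by (rule vector_bundle_dagger[OF M B L])
    have tdd: "local_triv M ?C ?U (?dd \<psi> \<mu>)"
      using local_triv_dual[OF M B L local_triv_dual[OF M A L tA tL] tL] by (simp add: Int_assoc)
    have tU: "local_triv M A ?U \<psi>"
    proof -
      have "trivialisation A ?U \<psi>" using ttA o by (auto simp: trivialisation_def)
      then show ?thesis
        using tA unfolding local_triv_def triv_compatible_def
        by (fastforce intro: smooth_fun_subset)
    qed
    have eq: "trans_mat ?e \<psi> y a b = trans_mat \<zeta> (?dd \<psi> \<mu>) y a b" "trans_mat \<psi> ?e y a b = trans_mat (?dd \<psi> \<mu>) \<zeta> y a b"
      if "y \<in> W \<inter> ?U" for y a b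
      using loc[OF _ _ _ ttA ttL, of y] that by auto
    have "smooth_fun M (W \<inter> ?U) (\<lambda>x. trans_mat ?e \<psi> x a b)" for a b
      by (rule smooth_fun_cong[OF M oW trans_mat_smooth[OF M C \<zeta> tdd]]) (rule eq(1)[symmetric])
    moreover have "smooth_fun M (W \<inter> ?U) (\<lambda>x. trans_mat \<psi> ?e x a b)" for a b
      by (rule smooth_fun_cong[OF M oW trans_mat_smooth[OF M C tdd \<zeta>, unfolded Int_commute[of ?U]]]) (rule eq(2)[symmetric])
    ultimately show "\<exists>U \<psi>. local_triv M A U \<psi> \<and> x \<in> U \<and>
      (\<forall>a b. smooth_fun M (W \<inter> U) (\<lambda>x. trans_mat ?e \<psi> x a b)) \<and>
      (\<forall>a b. smooth_fun M (W \<inter> U) (\<lambda>x. trans_mat \<psi> ?e x a b))"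
      using tU t by blast
  qed
qed

section \<open>Changes of adapted coordinates\<close>

text \<open>The transition functions \<open>l\<close> and \<open>g\<close> in \<open>p' = l p\<close> and \<open>u' = g u\<close>.\<close>

definition ll :: "('m, 'n::finite, 'r::finite, 'v, 'w) achart \<Rightarrow> ('m, 'n, 'r, 'v, 'w) achart \<Rightarrow> 'm \<Rightarrow> real" where
  "ll c c' x = trans_mat (lfr c) (lfr c') x 1 1"

definition gg :: "('m, 'n::finite, 'r::finite, 'v, 'w) achart \<Rightarrow> ('m, 'n, 'r, 'v, 'w) achart \<Rightarrow> 'r \<Rightarrow> 'r \<Rightarrow> 'm \<Rightarrow> real" where
  "gg c c' a b x = trans_mat (afr c) (afr c') x a b"

definition JC :: "('m, 'n::finite, 'r::{finite,linorder}, 'v, 'w) achart \<Rightarrow> ('m, 'n, 'r, 'v, 'w) achart \<Rightarrow> 'm \<Rightarrow>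
   ('n, 'r) coord \<Rightarrow> ('n, 'r) sp" where
  "JC c c' x z = Sp (jet_change c c' x z)"

declare gen.simps [simp del]

lemma JC_simps:
  "JC c c' x (CU a) = (\<Sum>b\<in>UNIV. gg c c' a b x *\<^sub>R G (CU b))"
  "JC c c' x (CPU a) = (\<Sum>b\<in>UNIV. (ll c c' x * gg c' c b a x) *\<^sub>R G (CPU b))"
  "JC c c' x CP = ll c c' x *\<^sub>R G CP"
  "JC c c' x (CPX i) = (\<Sum>j\<in>UNIV. (ll c c' x * cpderiv c' i (\<lambda>y. cmap c y $ j) x) *\<^sub>R G (CPX j)) +
     cpderiv c' i (ll c c') x *\<^sub>R G CP +
     (\<Sum>a\<in>UNIV. \<Sum>b\<in>UNIV. (ll c c' x * cpderiv c' i (gg c' c b a) x) *\<^sub>R (JC c c' x (CU a) * G (CPU b)))"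
  unfolding JC_def jet_change.simps u_change_def Sp_simps Sp_sum ll_def[abs_def] gg_def[abs_def]
  by (rule refl)+

lemma graded_CU: "graded cdeg 1 (G (CU a))" and graded_CPU: "graded cdeg 1 (G (CPU a))"
  and graded_CP: "graded cdeg 2 (G CP)" and graded_CPX: "graded cdeg 2 (G (CPX i))"
  using graded_G[of cdeg] unfolding cdeg.simps by blast+

lemma G_anticommute: "G (CPU b) * G (CU a) = - (G (CU a) * G (CPU b))"
  using graded_parity[OF graded_CU] graded_parity[OF graded_CPU] by (intro odd_anticommute) simp_all

lemma graded_CU_CPU: "graded cdeg 2 (p * q)" if "graded cdeg 1 p" "graded cdeg 1 q"
  for p q :: "('n::finite, 'r::{finite,linorder}) sp"
  using graded_mult[OF that] by (simp add: numeral_2_eq_2)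

lemma deg_hom_JC: "deg_hom (JC c c' x)"
  unfolding deg_hom_def JC_simps
  by (intro conjI allI graded_add graded_sum graded_scaleR graded_CU_CPU graded_CU graded_CPU graded_CP graded_CPX)

lemma sum4_reverse:
  fixes F :: "'a::finite \<Rightarrow> 'b::finite \<Rightarrow> 'c::finite \<Rightarrow> 'd::finite \<Rightarrow> 'e::comm_monoid_add"
  shows "(\<Sum>a\<in>UNIV. \<Sum>b\<in>UNIV. \<Sum>c\<in>UNIV. \<Sum>d\<in>UNIV. F a b c d) = (\<Sum>d\<in>UNIV. \<Sum>c\<in>UNIV. \<Sum>b\<in>UNIV. \<Sum>a\<in>UNIV. F a b c d)"
  unfolding sum.cartesian_product
  by (rule sum.reindex_bij_witness[of _ "\<lambda>(d, c, b, a). (a, b, c, d)" "\<lambda>(a, b, c, d). (d, c, b, a)"]) auto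

lemma sum3_rotate:
  fixes F :: "'a::finite \<Rightarrow> 'b::finite \<Rightarrow> 'c::finite \<Rightarrow> 'e::comm_monoid_add"
  shows "(\<Sum>a\<in>UNIV. \<Sum>b\<in>UNIV. \<Sum>c\<in>UNIV. F a b c) = (\<Sum>c\<in>UNIV. \<Sum>b\<in>UNIV. \<Sum>a\<in>UNIV. F a b c)"
    "(\<Sum>a\<in>UNIV. \<Sum>b\<in>UNIV. \<Sum>c\<in>UNIV. F a b c) = (\<Sum>b\<in>UNIV. \<Sum>c\<in>UNIV. \<Sum>a\<in>UNIV. F a b c)"
    "(\<Sum>a\<in>UNIV. \<Sum>b\<in>UNIV. \<Sum>c\<in>UNIV. F a b c) = (\<Sum>a\<in>UNIV. \<Sum>c\<in>UNIV. \<Sum>b\<in>UNIV. F a b c)"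
  unfolding sum.cartesian_product
  by (rule sum.reindex_bij_witness[of _ "\<lambda>(c, b, a). (a, b, c)" "\<lambda>(a, b, c). (c, b, a)"]
      sum.reindex_bij_witness[of _ "\<lambda>(b, c, a). (a, b, c)" "\<lambda>(a, b, c). (b, c, a)"]
      sum.reindex_bij_witness[of _ "\<lambda>(a, c, b). (a, b, c)" "\<lambda>(a, b, c). (a, c, b)"]; auto)+

section \<open>Restriction of charts and frames; corresponding charts of \<open>A\<close> and its
  dual\<close>

lemma is_chart_restrict:
  assumes M: "smooth_manifold M" and U: "is_chart M U \<phi>" and V: "open V" "V \<subseteq> U"
  shows "is_chart M V \<phi>"
proof -
  note cs = is_chart_coord_system[OF U]
  have inj: "inj_on \<phi> V" using coord_system_inj[OF cs] V(2) by (rule inj_on_subset)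
  have inv: "inv_into V \<phi> y = inv_into U \<phi> y" if "y \<in> \<phi> ` V" for y
    using that inj coord_system_inv[OF cs] V(2) by (auto simp: inv_into_f_f)
  have o: "open (\<phi> ` V)" using coord_system_open_image[OF cs V(1)] V(2) by (simp add: Int_absorb1)
  have h: "homeomorphism U (\<phi> ` U) \<phi> (inv_into U \<phi>)" using cs by (simp add: coord_system_def)
  have "homeomorphism V (\<phi> ` V) \<phi> (inv_into U \<phi>)"
    using h by (rule homeomorphism_of_subsets) (use V(2) in auto)
  then have "homeomorphism V (\<phi> ` V) \<phi> (inv_into V \<phi>)"
    by (rule homeomorphism_cong) (use inv in auto)
  then have csV: "coord_system V \<phi>" using V(1) o by (simp add: coord_system_def)
  moreover have "coord_compatible V \<phi> W \<kappa>" if "(W, \<kappa>) \<in> M" for W \<kappa>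
  proof -
    have *: "smooth_on (\<phi> ` (U \<inter> W)) (\<kappa> \<circ> inv_into U \<phi>)" "smooth_on (\<kappa> ` (U \<inter> W)) (\<phi> \<circ> inv_into W \<kappa>)"
      using U that unfolding is_chart_def coord_compatible_def by blast+
    have "smooth_on (\<phi> ` (V \<inter> W)) (\<kappa> \<circ> inv_into U \<phi>)"
      using *(1) by (rule smooth_on_subset) (use V in auto)
    then have "smooth_on (\<phi> ` (V \<inter> W)) (\<kappa> \<circ> inv_into V \<phi>)"
      by (rule smooth_on_cong[OF coord_system_open_image[OF csV is_chart_open[OF atlas_is_chart[OF M that]]]]) (use inv in auto)
    moreover have "smooth_on (\<kappa> ` (V \<inter> W)) (\<phi> \<circ> inv_into W \<kappa>)"
      using *(2) by (rule smooth_on_subset) (use V in auto)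
    ultimately show ?thesis by (simp add: coord_compatible_def)
  qed
  ultimately show ?thesis unfolding is_chart_def by blast
qed

lemma local_triv_restrict:
  assumes "local_triv M E U \<psi>" "open V" "V \<subseteq> U"
  shows "local_triv M E V \<psi>"
proof -
  have "trivialisation E V \<psi>" using assms unfolding local_triv_def trivialisation_def by blast
  moreover have "triv_compatible M V \<psi> W \<eta>" if "(W, \<eta>) \<in> trivs E" for W \<eta>
  proof -
    have "triv_compatible M U \<psi> W \<eta>" using assms(1) that by (auto simp: local_triv_def)
    moreover have "V \<inter> W \<subseteq> U \<inter> W" using assms(3) by blast
    ultimately show ?thesis unfolding triv_compatible_def using smooth_fun_subset by blast
  qed
  ultimately show ?thesis by (auto simp: local_triv_def)
qed

text \<open>A relation rather than the function \<open>dual_chart\<close>: a chart of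
  \<open>dagger A L\<close> agrees with the dual of its primal chart over the domain only, while
  frames are total functions.\<close>

definition dual_pair ::
  "('m, 'v, 'r::finite) vbundle \<Rightarrow> ('m, 'n::finite, 'r, 'v, 'w) achart \<Rightarrow> ('m, 'n, 'r, 'v \<Rightarrow> 'w, 'w) achart \<Rightarrow> bool" where
  "dual_pair A c d \<longleftrightarrow> cdom d = cdom c \<and> cmap d = cmap c \<and> lfr d = lfr c \<and>
     (\<forall>x\<in>cdom c. afr d x = dual_triv A (afr c) (lfr c) x)"

lemma dual_pair_dual_chart: "dual_pair A c (dual_chart A c)"
  by (simp add: dual_pair_def dual_chart_def)

text \<open>The frame is dualised once more, giving a frame of the bidual, and then carried back to
  \<open>A\<close> by the inverse of evaluation.\<close>

definition primal_chart ::
  "('m, 'v, 'r::finite) vbundle \<Rightarrow> ('m, 'w) lbundle \<Rightarrow> ('m, 'n::finite, 'r, 'v \<Rightarrow> 'w, 'w) achart \<Rightarrow> ('m, 'n, 'r, 'v, 'w) achart" where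
  "primal_chart A L d = \<lparr>cdom = cdom d, cmap = cmap d,
     afr = (\<lambda>x c. ev_inv A L x (dual_triv (dagger A L) (afr d) (lfr d) x c)), lfr = lfr d\<rparr>"

text \<open>The substitution \<Lambda>. The value at \<open>CX\<close> is a placeholder as in
  \<open>gen\<close>: substitution takes place over a fixed point of the base.\<close>

definition leg :: "('n, 'r) coord \<Rightarrow> ('n::finite, 'r::{finite,linorder}) sp" where
  "leg z = (case z of CX i \<Rightarrow> 0 | CU a \<Rightarrow> G (CPU a) | CPU a \<Rightarrow> G (CU a)
     | CP \<Rightarrow> G CP - (\<Sum>a\<in>UNIV. G (CU a) * G (CPU a)) | CPX i \<Rightarrow> G (CPX i))"

lemma leg_simps:
  "leg (CU a) = G (CPU a)" "leg (CPU a) = G (CU a)" "leg CP = G CP - (\<Sum>a\<in>UNIV. G (CU a) * G (CPU a))"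
  "leg (CPX i) = G (CPX i)"
  by (simp_all add: leg_def)

lemma deg_hom_leg: "deg_hom leg"
  unfolding deg_hom_def leg_simps
  by (intro conjI allI graded_diff graded_sum graded_CU_CPU graded_CU graded_CPU graded_CP graded_CPX)

lemmas fins_G = graded_CU[THEN fins_graded] graded_CPU[THEN fins_graded] graded_CP[THEN fins_graded] graded_CPX[THEN fins_graded]

lemma fins_JC: "fins (JC c c' x (CU a))" "fins (JC c c' x (CPU a))" "fins (JC c c' x CP)" "fins (JC c c' x (CPX i))"
  for c c' :: "('m, 'n::{finite,linorder}, 'r::{finite,linorder}, 'v, 'w) achart"
  by (simp_all add: deg_hom_fins[OF deg_hom_JC])

text \<open>Exchanging u^a and p_a turns u^a p_a into p_a u^a, which is its negative; so the
  quadratic term subtracted first is added back by the second application.\<close>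

lemma evalp_leg_leg: "fins p \<Longrightarrow> evalp leg (evalp leg p) = p"
proof -
  assume p: "fins p"
  have "evalp leg (leg CP) = (G CP :: ('a, 'b) sp)"
    unfolding leg_simps
    by (simp only: evalp_diff evalp_sum evalp_mult[OF deg_hom_leg] fins_sum fins_mult fins_G evalp_gen leg_simps)
      (simp add: G_anticommute sum_negf)
  then have "evalp (\<lambda>z. evalp leg (leg z)) p = evalp G p"
    by (intro evalp_cong) (simp_all only: leg_simps evalp_gen)
  then show ?thesis by (simp add: evalp_evalp[OF deg_hom_leg deg_hom_leg] evalp_G p)
qed

locale jet_setting =
  fixes M :: "('m::{t2_space,second_countable_topology}, 'n::{finite,linorder}) atlas"
    and A :: "('m, 'v, 'r::{finite,linorder}) vbundle"
    and L :: "('m, 'w) lbundle"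
  assumes M: "smooth_manifold M" and A: "vector_bundle M A" and L: "vector_bundle M L"
begin

lemma dual_setting: "jet_setting M (dagger A L) L"
  by unfold_locales (rule M L vector_bundle_dagger[OF M A L])+

lemma adaptedD:
  assumes "adapted M A L c"
  shows "is_chart M (cdom c) (cmap c)" "local_triv M A (cdom c) (afr c)" "local_triv M L (cdom c) (lfr c)"
    "trivialisation A (cdom c) (afr c)" "trivialisation L (cdom c) (lfr c)" "open (cdom c)"
  using assms is_chart_open unfolding adapted_def by (blast intro: local_triv_triv)+

lemma adapted_restrict:
  assumes c: "adapted M A L c" and V: "open V" "V \<subseteq> cdom c"
  shows "adapted M A L (c\<lparr>cdom := V\<rparr>)"
  using adaptedD[OF c] V by (auto simp: adapted_def intro: is_chart_restrict[OF M] local_triv_restrict)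

lemma adapted_exists:
  obtains c where "adapted M A L c" "x \<in> cdom c"
proof -
  obtain U \<phi> where U: "(U, \<phi>) \<in> M" "x \<in> U" using atlas_covers[OF M] .
  obtain V \<psi> where V: "(V, \<psi>) \<in> trivs A" "x \<in> V" using bundle_covers[OF A] .
  obtain W \<mu> where W: "(W, \<mu>) \<in> trivs L" "x \<in> W" using bundle_covers[OF L] .
  note ch = atlas_is_chart[OF M U(1)] bundle_local_triv[OF A V(1)] bundle_local_triv[OF L W(1)]
  have o: "open (U \<inter> V \<inter> W)"
    using is_chart_open[OF ch(1)] triv_open[OF local_triv_triv[OF ch(2)]] triv_open[OF local_triv_triv[OF ch(3)]] by auto
  have "adapted M A L \<lparr>cdom = U \<inter> V \<inter> W, cmap = \<phi>, afr = \<psi>, lfr = \<mu>\<rparr>"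
    using is_chart_restrict[OF M ch(1) o] local_triv_restrict[OF ch(2) o] local_triv_restrict[OF ch(3) o]
    by (auto simp: adapted_def)
  then show thesis by (rule that) (use U V W in simp)
qed

lemma adapted_dual_chart:
  assumes "adapted M A L c"
  shows "adapted M (dagger A L) L (dual_chart A c)"
  using adaptedD[OF assms] local_triv_dual[OF M A L, of "cdom c" "afr c" "cdom c" "lfr c"]
  by (simp add: adapted_def dual_chart_def)

text \<open>Duality of the frames is checked on the primal frame: by definition of evaluation,
  applying \<open>afr d x e\<close> to a primal vector is applying the corresponding double dual
  covector to \<open>afr d x e\<close>, and this pairing is again the symmetric sum of products of
  coordinates.\<close>

lemma adapted_primal_chart:
  assumes d: "adapted M (dagger A L) L d"
  shows "adapted M A L (primal_chart A L d)" "dual_pair A (primal_chart A L d) d"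
proof -
  interpret B: jet_setting M "dagger A L" L by (rule dual_setting)
  let ?p = "\<lambda>x c. ev_inv A L x (dual_triv (dagger A L) (afr d) (lfr d) x c)"
  have dd: "local_triv M (dagger (dagger A L) L) (cdom d) (dual_triv (dagger A L) (afr d) (lfr d))"
    using local_triv_dual[OF M B.A L B.adaptedD(2,3)[OF d]] by simp
  have p: "local_triv M A (cdom d) ?p" by (rule local_triv_ev_inv[OF M A L dd])
  then show "adapted M A L (primal_chart A L d)"
    using B.adaptedD[OF d] by (simp add: adapted_def primal_chart_def)
  have "afr d x = dual_triv A ?p (lfr d) x" if x: "x \<in> cdom d" for x
  proof
    fix e
    note tp = local_triv_triv[OF p] and tl = B.adaptedD(5)[OF d] and td = B.adaptedD(4)[OF d]
    have e_fibre: "afr d x e \<in> fibre (dagger A L) x" by (rule triv_fibre[OF td x])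
    show "afr d x e = dual_triv A ?p (lfr d) x e"
    proof (rule dual_triv_eqI[OF tp tl x x e_fibre dual_triv_fibre[OF tp tl x x]])
      fix v
      \<comment> \<open>The double dual covector with coordinates \<open>v\<close> is an evaluation:
        the frame \<open>?p\<close> is already known to be one of \<open>A\<close>, so its double
        dual spans the fibre of the bidual and consists of evaluations.\<close>
      obtain w where w: "dual_triv (dagger A L) (afr d) (lfr d) x v = bidual_ev A L x w" "w \<in> fibre A x"
      proof -
        have "dual_triv (dagger A L) (dual_triv A ?p (lfr d)) (lfr d) x `UNIV = fibre (dagger (dagger A L) L) x"
          using dual_triv_bij[OF dual_trivialisation[OF tp tl] tl, of x] x by (simp add: bij_betw_def)
        moreover have "dual_triv (dagger A L) (afr d) (lfr d) x v \<in> fibre (dagger (dagger A L) L) x"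
          by (rule dual_triv_fibre[OF td tl x x])
        ultimately obtain u where "dual_triv (dagger A L) (afr d) (lfr d) x v = dual_triv (dagger A L) (dual_triv A ?p (lfr d)) (lfr d) x u"
          by (metis (no_types, lifting) imageE)
        then show thesis
          using that[of "?p x u"] bidual_ev_frame[OF tp tl x x, of u] triv_fibre[OF tp x] by simp
      qed
      then have pv: "?p x v = w"
        using bidual_ev_inj[OF tp tl x x] by simp
      have "afr d x e (?p x v) = bidual_ev A L x w (afr d x e)"
        using e_fibre by (simp add: bidual_ev_def pv)
      also have "\<dots> = dual_triv (dagger A L) (afr d) (lfr d) x v (afr d x e)" by (simp add: w)
      also have "\<dots> = lfr d x (vec1 (\<Sum>a\<in>UNIV. v $ a * e $ a))"
        by (rule dual_triv_frame[OF td tl x x])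
      also have "\<dots> = dual_triv A ?p (lfr d) x e (?p x v)"
        using dual_triv_frame[OF tp tl x x, of e v] by (simp add: mult.commute)
      finally show "afr d x e (?p x v) = dual_triv A ?p (lfr d) x e (?p x v)" .
    qed
  qed
  then show "dual_pair A (primal_chart A L d) d"
    by (simp add: dual_pair_def primal_chart_def)
qed

lemma ll_smooth:
  "adapted M A L c \<Longrightarrow> adapted M A L c' \<Longrightarrow> smooth_fun M (cdom c \<inter> cdom c') (ll c c')"
  unfolding ll_def[abs_def] by (rule trans_mat_smooth[OF M L]) (rule adaptedD(3), assumption)+

lemma gg_smooth:
  "adapted M A L c \<Longrightarrow> adapted M A L c' \<Longrightarrow> smooth_fun M (cdom c \<inter> cdom c') (gg c c' a b)"
  unfolding gg_def[abs_def] by (rule trans_mat_smooth[OF M A]) (rule adaptedD(2), assumption)+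

lemma coord_smooth: "adapted M A L c \<Longrightarrow> smooth_fun M (cdom c) (\<lambda>y. cmap c y $ j)"
  by (rule smooth_fun_coordinate[OF M adaptedD(1)])

context
  fixes c c' c'' x
  assumes c: "adapted M A L c" and c': "adapted M A L c'" and c'': "adapted M A L c''"
    and x: "x \<in> cdom c" "x \<in> cdom c'" "x \<in> cdom c''"
begin

lemma ll_cocycle: "ll c c'' x = ll c' c'' x * ll c c' x"
  unfolding ll_def using trans_mat_cocycle[OF adaptedD(5)[OF c] adaptedD(5)[OF c'] adaptedD(5)[OF c''] x]
  by (simp add: UNIV_1)

lemma gg_cocycle: "gg c c'' a b x = (\<Sum>e\<in>UNIV. gg c' c'' a e x * gg c c' e b x)"
  unfolding gg_def by (rule trans_mat_cocycle[OF adaptedD(4)[OF c] adaptedD(4)[OF c'] adaptedD(4)[OF c''] x])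

lemma ll_self: "ll c c x = 1"
  unfolding ll_def using trans_mat_self[OF adaptedD(5)[OF c] x(1)] by simp

lemma gg_self: "gg c c a b x = (if a = b then 1 else 0)"
  unfolding gg_def by (rule trans_mat_self[OF adaptedD(4)[OF c] x(1)])

end

lemma ll_inverse:
  "adapted M A L c \<Longrightarrow> adapted M A L c' \<Longrightarrow> x \<in> cdom c \<Longrightarrow> x \<in> cdom c' \<Longrightarrow> ll c' c x * ll c c' x = 1"
  using ll_cocycle[of c c' c x] ll_self[of c c c x] by simp

lemma gg_inverse:
  "adapted M A L c \<Longrightarrow> adapted M A L c' \<Longrightarrow> x \<in> cdom c \<Longrightarrow> x \<in> cdom c' \<Longrightarrow>
    (\<Sum>e\<in>UNIV. gg c' c a e x * gg c c' e b x) = (if a = b then 1 else 0)"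
  using gg_cocycle[of c c' c x a b] gg_self[of c c c x a b] by simp

text \<open>A chart is only compared with another one near a point, so frames may differ elsewhere.\<close>

lemma JC_trivial:
  assumes c: "adapted M A L c" and c': "adapted M A L c'" and N: "open N" "N \<subseteq> cdom c" "N \<subseteq> cdom c'" "x \<in> N"
    and eq: "\<And>y. y \<in> N \<Longrightarrow> cmap c y = cmap c' y" "\<And>y. y \<in> N \<Longrightarrow> afr c y = afr c' y" "\<And>y. y \<in> N \<Longrightarrow> lfr c y = lfr c' y"
  shows "fins p \<Longrightarrow> evalp (JC c c' x) p = p"
proof -
  assume p: "fins p"
  have x: "x \<in> cdom c" "x \<in> cdom c'" using N by auto
  have l: "ll c c' y = 1" if "y \<in> N" for y
    using ll_self[OF c c c, of y] that N eq(3)[of y] by (auto simp: ll_def trans_mat_def)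
  have g: "gg c c' a b y = (if a = b then 1 else 0)" "gg c' c a b y = (if a = b then 1 else 0)" if "y \<in> N" for y a b
    using gg_self[OF c c c, of y a b] that N eq(2)[of y] by (auto simp: gg_def trans_mat_def)
  note cong = pderiv_chart_cong[OF adaptedD(1)[OF c'] N(1,4) x(2)]
  have d1: "cpderiv c' i (\<lambda>y. cmap c y $ j) x = (if i = j then 1 else 0)" for i j
    using cong[of "\<lambda>y. cmap c y $ j" "\<lambda>y. cmap c' y $ j" i] eq(1)
      pderiv_chart_coordinate[OF M adaptedD(1)[OF c'] N(1) x(2) N(4)] by simp
  have d2: "cpderiv c' i (ll c c') x = 0" for i
    using cong[of "ll c c'" "\<lambda>_. 1" i] l pderiv_chart_const[OF M adaptedD(1)[OF c'] N(1) x(2) N(4)] by simp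
  have d3: "cpderiv c' i (gg c' c b a) x = 0" for i a b
    using cong[of "gg c' c b a" "\<lambda>_. if b = a then 1 else 0" i] g
      pderiv_chart_const[OF M adaptedD(1)[OF c'] N(1) x(2) N(4)] by simp
  have "evalp (JC c c' x) p = evalp G p"
    by (rule evalp_cong)
      (simp_all add: JC_simps l[OF N(4)] g[OF N(4)] d1 d2 d3 if_distrib[of "\<lambda>r. r *\<^sub>R _"] cong: if_cong)
  then show ?thesis using p by (simp add: evalp_G)
qed

text \<open>On u^a, p_a and p this is the cocycle of the transition functions. For p_i, the product
  rule splits the derivative of a composite transition function into one of the factor from
  \<open>c'\<close> to \<open>c''\<close>, which occurs in the outer change, and one of the factor
  from \<open>c\<close> to \<open>c'\<close>; the chain rule expresses the latter in the coordinates
  of \<open>c'\<close>, as it occurs in the substituted p_j.\<close>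

lemma JC_cocycle:
  assumes c: "adapted M A L c" and c': "adapted M A L c'" and c'': "adapted M A L c''"
    and x: "x \<in> cdom c" "x \<in> cdom c'" "x \<in> cdom c''"
  shows "evalp (JC c c' x) (evalp (JC c' c'' x) p) = evalp (JC c c'' x) p"
proof -
  let ?T = "evalp (JC c c' x)"
  let ?W = "cdom c \<inter> cdom c' \<inter> cdom c''"
  have oW: "open ?W" and xW: "x \<in> ?W" using adaptedD(6) c c' c'' x by auto
  have CU: "?T (JC c' c'' x (CU a)) = JC c c'' x (CU a)" for a
  proof -
    have "?T (JC c' c'' x (CU a)) = (\<Sum>b\<in>UNIV. gg c' c'' a b x *\<^sub>R JC c c' x (CU b))"
      unfolding JC_simps(1)[of c'] by (simp only: evalp_sum fins_scaleR fins_G evalp_scaleR evalp_gen)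
    also have "\<dots> = (\<Sum>b\<in>UNIV. \<Sum>e\<in>UNIV. (gg c' c'' a b x * gg c c' b e x) *\<^sub>R G (CU e))"
      by (simp add: JC_simps scaleR_sum_right)
    also have "\<dots> = JC c c'' x (CU a)"
      unfolding JC_simps gg_cocycle[OF c c' c'' x] by (subst sum.swap) (simp add: scaleR_sum_left)
    finally show ?thesis .
  qed
  have CPU: "?T (JC c' c'' x (CPU a)) = JC c c'' x (CPU a)" for a
  proof -
    have "?T (JC c' c'' x (CPU a)) = (\<Sum>b\<in>UNIV. (ll c' c'' x * gg c'' c' b a x) *\<^sub>R JC c c' x (CPU b))"
      unfolding JC_simps(2)[of c'] by (simp only: evalp_sum fins_scaleR fins_G evalp_scaleR evalp_gen)
    also have "\<dots> = (\<Sum>b\<in>UNIV. \<Sum>e\<in>UNIV. (ll c' c'' x * gg c'' c' b a x * (ll c c' x * gg c' c e b x)) *\<^sub>R G (CPU e))"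
      by (simp add: JC_simps scaleR_sum_right)
    also have "\<dots> = JC c c'' x (CPU a)"
      unfolding JC_simps gg_cocycle[OF c'' c' c x(3,2,1)] ll_cocycle[OF c c' c'' x]
      by (subst sum.swap) (simp add: scaleR_sum_left sum_distrib_left mult_ac)
    finally show ?thesis .
  qed
  have CP: "?T (JC c' c'' x CP) = JC c c'' x CP"
    unfolding JC_simps evalp_scaleR evalp_gen ll_cocycle[OF c c' c'' x] by simp
  have CPX: "?T (JC c' c'' x (CPX i)) = JC c c'' x (CPX i)" for i
  proof -
    let ?d = "cpderiv c'' i"
    define t where "t j = ?d (\<lambda>y. cmap c' y $ j) x" for j
    define X where "X a b = JC c c'' x (CU a) * G (CPU b)" for a b
    note ch'' = adaptedD(1)[OF c''] and ch' = adaptedD(1)[OF c']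
    note sm = smooth_fun_subset[of M _ _ ?W]
    have sm_l: "smooth_fun M ?W (ll c c')" "smooth_fun M ?W (ll c' c'')"
      by (rule sm[OF ll_smooth[OF c c']]; blast) (rule sm[OF ll_smooth[OF c' c'']]; blast)
    have sm_g: "smooth_fun M ?W (gg c' c a b)" "smooth_fun M ?W (gg c'' c' a b)" for a b
      by (rule sm[OF gg_smooth[OF c' c]]; blast) (rule sm[OF gg_smooth[OF c'' c']]; blast)
    have sm_x: "smooth_fun M ?W (\<lambda>y. cmap c y $ j)" for j
      by (rule sm[OF coord_smooth[OF c]]) blast
    note chain = pderiv_chart_chain[OF M ch'' oW x(3) xW ch' x(2)]
    note mult = pderiv_chart_mult[OF M ch'' oW x(3) xW]
    have D1: "?d (\<lambda>y. cmap c y $ k) x = (\<Sum>j\<in>UNIV. t j * cpderiv c' j (\<lambda>y. cmap c y $ k) x)" for k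
      unfolding t_def by (rule chain[OF sm_x])
    have D2: "?d (ll c c'') x = ll c' c'' x * (\<Sum>j\<in>UNIV. t j * cpderiv c' j (ll c c') x) + ?d (ll c' c'') x * ll c c' x"
    proof -
      have "?d (ll c c'') x = ?d (\<lambda>y. ll c' c'' y * ll c c' y) x"
        by (rule pderiv_chart_cong[OF ch'' oW xW x(3)]) (auto intro: ll_cocycle[OF c c' c''])
      then show ?thesis unfolding t_def chain[OF sm_l(1), symmetric] mult[OF sm_l(2,1)] .
    qed
    have D3: "?d (gg c'' c b a) x = (\<Sum>e\<in>UNIV. gg c' c b e x * ?d (gg c'' c' e a) x +
        (\<Sum>j\<in>UNIV. t j * cpderiv c' j (gg c' c b e) x) * gg c'' c' e a x)" for a b
    proof -
      have "?d (gg c'' c b a) x = ?d (\<lambda>y. \<Sum>e\<in>UNIV. gg c' c b e y * gg c'' c' e a y) x"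
        by (rule pderiv_chart_cong[OF ch'' oW xW x(3)]) (auto intro: gg_cocycle[OF c'' c' c])
      also have "\<dots> = (\<Sum>e\<in>UNIV. ?d (\<lambda>y. gg c' c b e y * gg c'' c' e a y) x)"
        by (rule pderiv_chart_sum[OF M ch'' oW x(3) xW]) (rule smooth_fun_mult[OF M oW sm_g])
      finally show ?thesis unfolding t_def chain[OF sm_g(1), symmetric] mult[OF sm_g] .
    qed
    \<comment> \<open>The u of \<open>c'\<close> are rewritten through those of \<open>c''\<close>,
      so that all quadratic terms become combinations of the same products
      \<open>X a b\<close>.\<close>
    have U: "JC c c' x (CU b) = (\<Sum>a\<in>UNIV. gg c'' c' b a x *\<^sub>R JC c c'' x (CU a))" for b
    proof -
      have "(\<Sum>a\<in>UNIV. gg c'' c' b a x *\<^sub>R JC c c'' x (CU a)) =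
          (\<Sum>a\<in>UNIV. \<Sum>e\<in>UNIV. (gg c'' c' b a x * gg c c'' a e x) *\<^sub>R G (CU e))"
        by (simp add: JC_simps scaleR_sum_right)
      also have "\<dots> = JC c c' x (CU b)"
        unfolding JC_simps gg_cocycle[OF c c'' c' x(1,3,2)] by (subst sum.swap) (simp add: scaleR_sum_left)
      finally show ?thesis by simp
    qed
    let ?l1 = "ll c c' x" and ?l2 = "ll c' c'' x"
    have "?T (JC c' c'' x (CPX i)) = (\<Sum>j\<in>UNIV. (?l2 * t j) *\<^sub>R JC c c' x (CPX j)) +
        ?d (ll c' c'') x *\<^sub>R JC c c' x CP +
        (\<Sum>a\<in>UNIV. \<Sum>b\<in>UNIV. (?l2 * ?d (gg c'' c' b a) x) *\<^sub>R (JC c c'' x (CU a) * JC c c' x (CPU b)))"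
      unfolding JC_simps(4)[of c'] t_def CU[symmetric]
      by (simp only: evalp_add evalp_sum fins_add fins_sum fins_mult fins_scaleR fins_G fins_JC evalp_scaleR evalp_gen evalp_mult[OF deg_hom_JC])
    also have "(\<Sum>j\<in>UNIV. (?l2 * t j) *\<^sub>R JC c c' x (CPX j)) =
        (\<Sum>j\<in>UNIV. \<Sum>k\<in>UNIV. (?l2 * t j * (?l1 * cpderiv c' j (\<lambda>y. cmap c y $ k) x)) *\<^sub>R G (CPX k)) +
        (\<Sum>j\<in>UNIV. (?l2 * t j * cpderiv c' j (ll c c') x) *\<^sub>R G CP) +
        (\<Sum>j\<in>UNIV. \<Sum>e\<in>UNIV. \<Sum>b\<in>UNIV. \<Sum>a\<in>UNIV. (?l2 * t j * (?l1 * cpderiv c' j (gg c' c b e) x) * gg c'' c' e a x) *\<^sub>R X a b)"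
      unfolding JC_simps(4)[of c c'] U X_def
      by (simp add: scaleR_sum_right scaleR_add_right sum.distrib sum_distrib_right mult_ac)
    also have "(\<Sum>j\<in>UNIV. \<Sum>k\<in>UNIV. (?l2 * t j * (?l1 * cpderiv c' j (\<lambda>y. cmap c y $ k) x)) *\<^sub>R G (CPX k)) =
        (\<Sum>k\<in>UNIV. (ll c c'' x * ?d (\<lambda>y. cmap c y $ k) x) *\<^sub>R G (CPX k))"
      unfolding D1 ll_cocycle[OF c c' c'' x]
      by (subst sum.swap) (simp add: scaleR_sum_left sum_distrib_left mult_ac)
    also have "(\<Sum>j\<in>UNIV. \<Sum>e\<in>UNIV. \<Sum>b\<in>UNIV. \<Sum>a\<in>UNIV. (?l2 * t j * (?l1 * cpderiv c' j (gg c' c b e) x) * gg c'' c' e a x) *\<^sub>R X a b) =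
        (\<Sum>a\<in>UNIV. \<Sum>b\<in>UNIV. (ll c c'' x * (\<Sum>e\<in>UNIV. (\<Sum>j\<in>UNIV. t j * cpderiv c' j (gg c' c b e) x) * gg c'' c' e a x)) *\<^sub>R X a b)"
      unfolding ll_cocycle[OF c c' c'' x]
      by (subst sum4_reverse) (simp add: scaleR_sum_left sum_distrib_left sum_distrib_right mult_ac)
    also have "(\<Sum>a\<in>UNIV. \<Sum>b\<in>UNIV. (?l2 * ?d (gg c'' c' b a) x) *\<^sub>R (JC c c'' x (CU a) * JC c c' x (CPU b))) =
        (\<Sum>a\<in>UNIV. \<Sum>e\<in>UNIV. \<Sum>b\<in>UNIV. (?l2 * ?d (gg c'' c' e a) x * (?l1 * gg c' c b e x)) *\<^sub>R X a b)"
      unfolding JC_simps(2) X_def by (simp add: scaleR_sum_right sum_distrib_left)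
    also have "\<dots> = (\<Sum>a\<in>UNIV. \<Sum>b\<in>UNIV. (ll c c'' x * (\<Sum>e\<in>UNIV. gg c' c b e x * ?d (gg c'' c' e a) x)) *\<^sub>R X a b)"
      unfolding ll_cocycle[OF c c' c'' x]
      by (subst sum3_rotate(3)) (simp add: scaleR_sum_left sum_distrib_left mult_ac)
    finally show ?thesis
      unfolding JC_simps(4)[of c c''] D2 D3 X_def[symmetric] JC_simps(3) ll_cocycle[OF c c' c'' x]
      by (simp add: scaleR_sum_left sum.distrib distrib_left scaleR_add_left sum_distrib_left mult_ac)
  qed
  show ?thesis
    unfolding evalp_evalp[OF deg_hom_JC deg_hom_JC] by (rule evalp_cong) (rule CU CPU CP CPX)+
qed

end

section \<open>The Legendre substitution intertwines the coordinate changes\<close>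

context jet_setting
begin

lemma dual_pair_transition:
  assumes cd: "adapted M A L c" "dual_pair A c d" and cd': "adapted M A L c'" "dual_pair A c' d'"
    and x: "x \<in> cdom c" "x \<in> cdom c'"
  shows "ll d d' = ll c c'" "gg d d' a b x = ll c c' x * gg c' c b a x"
proof -
  show "ll d d' = ll c c'" using cd(2) cd'(2) by (simp add: ll_def[abs_def] dual_pair_def)
  have "gg d d' a b x = trans_mat (dual_triv A (afr c) (lfr c)) (dual_triv A (afr c') (lfr c')) x a b"
    using cd(2) cd'(2) x by (simp add: gg_def dual_pair_def trans_mat_def)
  also have "\<dots> = ll c c' x * gg c' c b a x"
    unfolding ll_def gg_def
    by (rule trans_mat_dual[OF adaptedD(4,5)[OF cd(1)] adaptedD(4,5)[OF cd'(1)] x(1,1,2,2)])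
  finally show "gg d d' a b x = ll c c' x * gg c' c b a x" .
qed

text \<open>The matrix acting on u and the inverse matrix acting on p_a cancel, leaving the factor
  of \<open>L\<close>. Thus u^a p_a changes exactly like p, and so does p - u^a p_a.\<close>

lemma JC_pairing:
  assumes c: "adapted M A L c" and c': "adapted M A L c'" and x: "x \<in> cdom c" "x \<in> cdom c'"
  shows "(\<Sum>a\<in>UNIV. JC c c' x (CU a) * JC c c' x (CPU a)) = ll c c' x *\<^sub>R (\<Sum>a\<in>UNIV. G (CU a) * G (CPU a))"
proof -
  have "(\<Sum>a\<in>UNIV. JC c c' x (CU a) * JC c c' x (CPU a)) =
      (\<Sum>a\<in>UNIV. \<Sum>b\<in>UNIV. \<Sum>e\<in>UNIV. (ll c c' x * (gg c' c e a x * gg c c' a b x)) *\<^sub>R (G (CU b) * G (CPU e)))"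
    unfolding JC_simps by (simp add: sum_product mult_ac)
  also have "\<dots> = (\<Sum>b\<in>UNIV. \<Sum>e\<in>UNIV. (ll c c' x * (if e = b then 1 else 0)) *\<^sub>R (G (CU b) * G (CPU e)))"
    unfolding gg_inverse[OF c c' x, symmetric]
    by (subst sum3_rotate(2)) (simp add: scaleR_sum_left sum_distrib_left)
  also have "\<dots> = ll c c' x *\<^sub>R (\<Sum>a\<in>UNIV. G (CU a) * G (CPU a))"
    by (simp add: scaleR_sum_right if_distrib[of "\<lambda>r. r *\<^sub>R _"] if_distrib[of "\<lambda>r. _ * r"] cong: if_cong)
  finally show ?thesis .
qed

text \<open>For the odd generators this is the transition matrix of dual frames, for p the
  invariance of the pairing. For p_i both sides are brought to the form \<open>R\<close>: the dual
  frames change by a product of a factor of \<open>L\<close> and a matrix of \<open>A\<close>, and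
  differentiating that product creates an extra term with the derivative of \<open>l\<close>, which
  the quadratic part of \<Lambda> p absorbs.\<close>

lemma JC_leg_gen:
  assumes cd: "adapted M A L c" "dual_pair A c d" and cd': "adapted M A L c'" "dual_pair A c' d'"
    and x: "x \<in> cdom c" "x \<in> cdom c'"
  shows "evalp (JC c c' x) (leg (CU a)) = evalp leg (JC d d' x (CU a))"
    "evalp (JC c c' x) (leg (CPU a)) = evalp leg (JC d d' x (CPU a))"
    "evalp (JC c c' x) (leg CP) = evalp leg (JC d d' x CP)"
    "evalp (JC c c' x) (leg (CPX i)) = evalp leg (JC d d' x (CPX i))"
proof -
  note c = cd(1) and c' = cd'(1)
  note tr = dual_pair_transition[OF cd cd' x] and tr' = dual_pair_transition[OF cd' cd x(2,1)]
  let ?l = "ll c c' x" and ?l' = "ll c' c x"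
  have l1: "?l * ?l' = 1" using ll_inverse[OF c' c x(2,1)] .
  have l1': "?l' * ?l = 1" using l1 by (simp add: mult.commute)
  show "evalp (JC c c' x) (leg (CU a)) = evalp leg (JC d d' x (CU a))"
    unfolding leg_simps evalp_gen JC_simps
    by (simp only: evalp_sum fins_scaleR fins_G evalp_scaleR evalp_gen leg_simps tr)
  show "evalp (JC c c' x) (leg (CPU a)) = evalp leg (JC d d' x (CPU a))"
    unfolding leg_simps evalp_gen JC_simps
    by (simp only: evalp_sum fins_scaleR fins_G evalp_scaleR evalp_gen leg_simps tr tr' mult.assoc[symmetric] l1 mult_1_left)
  have pair: "evalp (JC c c' x) (\<Sum>a\<in>UNIV. G (CU a) * G (CPU a)) = ?l *\<^sub>R (\<Sum>a\<in>UNIV. G (CU a) * G (CPU a))"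
    unfolding JC_pairing[OF c c' x, symmetric]
    by (simp only: evalp_sum fins_mult fins_G evalp_mult[OF deg_hom_JC] evalp_gen)
  have fins_pair: "fins (\<Sum>a\<in>UNIV. G (CU a) * G (CPU a))" by (intro fins_sum fins_mult fins_G)
  show "evalp (JC c c' x) (leg CP) = evalp leg (JC d d' x CP)"
    unfolding leg_simps evalp_diff[OF fins_G(3) fins_pair] pair JC_simps evalp_gen evalp_scaleR tr
    by (simp add: scaleR_diff_right)
  show "evalp (JC c c' x) (leg (CPX i)) = evalp leg (JC d d' x (CPX i))"
  proof -
    let ?d = "cpderiv c' i"
    let ?W = "cdom c \<inter> cdom c'"
    have oW: "open ?W" and xW: "x \<in> ?W" using adaptedD(6) c c' x by auto
    note ch = adaptedD(1)[OF c']
    note mult = pderiv_chart_mult[OF M ch oW x(2) xW]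
    have sm_l: "smooth_fun M ?W (ll c c')" "smooth_fun M ?W (ll c' c)"
      using ll_smooth[OF c c'] ll_smooth[OF c' c] by (simp_all add: Int_commute)
    have sm_g: "smooth_fun M ?W (gg c c' a b)" "smooth_fun M ?W (gg c' c a b)" for a b
      using gg_smooth[OF c c'] gg_smooth[OF c' c] by (simp_all add: Int_commute)
    have same: "cmap d = cmap c" "cpderiv d' = cpderiv c'" "ll d d' = ll c c'"
      using cd(2) cd'(2) tr by (simp_all add: dual_pair_def)
    \<comment> \<open>\<open>H4\<close> and \<open>H1\<close> are the derivatives of the identities
      stating that the two changes of frame, of \<open>L\<close> and of \<open>A\<close>, are
      inverse to each other.\<close>
    have H4: "?l' * ?d (ll c c') x + ?d (ll c' c) x * ?l = 0"
    proof -
      have "?d (\<lambda>y. ll c' c y * ll c c' y) x = ?d (\<lambda>y. 1) x"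
        by (rule pderiv_chart_cong[OF ch oW xW x(2)]) (auto intro: ll_inverse[OF c c'])
      then show ?thesis unfolding mult[OF sm_l(2,1)] pderiv_chart_const[OF M ch oW x(2) xW] .
    qed
    have H1: "(\<Sum>a\<in>UNIV. gg c' c e a x * ?d (gg c c' a b) x + ?d (gg c' c e a) x * gg c c' a b x) = 0" for b e
    proof -
      have "?d (\<lambda>y. \<Sum>a\<in>UNIV. gg c' c e a y * gg c c' a b y) x = ?d (\<lambda>y. if e = b then 1 else 0) x"
        by (rule pderiv_chart_cong[OF ch oW xW x(2)]) (use gg_inverse[OF c c'] in auto)
      moreover have "?d (\<lambda>y. \<Sum>a\<in>UNIV. gg c' c e a y * gg c c' a b y) x = (\<Sum>a\<in>UNIV. ?d (\<lambda>y. gg c' c e a y * gg c c' a b y) x)"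
        by (rule pderiv_chart_sum[OF M ch oW x(2) xW]) (rule smooth_fun_mult[OF M oW sm_g(2,1)])
      ultimately show ?thesis unfolding mult[OF sm_g(2,1)] pderiv_chart_const[OF M ch oW x(2) xW] by simp
    qed
    have D: "?d (gg d' d b a) x = ?l' * ?d (gg c c' a b) x + ?d (ll c' c) x * gg c c' a b x" for a b
    proof -
      have "?d (gg d' d b a) x = ?d (\<lambda>y. ll c' c y * gg c c' a b y) x"
        by (rule pderiv_chart_cong[OF ch oW xW x(2)]) (use dual_pair_transition(2)[OF cd' cd] in auto)
      then show ?thesis unfolding mult[OF sm_l(2) sm_g(1)] .
    qed
    \<comment> \<open>\<open>H1\<close> moves the derivative from the matrix to its inverse; the
      minus sign is later undone by anticommuting p past u. \<open>H4\<close> replaces the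
      derivative of the inverse factor of \<open>L\<close> by that of \<open>l\<close>, whose matrix
      coefficient collapses to the diagonal.\<close>
    have coeff: "(\<Sum>a\<in>UNIV. ?l * ?d (gg d' d b a) x * gg d d' a e x) =
        - ?d (ll c c') x * (if e = b then 1 else 0) - (\<Sum>a\<in>UNIV. ?l * ?d (gg c' c e a) x * gg c c' a b x)" for b e
    proof -
      have "(\<Sum>a\<in>UNIV. ?l * ?d (gg d' d b a) x * gg d d' a e x) =
          (\<Sum>a\<in>UNIV. ?l * (?l * ?l') * (gg c' c e a x * ?d (gg c c' a b) x) + ?l * (?d (ll c' c) x * ?l) * (gg c' c e a x * gg c c' a b x))"
        by (intro sum.cong refl) (simp add: D tr algebra_simps)
      also have "\<dots> = ?l * (\<Sum>a\<in>UNIV. gg c' c e a x * ?d (gg c c' a b) x) +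
          ?l * (?d (ll c' c) x * ?l) * (\<Sum>a\<in>UNIV. gg c' c e a x * gg c c' a b x)"
        by (simp add: l1 sum.distrib sum_distrib_left)
      also have "(\<Sum>a\<in>UNIV. gg c' c e a x * ?d (gg c c' a b) x) = - (\<Sum>a\<in>UNIV. ?d (gg c' c e a) x * gg c c' a b x)"
        using H1[of e b] by (simp add: sum.distrib)
      also have "?l * (?d (ll c' c) x * ?l) = - ?d (ll c c') x"
      proof -
        have "?d (ll c' c) x * ?l = - (?l' * ?d (ll c c') x)" using H4 by simp
        then show ?thesis using l1 by (simp add: mult.assoc[symmetric])
      qed
      finally show ?thesis unfolding gg_inverse[OF c c' x]
        by (simp add: sum_distrib_left sum_negf mult.assoc)
    qed
    have "evalp leg (JC d d' x (CPX i)) =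
        (\<Sum>j\<in>UNIV. (?l * ?d (\<lambda>y. cmap c y $ j) x) *\<^sub>R G (CPX j)) +
        ?d (ll c c') x *\<^sub>R (G CP - (\<Sum>b\<in>UNIV. G (CU b) * G (CPU b))) +
        (\<Sum>a\<in>UNIV. \<Sum>b\<in>UNIV. (?l * ?d (gg d' d b a) x) *\<^sub>R ((\<Sum>e\<in>UNIV. gg d d' a e x *\<^sub>R G (CPU e)) * G (CU b)))"
      unfolding JC_simps same
      by (simp only: evalp_add evalp_sum fins_add fins_sum fins_mult fins_scaleR fins_G evalp_scaleR evalp_gen evalp_mult[OF deg_hom_leg] leg_simps)
    also have "(\<Sum>a\<in>UNIV. \<Sum>b\<in>UNIV. (?l * ?d (gg d' d b a) x) *\<^sub>R ((\<Sum>e\<in>UNIV. gg d d' a e x *\<^sub>R G (CPU e)) * G (CU b))) =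
        - (\<Sum>a\<in>UNIV. \<Sum>b\<in>UNIV. \<Sum>e\<in>UNIV. (?l * ?d (gg d' d b a) x * gg d d' a e x) *\<^sub>R (G (CU b) * G (CPU e)))"
      by (simp add: sum_distrib_left sum_distrib_right scaleR_sum_right sum_negf[symmetric] G_anticommute)
    also have "(\<Sum>a\<in>UNIV. \<Sum>b\<in>UNIV. \<Sum>e\<in>UNIV. (?l * ?d (gg d' d b a) x * gg d d' a e x) *\<^sub>R (G (CU b) * G (CPU e))) =
        (\<Sum>b\<in>UNIV. \<Sum>e\<in>UNIV. (\<Sum>a\<in>UNIV. ?l * ?d (gg d' d b a) x * gg d d' a e x) *\<^sub>R (G (CU b) * G (CPU e)))"
      by (subst sum3_rotate(2)) (simp add: scaleR_sum_left)
    also have "\<dots> = - (?d (ll c c') x *\<^sub>R (\<Sum>b\<in>UNIV. G (CU b) * G (CPU b))) -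
        (\<Sum>b\<in>UNIV. \<Sum>e\<in>UNIV. (\<Sum>a\<in>UNIV. ?l * ?d (gg c' c e a) x * gg c c' a b x) *\<^sub>R (G (CU b) * G (CPU e)))"
      unfolding coeff
      by (simp add: scaleR_diff_left sum_subtractf sum_negf scaleR_sum_right if_distrib[of "\<lambda>r. r *\<^sub>R _"] if_distrib[of "\<lambda>r. _ * r"] cong: if_cong)
    \<comment> \<open>The diagonal terms cancel the product of the derivative of \<open>l\<close>
      with the quadratic part of \<Lambda> p.\<close>
    finally have R: "evalp leg (JC d d' x (CPX i)) =
        (\<Sum>j\<in>UNIV. (?l * ?d (\<lambda>y. cmap c y $ j) x) *\<^sub>R G (CPX j)) + ?d (ll c c') x *\<^sub>R G CP +
        (\<Sum>b\<in>UNIV. \<Sum>e\<in>UNIV. (\<Sum>a\<in>UNIV. ?l * ?d (gg c' c e a) x * gg c c' a b x) *\<^sub>R (G (CU b) * G (CPU e)))"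
      by (simp add: scaleR_diff_right)
    have "(\<Sum>a\<in>UNIV. \<Sum>b\<in>UNIV. (?l * ?d (gg c' c b a) x) *\<^sub>R (JC c c' x (CU a) * G (CPU b))) =
        (\<Sum>a\<in>UNIV. \<Sum>b\<in>UNIV. \<Sum>e\<in>UNIV. (?l * ?d (gg c' c b a) x * gg c c' a e x) *\<^sub>R (G (CU e) * G (CPU b)))"
      unfolding JC_simps by (simp add: sum_distrib_right scaleR_sum_right)
    also have "\<dots> = (\<Sum>b\<in>UNIV. \<Sum>e\<in>UNIV. (\<Sum>a\<in>UNIV. ?l * ?d (gg c' c e a) x * gg c c' a b x) *\<^sub>R (G (CU b) * G (CPU e)))"
      by (subst sum3_rotate(1)) (simp add: scaleR_sum_left)
    finally show ?thesis
      unfolding R leg_simps evalp_gen by (simp only: JC_simps(4))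
  qed
qed

lemma JC_leg:
  assumes cd: "adapted M A L c" "dual_pair A c d" and cd': "adapted M A L c'" "dual_pair A c' d'"
    and x: "x \<in> cdom c" "x \<in> cdom c'"
  shows "evalp (JC c c' x) (evalp leg p) = evalp leg (evalp (JC d d' x) p)"
  unfolding evalp_evalp[OF deg_hom_JC deg_hom_leg] evalp_evalp[OF deg_hom_leg deg_hom_JC]
  by (rule evalp_cong) (rule JC_leg_gen[OF cd cd' x])+

text \<open>\<open>JC_leg\<close> conjugated by the involution \<open>evalp leg\<close>; finite
  support is what makes the latter an involution.\<close>

lemma JC_leg':
  assumes cd: "adapted M A L c" "dual_pair A c d" and cd': "adapted M A L c'" "dual_pair A c' d'"
    and x: "x \<in> cdom c" "x \<in> cdom c'" and p: "fins p"
  shows "evalp (JC d d' x) (evalp leg p) = evalp leg (evalp (JC c c' x) p)"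
proof -
  have "evalp (JC d d' x) (evalp leg p) = evalp leg (evalp leg (evalp (JC d d' x) (evalp leg p)))"
    by (simp add: evalp_leg_leg fins_evalp deg_hom_JC)
  also have "\<dots> = evalp leg (evalp (JC c c' x) (evalp leg (evalp leg p)))"
    by (simp only: JC_leg[OF cd cd' x])
  finally show ?thesis by (simp add: evalp_leg_leg p)
qed

end

section \<open>Functions on the jet manifold\<close>

definition smooth_sp :: "('m::{t2_space,second_countable_topology}, 'n::finite) atlas \<Rightarrow> 'm set \<Rightarrow> ('m \<Rightarrow> ('n, 'r) sp) \<Rightarrow> bool" where
  "smooth_sp M W P \<longleftrightarrow> (\<forall>m. smooth_fun M W (\<lambda>x. coef (P x) m))"

context
  fixes M :: "('m::{t2_space,second_countable_topology}, 'n::{finite,linorder}) atlas" and W :: "'m set"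
  assumes M: "smooth_manifold M" and W: "open W"
begin

lemma smooth_sp_cong: "smooth_sp M W P \<Longrightarrow> (\<And>x. x \<in> W \<Longrightarrow> P x = Q x) \<Longrightarrow> smooth_sp M W Q"
  unfolding smooth_sp_def using smooth_fun_cong[OF M W] by fastforce

lemma smooth_sp_const: "smooth_sp M W (\<lambda>_. p)"
  by (simp add: smooth_sp_def smooth_fun_const)

lemma smooth_sp_add:
  fixes P Q :: "'m \<Rightarrow> ('n, 'r::{finite,linorder}) sp"
  shows "smooth_sp M W P \<Longrightarrow> smooth_sp M W Q \<Longrightarrow> smooth_sp M W (\<lambda>x. P x + Q x)"
  by (simp add: smooth_sp_def smooth_fun_add[OF M W])

lemma smooth_sp_scaleR:
  fixes P :: "'m \<Rightarrow> ('n, 'r::{finite,linorder}) sp"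
  shows "smooth_fun M W f \<Longrightarrow> smooth_sp M W P \<Longrightarrow> smooth_sp M W (\<lambda>x. f x *\<^sub>R P x)"
  by (simp add: smooth_sp_def smooth_fun_mult[OF M W])

lemma smooth_sp_sum:
  fixes P :: "'i \<Rightarrow> 'm \<Rightarrow> ('n, 'r::{finite,linorder}) sp"
  shows "(\<And>i. i \<in> I \<Longrightarrow> smooth_sp M W (P i)) \<Longrightarrow> smooth_sp M W (\<lambda>x. \<Sum>i\<in>I. P i x)"
  by (simp add: smooth_sp_def smooth_fun_sum[OF M W])

lemma smooth_sp_mult:
  fixes P Q :: "'m \<Rightarrow> ('n, 'r::{finite,linorder}) sp"
  assumes "smooth_sp M W P" "smooth_sp M W Q"
  shows "smooth_sp M W (\<lambda>x. P x * Q x)"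
  unfolding smooth_sp_def coef_mult sp_mult_eq split_def
proof
  fix m
  show "smooth_fun M W (\<lambda>x. \<Sum>p | madd (fst p) (snd p) = m. msgn (fst p) (snd p) * coef (P x) (fst p) * coef (Q x) (snd p))"
    using assms unfolding smooth_sp_def
    by (intro smooth_fun_sum[OF M W] smooth_fun_mult[OF M W] smooth_fun_const) auto
qed

lemma smooth_sp_prod_list:
  fixes P :: "'z \<Rightarrow> 'm \<Rightarrow> ('n, 'r::{finite,linorder}) sp"
  shows "(\<And>z. z \<in> set zs \<Longrightarrow> smooth_sp M W (P z)) \<Longrightarrow> smooth_sp M W (\<lambda>x. prod_list (map (\<lambda>z. P z x) zs))"
  by (induction zs) (auto intro: smooth_sp_const smooth_sp_mult)

text \<open>The support of \<open>P x\<close> varies with \<open>x\<close>. The uniform degree bound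
  replaces it by one fixed finite set of monomials, after which smoothness holds term by
  term.\<close>

lemma smooth_sp_evalp:
  fixes P :: "'m \<Rightarrow> ('n, 'r::{finite,linorder}) sp"
  assumes T: "\<And>z. z \<in> range CU \<union> range CPU \<union> {CP} \<union> range CPX \<Longrightarrow> smooth_sp M W (\<lambda>x. T x z)"
    and P: "smooth_sp M W P" and bound: "\<And>x m. x \<in> W \<Longrightarrow> coef (P x) m \<noteq> 0 \<Longrightarrow> mono_degree m \<le> k"
  shows "smooth_sp M W (\<lambda>x. evalp (T x) (P x))"
proof -
  have "smooth_sp M W (\<lambda>x. evalm (T x) m)" for m
    unfolding evalm_def using set_mono_factors[of m] by (intro smooth_sp_prod_list T) blast
  then have *: "smooth_sp M W (\<lambda>x. \<Sum>m | mono_degree m \<le> k. coef (P x) m *\<^sub>R evalm (T x) m)"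
    using P by (intro smooth_sp_sum smooth_sp_scaleR) (auto simp: smooth_sp_def)
  have eq: "(\<Sum>m | mono_degree m \<le> k. coef (P x) m *\<^sub>R evalm (T x) m) = evalp (T x) (P x)" if "x \<in> W" for x
    using bound[OF that] by (intro evalp_superset[symmetric] finite_degree_le) auto
  show ?thesis
    unfolding smooth_sp_def
  proof
    fix m
    show "smooth_fun M W (\<lambda>x. coef (evalp (T x) (P x)) m)"
      by (rule smooth_fun_cong[OF M W *[unfolded smooth_sp_def, rule_format, of m]]) (simp only: eq)
  qed
qed

end

lemma smooth_sp_subset: "smooth_sp M W P \<Longrightarrow> V \<subseteq> W \<Longrightarrow> smooth_sp M V P"
  unfolding smooth_sp_def using smooth_fun_subset by blast

context jet_setting
begin

lemma JC_smooth:
  assumes c: "adapted M A L c" and c': "adapted M A L c'" and z: "z \<in> range CU \<union> range CPU \<union> {CP} \<union> range CPX"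
  shows "smooth_sp M (cdom c \<inter> cdom c') (\<lambda>x. JC c c' x z)"
proof -
  let ?W = "cdom c \<inter> cdom c'"
  have oW: "open ?W" using adaptedD(6) c c' by auto
  have sm: "smooth_fun M ?W (ll c c')" "\<And>a b. smooth_fun M ?W (gg c c' a b)" "\<And>a b. smooth_fun M ?W (gg c' c a b)"
    using ll_smooth[OF c c'] gg_smooth[OF c c'] gg_smooth[OF c' c]
    by (simp_all add: Int_commute)
  have smx: "smooth_fun M ?W (\<lambda>y. cmap c y $ j)" for j
    by (rule smooth_fun_subset[OF coord_smooth[OF c]]) blast
  have d: "smooth_fun M ?W (cpderiv c' i f)" if "smooth_fun M ?W f" for f i
    by (rule smooth_fun_subset[OF smooth_fun_pderiv[OF M adaptedD(1)[OF c'] oW that]]) auto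
  note rules = smooth_sp_sum[OF M oW] smooth_sp_scaleR[OF M oW] smooth_sp_const smooth_sp_add[OF M oW]
    smooth_sp_mult[OF M oW] smooth_fun_mult[OF M oW] sm d smx
  from z consider a where "z = CU a" | a where "z = CPU a" | "z = CP" | i where "z = CPX i" by auto
  then show ?thesis
    by cases (simp_all only: JC_simps, (intro rules M oW)+)
qed

lemma jet_funD:
  assumes "s \<in> jet_fun M A L W"
  shows "open W" "\<not> (adapted M A L c \<and> x \<in> W \<inter> cdom c) \<Longrightarrow> s c x = (\<lambda>_. 0)"
    "adapted M A L c \<Longrightarrow> smooth_sp M (W \<inter> cdom c) (\<lambda>x. Sp (s c x))"
    "\<exists>k. \<forall>c x m. s c x m \<noteq> 0 \<longrightarrow> mono_degree m \<le> k"
    "adapted M A L c \<Longrightarrow> adapted M A L c' \<Longrightarrow> x \<in> W \<inter> cdom c \<inter> cdom c' \<Longrightarrow>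
      Sp (s c x) = evalp (JC c c' x) (Sp (s c' x))"
    "fins (Sp (s c x))"
proof -
  show "open W" "adapted M A L c \<Longrightarrow> smooth_sp M (W \<inter> cdom c) (\<lambda>x. Sp (s c x))"
    "\<exists>k. \<forall>c x m. s c x m \<noteq> 0 \<longrightarrow> mono_degree m \<le> k"
    using assms unfolding jet_fun_def smooth_sp_def coef_Sp by blast+
  have "\<forall>c x m. \<not> (adapted M A L c \<and> x \<in> W \<inter> cdom c) \<longrightarrow> s c x m = 0"
    using assms unfolding jet_fun_def by blast
  then show "\<not> (adapted M A L c \<and> x \<in> W \<inter> cdom c) \<Longrightarrow> s c x = (\<lambda>_. 0)" by (intro ext) blast
  have "\<forall>c c'. adapted M A L c \<and> adapted M A L c' \<longrightarrow>
        (\<forall>x\<in>W \<inter> cdom c \<inter> cdom c'. s c x = subst_sp (jet_change c c' x) (s c' x))"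
    using assms unfolding jet_fun_def by blast
  then show "adapted M A L c \<Longrightarrow> adapted M A L c' \<Longrightarrow> x \<in> W \<inter> cdom c \<inter> cdom c' \<Longrightarrow>
      Sp (s c x) = evalp (JC c c' x) (Sp (s c' x))"
    unfolding JC_def[abs_def] Sp_subst[symmetric] by (intro arg_cong[of _ _ Sp]) blast
  show "fins (Sp (s c x))"
    using \<open>\<exists>k. \<forall>c x m. s c x m \<noteq> 0 \<longrightarrow> mono_degree m \<le> k\<close> fins_degree_le[of "Sp (s c x)"]
    unfolding coef_Sp by blast
qed

lemma jet_funI:
  assumes "open W" "\<And>c x. \<not> (adapted M A L c \<and> x \<in> W \<inter> cdom c) \<Longrightarrow> s c x = (\<lambda>_. 0)"
    "\<And>c. adapted M A L c \<Longrightarrow> smooth_sp M (W \<inter> cdom c) (\<lambda>x. Sp (s c x))"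
    "\<And>c x m. adapted M A L c \<Longrightarrow> x \<in> W \<inter> cdom c \<Longrightarrow> s c x m \<noteq> 0 \<Longrightarrow> mono_degree m \<le> k"
    "\<And>c c' x. adapted M A L c \<Longrightarrow> adapted M A L c' \<Longrightarrow> x \<in> W \<inter> cdom c \<inter> cdom c' \<Longrightarrow>
      Sp (s c x) = evalp (JC c c' x) (Sp (s c' x))"
  shows "s \<in> jet_fun M A L W"
proof -
  have "s c x = subst_sp (jet_change c c' x) (s c' x)"
    if "adapted M A L c" "adapted M A L c'" "x \<in> W \<inter> cdom c \<inter> cdom c'" for c c' x
    using assms(5)[OF that] unfolding JC_def[abs_def] Sp_subst[symmetric] Sp_eq_iff .
  moreover have "\<exists>k. \<forall>c x m. s c x m \<noteq> 0 \<longrightarrow> mono_degree m \<le> k"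
    using assms(2,4) by (intro exI[of _ k]) metis
  ultimately show ?thesis
    using assms(1,2,3) unfolding jet_fun_def smooth_sp_def coef_Sp by simp
qed

lemma jet_fun_add:
  assumes s: "s \<in> jet_fun M A L W" and t: "t \<in> jet_fun M A L W"
  shows "(\<lambda>c x m. s c x m + t c x m) \<in> jet_fun M A L W"
proof -
  obtain k l where kl: "\<And>c x m. s c x m \<noteq> 0 \<Longrightarrow> mono_degree m \<le> k" "\<And>c x m. t c x m \<noteq> 0 \<Longrightarrow> mono_degree m \<le> l"
    using jet_funD(4)[OF s] jet_funD(4)[OF t] by blast
  show ?thesis
  proof (rule jet_funI[where k = "max k l"])
    show "open W" by (rule jet_funD(1)[OF s])
    fix c x m
    show "(\<lambda>m. s c x m + t c x m) = (\<lambda>_. 0)" if "\<not> (adapted M A L c \<and> x \<in> W \<inter> cdom c)"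
      using jet_funD(2)[OF s that] jet_funD(2)[OF t that] by simp
    show "mono_degree m \<le> max k l" if "s c x m + t c x m \<noteq> 0"
      using that kl[of c x m] by (cases "s c x m = 0") (auto simp: max.coboundedI1 max.coboundedI2)
  next
    fix c assume c: "adapted M A L c"
    then have "open (W \<inter> cdom c)" using jet_funD(1)[OF s] adaptedD(6) by auto
    then show "smooth_sp M (W \<inter> cdom c) (\<lambda>x. Sp (\<lambda>m. s c x m + t c x m))"
      unfolding Sp_simps by (rule smooth_sp_add[OF M _ jet_funD(3)[OF s c] jet_funD(3)[OF t c]])
  next
    fix c c' x assume "adapted M A L c" "adapted M A L c'" "x \<in> W \<inter> cdom c \<inter> cdom c'"
    then show "Sp (\<lambda>m. s c x m + t c x m) = evalp (JC c c' x) (Sp (\<lambda>m. s c' x m + t c' x m))"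
      unfolding Sp_simps evalp_add[OF jet_funD(6)[OF s] jet_funD(6)[OF t]]
      using jet_funD(5)[OF s, of c c' x] jet_funD(5)[OF t, of c c' x] by simp
  qed
qed

lemma jet_fun_scale:
  assumes s: "s \<in> jet_fun M A L W"
  shows "(\<lambda>c x m. r * s c x m) \<in> jet_fun M A L W"
proof -
  obtain k where k: "\<And>c x m. s c x m \<noteq> 0 \<Longrightarrow> mono_degree m \<le> k"
    using jet_funD(4)[OF s] by blast
  show ?thesis
  proof (rule jet_funI[where k = k])
    show "open W" by (rule jet_funD(1)[OF s])
    fix c x m
    show "(\<lambda>m. r * s c x m) = (\<lambda>_. 0)" if "\<not> (adapted M A L c \<and> x \<in> W \<inter> cdom c)"
      using jet_funD(2)[OF s that] by simp
    show "mono_degree m \<le> k" if "r * s c x m \<noteq> 0"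
      using that k[of c x m] by auto
  next
    fix c assume c: "adapted M A L c"
    then have "open (W \<inter> cdom c)" using jet_funD(1)[OF s] adaptedD(6) by auto
    then show "smooth_sp M (W \<inter> cdom c) (\<lambda>x. Sp (\<lambda>m. r * s c x m))"
      unfolding Sp_simps by (intro smooth_sp_scaleR[OF M] smooth_fun_const jet_funD(3)[OF s c])
  next
    fix c c' x assume "adapted M A L c" "adapted M A L c'" "x \<in> W \<inter> cdom c \<inter> cdom c'"
    then show "Sp (\<lambda>m. r * s c x m) = evalp (JC c c' x) (Sp (\<lambda>m. r * s c' x m))"
      unfolding Sp_simps evalp_scaleR using jet_funD(5)[OF s, of c c' x] by simp
  qed
qed

lemma jet_fun_mult:
  assumes s: "s \<in> jet_fun M A L W" and t: "t \<in> jet_fun M A L W"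
  shows "(\<lambda>c x. sp_mult (s c x) (t c x)) \<in> jet_fun M A L W"
proof -
  obtain k l where kl: "\<And>c x m. s c x m \<noteq> 0 \<Longrightarrow> mono_degree m \<le> k" "\<And>c x m. t c x m \<noteq> 0 \<Longrightarrow> mono_degree m \<le> l"
    using jet_funD(4)[OF s] jet_funD(4)[OF t] by blast
  show ?thesis
  proof (rule jet_funI[where k = "k + l"])
    show "open W" by (rule jet_funD(1)[OF s])
    fix c x m
    show "sp_mult (s c x) (t c x) = (\<lambda>_. 0)" if "\<not> (adapted M A L c \<and> x \<in> W \<inter> cdom c)"
      using jet_funD(2)[OF s that] by (simp add: sp_mult_eq fun_eq_iff split_def)
    show "mono_degree m \<le> k + l" if "sp_mult (s c x) (t c x) m \<noteq> 0"
    proof -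
      obtain a b where "madd a b = m" "msgn a b \<noteq> 0" "s c x a \<noteq> 0" "t c x b \<noteq> 0"
        using \<open>sp_mult (s c x) (t c x) m \<noteq> 0\<close> by (auto simp: sp_mult_eq elim!: sum.not_neutral_contains_not_neutral)
      then show ?thesis using kl by (auto simp: mono_degree_wt wt_madd intro!: add_mono)
    qed
  next
    fix c assume c: "adapted M A L c"
    then have "open (W \<inter> cdom c)" using jet_funD(1)[OF s] adaptedD(6) by auto
    then show "smooth_sp M (W \<inter> cdom c) (\<lambda>x. Sp (sp_mult (s c x) (t c x)))"
      unfolding Sp_simps by (rule smooth_sp_mult[OF M _ jet_funD(3)[OF s c] jet_funD(3)[OF t c]])
  next
    fix c c' x assume "adapted M A L c" "adapted M A L c'" "x \<in> W \<inter> cdom c \<inter> cdom c'"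
    then show "Sp (sp_mult (s c x) (t c x)) = evalp (JC c c' x) (Sp (sp_mult (s c' x) (t c' x)))"
      unfolding Sp_simps evalp_mult[OF deg_hom_JC jet_funD(6)[OF s] jet_funD(6)[OF t]]
      using jet_funD(5)[OF s, of c c' x] jet_funD(5)[OF t, of c c' x] by simp
  qed
qed

lemma jet_fun_restr:
  assumes s: "s \<in> jet_fun M A L W" and V: "open V" "V \<subseteq> W"
  shows "(\<lambda>c x m. if x \<in> V then s c x m else 0) \<in> jet_fun M A L V"
proof -
  obtain k where k: "\<And>c x m. s c x m \<noteq> 0 \<Longrightarrow> mono_degree m \<le> k"
    using jet_funD(4)[OF s] by blast
  show ?thesis
  proof (rule jet_funI[where k = k])
    fix c x m
    show "(\<lambda>m. if x \<in> V then s c x m else 0) = (\<lambda>_. 0)" if "\<not> (adapted M A L c \<and> x \<in> V \<inter> cdom c)"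
      using jet_funD(2)[OF s, of c x] that V(2) by auto
    show "mono_degree m \<le> k" if "(if x \<in> V then s c x m else 0) \<noteq> 0"
      using that k[of c x m] by (auto split: if_splits)
  next
    fix c assume c: "adapted M A L c"
    then have o: "open (V \<inter> cdom c)" using V(1) adaptedD(6) by auto
    have "smooth_sp M (V \<inter> cdom c) (\<lambda>x. Sp (s c x))"
      by (rule smooth_sp_subset[OF jet_funD(3)[OF s c]]) (use V(2) in auto)
    then show "smooth_sp M (V \<inter> cdom c) (\<lambda>x. Sp (\<lambda>m. if x \<in> V then s c x m else 0))"
      unfolding smooth_sp_def coef_Sp by (auto intro: smooth_fun_cong[OF M o])
  next
    fix c c' x assume "adapted M A L c" "adapted M A L c'" "x \<in> V \<inter> cdom c \<inter> cdom c'"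
    then show "Sp (\<lambda>m. if x \<in> V then s c x m else 0) = evalp (JC c c' x) (Sp (\<lambda>m. if x \<in> V then s c' x m else 0))"
      using jet_funD(5)[OF s, of c c' x] V(2) by auto
  qed (rule V(1))
qed

text \<open>The expressions in two further charts are compatible by \<open>JC_cocycle\<close>, and
  coordinate changes preserve the degree bound.\<close>

lemma jet_fun_of_in_jet_fun:
  assumes c: "adapted M A L c" and h: "smooth_sp M (cdom c) (\<lambda>x. Sp (h x))"
    and k: "\<And>x m. x \<in> cdom c \<Longrightarrow> h x m \<noteq> 0 \<Longrightarrow> mono_degree m \<le> k"
  shows "jet_fun_of M A L c h \<in> jet_fun M A L (cdom c)"
    and "adapted M A L c' \<Longrightarrow> x \<in> cdom c \<Longrightarrow> x \<in> cdom c' \<Longrightarrow>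
      Sp (jet_fun_of M A L c h c' x) = evalp (JC c' c x) (Sp (h x))"
proof -
  show eq: "Sp (jet_fun_of M A L c h c' x) = evalp (JC c' c x) (Sp (h x))"
    if "adapted M A L c'" "x \<in> cdom c" "x \<in> cdom c'" for c' x
    using that by (simp add: jet_fun_of_def Sp_subst JC_def[abs_def])
  show "jet_fun_of M A L c h \<in> jet_fun M A L (cdom c)"
  proof (rule jet_funI[where k = k])
    show "open (cdom c)" by (rule adaptedD(6)[OF c])
    fix c' x m
    show "jet_fun_of M A L c h c' x = (\<lambda>_. 0)" if "\<not> (adapted M A L c' \<and> x \<in> cdom c \<inter> cdom c')"
      using that by (auto simp: jet_fun_of_def)
    show "mono_degree m \<le> k" if "adapted M A L c'" "x \<in> cdom c \<inter> cdom c'" "jet_fun_of M A L c h c' x m \<noteq> 0"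
    proof -
      have "coef (evalp (JC c' c x) (Sp (h x))) m \<noteq> 0"
        using that eq[of c' x] by (metis IntD1 IntD2 coef_Sp)
      from coef_evalp_degree[OF deg_hom_JC this] show ?thesis using k that(2) by auto
    qed
  next
    fix c' assume c': "adapted M A L c'"
    let ?W = "cdom c \<inter> cdom c'"
    have o: "open ?W" using adaptedD(6) c c' by auto
    have "smooth_sp M ?W (\<lambda>x. evalp (JC c' c x) (Sp (h x)))"
    proof (rule smooth_sp_evalp[OF M o, where k = k])
      show "smooth_sp M ?W (\<lambda>x. JC c' c x z)" if "z \<in> range CU \<union> range CPU \<union> {CP} \<union> range CPX" for z
        using JC_smooth[OF c' c that] by (simp add: Int_commute)
      show "smooth_sp M ?W (\<lambda>x. Sp (h x))" by (rule smooth_sp_subset[OF h]) auto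
    qed (use k in auto)
    then show "smooth_sp M ?W (\<lambda>x. Sp (jet_fun_of M A L c h c' x))"
      by (rule smooth_sp_cong[OF M o]) (use eq[OF c'] in simp)
  next
    fix c1 c2 x assume c12: "adapted M A L c1" "adapted M A L c2" "x \<in> cdom c \<inter> cdom c1 \<inter> cdom c2"
    then show "Sp (jet_fun_of M A L c h c1 x) = evalp (JC c1 c2 x) (Sp (jet_fun_of M A L c h c2 x))"
      by (simp add: eq JC_cocycle[OF c12(1,2) c])
  qed
qed

lemma jet_fun_determined:
  assumes s: "s \<in> jet_fun M A L W" and t: "t \<in> jet_fun M A L W" and c: "adapted M A L c" "W \<subseteq> cdom c"
    and eq: "\<And>x. x \<in> W \<Longrightarrow> s c x = t c x"
  shows "s = t"
proof (intro ext)
  fix c' x m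
  show "s c' x m = t c' x m"
  proof (cases "adapted M A L c' \<and> x \<in> W \<inter> cdom c'")
    case True
    then have "Sp (s c' x) = Sp (t c' x)"
      using jet_funD(5)[OF s, of c' c x] jet_funD(5)[OF t, of c' c x] c eq[of x] by auto
    then show ?thesis by (simp add: Sp_eq_iff)
  qed (use jet_funD(2)[OF s, of c' x] jet_funD(2)[OF t, of c' x] in simp)
qed

text \<open>Where two charts coincide near a point, the change at that point is trivial including
  its derivatives. This identifies expressions in restricted charts and in charts whose frames
  differ only off the domain.\<close>

lemma jet_fun_chart_cong:
  assumes s: "s \<in> jet_fun M A L W" and c: "adapted M A L c" and c': "adapted M A L c'"
    and N: "open N" "N \<subseteq> cdom c" "N \<subseteq> cdom c'" "x \<in> N"
    and eq: "\<And>y. y \<in> N \<Longrightarrow> cmap c y = cmap c' y" "\<And>y. y \<in> N \<Longrightarrow> afr c y = afr c' y" "\<And>y. y \<in> N \<Longrightarrow> lfr c y = lfr c' y"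
  shows "s c x = s c' x"
proof (cases "x \<in> W")
  case True
  then have "Sp (s c x) = evalp (JC c c' x) (Sp (s c' x))"
    using N by (intro jet_funD(5)[OF s c c']) auto
  also have "\<dots> = Sp (s c' x)"
    by (rule JC_trivial[OF c c' N]) (auto intro: eq jet_funD(6)[OF s])
  finally show ?thesis by (simp add: Sp_eq_iff)
next
  case False
  then show ?thesis using jet_funD(2)[OF s] by simp
qed

lemma jet_body:
  assumes s: "s \<in> jet_fun M A L W" and c: "adapted M A L c" and x: "x \<in> W" "x \<in> cdom c"
  shows "body (jet_manifold M A L) s x = s c x one_mono"
proof -
  define c' where "c' = (SOME c. adapted M A L c \<and> x \<in> cdom c)"
  have "adapted M A L c' \<and> x \<in> cdom c'" unfolding c'_def using c x(2) by (intro someI) blast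
  then have "Sp (s c' x) = evalp (JC c' c x) (Sp (s c x))"
    using x by (intro jet_funD(5)[OF s _ c]) auto
  then have "coef (Sp (s c' x)) one_mono = coef (Sp (s c x)) one_mono"
    by (simp only: coef_evalp_one_mono[OF deg_hom_JC jet_funD(6)[OF s]])
  then show ?thesis by (simp add: jet_manifold_def c'_def)
qed

end

section \<open>The Legendre transform of functions\<close>

text \<open>The same substitution, which is an involution on coordinates, gives the transform and its
  inverse; only the correspondence \<open>\<kappa>\<close> between adapted charts differs.\<close>

definition leg_mor ::
  "('m::topological_space, 'n::{finite,linorder}) atlas \<Rightarrow> ('m, 'v, 'r::{finite,linorder}) vbundle \<Rightarrow>
   ('m, 'b, 'r) vbundle \<Rightarrow> ('m, 'w) lbundle \<Rightarrow> (('m, 'n, 'r, 'v, 'w) achart \<Rightarrow> ('m, 'n, 'r, 'b, 'w) achart) \<Rightarrow>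
   ('m, ('m, 'n, 'r, 'v, 'w) jfun, ('m, 'n, 'r, 'b, 'w) jfun) nmor" where
  "leg_mor M A B L \<kappa> = \<lparr>base = id, pull = (\<lambda>W. \<lambda>s\<in>jet_fun M B L W. \<lambda>c x.
     if adapted M A L c \<and> x \<in> W \<inter> cdom c then coef (evalp leg (Sp (s (\<kappa> c) x))) else (\<lambda>_. 0))\<rparr>"

lemma leg_mor_base [simp]: "base (leg_mor M A B L \<kappa>) = id"
  by (simp add: leg_mor_def)

lemma leg_mor_pull:
  "s \<in> jet_fun M B L W \<Longrightarrow> adapted M A L c \<Longrightarrow> x \<in> W \<Longrightarrow> x \<in> cdom c \<Longrightarrow>
    Sp (pull (leg_mor M A B L \<kappa>) W s c x) = evalp leg (Sp (s (\<kappa> c) x))"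
  "s \<in> jet_fun M B L W \<Longrightarrow> \<not> (adapted M A L c \<and> x \<in> W \<inter> cdom c) \<Longrightarrow>
    pull (leg_mor M A B L \<kappa>) W s c x = (\<lambda>_. 0)"
  by (auto simp: leg_mor_def)

lemma leg_mor_support:
  "s \<in> jet_fun M B L W \<Longrightarrow> pull (leg_mor M A B L \<kappa>) W s c x m \<noteq> 0 \<Longrightarrow> adapted M A L c \<and> x \<in> W \<and> x \<in> cdom c"
  by (auto simp: leg_mor_def split: if_splits)

text \<open>The odd generators trade places, and u^a p_a has the same bidegree (1,1) as p.\<close>

lemma leg_bidegree:
  fixes z :: "('n::{finite,linorder}, 'r::{finite,linorder}) coord"
  assumes "z \<in> range CU \<union> range CPU \<union> {CP} \<union> range CPX"
  shows "graded cdeg1 (cdeg2 z) (leg z)" "graded cdeg2 (cdeg1 z) (leg z)"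
proof -
  have p1: "graded cdeg1 1 (G (CU a) * G (CPU a))" for a
    using graded_mult[OF graded_G(1)[of cdeg1 a] graded_G(2)[of cdeg1 a]] by simp
  have p2: "graded cdeg2 1 (G (CU a) * G (CPU a))" for a
    using graded_mult[OF graded_G(1)[of cdeg2 a] graded_G(2)[of cdeg2 a]] by simp
  have cp: "graded cdeg1 1 (leg CP)"
    unfolding leg_simps using graded_G(3)[of cdeg1] by (intro graded_diff graded_sum p1) simp
  have cp': "graded cdeg2 1 (leg CP)"
    unfolding leg_simps using graded_G(3)[of cdeg2] by (intro graded_diff graded_sum p2) simp
  show "graded cdeg1 (cdeg2 z) (leg z)"
    using assms cp graded_G[of cdeg1] by (auto simp: leg_simps(1,2,4))
  show "graded cdeg2 (cdeg1 z) (leg z)"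
    using assms cp' graded_G[of cdeg2] by (auto simp: leg_simps(1,2,4))
qed

text \<open>\<open>commute\<close> is the condition for the chartwise substitutions to glue. The
  locale is used twice, with \<open>dual_chart\<close> for the transform and with
  \<open>primal_chart\<close> for its inverse.\<close>

locale leg_transport = SA: jet_setting M A L + SB: jet_setting M B L
  for M :: "('m::{t2_space,second_countable_topology}, 'n::{finite,linorder}) atlas"
    and A :: "('m, 'v, 'r::{finite,linorder}) vbundle" and B :: "('m, 'b, 'r) vbundle"
    and L :: "('m, 'w) lbundle" +
  fixes \<kappa> :: "('m, 'n, 'r, 'v, 'w) achart \<Rightarrow> ('m, 'n, 'r, 'b, 'w) achart"
  assumes adapted_\<kappa>: "adapted M A L c \<Longrightarrow> adapted M B L (\<kappa> c)"
    and cdom_\<kappa>: "cdom (\<kappa> c) = cdom c"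
    and commute: "adapted M A L c \<Longrightarrow> adapted M A L c' \<Longrightarrow> x \<in> cdom c \<Longrightarrow> x \<in> cdom c' \<Longrightarrow> fins p \<Longrightarrow>
      evalp (JC c c' x) (evalp leg p) = evalp leg (evalp (JC (\<kappa> c) (\<kappa> c') x) p)"
begin

abbreviation "T \<equiv> leg_mor M A B L \<kappa>"

lemma pull_in_jet_fun:
  assumes s: "s \<in> jet_fun M B L W"
  shows "pull T W s \<in> jet_fun M A L W"
proof -
  obtain k where k: "\<And>c x m. s c x m \<noteq> 0 \<Longrightarrow> mono_degree m \<le> k"
    using SB.jet_funD(4)[OF s] by blast
  show ?thesis
  proof (rule SA.jet_funI[where k = k])
    show "open W" by (rule SB.jet_funD(1)[OF s])
    show "pull T W s c x = (\<lambda>_. 0)" if "\<not> (adapted M A L c \<and> x \<in> W \<inter> cdom c)" for c x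
      using leg_mor_pull(2)[OF s that] .
    show "mono_degree m \<le> k" if "adapted M A L c" "x \<in> W \<inter> cdom c" "pull T W s c x m \<noteq> 0" for c x m
    proof -
      have "coef (evalp leg (Sp (s (\<kappa> c) x))) m \<noteq> 0"
        using that leg_mor_pull(1)[OF s that(1), of x \<kappa>] by (metis IntD1 IntD2 coef_Sp)
      from coef_evalp_degree[OF deg_hom_leg this] show ?thesis using k by auto
    qed
  next
    fix c assume c: "adapted M A L c"
    let ?W = "W \<inter> cdom c"
    have o: "open ?W" using SB.jet_funD(1)[OF s] SA.adaptedD(6)[OF c] by auto
    have sm: "smooth_sp M ?W (\<lambda>x. Sp (s (\<kappa> c) x))"
      using SB.jet_funD(3)[OF s adapted_\<kappa>[OF c]] by (simp add: cdom_\<kappa>)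
    have "smooth_sp M ?W (\<lambda>x. evalp leg (Sp (s (\<kappa> c) x)))"
      by (rule smooth_sp_evalp[OF SA.M o smooth_sp_const[OF SA.M o] sm]) (use k in auto)
    then show "smooth_sp M ?W (\<lambda>x. Sp (pull T W s c x))"
      by (rule smooth_sp_cong[OF SA.M o]) (use leg_mor_pull(1)[OF s c] in auto)
  next
    fix c c' x assume c: "adapted M A L c" "adapted M A L c'" and x: "x \<in> W \<inter> cdom c \<inter> cdom c'"
    have "evalp leg (Sp (s (\<kappa> c) x)) = evalp leg (evalp (JC (\<kappa> c) (\<kappa> c') x) (Sp (s (\<kappa> c') x)))"
      using SB.jet_funD(5)[OF s adapted_\<kappa>[OF c(1)] adapted_\<kappa>[OF c(2)], of x] x by (simp add: cdom_\<kappa>)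
    also have "\<dots> = evalp (JC c c' x) (evalp leg (Sp (s (\<kappa> c') x)))"
      using c x SB.jet_funD(6)[OF s] by (intro commute[symmetric]) auto
    finally show "Sp (pull T W s c x) = evalp (JC c c' x) (Sp (pull T W s c' x))"
      using c x by (simp add: leg_mor_pull(1)[OF s])
  qed
qed

lemma pull_bidegree:
  assumes "s \<in> jet_bidegree M B L W \<epsilon> \<delta>"
  shows "pull T W s \<in> jet_bidegree M A L W \<delta> \<epsilon>"
proof -
  have s: "s \<in> jet_fun M B L W" and b: "\<And>c x m. s c x m \<noteq> 0 \<Longrightarrow> mono_bidegree m = (\<epsilon>, \<delta>)"
    using assms by (auto simp: jet_bidegree_def)
  have "mono_bidegree m = (\<delta>, \<epsilon>)" if nz: "pull T W s c x m \<noteq> 0" for c x m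
  proof -
    have cx: "adapted M A L c" "x \<in> W" "x \<in> cdom c"
      using leg_mor_support[OF s nz] by auto
    then have nz': "coef (evalp leg (Sp (s (\<kappa> c) x))) m \<noteq> 0"
      using nz leg_mor_pull(1)[OF s cx, of \<kappa>] by (metis coef_Sp)
    \<comment> \<open>Each component of the bidegree is traced back by its own weight. The two
      monomials found may differ, but both occur in \<open>s\<close> and so have bidegree
      (\<epsilon>, \<delta>).\<close>
    obtain m1 where "s (\<kappa> c) x m1 \<noteq> 0" "wt cdeg1 m = wt cdeg2 m1"
      using coef_evalp_nonzero[OF leg_bidegree(1) nz'] by auto
    moreover obtain m2 where "s (\<kappa> c) x m2 \<noteq> 0" "wt cdeg2 m = wt cdeg1 m2"
      using coef_evalp_nonzero[OF leg_bidegree(2) nz'] by auto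
    ultimately show ?thesis using b[of "\<kappa> c" x m1] b[of "\<kappa> c" x m2] by (simp add: mono_bidegree_wt)
  qed
  then show ?thesis using pull_in_jet_fun[OF s] by (simp add: jet_bidegree_def)
qed

lemma pull_restr:
  assumes s: "s \<in> jet_fun M B L W" and V: "open V" "V \<subseteq> W"
  shows "pull T V (\<lambda>c x m. if x \<in> V then s c x m else 0) = (\<lambda>c x m. if x \<in> V then pull T W s c x m else 0)"
proof -
  note sV = SB.jet_fun_restr[OF s V]
  have "Sp (pull T V (\<lambda>c x m. if x \<in> V then s c x m else 0) c x) = Sp (\<lambda>m. if x \<in> V then pull T W s c x m else 0)" for c x
  proof (cases "adapted M A L c \<and> x \<in> V \<inter> cdom c")
    case True
    then show ?thesis using V by (auto simp: leg_mor_pull(1)[OF sV] leg_mor_pull(1)[OF s])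
  next
    case False
    then show ?thesis using leg_mor_pull(2)[OF sV False, of \<kappa>] leg_mor_pull(2)[OF s, of A c x \<kappa>] by (cases "x \<in> V") auto
  qed
  then show ?thesis by (simp add: Sp_eq_iff fun_eq_iff)
qed

lemma pull_eqI:
  assumes "\<And>c x. adapted M A L c \<Longrightarrow> x \<in> W \<Longrightarrow> x \<in> cdom c \<Longrightarrow> Sp (s c x) = Sp (t c x)"
    and "\<And>c x. \<not> (adapted M A L c \<and> x \<in> W \<inter> cdom c) \<Longrightarrow> s c x = t c x"
  shows "s = t"
  using assms by (auto simp: Sp_eq_iff fun_eq_iff) metis

lemma pull_add:
  assumes s: "s \<in> jet_fun M B L W" and t: "t \<in> jet_fun M B L W"
  shows "pull T W (\<lambda>c x m. s c x m + t c x m) = (\<lambda>c x m. pull T W s c x m + pull T W t c x m)"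
proof (rule pull_eqI[of W])
  note st = SB.jet_fun_add[OF s t]
  fix c x
  show "Sp (pull T W (\<lambda>c x m. s c x m + t c x m) c x) = Sp (\<lambda>m. pull T W s c x m + pull T W t c x m)"
    if "adapted M A L c" "x \<in> W" "x \<in> cdom c"
    using that by (simp add: leg_mor_pull(1)[OF st] leg_mor_pull(1)[OF s] leg_mor_pull(1)[OF t] Sp_simps
        evalp_add SB.jet_funD(6)[OF s] SB.jet_funD(6)[OF t])
  show "pull T W (\<lambda>c x m. s c x m + t c x m) c x = (\<lambda>m. pull T W s c x m + pull T W t c x m)"
    if "\<not> (adapted M A L c \<and> x \<in> W \<inter> cdom c)"
    using leg_mor_pull(2)[OF st that] leg_mor_pull(2)[OF s that] leg_mor_pull(2)[OF t that] by simp
qed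

lemma pull_scale:
  assumes s: "s \<in> jet_fun M B L W"
  shows "pull T W (\<lambda>c x m. r * s c x m) = (\<lambda>c x m. r * pull T W s c x m)"
proof (rule pull_eqI[of W])
  note st = SB.jet_fun_scale[OF s]
  fix c x
  show "Sp (pull T W (\<lambda>c x m. r * s c x m) c x) = Sp (\<lambda>m. r * pull T W s c x m)"
    if "adapted M A L c" "x \<in> W" "x \<in> cdom c"
    using that by (simp add: leg_mor_pull(1)[OF st] leg_mor_pull(1)[OF s] Sp_simps evalp_scaleR)
  show "pull T W (\<lambda>c x m. r * s c x m) c x = (\<lambda>m. r * pull T W s c x m)"
    if "\<not> (adapted M A L c \<and> x \<in> W \<inter> cdom c)"
    using leg_mor_pull(2)[OF st that] leg_mor_pull(2)[OF s that] by simp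
qed

lemma pull_mult:
  assumes s: "s \<in> jet_fun M B L W" and t: "t \<in> jet_fun M B L W"
  shows "pull T W (\<lambda>c x. sp_mult (s c x) (t c x)) = (\<lambda>c x. sp_mult (pull T W s c x) (pull T W t c x))"
proof (rule pull_eqI[of W])
  note st = SB.jet_fun_mult[OF s t]
  fix c x
  show "Sp (pull T W (\<lambda>c x. sp_mult (s c x) (t c x)) c x) = Sp (sp_mult (pull T W s c x) (pull T W t c x))"
    if "adapted M A L c" "x \<in> W" "x \<in> cdom c"
    using that by (simp add: leg_mor_pull(1)[OF st] leg_mor_pull(1)[OF s] leg_mor_pull(1)[OF t] Sp_simps
        evalp_mult[OF deg_hom_leg] SB.jet_funD(6)[OF s] SB.jet_funD(6)[OF t])
  show "pull T W (\<lambda>c x. sp_mult (s c x) (t c x)) c x = sp_mult (pull T W s c x) (pull T W t c x)"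
    if "\<not> (adapted M A L c \<and> x \<in> W \<inter> cdom c)"
    using leg_mor_pull(2)[OF st that] leg_mor_pull(2)[OF s that] leg_mor_pull(2)[OF t that]
    by (simp add: sp_mult_eq fun_eq_iff split_def)
qed

end

lemma (in jet_setting) jet_fun_unit:
  assumes W: "open W"
  shows "(\<lambda>c x. if adapted M A L c \<and> x \<in> W \<inter> cdom c then single one_mono 1 else (\<lambda>_. 0)) \<in> jet_fun M A L W"
proof (rule jet_funI[where k = 0])
  fix c assume c: "adapted M A L c"
  then have o: "open (W \<inter> cdom c)" using W adaptedD(6) by auto
  show "smooth_sp M (W \<inter> cdom c) (\<lambda>x. Sp (if adapted M A L c \<and> x \<in> W \<inter> cdom c then single one_mono 1 :: ('n, 'r) spoly else (\<lambda>_. 0)))"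
  proof (rule smooth_sp_cong[OF M o])
    show "smooth_sp M (W \<inter> cdom c) (\<lambda>_. 1 :: ('n, 'r) sp)" by (rule smooth_sp_const[OF M o])
  qed (use c in \<open>simp add: Sp_simps\<close>)
next
  fix c c' x assume "adapted M A L c" "adapted M A L c'" "x \<in> W \<inter> cdom c \<inter> cdom c'"
  then show "Sp (if adapted M A L c \<and> x \<in> W \<inter> cdom c then single one_mono 1 :: ('n, 'r) spoly else (\<lambda>_. 0)) =
      evalp (JC c c' x) (Sp (if adapted M A L c' \<and> x \<in> W \<inter> cdom c' then single one_mono 1 else (\<lambda>_. 0)))"
    by (simp add: Sp_simps)
qed (use W in \<open>auto simp: single_def mono_degree_wt split: if_splits\<close>)

context leg_transport
begin

lemma pull_unit:
  assumes W: "open W"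
  shows "pull T W (\<lambda>c x. if adapted M B L c \<and> x \<in> W \<inter> cdom c then single one_mono 1 else (\<lambda>_. 0)) =
    (\<lambda>c x. if adapted M A L c \<and> x \<in> W \<inter> cdom c then single one_mono 1 else (\<lambda>_. 0))"
proof (rule pull_eqI[of W])
  note st = SB.jet_fun_unit[OF W]
  fix c x
  show "Sp (pull T W (\<lambda>c x. if adapted M B L c \<and> x \<in> W \<inter> cdom c then single one_mono 1 else (\<lambda>_. 0)) c x) =
      Sp (if adapted M A L c \<and> x \<in> W \<inter> cdom c then single one_mono 1 else (\<lambda>_. 0))"
    if "adapted M A L c" "x \<in> W" "x \<in> cdom c"
    unfolding leg_mor_pull(1)[OF st that] using that by (simp add: Sp_simps adapted_\<kappa> cdom_\<kappa>)
  show "pull T W (\<lambda>c x. if adapted M B L c \<and> x \<in> W \<inter> cdom c then single one_mono 1 else (\<lambda>_. 0)) c x =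
      (if adapted M A L c \<and> x \<in> W \<inter> cdom c then single one_mono 1 else (\<lambda>_. 0))"
    if "\<not> (adapted M A L c \<and> x \<in> W \<inter> cdom c)"
    using leg_mor_pull(2)[OF st that, of \<kappa>] that by auto
qed

lemma is_nmor: "is_nmor (jet_manifold M A L) (jet_manifold M B L) T"
  unfolding is_nmor_def
proof (intro conjI allI impI)
  let ?X = "jet_manifold M A L" and ?Y = "jet_manifold M B L"
  show "continuous_on UNIV (base T)" by simp
  show "pull T W \<in> extensional (sect ?Y W)" for W
    by (simp add: leg_mor_def jet_manifold_def)
  fix W :: "'m set" assume W: "open W"
  show "pull T W ` sect ?Y W \<subseteq> sect ?X (base T -` W)"
    using pull_in_jet_fun by (auto simp: jet_manifold_def)
  show "pull T W ` homog ?Y k W \<subseteq> homog ?X k (base T -` W)" for k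
  proof
    fix t assume "t \<in> pull T W ` homog ?Y k W"
    then obtain s where s: "s \<in> jet_fun M B L W" and deg: "\<And>c x m. s c x m \<noteq> 0 \<Longrightarrow> mono_degree m = k"
      and t: "t = pull T W s" by (auto simp: jet_manifold_def)
    have "mono_degree m = k" if nz: "pull T W s c x m \<noteq> 0" for c x m
    proof -
      have cx: "adapted M A L c" "x \<in> W" "x \<in> cdom c"
        using leg_mor_support[OF s nz] by auto
      then have "coef (evalp leg (Sp (s (\<kappa> c) x))) m \<noteq> 0"
        using nz leg_mor_pull(1)[OF s cx, of \<kappa>] by (metis coef_Sp)
      from coef_evalp_degree[OF deg_hom_leg this] show ?thesis using deg by auto
    qed
    then show "t \<in> homog ?X k (base T -` W)"
      using pull_in_jet_fun[OF s] by (simp add: jet_manifold_def t)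
  qed
  show "\<forall>s\<in>sect ?Y W. \<forall>t\<in>sect ?Y W.
       pull T W (nadd ?Y s t) = nadd ?X (pull T W s) (pull T W t) \<and>
       pull T W (nmult ?Y s t) = nmult ?X (pull T W s) (pull T W t)"
    by (simp add: jet_manifold_def pull_add pull_mult)
  show "\<forall>s\<in>sect ?Y W. pull T W (nscale ?Y r s) = nscale ?X r (pull T W s)" for r
    by (simp add: jet_manifold_def pull_scale)
  show "pull T W (nunit ?Y W) = nunit ?X (base T -` W)"
    by (simp add: jet_manifold_def pull_unit[OF W, simplified])
  show "pull T V (restr ?Y V s) = restr ?X (base T -` V) (pull T W s)"
    if "open V \<and> V \<subseteq> W \<and> s \<in> sect ?Y W" for V s
    using that pull_restr[of s W V] by (simp add: jet_manifold_def)
  show "\<forall>s\<in>sect ?Y W. \<forall>x\<in>base T -` W. body ?X (pull T W s) x = body ?Y s (base T x)"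
  proof (intro ballI)
    fix s x assume "s \<in> sect ?Y W" "x \<in> base T -` W"
    then have s: "s \<in> jet_fun M B L W" and x: "x \<in> W" by (simp_all add: jet_manifold_def)
    obtain c where c: "adapted M A L c" "x \<in> cdom c" by (rule SA.adapted_exists)
    have "body ?X (pull T W s) x = coef (Sp (pull T W s c x)) one_mono"
      using SA.jet_body[OF pull_in_jet_fun[OF s] c(1) x c(2)] by simp
    also have "\<dots> = coef (Sp (s (\<kappa> c) x)) one_mono"
      unfolding leg_mor_pull(1)[OF s c(1) x c(2)] by (rule coef_evalp_one_mono[OF deg_hom_leg SB.jet_funD(6)[OF s]])
    also have "\<dots> = body ?Y s x"
      using SB.jet_body[OF s adapted_\<kappa>[OF c(1)] x] c(2) by (simp add: cdom_\<kappa>)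
    finally show "body ?X (pull T W s) x = body ?Y s (base T x)" by simp
  qed
qed

end

text \<open>On expressions this is the involution \<open>evalp leg\<close>. The round trip through
  the charts returns a chart equal to \<open>c\<close> over its domain only, which suffices by
  \<open>jet_fun_chart_cong\<close>.\<close>

lemma leg_mor_inverse:
  assumes T: "leg_transport M A B L \<kappa>" and T': "leg_transport M B A L \<kappa>'"
    and inv: "\<And>c. adapted M A L c \<Longrightarrow> cmap (\<kappa>' (\<kappa> c)) = cmap c \<and> lfr (\<kappa>' (\<kappa> c)) = lfr c \<and> (\<forall>x\<in>cdom c. afr (\<kappa>' (\<kappa> c)) x = afr c x)"
  shows "ncomp (jet_fun M A L) (leg_mor M B A L \<kappa>') (leg_mor M A B L \<kappa>) = nid (jet_manifold M A L)"
proof -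
  interpret T: leg_transport M A B L \<kappa> by (rule T)
  interpret T': leg_transport M B A L \<kappa>' by (rule T')
  have "pull T.T W (pull T'.T W s) = s" if s: "s \<in> jet_fun M A L W" for W s
  proof (rule T.pull_eqI[of W])
    note s' = T'.pull_in_jet_fun[OF s]
    show "Sp (pull T.T W (pull T'.T W s) c x) = Sp (s c x)" if c: "adapted M A L c" and x: "x \<in> W" "x \<in> cdom c" for c x
    proof -
      note cB = T.adapted_\<kappa>[OF c] and cA = T'.adapted_\<kappa>[OF T.adapted_\<kappa>[OF c]]
      have "Sp (pull T.T W (pull T'.T W s) c x) = evalp leg (evalp leg (Sp (s (\<kappa>' (\<kappa> c)) x)))"
        using leg_mor_pull(1)[OF s' c x] leg_mor_pull(1)[OF s cB x(1)] x(2) by (simp add: T.cdom_\<kappa>)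
      also have "\<dots> = Sp (s (\<kappa>' (\<kappa> c)) x)" by (rule evalp_leg_leg[OF T.SA.jet_funD(6)[OF s]])
      also have "s (\<kappa>' (\<kappa> c)) x = s c x"
        by (rule T.SA.jet_fun_chart_cong[OF s cA c, of "cdom c"])
          (use inv[OF c] T.SA.adaptedD(6)[OF c] x in \<open>auto simp: T.cdom_\<kappa> T'.cdom_\<kappa>\<close>)
      finally show ?thesis .
    qed
    show "pull T.T W (pull T'.T W s) c x = s c x" if "\<not> (adapted M A L c \<and> x \<in> W \<inter> cdom c)" for c x
      using leg_mor_pull(2)[OF s' that] T.SA.jet_funD(2)[OF s that] by simp
  qed
  then show ?thesis
    by (simp add: ncomp_def nid_def jet_manifold_def fun_eq_iff restrict_def)
qed

context jet_setting
begin

lemma leg_transport_dual: "leg_transport M A (dagger A L) L (dual_chart A)"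
proof -
  interpret B: jet_setting M "dagger A L" L by (rule dual_setting)
  show ?thesis
    by unfold_locales
      (auto simp: dual_chart_def[of A] intro!: JC_leg dual_pair_dual_chart[unfolded dual_chart_def] adapted_dual_chart[unfolded dual_chart_def])
qed

lemma leg_transport_primal: "leg_transport M (dagger A L) A L (primal_chart A L)"
proof -
  interpret B: jet_setting M "dagger A L" L by (rule dual_setting)
  show ?thesis
  proof unfold_locales
    fix d assume d: "adapted M (dagger A L) L d"
    then show "adapted M A L (primal_chart A L d)" by (rule adapted_primal_chart)
  next
    fix d show "cdom (primal_chart A L d) = cdom d" by (simp add: primal_chart_def)
  next
    fix d d' x and p :: "('n, 'r) sp" assume d: "adapted M (dagger A L) L d" "adapted M (dagger A L) L d'"
      and x: "x \<in> cdom d" "x \<in> cdom d'" and p: "fins p"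
    show "evalp (JC d d' x) (evalp leg p) = evalp leg (evalp (JC (primal_chart A L d) (primal_chart A L d') x) p)"
      by (rule JC_leg'[OF adapted_primal_chart[OF d(1)] adapted_primal_chart[OF d(2)] _ _ p])
        (use x in \<open>simp_all add: primal_chart_def\<close>)
  qed
qed

abbreviation "F0 \<equiv> leg_mor M A (dagger A L) L (dual_chart A)"

lemma ndiffeo_F0: "ndiffeo (jet_manifold M A L) (jet_manifold M (dagger A L) L) F0"
  "pull F0 W ` jet_bidegree M (dagger A L) L W \<epsilon> \<delta> = jet_bidegree M A L W \<delta> \<epsilon>"
proof -
  let ?G = "leg_mor M (dagger A L) A L (primal_chart A L)"
  interpret T: leg_transport M A "dagger A L" L "dual_chart A" by (rule leg_transport_dual)
  interpret T': leg_transport M "dagger A L" A L "primal_chart A L" by (rule leg_transport_primal)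
  have 1: "ncomp (jet_fun M A L) ?G F0 = nid (jet_manifold M A L)"
  proof (rule leg_mor_inverse[OF leg_transport_dual leg_transport_primal])
    fix c assume c: "adapted M A L c"
    have "ev_inv A L x (dual_triv (dagger A L) (dual_triv A (afr c) (lfr c)) (lfr c) x v) = afr c x v" if "x \<in> cdom c" for x v
      by (rule ev_inv_frame[OF adaptedD(4,5)[OF c] that that])
    then show "cmap (primal_chart A L (dual_chart A c)) = cmap c \<and> lfr (primal_chart A L (dual_chart A c)) = lfr c \<and>
        (\<forall>x\<in>cdom c. afr (primal_chart A L (dual_chart A c)) x = afr c x)"
      by (simp add: primal_chart_def dual_chart_def)
  qed
  have 2: "ncomp (jet_fun M (dagger A L) L) F0 ?G = nid (jet_manifold M (dagger A L) L)"
  proof (rule leg_mor_inverse[OF leg_transport_primal leg_transport_dual])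
    fix d assume "adapted M (dagger A L) L d"
    then have "dual_pair A (primal_chart A L d) d" by (rule adapted_primal_chart)
    then show "cmap (dual_chart A (primal_chart A L d)) = cmap d \<and> lfr (dual_chart A (primal_chart A L d)) = lfr d \<and>
        (\<forall>x\<in>cdom d. afr (dual_chart A (primal_chart A L d)) x = afr d x)"
      by (simp add: primal_chart_def dual_chart_def dual_pair_def)
  qed
  show "ndiffeo (jet_manifold M A L) (jet_manifold M (dagger A L) L) F0"
    unfolding ndiffeo_def using T.is_nmor T'.is_nmor 1 2 by (auto simp: jet_manifold_def)
  have inv: "pull F0 W (pull ?G W s) = s" if "s \<in> jet_fun M A L W" for s
  proof -
    have "pull (ncomp (jet_fun M A L) ?G F0) W s = s" using that by (simp add: 1 nid_def jet_manifold_def)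
    then show ?thesis using that by (simp add: ncomp_def)
  qed
  show "pull F0 W ` jet_bidegree M (dagger A L) L W \<epsilon> \<delta> = jet_bidegree M A L W \<delta> \<epsilon>"
  proof
    show "pull F0 W ` jet_bidegree M (dagger A L) L W \<epsilon> \<delta> \<subseteq> jet_bidegree M A L W \<delta> \<epsilon>"
      using T.pull_bidegree by blast
    show "jet_bidegree M A L W \<delta> \<epsilon> \<subseteq> pull F0 W ` jet_bidegree M (dagger A L) L W \<epsilon> \<delta>"
    proof
      fix s assume s: "s \<in> jet_bidegree M A L W \<delta> \<epsilon>"
      then have "pull F0 W (pull ?G W s) = s" by (intro inv) (simp add: jet_bidegree_def)
      then show "s \<in> pull F0 W ` jet_bidegree M (dagger A L) L W \<epsilon> \<delta>"
        using T'.pull_bidegree[OF s] by (metis image_eqI)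
    qed
  qed
qed

end

section \<open>The contact form\<close>

lemma sum_coord:
  fixes f :: "('n::finite, 'r::finite) coord \<Rightarrow> 'a::comm_monoid_add"
  shows "sum f UNIV = (\<Sum>i\<in>UNIV. f (CX i)) + (\<Sum>a\<in>UNIV. f (CU a)) + (\<Sum>a\<in>UNIV. f (CPU a)) + f CP + (\<Sum>i\<in>UNIV. f (CPX i))"
proof -
  have U: "(UNIV :: ('n, 'r) coord set) = range CX \<union> (range CU \<union> (range CPU \<union> ({CP} \<union> range CPX)))"
  proof -
    have "z \<in> range CX \<union> (range CU \<union> (range CPU \<union> ({CP} \<union> range CPX)))" for z :: "('n, 'r) coord"
      by (cases z) auto
    then show ?thesis by blast
  qed
  have inj: "inj CX" "inj CU" "inj CPU" "inj CPX" by (auto intro: injI)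
  have "sum f UNIV = sum f (range CX) + (sum f (range CU) + (sum f (range CPU) + (sum f {CP} + sum f (range CPX))))"
    unfolding U by (subst sum.union_disjoint; (subst sum.union_disjoint; (subst sum.union_disjoint; (subst sum.union_disjoint; auto)?; auto)?; auto)?; auto)
  then show ?thesis by (simp add: sum.reindex[OF inj(1)] sum.reindex[OF inj(2)] sum.reindex[OF inj(3)] sum.reindex[OF inj(4)] o_def add.assoc)
qed

text \<open>The coefficient of \<open>dz\<close> in \<open>dq\<close> for a polynomial \<open>q\<close> with constant coefficients; for a base
  coordinate it is the sign picked up by a differentiated coefficient.\<close>

fun cdiff :: "('n, 'r) coord \<Rightarrow> ('n::finite, 'r::{finite,linorder}) sp \<Rightarrow> ('n, 'r) sp" where
  "cdiff (CX i) q = Sp (\<lambda>m. parity_sign m * coef q m)"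
| "cdiff (CU a) q = Sp (\<lambda>m. if a \<in> mU m then 0
     else (-1) ^ card {b \<in> mU m. b < a} * coef q (m\<lparr>mU := insert a (mU m)\<rparr>))"
| "cdiff (CPU a) q = Sp (\<lambda>m. if a \<in> mPU m then 0
     else (-1) ^ (card (mU m) + card {b \<in> mPU m. b < a}) * coef q (m\<lparr>mPU := insert a (mPU m)\<rparr>))"
| "cdiff CP q = Sp (\<lambda>m. parity_sign m * real (mP m + 1) * coef q (m\<lparr>mP := mP m + 1\<rparr>))"
| "cdiff (CPX i) q = Sp (\<lambda>m.
     parity_sign m * real (mPX m i + 1) * coef q (m\<lparr>mPX := (mPX m)(i := mPX m i + 1)\<rparr>))"

lemma cdiff_add: "cdiff z (p + q) = cdiff z p + cdiff z q"
  and cdiff_diff: "cdiff z (p - q) = cdiff z p - cdiff z q"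
  by (cases z; auto intro!: sp_eqI simp: algebra_simps)+

lemma cdiff_0: "cdiff z 0 = 0"
  by (cases z) (auto intro!: sp_eqI)

lemma cdiff_sum: "cdiff z (sum f I) = (\<Sum>i\<in>I. cdiff z (f i))"
  by (induction I rule: infinite_finite_induct) (simp_all add: cdiff_0 cdiff_add)

lemma coef_1: "coef 1 m = (if m = one_mono then 1 else 0)"
  by (simp add: single_def)

lemma gen_apply:
  "gen (CU a) m = (if mU m = {a} \<and> mPU m = {} \<and> mP m = 0 \<and> mPX m = (\<lambda>_. 0) then 1 else 0)"
  "gen (CPU a) m = (if mU m = {} \<and> mPU m = {a} \<and> mP m = 0 \<and> mPX m = (\<lambda>_. 0) then 1 else 0)"
  "gen CP m = (if mU m = {} \<and> mPU m = {} \<and> mP m = 1 \<and> mPX m = (\<lambda>_. 0) then 1 else 0)"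
  "gen (CPX i) m = (if mU m = {} \<and> mPU m = {} \<and> mP m = 0 \<and> mPX m = (\<lambda>j. if j = i then 1 else 0) then 1 else 0)"
  by (cases m; simp add: gen.simps single_def one_mono_def)+

lemma insert_eq_singleton: "a \<notin> S \<Longrightarrow> insert a S = {b} \<longleftrightarrow> a = b \<and> S = {}"
  by auto

lemma coef_G_mult:
  "coef (G (CU a) * G (CPU b)) m = (if mU m = {a} \<and> mPU m = {b} \<and> mP m = 0 \<and> mPX m = (\<lambda>_. 0) then 1 else 0)"
  unfolding G_mon mon_mult
  by (cases m) (auto simp: coef_mon one_mono_def madd_def msgn_def mono_sign_def)

lemma coef_1': "coef 1 m = (if mU m = {} \<and> mPU m = {} \<and> mP m = 0 \<and> mPX m = (\<lambda>_. 0) then 1 else 0)"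
  by (cases m) (simp add: coef_1 one_mono_def del: coef_simps)

lemma cdiff_1: "cdiff (CX k) 1 = 1" "cdiff (CU a) 1 = 0" "cdiff (CPU a) 1 = 0" "cdiff CP 1 = 0" "cdiff (CPX i) 1 = 0"
  by (rule sp_eqI; auto simp: coef_1' parity_sign_def fun_eq_iff simp del: coef_simps(2) singleton_insert_inj_eq singleton_insert_inj_eq')+

lemma cdiff_CPU:
  "cdiff (CX k) (G (CPU b)) = - G (CPU b)" "cdiff (CU a) (G (CPU b)) = 0"
  "cdiff (CPU a) (G (CPU b)) = (if a = b then 1 else 0)" "cdiff CP (G (CPU b)) = 0" "cdiff (CPX i) (G (CPU b)) = 0"
  by (rule sp_eqI; auto simp: gen_apply insert_eq_singleton coef_1' parity_sign_def fun_eq_iff simp del: coef_simps(2) singleton_insert_inj_eq singleton_insert_inj_eq')+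

lemma cdiff_CP:
  "cdiff (CX k) (G CP) = G CP" "cdiff (CU a) (G CP) = 0"
  "cdiff (CPU a) (G CP) = 0" "cdiff CP (G CP) = 1" "cdiff (CPX i) (G CP) = 0"
  by (rule sp_eqI; auto simp: gen_apply insert_eq_singleton coef_1' parity_sign_def fun_eq_iff simp del: coef_simps(2) singleton_insert_inj_eq singleton_insert_inj_eq')+

lemma cdiff_CU_CPU:
  "cdiff (CX k) (G (CU a) * G (CPU b)) = G (CU a) * G (CPU b)"
  "cdiff (CU e) (G (CU a) * G (CPU b)) = (if e = a then G (CPU b) else 0)"
  "cdiff (CPU e) (G (CU a) * G (CPU b)) = (if e = b then - G (CU a) else 0)"
  "cdiff CP (G (CU a) * G (CPU b)) = 0" "cdiff (CPX i) (G (CU a) * G (CPU b)) = 0"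
  by (rule sp_eqI; auto simp: coef_G_mult gen_apply insert_eq_singleton parity_sign_def fun_eq_iff simp del: singleton_insert_inj_eq singleton_insert_inj_eq')+

text \<open>The differential dp - p_a du^a + u^a dp_a of \<Lambda> p. The same values serve as the
  system of equations in the uniqueness argument.\<close>

lemma cdiff_leg_CP:
  "cdiff (CX k) (leg CP) = leg CP" "cdiff (CU a) (leg CP) = - G (CPU a)" "cdiff (CPU a) (leg CP) = G (CU a)"
  "cdiff CP (leg CP) = 1" "cdiff (CPX i) (leg CP) = 0"
  unfolding leg_simps cdiff_diff cdiff_sum cdiff_CP cdiff_CU_CPU by (simp_all add: sum_negf)

lemma Sp_contact_form:
  "Sp (contact_form CP) = 1" "Sp (contact_form (CX i)) = - G (CPX i)" "Sp (contact_form (CU a)) = - G (CPU a)"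
  "Sp (contact_form (CPX i)) = 0" "Sp (contact_form (CPU a)) = 0"
  by (simp_all add: Sp_simps)

lemma Sp_local_coord:
  "Sp (local_coord c (CX i) x) = (cmap c x $ i) *\<^sub>R 1" "Sp (local_coord c (CU a) x) = G (CU a)"
  "Sp (local_coord c (CPU a) x) = G (CPU a)" "Sp (local_coord c CP x) = G CP" "Sp (local_coord c (CPX i) x) = G (CPX i)"
proof -
  show "Sp (local_coord c (CX i) x) = (cmap c x $ i) *\<^sub>R 1"
    by (rule sp_eqI) (simp add: local_coord_def single_def)
qed (simp_all add: local_coord_def)

lemma Sp_pull_form:
  "Sp (pull_form M B L F d \<omega> c z x) = (\<Sum>w\<in>UNIV. Sp (pull F (cdom d) (jet_fun_of M B L d (\<omega> w)) c x) *
     Sp (sdiff c (pull F (cdom d) (coord_fun M B L d w) c) z x))"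
  unfolding pull_form_def Sp_sum Sp_simps ..

lemma graded_minus: "graded \<omega> k p \<Longrightarrow> graded \<omega> k (- p)"
  for p :: "('n::finite, 'r::{finite,linorder}) sp"
  using graded_scaleR[of \<omega> k p "-1"] by simp

context jet_setting
begin

lemma sdiff_cong:
  assumes c: "adapted M A L c" and W: "open W" "x \<in> W" "x \<in> cdom c" and eq: "\<And>y. y \<in> W \<Longrightarrow> f y = g y"
  shows "sdiff c f z x = sdiff c g z x"
proof (cases z)
  case (CX i)
  have "cpderiv c i (\<lambda>y. f y m) x = cpderiv c i (\<lambda>y. g y m) x" for m
    by (rule pderiv_chart_cong[OF adaptedD(1)[OF c] W]) (simp add: eq)
  then show ?thesis by (simp add: CX)
qed (use eq[OF W(2)] in \<open>simp_all cong: if_cong\<close>)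

text \<open>Coefficient functions are separated from fixed polynomials: a base direction
  differentiates the coefficients and leaves a parity sign on the polynomial, while for all other
  directions the coefficients are constants.\<close>

lemma sdiff_sum:
  assumes c: "adapted M A L c" and W: "open W" "x \<in> cdom c" "x \<in> W"
    and sm: "\<And>i. i \<in> I \<Longrightarrow> smooth_fun M W (\<phi> i)" and f: "\<And>y. y \<in> W \<Longrightarrow> Sp (f y) = (\<Sum>i\<in>I. \<phi> i y *\<^sub>R q i)"
  shows "Sp (sdiff c f z x) = (\<Sum>i\<in>I. (case z of CX k \<Rightarrow> cpderiv c k (\<phi> i) x | _ \<Rightarrow> \<phi> i x) *\<^sub>R cdiff z (q i))"
proof -
  have f': "f y = (\<lambda>m. \<Sum>i\<in>I. \<phi> i y * coef (q i) m)" if "y \<in> W" for y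
  proof
    fix m show "f y m = (\<Sum>i\<in>I. \<phi> i y * coef (q i) m)"
      using arg_cong[OF f[OF that], of "\<lambda>p. coef p m"] by simp
  qed
  have s: "sdiff c f z x = sdiff c (\<lambda>y m. \<Sum>i\<in>I. \<phi> i y * coef (q i) m) z x"
    by (rule sdiff_cong[OF c W(1,3,2) f'])
  show ?thesis
  proof (cases z)
    case (CX k)
    have "cpderiv c k (\<lambda>y. \<Sum>i\<in>I. \<phi> i y * coef (q i) m) x = (\<Sum>i\<in>I. cpderiv c k (\<phi> i) x * coef (q i) m)" for m
    proof -
      note ctx = M adaptedD(1)[OF c] W(1,2,3)
      have "cpderiv c k (\<lambda>y. \<Sum>i\<in>I. coef (q i) m * \<phi> i y) x = (\<Sum>i\<in>I. cpderiv c k (\<lambda>y. coef (q i) m * \<phi> i y) x)"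
        by (rule pderiv_chart_sum[OF ctx]) (intro smooth_fun_mult[OF M W(1)] smooth_fun_const sm)
      also have "\<dots> = (\<Sum>i\<in>I. coef (q i) m * cpderiv c k (\<phi> i) x)"
        by (intro sum.cong refl pderiv_chart_cmult[OF ctx] sm)
      finally show ?thesis by (simp add: mult.commute)
    qed
    then show ?thesis unfolding s unfolding CX by (intro sp_eqI) (simp add: sum_distrib_left mult_ac)
  qed (unfold s, (intro sp_eqI, simp add: sum_distrib_left sum_distrib_right mult_ac)+)
qed

lemma local_coord_bounded:
  assumes "adapted M A L d"
  shows "smooth_sp M (cdom d) (\<lambda>x. Sp (local_coord d w x))" "local_coord d w x m \<noteq> 0 \<Longrightarrow> mono_degree m \<le> 2"
proof -
  note o = adaptedD(6)[OF assms]
  show "smooth_sp M (cdom d) (\<lambda>x. Sp (local_coord d w x))"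
    by (cases w; simp only: Sp_local_coord)
      (intro smooth_sp_scaleR[OF M o] smooth_sp_const[OF M o] coord_smooth[OF assms])+
  have "graded cdeg (cdeg w) (Sp (local_coord d w x))"
    by (cases w; simp only: Sp_local_coord cdeg.simps graded_CU graded_CPU graded_CP graded_CPX graded_scaleR[OF graded_1])
  moreover have "cdeg w \<le> 2" by (cases w) auto
  ultimately show "mono_degree m \<le> 2" if "local_coord d w x m \<noteq> 0"
    using that by (auto simp: graded_def mono_degree_wt)
qed

lemma contact_form_degree: "contact_form w m \<noteq> 0 \<Longrightarrow> mono_degree m \<le> 2"
  for w :: "('n, 'r) coord"
proof -
  \<comment> \<open>The contact form is homogeneous of degree 2, not counting the differential
    itself, so the coefficient of dw has the complementary degree.\<close>
  have "graded cdeg (2 - cdeg w) (Sp (contact_form w))"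
    by (cases w; simp add: Sp_contact_form graded_minus graded_CPU[unfolded One_nat_def] graded_CPX del: contact_form.simps)
  then show "contact_form w m \<noteq> 0 \<Longrightarrow> mono_degree m \<le> 2"
    by (auto simp: graded_def mono_degree_wt)
qed

lemma coord_fun_in_jet_fun:
  assumes "adapted M A L d"
  shows "coord_fun M A L d w \<in> jet_fun M A L (cdom d)"
    and "adapted M A L c \<Longrightarrow> x \<in> cdom d \<Longrightarrow> x \<in> cdom c \<Longrightarrow>
      Sp (coord_fun M A L d w c x) = evalp (JC c d x) (Sp (local_coord d w x))"
  unfolding coord_fun_def
  by (rule jet_fun_of_in_jet_fun[OF assms local_coord_bounded(1)[OF assms] local_coord_bounded(2)[OF assms]]; assumption)+

lemma contact_form_in_jet_fun:
  assumes "adapted M A L d"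
  shows "jet_fun_of M A L d (\<lambda>_. contact_form w) \<in> jet_fun M A L (cdom d)"
    and "adapted M A L c \<Longrightarrow> x \<in> cdom d \<Longrightarrow> x \<in> cdom c \<Longrightarrow>
      Sp (jet_fun_of M A L d (\<lambda>_. contact_form w) c x) = evalp (JC c d x) (Sp (contact_form w))"
  by (rule jet_fun_of_in_jet_fun[OF assms smooth_sp_const[OF M adaptedD(6)[OF assms]] contact_form_degree]; assumption)+

text \<open>An arbitrary chart \<open>d\<close> of \<open>dagger A L\<close> is replaced by its
  primal chart. The change of coordinates then takes place on the source, where only charts of
  \<open>A\<close> are involved.\<close>

lemma JC_leg_primal:
  assumes c: "adapted M A L c" and d: "adapted M (dagger A L) L d" and x: "x \<in> cdom c" "x \<in> cdom d"
  shows "evalp leg (evalp (JC (dual_chart A c) d x) p) = evalp (JC c (primal_chart A L d) x) (evalp leg p)"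
  by (rule JC_leg[OF c dual_pair_dual_chart adapted_primal_chart[OF d], symmetric])
    (use x in \<open>simp_all add: primal_chart_def\<close>)

lemma F0_coord_fun:
  assumes c: "adapted M A L c" and d: "adapted M (dagger A L) L d" and x: "x \<in> cdom c" "x \<in> cdom d"
  shows "Sp (pull F0 (cdom d) (coord_fun M (dagger A L) L d w) c x) =
      evalp (JC c (primal_chart A L d) x) (evalp leg (Sp (local_coord d w x)))"
    "Sp (pull F0 (cdom d) (jet_fun_of M (dagger A L) L d (\<lambda>_. contact_form w)) c x) =
      evalp (JC c (primal_chart A L d) x) (evalp leg (Sp (contact_form w)))"
proof -
  interpret B: jet_setting M "dagger A L" L by (rule dual_setting)
  note c' = adapted_dual_chart[OF c]
  have x': "x \<in> cdom (dual_chart A c)" using x by (simp add: dual_chart_def)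
  show "Sp (pull F0 (cdom d) (coord_fun M (dagger A L) L d w) c x) =
      evalp (JC c (primal_chart A L d) x) (evalp leg (Sp (local_coord d w x)))"
    unfolding leg_mor_pull(1)[OF B.coord_fun_in_jet_fun(1)[OF d] c x(2,1)]
      B.coord_fun_in_jet_fun(2)[OF d c' x(2) x'] by (rule JC_leg_primal[OF assms])
  show "Sp (pull F0 (cdom d) (jet_fun_of M (dagger A L) L d (\<lambda>_. contact_form w)) c x) =
      evalp (JC c (primal_chart A L d) x) (evalp leg (Sp (contact_form w)))"
    unfolding leg_mor_pull(1)[OF B.contact_form_in_jet_fun(1)[OF d] c x(2,1)]
      B.contact_form_in_jet_fun(2)[OF d c' x(2) x'] by (rule JC_leg_primal[OF assms])
qed

lemma evalp_JC_leg_CP: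
  assumes c: "adapted M A L c" and c': "adapted M A L c'" and x: "x \<in> cdom c" "x \<in> cdom c'"
  shows "evalp (JC c c' x) (leg CP) = ll c c' x *\<^sub>R leg CP"
proof -
  have "evalp (JC c c' x) (\<Sum>a\<in>UNIV. G (CU a) * G (CPU a)) = (\<Sum>a\<in>UNIV. JC c c' x (CU a) * JC c c' x (CPU a))"
    by (simp only: evalp_sum fins_mult fins_G evalp_mult[OF deg_hom_JC] evalp_gen)
  moreover have "fins (\<Sum>a\<in>UNIV. G (CU a) * G (CPU a) :: ('n, 'r) sp)" by (intro fins_sum fins_mult fins_G)
  ultimately show ?thesis
    unfolding JC_pairing[OF assms] by (simp add: leg_simps evalp_diff fins_G evalp_gen JC_simps(3) scaleR_diff_right)
qed

text \<open>By the cancellation of the Leibniz terms, the contact form of \<open>d\<close> pulls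
  back to that of the primal chart of \<open>d\<close>. Contact forms of two charts of
  \<open>A\<close> differ by the change of frame of \<open>L\<close>, and this is the conformal
  factor.\<close>

lemma contact_F0_pointwise:
  assumes c: "adapted M A L c" and d: "adapted M (dagger A L) L d" and x: "x \<in> cdom c" "x \<in> cdom d"
  shows "Sp (pull_form M (dagger A L) L F0 d (\<lambda>w _. contact_form w) c z x) =
    ll c (primal_chart A L d) x *\<^sub>R Sp (contact_form z)"
proof -
  define c' where "c' = primal_chart A L d"
  have c': "adapted M A L c'" unfolding c'_def by (rule adapted_primal_chart[OF d])
  have c'd: "cdom c' = cdom d" "cmap c' = cmap d" by (simp_all add: c'_def primal_chart_def)
  have x': "x \<in> cdom c'" using x c'd by simp
  let ?W = "cdom c \<inter> cdom c'"
  have W: "open ?W" "x \<in> cdom c" "x \<in> ?W" using adaptedD(6)[OF c] adaptedD(6)[OF c'] x x' by auto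
  let ?s = "\<lambda>w. Sp (sdiff c (pull F0 (cdom d) (coord_fun M (dagger A L) L d w) c) z x)"
  let ?D = "\<lambda>f. (case z of CX k \<Rightarrow> cpderiv c k f x | _ \<Rightarrow> f x)"
  let ?l = "ll c c'"
  define h where "h a b = (\<lambda>y. ?l y * gg c' c b a y)" for a b
  have F0c: "Sp (pull F0 (cdom d) (coord_fun M (dagger A L) L d w) c y) = evalp (JC c c' y) (evalp leg (Sp (local_coord d w y)))"
    if "y \<in> cdom c" "y \<in> cdom c'" for w y
    using F0_coord_fun(1)[OF c d, of y] that c'd unfolding c'_def by blast
  have sm_l: "smooth_fun M ?W ?l" by (rule ll_smooth[OF c c'])
  have sm_g: "smooth_fun M ?W (gg c' c b a)" for a b using gg_smooth[OF c' c] by (simp add: Int_commute)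
  have sm_h: "smooth_fun M ?W (h a b)" for a b unfolding h_def by (rule smooth_fun_mult[OF M W(1) sm_l sm_g])
  have sX: "?s (CX i) = ?D (\<lambda>y. cmap c' y $ i) *\<^sub>R cdiff z 1" for i
  proof -
    have "?s (CX i) = (\<Sum>j\<in>{i}. ?D (\<lambda>y. cmap c' y $ j) *\<^sub>R cdiff z 1)"
      by (rule sdiff_sum[OF c W])
        (auto simp: F0c Sp_local_coord evalp_scaleR c'd(2)[symmetric] intro!: smooth_fun_subset[OF coord_smooth[OF c']])
    then show ?thesis by simp
  qed
  have sU: "?s (CU a) = (\<Sum>b\<in>UNIV. ?D (h a b) *\<^sub>R cdiff z (G (CPU b)))" for a
    by (rule sdiff_sum[OF c W sm_h])
      (auto simp: F0c Sp_local_coord evalp_gen leg_simps JC_simps h_def)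
  have sP: "?s CP = ?D ?l *\<^sub>R cdiff z (leg CP)"
  proof -
    have "?s CP = (\<Sum>j\<in>{()}. ?D ?l *\<^sub>R cdiff z (leg CP))"
      by (rule sdiff_sum[OF c W])
        (auto simp: F0c Sp_local_coord evalp_gen evalp_JC_leg_CP[OF c c'] intro: sm_l)
    then show ?thesis by simp
  qed
  have "Sp (pull_form M (dagger A L) L F0 d (\<lambda>w _. contact_form w) c z x) =
      ?s CP - (\<Sum>i\<in>UNIV. JC c c' x (CPX i) * ?s (CX i)) - (\<Sum>a\<in>UNIV. JC c c' x (CU a) * ?s (CU a))"
    unfolding Sp_pull_form sum_coord F0_coord_fun(2)[OF assms, folded c'_def] Sp_contact_form
    by (simp add: evalp_minus evalp_gen leg_simps sum_negf)
  also have "\<dots> = ?D ?l *\<^sub>R cdiff z (leg CP) -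
      (\<Sum>i\<in>UNIV. ?D (\<lambda>y. cmap c' y $ i) *\<^sub>R (JC c c' x (CPX i) * cdiff z 1)) -
      (\<Sum>a\<in>UNIV. \<Sum>b\<in>UNIV. ?D (h a b) *\<^sub>R (JC c c' x (CU a) * cdiff z (G (CPU b))))"
    unfolding sX sU sP by (simp add: sum_distrib_left)
  finally have *: "Sp (pull_form M (dagger A L) L F0 d (\<lambda>w _. contact_form w) c z x) = \<dots>" .
  \<comment> \<open>The u of \<open>c\<close> recovered from those of \<open>c'\<close> by the
    inverse matrix.\<close>
  have U: "(\<Sum>a\<in>UNIV. gg c' c b a x *\<^sub>R JC c c' x (CU a)) = G (CU b)" for b
  proof -
    have "(\<Sum>a\<in>UNIV. gg c' c b a x *\<^sub>R JC c c' x (CU a)) =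
        (\<Sum>e\<in>UNIV. (\<Sum>a\<in>UNIV. gg c' c b a x * gg c c' a e x) *\<^sub>R G (CU e))"
      unfolding JC_simps scaleR_sum_right scaleR_sum_left by (subst sum.swap) simp
    then show ?thesis
      unfolding gg_inverse[OF c c' x(1) x'] by (simp add: if_distrib[of "\<lambda>r. r *\<^sub>R _"] cong: if_cong)
  qed
  show ?thesis
  proof (cases z)
    case (CU b)
    then show ?thesis unfolding * by (simp add: cdiff_1 cdiff_CPU cdiff_leg_CP Sp_contact_form c'_def del: cdiff.simps contact_form.simps)
  next
    case (CPU b)
    have "(\<Sum>a\<in>UNIV. \<Sum>e\<in>UNIV. h a e x *\<^sub>R (JC c c' x (CU a) * cdiff (CPU b) (G (CPU e)))) =
        (\<Sum>a\<in>UNIV. h a b x *\<^sub>R JC c c' x (CU a))"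
      by (simp add: cdiff_CPU if_distrib[of "\<lambda>q. _ * q"] if_distrib[of "\<lambda>q. _ *\<^sub>R q"] del: cdiff.simps cong: if_cong)
    also have "\<dots> = ?l x *\<^sub>R G (CU b)"
      unfolding U[symmetric] h_def by (simp add: scaleR_sum_right)
    finally show ?thesis unfolding CPU *[unfolded CPU]
      by (simp add: cdiff_1 cdiff_leg_CP Sp_contact_form del: cdiff.simps contact_form.simps)
  next
    case CP
    then show ?thesis unfolding * by (simp add: cdiff_1 cdiff_CPU cdiff_leg_CP Sp_contact_form c'_def del: cdiff.simps contact_form.simps)
  next
    case (CPX i)
    then show ?thesis unfolding * by (simp add: cdiff_1 cdiff_CPU cdiff_leg_CP Sp_contact_form c'_def del: cdiff.simps contact_form.simps)
  next
    \<comment> \<open>Three sources of derivatives of transition functions meet in the coefficient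
      of dx^k: the factor of \<Lambda> p, the change of p_i (\<open>A1\<close>), and the
      coefficients \<open>h\<close> of the p_a (\<open>A2\<close>). They cancel, and only p_k times
      the factor of \<open>L\<close> remains.\<close>
    case (CX k)
    let ?d = "cpderiv c k"
    note ctx = M adaptedD(1)[OF c] W
    note chain = pderiv_chart_chain[OF ctx adaptedD(1)[OF c'] x']
    define t where "t i = ?d (\<lambda>y. cmap c' y $ i) x" for i
    define X where "X a b = JC c c' x (CU a) * G (CPU b)" for a b
    have D1: "(\<Sum>i\<in>UNIV. t i * cpderiv c' i (\<lambda>y. cmap c y $ j) x) = (if k = j then 1 else 0)" for j
      unfolding t_def chain[OF smooth_fun_subset[OF coord_smooth[OF c]], of k j, OF Int_lower1, symmetric]
      by (rule pderiv_chart_coordinate[OF ctx])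
    have D2: "(\<Sum>i\<in>UNIV. t i * cpderiv c' i ?l x) = ?d ?l x"
      unfolding t_def by (rule chain[OF sm_l, symmetric])
    have D3: "(\<Sum>i\<in>UNIV. t i * cpderiv c' i (gg c' c b a) x) = ?d (gg c' c b a) x" for a b
      unfolding t_def by (rule chain[OF sm_g, symmetric])
    have Dh: "?d (h a b) x = ?l x * ?d (gg c' c b a) x + ?d ?l x * gg c' c b a x" for a b
      unfolding h_def by (rule pderiv_chart_mult[OF ctx sm_l sm_g])
    have A1: "(\<Sum>i\<in>UNIV. t i *\<^sub>R JC c c' x (CPX i)) = ?l x *\<^sub>R G (CPX k) + ?d ?l x *\<^sub>R G CP +
        (\<Sum>a\<in>UNIV. \<Sum>b\<in>UNIV. (?l x * ?d (gg c' c b a) x) *\<^sub>R X a b)"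
    proof -
      have "(\<Sum>i\<in>UNIV. t i *\<^sub>R JC c c' x (CPX i)) =
          (\<Sum>i\<in>UNIV. \<Sum>j\<in>UNIV. (?l x * (t i * cpderiv c' i (\<lambda>y. cmap c y $ j) x)) *\<^sub>R G (CPX j)) +
          (\<Sum>i\<in>UNIV. (t i * cpderiv c' i ?l x) *\<^sub>R G CP) +
          (\<Sum>i\<in>UNIV. \<Sum>a\<in>UNIV. \<Sum>b\<in>UNIV. (?l x * (t i * cpderiv c' i (gg c' c b a) x)) *\<^sub>R X a b)"
        unfolding JC_simps(4) X_def[symmetric] by (simp add: scaleR_add_right scaleR_sum_right sum.distrib mult_ac)
      also have "(\<Sum>i\<in>UNIV. \<Sum>j\<in>UNIV. (?l x * (t i * cpderiv c' i (\<lambda>y. cmap c y $ j) x)) *\<^sub>R G (CPX j)) =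
          (\<Sum>j\<in>UNIV. (?l x * (\<Sum>i\<in>UNIV. t i * cpderiv c' i (\<lambda>y. cmap c y $ j) x)) *\<^sub>R G (CPX j))"
        by (subst sum.swap) (simp add: sum_distrib_left scaleR_sum_left)
      also have "\<dots> = ?l x *\<^sub>R G (CPX k)"
        unfolding D1 by (simp add: if_distrib[of "\<lambda>r. r *\<^sub>R _"] if_distrib[of "\<lambda>r. _ * r"] cong: if_cong)
      also have "(\<Sum>i\<in>UNIV. (t i * cpderiv c' i ?l x) *\<^sub>R G CP) = ?d ?l x *\<^sub>R G CP"
        unfolding D2[symmetric] by (simp add: scaleR_sum_left)
      also have "(\<Sum>i\<in>UNIV. \<Sum>a\<in>UNIV. \<Sum>b\<in>UNIV. (?l x * (t i * cpderiv c' i (gg c' c b a) x)) *\<^sub>R X a b) =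
          (\<Sum>a\<in>UNIV. \<Sum>b\<in>UNIV. (?l x * ?d (gg c' c b a) x) *\<^sub>R X a b)"
        unfolding D3[symmetric] by (subst sum3_rotate(2)) (simp add: sum_distrib_left scaleR_sum_left)
      finally show ?thesis .
    qed
    have A2: "(\<Sum>a\<in>UNIV. \<Sum>b\<in>UNIV. ?d (h a b) x *\<^sub>R X a b) =
        (\<Sum>a\<in>UNIV. \<Sum>b\<in>UNIV. (?l x * ?d (gg c' c b a) x) *\<^sub>R X a b) + ?d ?l x *\<^sub>R (\<Sum>b\<in>UNIV. G (CU b) * G (CPU b))"
    proof -
      have "(\<Sum>a\<in>UNIV. \<Sum>b\<in>UNIV. (?d ?l x * gg c' c b a x) *\<^sub>R X a b) =
          ?d ?l x *\<^sub>R (\<Sum>b\<in>UNIV. (\<Sum>a\<in>UNIV. gg c' c b a x *\<^sub>R JC c c' x (CU a)) * G (CPU b))"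
        unfolding X_def by (subst sum.swap) (simp add: scaleR_sum_right sum_distrib_right)
      then show ?thesis unfolding Dh U by (simp add: scaleR_add_left sum.distrib)
    qed
    have "Sp (pull_form M (dagger A L) L F0 d (\<lambda>w _. contact_form w) c z x) =
        ?d ?l x *\<^sub>R leg CP - (\<Sum>i\<in>UNIV. t i *\<^sub>R JC c c' x (CPX i)) + (\<Sum>a\<in>UNIV. \<Sum>b\<in>UNIV. ?d (h a b) x *\<^sub>R X a b)"
      unfolding CX *[unfolded CX] t_def X_def
      by (simp add: cdiff_1 cdiff_CPU cdiff_leg_CP sum_negf del: cdiff.simps)
    also have "\<dots> = - (?l x *\<^sub>R G (CPX k))"
      unfolding A1 A2 leg_simps by (simp add: scaleR_diff_right)
    finally show ?thesis unfolding CX Sp_contact_form c'_def by simp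
  qed
qed

lemma contactomorphism_F0: "contactomorphism M A (dagger A L) L F0"
  unfolding contactomorphism_def
proof (intro conjI allI impI ndiffeo_F0)
  fix c d assume "adapted M A L c \<and> adapted M (dagger A L) L d"
  then have c: "adapted M A L c" and d: "adapted M (dagger A L) L d" by auto
  let ?c' = "primal_chart A L d"
  have c': "adapted M A L ?c'" by (rule adapted_primal_chart[OF d])
  have cd: "cdom ?c' = cdom d" by (simp add: primal_chart_def)
  show "\<exists>\<rho>. smooth_fun M (cdom c \<inter> base F0 -` cdom d) \<rho> \<and>
      (\<forall>x\<in>cdom c \<inter> base F0 -` cdom d. \<rho> x \<noteq> 0 \<and>
        (\<forall>z m. pull_form M (dagger A L) L F0 d (\<lambda>w _. contact_form w) c z x m = \<rho> x * contact_form z m))"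
  proof (intro exI[of _ "ll c ?c'"] conjI ballI allI)
    show "smooth_fun M (cdom c \<inter> base F0 -` cdom d) (ll c ?c')"
      using ll_smooth[OF c c'] by (simp add: cd)
    fix x assume "x \<in> cdom c \<inter> base F0 -` cdom d"
    then have x: "x \<in> cdom c" "x \<in> cdom d" by auto
    show "ll c ?c' x \<noteq> 0"
      using ll_inverse[OF c c' x(1)] x(2) cd by auto
    fix z m
    show "pull_form M (dagger A L) L F0 d (\<lambda>w _. contact_form w) c z x m = ll c ?c' x * contact_form z m"
      using arg_cong[OF contact_F0_pointwise[OF c d x, of z], of "\<lambda>p. coef p m"] by simp
  qed
qed

end

section \<open>Alternating forms\<close>

text \<open>Insertion sort consists of swaps of neighbours; the prefix \<open>us\<close> is carried
  along so that they may occur anywhere in the list.\<close>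

lemma swap_invariant_sort:
  fixes f :: "'i::linorder list \<Rightarrow> 'b"
  assumes swap: "\<And>xs a b ys. f (xs @ a # b # ys) = f (xs @ b # a # ys)"
  shows "f (sort xs) = f xs"
proof -
  have ins: "f (us @ insort x xs) = f (us @ x # xs)" for us x xs
  proof (induction xs arbitrary: us)
    case (Cons y ys)
    then show ?case using Cons[of "us @ [y]"] swap[of us x y ys] by auto
  qed simp
  have "f (us @ sort xs) = f (us @ xs)" for us
  proof (induction xs arbitrary: us)
    case (Cons y ys)
    then show ?case using ins[of us y "sort ys"] Cons[of "us @ [y]"] by simp
  qed simp
  from this[of "[]"] show ?thesis by simp
qed

lemma finite_lists_of_length: "finite {xs :: 'i::finite list. length xs = k}"
  using finite_lists_length_eq[of "UNIV :: 'i set" k] by simp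

text \<open>Lists with repetitions contribute nothing. The others are grouped by their underlying
  set: each set with \<open>k\<close> elements has \<open>k!\<close> enumerations, all with the
  value of the sorted one.\<close>

lemma sum_swap_invariant:
  fixes f :: "'i::{finite,linorder} list \<Rightarrow> 'b::real_vector"
  assumes swap: "\<And>xs a b ys. f (xs @ a # b # ys) = f (xs @ b # a # ys)"
    and zero: "\<And>xs. \<not> distinct xs \<Longrightarrow> f xs = 0"
  shows "(\<Sum>xs | length xs = k. f xs) = fact k *\<^sub>R (\<Sum>I | card I = k. f (sorted_list_of_set I))"
proof -
  have "(\<Sum>xs | length xs = k. f xs) = (\<Sum>xs \<in> {xs. length xs = k \<and> distinct xs}. f xs)"
    by (rule sum.mono_neutral_right) (auto simp: finite_lists_of_length zero)
  also have "\<dots> = (\<Sum>I | card I = k. \<Sum>xs \<in> {xs \<in> {xs. length xs = k \<and> distinct xs}. set xs = I}. f xs)"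
    by (rule sum.group[symmetric]) (auto simp: distinct_card intro: finite_subset[OF _ finite_lists_of_length[of k]])
  also have "\<dots> = (\<Sum>I | card I = k. fact k *\<^sub>R f (sorted_list_of_set I))"
  proof (rule sum.cong[OF refl])
    fix I :: "'i set" assume "I \<in> {I. card I = k}"
    then have I: "card I = k" by simp
    have "{xs \<in> {xs. length xs = k \<and> distinct xs}. set xs = I} = permutations_of_set I"
      using I by (auto simp: permutations_of_set_def distinct_card[symmetric])
    moreover have "f xs = f (sorted_list_of_set I)" if "xs \<in> permutations_of_set I" for xs
    proof -
      have "sort xs = sorted_list_of_set I"
        using that by (auto simp: permutations_of_set_def sorted_list_of_set_sort_remdups distinct_remdups_id)
      then show ?thesis using swap_invariant_sort[of f xs, OF swap] by simp
    qed
    ultimately show "(\<Sum>xs \<in> {xs \<in> {xs. length xs = k \<and> distinct xs}. set xs = I}. f xs) = fact k *\<^sub>R f (sorted_list_of_set I)"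
      using I by (simp add: sum_constant_scaleR)
  qed
  finally show ?thesis by (simp add: scaleR_sum_right)
qed

definition alternating :: "((real^'r) list \<Rightarrow> real) \<Rightarrow> bool" where
  "alternating \<beta> \<longleftrightarrow> (\<forall>us v w ws. \<beta> (us @ (v + w) # ws) = \<beta> (us @ v # ws) + \<beta> (us @ w # ws)) \<and>
     (\<forall>us t v ws. \<beta> (us @ (t *\<^sub>R v) # ws) = t * \<beta> (us @ v # ws)) \<and>
     (\<forall>vs. \<not> distinct vs \<longrightarrow> \<beta> vs = 0)"

context
  fixes \<beta> :: "(real^'r::{finite,linorder}) list \<Rightarrow> real"
  assumes alt: "alternating \<beta>"
begin

lemma alternating_add: "\<beta> (us @ (v + w) # ws) = \<beta> (us @ v # ws) + \<beta> (us @ w # ws)"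
  and alternating_scale: "\<beta> (us @ (t *\<^sub>R v) # ws) = t * \<beta> (us @ v # ws)"
  and alternating_repeat: "\<not> distinct vs \<Longrightarrow> \<beta> vs = 0"
  using alt unfolding alternating_def by blast+

lemma alternating_sum: "\<beta> (us @ (\<Sum>i\<in>I. f i) # ws) = (\<Sum>i\<in>I. \<beta> (us @ f i # ws))"
proof (induction I rule: infinite_finite_induct)
  case empty
  show ?case using alternating_scale[of us 0 0 ws] by simp
next
  case (infinite I)
  then show ?case using alternating_scale[of us 0 0 ws] by simp
qed (simp add: alternating_add)

lemma alternating_swap: "\<beta> (us @ v # w # ws) = - \<beta> (us @ w # v # ws)"
proof -
  have z: "\<beta> (us @ u # u # ws) = 0" for u by (rule alternating_repeat) simp
  have "\<beta> (us @ (v + w) # (v + w) # ws) =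
      \<beta> (us @ v # v # ws) + \<beta> (us @ v # w # ws) + (\<beta> (us @ w # v # ws) + \<beta> (us @ w # w # ws))"
    using alternating_add[of "us @ [v]" v w ws] alternating_add[of "us @ [w]" v w ws]
    by (simp add: alternating_add[of us v w "(v + w) # ws"])
  then show ?thesis by (simp add: z)
qed

text \<open>By multilinearity the matrix \<open>g\<close> moves, slot by slot, from the vectors to
  the algebra elements. The prefix \<open>us\<close> holds the arguments in front of the slots under
  consideration.\<close>

lemma sum_lists_change_frame:
  fixes \<theta> \<theta>' :: "'r \<Rightarrow> 'a::real_algebra_1"
  assumes v: "\<And>b. v b = (\<Sum>a\<in>UNIV. g a b *\<^sub>R e a)" and \<theta>': "\<And>a. \<theta>' a = (\<Sum>b\<in>UNIV. g a b *\<^sub>R \<theta> b)"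
  shows "(\<Sum>bs | length bs = k. \<beta> (us @ map v bs) *\<^sub>R prod_list (map \<theta> bs)) =
    (\<Sum>as | length as = k. \<beta> (us @ map e as) *\<^sub>R prod_list (map \<theta>' as))"
proof (induction k arbitrary: us)
  case 0
  then show ?case by simp
next
  case (Suc k)
  have split: "(\<Sum>bs | length bs = Suc k. F bs) = (\<Sum>b\<in>UNIV. \<Sum>bs | length bs = k. F (b # bs))"
    for F :: "'r list \<Rightarrow> 'a"
  proof -
    have "(\<Sum>b\<in>UNIV. \<Sum>bs | length bs = k. F (b # bs)) = (\<Sum>(b, bs)\<in>UNIV \<times> {bs. length bs = k}. F (b # bs))"
      by (simp add: sum.cartesian_product finite_lists_of_length)
    also have "\<dots> = (\<Sum>bs | length bs = Suc k. F bs)"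
      by (rule sum.reindex_bij_witness[of _ "\<lambda>bs. (hd bs, tl bs)" "\<lambda>(b, bs). b # bs"]) (auto simp: length_Suc_conv)
    finally show ?thesis by simp
  qed
  have "(\<Sum>bs | length bs = Suc k. \<beta> (us @ map v bs) *\<^sub>R prod_list (map \<theta> bs)) =
      (\<Sum>b\<in>UNIV. \<theta> b * (\<Sum>bs | length bs = k. \<beta> ((us @ [v b]) @ map v bs) *\<^sub>R prod_list (map \<theta> bs)))"
    unfolding split by (simp add: sum_distrib_left)
  also have "\<dots> = (\<Sum>b\<in>UNIV. \<Sum>as | length as = k. \<Sum>a\<in>UNIV. (g a b * \<beta> (us @ e a # map e as)) *\<^sub>R (\<theta> b * prod_list (map \<theta>' as)))"
    unfolding Suc by (simp add: v alternating_sum alternating_scale sum_distrib_left scaleR_sum_left)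
  also have "\<dots> = (\<Sum>as | length as = k. \<Sum>a\<in>UNIV. \<Sum>b\<in>UNIV. (g a b * \<beta> (us @ e a # map e as)) *\<^sub>R (\<theta> b * prod_list (map \<theta>' as)))"
    by (subst sum.swap) (intro sum.cong refl sum.swap)
  also have "\<dots> = (\<Sum>as | length as = k. \<Sum>a\<in>UNIV. \<beta> (us @ e a # map e as) *\<^sub>R (\<theta>' a * prod_list (map \<theta>' as)))"
    unfolding \<theta>' by (simp add: sum_distrib_right scaleR_sum_right mult.commute)
  also have "\<dots> = (\<Sum>as | length as = Suc k. \<beta> (us @ map e as) *\<^sub>R prod_list (map \<theta>' as))"
    unfolding split by (subst sum.swap) simp
  finally show ?case .
qed

text \<open>A swap of neighbours changes the sign of \<open>\<beta>\<close> and also that of the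
  product, so the summand is invariant.\<close>

lemma sum_lists_sorted:
  fixes \<theta> :: "'r \<Rightarrow> 'a::real_algebra_1"
  assumes "\<And>a b. \<theta> a * \<theta> b = - (\<theta> b * \<theta> a)"
  shows "(\<Sum>bs | length bs = k. \<beta> (map v bs) *\<^sub>R prod_list (map \<theta> bs)) =
    fact k *\<^sub>R (\<Sum>I | card I = k. \<beta> (map v (sorted_list_of_set I)) *\<^sub>R oprod \<theta> I)"
proof -
  have "\<beta> (map v (xs @ a # b # ys)) *\<^sub>R prod_list (map \<theta> (xs @ a # b # ys)) =
      \<beta> (map v (xs @ b # a # ys)) *\<^sub>R prod_list (map \<theta> (xs @ b # a # ys))" for xs a b ys
  proof -
    have "\<theta> a * (\<theta> b * p) = - (\<theta> b * (\<theta> a * p))" for p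
      using assms[of a b] by (simp add: mult.assoc[symmetric])
    then show ?thesis
      using alternating_swap[of "map v xs" "v a" "v b" "map v ys"] by simp
  qed
  moreover have "\<beta> (map v xs) *\<^sub>R prod_list (map \<theta> xs) = 0" if "\<not> distinct xs" for xs
    using that alternating_repeat[of "map v xs"] by (simp add: distinct_map)
  ultimately show ?thesis
    unfolding oprod_def by (rule sum_swap_invariant)
qed

text \<open>Summing over all index lists instead of the increasing ones makes the invariance under a change
  of frame evident, at the cost of a factor \<open>k!\<close> in degree \<open>k\<close>.\<close>

lemma sum_sets_change_frame:
  fixes \<theta> \<theta>' :: "'r \<Rightarrow> 'a::real_algebra_1"
  assumes v: "\<And>b. v b = (\<Sum>a\<in>UNIV. g a b *\<^sub>R e a)" and \<theta>': "\<And>a. \<theta>' a = (\<Sum>b\<in>UNIV. g a b *\<^sub>R \<theta> b)"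
    and anti: "\<And>a b. \<theta> a * \<theta> b = - (\<theta> b * \<theta> a)" "\<And>a b. \<theta>' a * \<theta>' b = - (\<theta>' b * \<theta>' a)"
  shows "(\<Sum>I\<in>UNIV. \<beta> (map v (sorted_list_of_set I)) *\<^sub>R oprod \<theta> I) =
    (\<Sum>I\<in>UNIV. \<beta> (map e (sorted_list_of_set I)) *\<^sub>R oprod \<theta>' I)"
proof -
  have k: "(\<Sum>I | card I = k. \<beta> (map v (sorted_list_of_set I)) *\<^sub>R oprod \<theta> I) =
      (\<Sum>I | card I = k. \<beta> (map e (sorted_list_of_set I)) *\<^sub>R oprod \<theta>' I)" for k
    using sum_lists_change_frame[of v g e \<theta>' \<theta> "[]" k, OF v \<theta>']
      sum_lists_sorted[of \<theta> v k, OF anti(1)] sum_lists_sorted[of \<theta>' e k, OF anti(2)] by simp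
  have split: "sum F UNIV = (\<Sum>k\<le>CARD('r). \<Sum>I | card I = k. F I)" for F :: "'r set \<Rightarrow> 'a"
  proof -
    have "(\<Sum>k\<le>CARD('r). \<Sum>I | I \<in> UNIV \<and> card I = k. F I) = sum F UNIV"
      by (rule sum.group) (auto intro: card_mono)
    then show ?thesis by simp
  qed
  show ?thesis unfolding split k ..
qed

end

lemma ext_fun_alternating:
  fixes E :: "('m::topological_space, 'v, 'r::finite) vbundle"
  assumes \<omega>: "\<omega> \<in> ext_fun M E W" and t: "trivialisation E U \<psi>" and x: "x \<in> W" "x \<in> U"
  shows "alternating (\<lambda>vs. \<omega> x (map (\<psi> x) vs))"
proof -
  have ml: "\<forall>us ws. set us \<subseteq> fibre E x \<and> set ws \<subseteq> fibre E x \<longrightarrow>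
        (\<forall>v\<in>fibre E x.
          (\<forall>v'\<in>fibre E x. \<omega> x (us @ vadd E x v v' # ws) = \<omega> x (us @ v # ws) + \<omega> x (us @ v' # ws)) \<and>
          (\<forall>t. \<omega> x (us @ vscale E x t v # ws) = t * \<omega> x (us @ v # ws)))"
    and rep: "\<forall>vs. set vs \<subseteq> fibre E x \<and> \<not> distinct vs \<longrightarrow> \<omega> x vs = 0"
    using \<omega> x(1) unfolding ext_fun_def by blast+
  have f: "set (map (\<psi> x) us) \<subseteq> fibre E x" for us using triv_fibre[OF t x(2)] by auto
  show ?thesis
    unfolding alternating_def
  proof (intro conjI allI impI)
    fix us v w ws and s :: real
    note ml' = ml[rule_format, OF conjI[OF f[of us] f[of ws]], OF triv_fibre[OF t x(2), of v]]
    show "\<omega> x (map (\<psi> x) (us @ (v + w) # ws)) = \<omega> x (map (\<psi> x) (us @ v # ws)) + \<omega> x (map (\<psi> x) (us @ w # ws))"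
      using conjunct1[OF ml'] triv_fibre[OF t x(2), of w] by (simp add: triv_add[OF t x(2)])
    show "\<omega> x (map (\<psi> x) (us @ (s *\<^sub>R v) # ws)) = s * \<omega> x (map (\<psi> x) (us @ v # ws))"
      using conjunct2[OF ml'] by (simp add: triv_scale[OF t x(2)])
  next
    fix vs :: "(real^'r) list" assume "\<not> distinct vs"
    then show "\<omega> x (map (\<psi> x) vs) = 0"
      using rep f[of vs] by (auto simp: distinct_map)
  qed
qed

text \<open>The vectors of a frame and its fibre coordinates change contragrediently, so the
  expansion of a form does not depend on the frame.\<close>

lemma ext_fun_change_frame:
  fixes \<theta> \<theta>' :: "'r::{finite,linorder} \<Rightarrow> 'a::real_algebra_1"
  assumes \<omega>: "\<omega> \<in> ext_fun M E W" and t: "trivialisation E U \<psi>" "trivialisation E U' \<psi>'" and x: "x \<in> W" "x \<in> U" "x \<in> U'"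
    and \<theta>': "\<And>a. \<theta>' a = (\<Sum>b\<in>UNIV. trans_mat \<psi> \<psi>' x a b *\<^sub>R \<theta> b)"
    and anti: "\<And>a b. \<theta> a * \<theta> b = - (\<theta> b * \<theta> a)" "\<And>a b. \<theta>' a * \<theta>' b = - (\<theta>' b * \<theta>' a)"
  shows "(\<Sum>I\<in>UNIV. \<omega> x (map (\<lambda>a. \<psi> x (axis a 1)) (sorted_list_of_set I)) *\<^sub>R oprod \<theta> I) =
    (\<Sum>I\<in>UNIV. \<omega> x (map (\<lambda>a. \<psi>' x (axis a 1)) (sorted_list_of_set I)) *\<^sub>R oprod \<theta>' I)"
proof -
  let ?\<beta> = "\<lambda>vs. \<omega> x (map (\<psi>' x) vs)"
  have alt: "alternating ?\<beta>" by (rule ext_fun_alternating[OF \<omega> t(2) x(1,3)])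
  define v where "v b = inv (\<psi>' x) (\<psi> x (axis b 1))" for b
  have "v b = (\<Sum>a\<in>UNIV. trans_mat \<psi> \<psi>' x a b *\<^sub>R axis a 1)" for b
    by (subst vec_axis_sum[of "v b"]) (simp add: v_def trans_mat_def)
  note * = sum_sets_change_frame[OF alt this \<theta>' anti]
  have "\<psi>' x (v b) = \<psi> x (axis b 1)" for b
    using t x by (simp add: v_def triv_inv_right triv_fibre)
  then show ?thesis using * by (simp add: o_def)
qed

lemma oprod_G:
  "oprod (\<lambda>a. G (CU a)) S = (mon (one_mono\<lparr>mU := S\<rparr>) :: ('n::{finite,linorder}, 'r::{finite,linorder}) sp)"
  "oprod (\<lambda>a. G (CPU a)) S = (mon (one_mono\<lparr>mPU := S\<rparr>) :: ('n::{finite,linorder}, 'r::{finite,linorder}) sp)"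
proof -
  have pl: "prod_list (map (\<lambda>i. 1) xs) = (1 :: ('n, 'r) sp)" for xs :: "'n list"
    by (induction xs) auto
  show "oprod (\<lambda>a. G (CU a)) S = (mon (one_mono\<lparr>mU := S\<rparr>) :: ('n, 'r) sp)"
    using evalm_G[of "one_mono\<lparr>mU := S\<rparr> :: ('n, 'r) smono"] unfolding evalm_eq by (simp add: pl)
  show "oprod (\<lambda>a. G (CPU a)) S = (mon (one_mono\<lparr>mPU := S\<rparr>) :: ('n, 'r) sp)"
    using evalm_G[of "one_mono\<lparr>mPU := S\<rparr> :: ('n, 'r) smono"] unfolding evalm_eq by (simp add: pl)
qed

lemma evalp_oprod:
  assumes T: "deg_hom T"
  shows "evalp T (oprod (\<lambda>a. G (CU a)) S) = oprod (\<lambda>a. T (CU a)) S"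
    "evalp T (oprod (\<lambda>a. G (CPU a)) S) = oprod (\<lambda>a. T (CPU a)) S"
  unfolding oprod_def
  by (subst evalp_prod_list[OF T]; auto simp: fins_G evalp_gen o_def)+

lemma deg_hom_anticommute:
  assumes "deg_hom T"
  shows "T (CU a) * T (CU b) = - (T (CU b) * T (CU a))" "T (CPU a) * T (CPU b) = - (T (CPU b) * T (CPU a))"
  using assms graded_parity[of 1] unfolding deg_hom_def by (auto intro: odd_anticommute)

section \<open>The two projections in coordinates and their composites with the transform\<close>

context jet_setting
begin

text \<open>The two projections are treated together: \<open>Z\<close> is the family of odd coordinates which is pulled
  back and \<open>K c\<close> the frame dual to it.\<close>

lemma ext_pull_in_jet_fun:
  fixes K :: "('m, 'n, 'r, 'v, 'w) achart \<Rightarrow> 'm \<Rightarrow> (real, 'r) vec \<Rightarrow> 'e" and Z :: "'r \<Rightarrow> ('n, 'r) coord"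
  assumes \<omega>: "\<omega> \<in> ext_fun M E W" and W: "open W"
    and Z: "Z = CU \<or> Z = CPU"
    and K: "\<And>c. adapted M A L c \<Longrightarrow> local_triv M E (cdom c) (K c)"
    and JC: "\<And>c c' x a. adapted M A L c \<Longrightarrow> adapted M A L c' \<Longrightarrow> x \<in> cdom c \<Longrightarrow> x \<in> cdom c' \<Longrightarrow>
      JC c c' x (Z a) = (\<Sum>b\<in>UNIV. trans_mat (K c) (K c') x a b *\<^sub>R G (Z b))"
    and s: "\<And>c x. adapted M A L c \<Longrightarrow> x \<in> W \<inter> cdom c \<Longrightarrow>
      Sp (s c x) = (\<Sum>I\<in>UNIV. \<omega> x (map (\<lambda>a. K c x (axis a 1)) (sorted_list_of_set I)) *\<^sub>R oprod (\<lambda>a. G (Z a)) I)"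
    and s0: "\<And>c x. \<not> (adapted M A L c \<and> x \<in> W \<inter> cdom c) \<Longrightarrow> s c x = (\<lambda>_. 0)"
  shows "s \<in> jet_fun M A L W"
proof (rule jet_funI[where k = "CARD('r)"])
  have ev: "evalp T (oprod (\<lambda>a. G (Z a)) I) = oprod (\<lambda>a. T (Z a)) I" if "deg_hom T" for T and I :: "'r set"
    using Z evalp_oprod[OF that, of I] by auto
  have anti: "T (Z a) * T (Z b) = - (T (Z b) * T (Z a))" if "deg_hom T" for T and a b :: 'r
    using Z deg_hom_anticommute[OF that, of a b] by auto
  show "open W" by (rule W)
  show "\<And>c x. \<not> (adapted M A L c \<and> x \<in> W \<inter> cdom c) \<Longrightarrow> s c x = (\<lambda>_. 0)" by (rule s0)
  show "smooth_sp M (W \<inter> cdom c) (\<lambda>x. Sp (s c x))" if c: "adapted M A L c" for c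
  proof -
    have o: "open (W \<inter> cdom c)" using W adaptedD(6)[OF c] by auto
    have "smooth_fun M (W \<inter> cdom c) (\<lambda>x. \<omega> x (map (\<lambda>a. K c x (axis a 1)) as))" for as
      using \<omega> K[OF c] unfolding ext_fun_def by blast
    then have "smooth_sp M (W \<inter> cdom c) (\<lambda>x. \<Sum>I\<in>UNIV. \<omega> x (map (\<lambda>a. K c x (axis a 1)) (sorted_list_of_set I)) *\<^sub>R oprod (\<lambda>a. G (Z a)) I)"
      by (intro smooth_sp_sum[OF M o] smooth_sp_scaleR[OF M o] smooth_sp_const[OF M o])
    then show ?thesis by (rule smooth_sp_cong[OF M o]) (simp add: s[OF c])
  qed
  show "mono_degree m \<le> CARD('r)" if c: "adapted M A L c" and x: "x \<in> W \<inter> cdom c" and nz: "s c x m \<noteq> 0" for c x m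
  proof -
    have "coef (Sp (s c x)) m \<noteq> 0" using nz by simp
    then obtain I where "coef (oprod (\<lambda>a. G (Z a)) I) m \<noteq> 0"
      unfolding s[OF c x] coef_sum by (auto elim!: sum.not_neutral_contains_not_neutral)
    then have "m = one_mono\<lparr>mU := I\<rparr> \<or> m = one_mono\<lparr>mPU := I\<rparr>"
      using Z by (auto simp: oprod_G coef_mon split: if_splits)
    then have "mono_degree m = card I" by (auto simp: mono_degree_def)
    then show ?thesis by (simp add: card_mono)
  qed
  show "Sp (s c x) = evalp (JC c c' x) (Sp (s c' x))"
    if c: "adapted M A L c" and c': "adapted M A L c'" and x: "x \<in> W \<inter> cdom c \<inter> cdom c'" for c c' x
  proof -
    have x': "x \<in> W" "x \<in> cdom c" "x \<in> cdom c'" using x by auto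
    have fin: "fins (oprod (\<lambda>a. G (Z a)) I)" for I using Z by (auto simp: oprod_G)
    have "Sp (s c x) = (\<Sum>I\<in>UNIV. \<omega> x (map (\<lambda>a. K c' x (axis a 1)) (sorted_list_of_set I)) *\<^sub>R oprod (\<lambda>a. JC c c' x (Z a)) I)"
      unfolding s[OF c IntI[OF x'(1,2)]]
      by (rule ext_fun_change_frame[OF \<omega> local_triv_triv[OF K[OF c]] local_triv_triv[OF K[OF c']] x'])
        (rule JC[OF c c' x'(2,3)] anti[OF deg_hom_G] anti[OF deg_hom_JC])+
    also have "\<dots> = evalp (JC c c' x) (Sp (s c' x))"
      unfolding s[OF c' IntI[OF x'(1,3)]] by (simp add: evalp_sum fins_scaleR fin evalp_scaleR ev[OF deg_hom_JC])
    finally show ?thesis .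
  qed
qed

lemma Sp_pi_proj:
  assumes \<omega>: "\<omega> \<in> ext_fun M A W" and c: "adapted M A L c" and x: "x \<in> W \<inter> cdom c"
  shows "Sp (pull (pi_proj M A L) W \<omega> c x) =
    (\<Sum>I\<in>UNIV. \<omega> x (map (\<lambda>a. afr c x (axis a 1)) (sorted_list_of_set I)) *\<^sub>R oprod (\<lambda>a. G (CU a)) I)"
proof (rule sp_eqI)
  fix m :: "('n, 'r) smono"
  have "m = one_mono\<lparr>mU := I\<rparr> \<longleftrightarrow> I = mU m \<and> m = one_mono\<lparr>mU := mU m\<rparr>" for I
    by (cases m) (auto simp: one_mono_def)
  then show "coef (Sp (pull (pi_proj M A L) W \<omega> c x)) m =
    coef (\<Sum>I\<in>UNIV. \<omega> x (map (\<lambda>a. afr c x (axis a 1)) (sorted_list_of_set I)) *\<^sub>R oprod (\<lambda>a. G (CU a)) I) m"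
    using \<omega> c x
    by (cases "m = one_mono\<lparr>mU := mU m\<rparr>")
      (simp_all add: pi_proj_def oprod_G coef_mon if_distrib[of "\<lambda>r. _ * r"] cong: if_cong)
qed

lemma Sp_tau_proj:
  assumes \<omega>: "\<omega> \<in> ext_fun M (dagger A L) W" and c: "adapted M A L c" and x: "x \<in> W \<inter> cdom c"
  shows "Sp (pull (tau_proj M A L) W \<omega> c x) =
    (\<Sum>I\<in>UNIV. \<omega> x (map (\<lambda>a. dual_triv A (afr c) (lfr c) x (axis a 1)) (sorted_list_of_set I)) *\<^sub>R oprod (\<lambda>a. G (CPU a)) I)"
proof (rule sp_eqI)
  fix m :: "('n, 'r) smono"
  have "m = one_mono\<lparr>mPU := I\<rparr> \<longleftrightarrow> I = mPU m \<and> m = one_mono\<lparr>mPU := mPU m\<rparr>" for I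
    by (cases m) (auto simp: one_mono_def)
  then show "coef (Sp (pull (tau_proj M A L) W \<omega> c x)) m =
    coef (\<Sum>I\<in>UNIV. \<omega> x (map (\<lambda>a. dual_triv A (afr c) (lfr c) x (axis a 1)) (sorted_list_of_set I)) *\<^sub>R oprod (\<lambda>a. G (CPU a)) I) m"
    using \<omega> c x
    by (cases "m = one_mono\<lparr>mPU := mPU m\<rparr>")
      (simp_all add: tau_proj_def oprod_G coef_mon if_distrib[of "\<lambda>r. _ * r"] cong: if_cong)
qed

lemma ext_fun_open: "\<omega> \<in> ext_fun M E W \<Longrightarrow> open W"
  by (simp add: ext_fun_def)

lemma pi_proj_in_jet_fun:
  assumes \<omega>: "\<omega> \<in> ext_fun M A W"
  shows "pull (pi_proj M A L) W \<omega> \<in> jet_fun M A L W"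
proof (rule ext_pull_in_jet_fun[OF \<omega> ext_fun_open[OF \<omega>], where Z = CU and K = afr])
  show "pull (pi_proj M A L) W \<omega> c x = (\<lambda>_. 0)" if "\<not> (adapted M A L c \<and> x \<in> W \<inter> cdom c)" for c x
    using \<omega> that by (auto simp: pi_proj_def)
qed (simp_all add: Sp_pi_proj[OF \<omega>] JC_simps gg_def adaptedD(2))

lemma tau_proj_in_jet_fun:
  assumes \<omega>: "\<omega> \<in> ext_fun M (dagger A L) W"
  shows "pull (tau_proj M A L) W \<omega> \<in> jet_fun M A L W"
proof (rule ext_pull_in_jet_fun[OF \<omega> ext_fun_open[OF \<omega>], where Z = CPU and K = "\<lambda>c. dual_triv A (afr c) (lfr c)"])
  show "local_triv M (dagger A L) (cdom c) (dual_triv A (afr c) (lfr c))" if "adapted M A L c" for c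
    using local_triv_dual[OF M A L adaptedD(2,3)[OF that]] by simp
  show "JC c c' x (CPU a) = (\<Sum>b\<in>UNIV. trans_mat (dual_triv A (afr c) (lfr c)) (dual_triv A (afr c') (lfr c')) x a b *\<^sub>R G (CPU b))"
    if "adapted M A L c" "adapted M A L c'" "x \<in> cdom c" "x \<in> cdom c'" for c c' x a
    using trans_mat_dual[OF adaptedD(4,5)[OF that(1)] adaptedD(4,5)[OF that(2)] that(3,3,4,4)]
    by (simp add: JC_simps ll_def gg_def)
  show "pull (tau_proj M A L) W \<omega> c x = (\<lambda>_. 0)" if "\<not> (adapted M A L c \<and> x \<in> W \<inter> cdom c)" for c x
    using \<omega> that by (auto simp: tau_proj_def)
qed (simp_all add: Sp_tau_proj[OF \<omega>])

lemma bidual_iso_in_ext_fun: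
  assumes \<omega>: "\<omega> \<in> ext_fun M A W"
  shows "pull (bidual_iso M A L) W \<omega> \<in> ext_fun M (dagger (dagger A L) L) W"
proof -
  let ?C = "dagger (dagger A L) L"
  let ?e = "\<lambda>x. ev_inv A L x"
  let ?\<omega>' = "pull (bidual_iso M A L) W \<omega>"
  have \<omega>': "?\<omega>' x \<xi>s = (if set \<xi>s \<subseteq> fibre ?C x then \<omega> x (map (?e x) \<xi>s) else 0)" for x \<xi>s
    using \<omega> by (simp add: bidual_iso_def)
  have W: "open W" using \<omega> by (rule ext_fun_open)
  have zero: "\<omega> x vs = 0" if "x \<notin> W" for x vs
    using \<omega> that unfolding ext_fun_def by blast
  have ml: "\<omega> x (us @ vadd A x v v' # ws) = \<omega> x (us @ v # ws) + \<omega> x (us @ v' # ws)"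
    "\<omega> x (us @ vscale A x t v # ws) = t * \<omega> x (us @ v # ws)"
    if "x \<in> W" "set us \<subseteq> fibre A x" "set ws \<subseteq> fibre A x" "v \<in> fibre A x" "v' \<in> fibre A x" for x us ws v v' t
    using \<omega> that unfolding ext_fun_def by blast+
  have rep: "\<omega> x vs = 0" if "x \<in> W" "set vs \<subseteq> fibre A x" "\<not> distinct vs" for x vs
    using \<omega> that unfolding ext_fun_def by blast
  \<comment> \<open>Linearity is read off in coordinates: \<open>ev_inv\<close> takes the double
    dual frame to the frame of \<open>A\<close> with unchanged coordinates.\<close>
  have lin: "?e x v \<in> fibre A x \<and> vadd ?C x v v' \<in> fibre ?C x \<and> vscale ?C x t v \<in> fibre ?C x \<and>
      ?e x (vadd ?C x v v') = vadd A x (?e x v) (?e x v') \<and> ?e x (vscale ?C x t v) = vscale A x t (?e x v)"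
    if v: "v \<in> fibre ?C x" "v' \<in> fibre ?C x" for x v v' t
  proof -
    obtain c where c: "adapted M A L c" "x \<in> cdom c" by (rule adapted_exists)
    note tA = adaptedD(4)[OF c(1)] and tL = adaptedD(5)[OF c(1)]
    let ?dd = "dual_triv (dagger A L) (dual_triv A (afr c) (lfr c)) (lfr c)"
    have tdd: "trivialisation ?C (cdom c) ?dd"
      using dual_trivialisation[OF dual_trivialisation[OF tA tL] tL] by simp
    obtain p p' where p: "v = ?dd x p" "v' = ?dd x p'"
      using triv_inv_right[OF tdd c(2) v(1)] triv_inv_right[OF tdd c(2) v(2)] by metis
    have e: "?e x (?dd x q) = afr c x q" for q by (rule ev_inv_frame[OF tA tL c(2,2)])
    show ?thesis
      unfolding p triv_add[OF tdd c(2), symmetric] triv_scale[OF tdd c(2), symmetric] e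
      using triv_add[OF tA c(2)] triv_scale[OF tA c(2)] triv_fibre[OF tA c(2)] triv_fibre[OF tdd c(2)] by simp
  qed
  have ef: "set (map (?e x) \<xi>s) \<subseteq> fibre A x" if "set \<xi>s \<subseteq> fibre ?C x" for x \<xi>s
    using that lin by auto
  show ?thesis
    unfolding ext_fun_def
  proof (intro CollectI conjI allI impI ballI)
    show "open W" by (rule W)
    show "?\<omega>' x vs = 0" if "\<not> (x \<in> W \<and> set vs \<subseteq> fibre ?C x)" for x vs
      using that zero by (auto simp: \<omega>')
    show "?\<omega>' x vs = 0" if "x \<in> W" "set vs \<subseteq> fibre ?C x \<and> \<not> distinct vs" for x vs
      using that rep[of x "map (?e x) vs"] ef[of vs x] by (auto simp: \<omega>' distinct_map)
  next
    fix x us ws v v' assume x: "x \<in> W" and uw: "set us \<subseteq> fibre ?C x \<and> set ws \<subseteq> fibre ?C x"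
      and v: "v \<in> fibre ?C x" and v': "v' \<in> fibre ?C x"
    show "?\<omega>' x (us @ vadd ?C x v v' # ws) = ?\<omega>' x (us @ v # ws) + ?\<omega>' x (us @ v' # ws)"
      using uw v v' lin[OF v v'] lin[OF v' v] ml(1)[OF x ef[of us x] ef[of ws x], of "?e x v" "?e x v'"]
      by (simp add: \<omega>')
  next
    fix x us ws v t assume x: "x \<in> W" and uw: "set us \<subseteq> fibre ?C x \<and> set ws \<subseteq> fibre ?C x"
      and v: "v \<in> fibre ?C x"
    show "?\<omega>' x (us @ vscale ?C x t v # ws) = t * ?\<omega>' x (us @ v # ws)"
      using uw v lin[OF v v] ml(2)[OF x ef[of us x] ef[of ws x], of "?e x v" "?e x v"]
      by (simp add: \<omega>')
  next
    fix U \<zeta> as assume \<zeta>: "local_triv M ?C U \<zeta>"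
    have o: "open (W \<inter> U)" using W triv_open[OF local_triv_triv[OF \<zeta>]] by auto
    have "smooth_fun M (W \<inter> U) (\<lambda>x. \<omega> x (map (\<lambda>a. ?e x (\<zeta> x (axis a 1))) as))"
      using \<omega> local_triv_ev_inv[OF M A L \<zeta>] unfolding ext_fun_def by blast
    then show "smooth_fun M (W \<inter> U) (\<lambda>x. ?\<omega>' x (map (\<lambda>a. \<zeta> x (axis a 1)) as))"
    proof (rule smooth_fun_cong[OF M o])
      fix x assume x: "x \<in> W \<inter> U"
      have "set (map (\<lambda>a. \<zeta> x (axis a 1)) as) \<subseteq> fibre ?C x"
        using triv_fibre[OF local_triv_triv[OF \<zeta>]] x by auto
      then show "\<omega> x (map (\<lambda>a. ?e x (\<zeta> x (axis a 1))) as) = ?\<omega>' x (map (\<lambda>a. \<zeta> x (axis a 1)) as)"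
        by (simp add: \<omega>' o_def)
    qed
  qed
qed

lemma tau_tilde_pull:
  assumes "\<omega> \<in> ext_fun M A W"
  shows "pull (tau_tilde M A L) W \<omega> = pull (tau_proj M (dagger A L) L) W (pull (bidual_iso M A L) W \<omega>)"
  using assms by (simp add: tau_tilde_def ncomp_def bidual_iso_def)

lemma tau_tilde_in_jet_fun:
  assumes "\<omega> \<in> ext_fun M A W"
  shows "pull (tau_tilde M A L) W \<omega> \<in> jet_fun M (dagger A L) L W"
  unfolding tau_tilde_pull[OF assms]
  by (rule jet_setting.tau_proj_in_jet_fun[OF dual_setting bidual_iso_in_ext_fun[OF assms]])

text \<open>In a dual chart the projection evaluates the form on the double dual frame, which the
  inverse of evaluation carries to the frame of \<open>c\<close>. Hence the fibre coordinates of
  \<open>A[1]\<close> pull back to the p_a of the dual chart.\<close>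

lemma Sp_tau_tilde:
  assumes \<omega>: "\<omega> \<in> ext_fun M A W" and c: "adapted M A L c" and x: "x \<in> W \<inter> cdom c"
  shows "Sp (pull (tau_tilde M A L) W \<omega> (dual_chart A c) x) =
    (\<Sum>I\<in>UNIV. \<omega> x (map (\<lambda>a. afr c x (axis a 1)) (sorted_list_of_set I)) *\<^sub>R oprod (\<lambda>a. G (CPU a)) I)"
proof -
  interpret B: jet_setting M "dagger A L" L by (rule dual_setting)
  have xc: "x \<in> cdom c" using x by simp
  note tA = adaptedD(4)[OF c] and tL = adaptedD(5)[OF c]
  let ?dd = "dual_triv (dagger A L) (dual_triv A (afr c) (lfr c)) (lfr c)"
  have f: "set (map (\<lambda>a. ?dd x (axis a 1)) as) \<subseteq> fibre (dagger (dagger A L) L) x" for as :: "'r list"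
    using dual_triv_fibre[OF dual_trivialisation[OF tA tL] tL, of x] xc by auto
  have e: "ev_inv A L x (?dd x q) = afr c x q" for q by (rule ev_inv_frame[OF tA tL xc xc])
  have "pull (bidual_iso M A L) W \<omega> x (map (\<lambda>a. ?dd x (axis a 1)) as) = \<omega> x (map (\<lambda>a. afr c x (axis a 1)) as)" for as
    using \<omega> f[of as] by (simp add: bidual_iso_def o_def e)
  then show ?thesis
    unfolding tau_tilde_pull[OF \<omega>]
    using B.Sp_tau_proj[OF bidual_iso_in_ext_fun[OF \<omega>] adapted_dual_chart[OF c], of x] x
    by (simp add: dual_chart_def)
qed

lemma fins_oprod_G: "fins (oprod (\<lambda>a. G (CU a)) I :: ('n, 'r) sp)" "fins (oprod (\<lambda>a. G (CPU a)) I :: ('n, 'r) sp)"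
  by (simp_all add: oprod_G)

lemma F0_tau_tilde: "ncomp (ext_fun M A) (tau_tilde M A L) F0 = pi_proj M A L"
proof -
  have b: "base (tau_tilde M A L) = id" by (simp add: tau_tilde_def ncomp_def bidual_iso_def tau_proj_def)
  have "pull F0 W (pull (tau_tilde M A L) W \<omega>) = pull (pi_proj M A L) W \<omega>" if \<omega>: "\<omega> \<in> ext_fun M A W" for W \<omega>
  proof (rule leg_transport.pull_eqI[OF leg_transport_dual, of W])
    note t = tau_tilde_in_jet_fun[OF \<omega>]
    fix c x
    show "Sp (pull F0 W (pull (tau_tilde M A L) W \<omega>) c x) = Sp (pull (pi_proj M A L) W \<omega> c x)"
      if c: "adapted M A L c" and x: "x \<in> W" "x \<in> cdom c"
      unfolding leg_mor_pull(1)[OF t c x] Sp_tau_tilde[OF \<omega> c IntI[OF x]] Sp_pi_proj[OF \<omega> c IntI[OF x]]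
      by (simp add: evalp_sum fins_scaleR fins_oprod_G evalp_scaleR evalp_oprod[OF deg_hom_leg] leg_simps)
    show "pull F0 W (pull (tau_tilde M A L) W \<omega>) c x = pull (pi_proj M A L) W \<omega> c x"
      if "\<not> (adapted M A L c \<and> x \<in> W \<inter> cdom c)"
      using leg_mor_pull(2)[OF t that] jet_funD(2)[OF pi_proj_in_jet_fun[OF \<omega>] that] by simp
  qed
  then show ?thesis
    by (simp add: ncomp_def b pi_proj_def fun_eq_iff restrict_def)
qed

lemma F0_pi_proj: "ncomp (ext_fun M (dagger A L)) (pi_proj M (dagger A L) L) F0 = tau_proj M A L"
proof -
  interpret B: jet_setting M "dagger A L" L by (rule dual_setting)
  have b: "base (pi_proj M (dagger A L) L) = id" by (simp add: pi_proj_def)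
  have "pull F0 W (pull (pi_proj M (dagger A L) L) W \<omega>) = pull (tau_proj M A L) W \<omega>"
    if \<omega>: "\<omega> \<in> ext_fun M (dagger A L) W" for W \<omega>
  proof (rule leg_transport.pull_eqI[OF leg_transport_dual, of W])
    note t = B.pi_proj_in_jet_fun[OF \<omega>]
    fix c x
    show "Sp (pull F0 W (pull (pi_proj M (dagger A L) L) W \<omega>) c x) = Sp (pull (tau_proj M A L) W \<omega> c x)"
      if c: "adapted M A L c" and x: "x \<in> W" "x \<in> cdom c"
      unfolding leg_mor_pull(1)[OF t c x] Sp_tau_proj[OF \<omega> c IntI[OF x]]
      using B.Sp_pi_proj[OF \<omega> adapted_dual_chart[OF c], of x] x
      by (simp add: dual_chart_def evalp_sum fins_scaleR fins_oprod_G evalp_scaleR evalp_oprod[OF deg_hom_leg] leg_simps)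
    show "pull F0 W (pull (pi_proj M (dagger A L) L) W \<omega>) c x = pull (tau_proj M A L) W \<omega> c x"
      if "\<not> (adapted M A L c \<and> x \<in> W \<inter> cdom c)"
      using leg_mor_pull(2)[OF t that] jet_funD(2)[OF tau_proj_in_jet_fun[OF \<omega>] that] by simp
  qed
  then show ?thesis
    by (simp add: ncomp_def b tau_proj_def fun_eq_iff restrict_def)
qed

lemma contact_legendre_F0: "contact_legendre M A L F0"
  unfolding contact_legendre_def swaps_bidegree_def
  using contactomorphism_F0 ndiffeo_F0(2) F0_tau_tilde F0_pi_proj by blast

end

section \<open>Uniqueness\<close>

text \<open>Test functions on a shifted bundle: \<open>form0\<close> is a function of the base and
  \<open>form1\<close> a fibre coordinate, both set to zero elsewhere. The conditions on the
  projections, applied to them, determine the pull-backs of smooth coefficients and of the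
  coordinates of degree 1.\<close>

definition form0 :: "'m set \<Rightarrow> ('m \<Rightarrow> real) \<Rightarrow> 'm \<Rightarrow> 'v list \<Rightarrow> real" where
  "form0 W f x vs = (if x \<in> W \<and> vs = [] then f x else 0)"

definition form1 :: "('m, 'v, 'r::finite) vbundle \<Rightarrow> 'm set \<Rightarrow> ('m \<Rightarrow> real^'r \<Rightarrow> 'v) \<Rightarrow> 'r \<Rightarrow> 'm \<Rightarrow> 'v list \<Rightarrow> real" where
  "form1 E U \<psi> a x vs = (if x \<in> U \<and> length vs = 1 \<and> set vs \<subseteq> fibre E x then inv (\<psi> x) (hd vs) $ a else 0)"

lemma form0_in_ext_fun:
  assumes M: "smooth_manifold M" and W: "open W" and f: "smooth_fun M W f"
  shows "form0 W f \<in> ext_fun M E W"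
  unfolding ext_fun_def
proof (intro CollectI conjI allI impI)
  fix U \<psi> and as assume t: "local_triv M E U \<psi>"
  have o: "open (W \<inter> U)" using W triv_open[OF local_triv_triv[OF t]] by auto
  show "smooth_fun M (W \<inter> U) (\<lambda>x. form0 W f x (map (\<lambda>a. \<psi> x (axis a 1)) as))"
  proof (cases as)
    case Nil
    have "smooth_fun M (W \<inter> U) f" by (rule smooth_fun_subset[OF f]) auto
    then show ?thesis by (rule smooth_fun_cong[OF M o]) (simp add: Nil form0_def)
  qed (simp add: form0_def smooth_fun_const)
qed (use W in \<open>auto simp: form0_def\<close>)

lemma form1_in_ext_fun:
  assumes M: "smooth_manifold M" and E: "vector_bundle M E" and U: "local_triv M E U \<psi>"
  shows "form1 E U \<psi> a \<in> ext_fun M E U"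
  unfolding ext_fun_def
proof (intro CollectI conjI allI impI ballI)
  note t = local_triv_triv[OF U]
  show "open U" by (rule triv_open[OF t])
  show "form1 E U \<psi> a x vs = 0" if "\<not> (x \<in> U \<and> set vs \<subseteq> fibre E x)" for x vs
    using that by (auto simp: form1_def)
  show "form1 E U \<psi> a x vs = 0" if "x \<in> U" "set vs \<subseteq> fibre E x \<and> \<not> distinct vs" for x vs
    using that by (cases vs) (auto simp: form1_def)
  fix x assume x: "x \<in> U"
  have closed: "vadd E x v v' \<in> fibre E x" "vscale E x s v \<in> fibre E x"
    if "v \<in> fibre E x" "v' \<in> fibre E x" for v v' s
  proof -
    have "vadd E x v v' = \<psi> x (inv (\<psi> x) v + inv (\<psi> x) v')" "vscale E x s v = \<psi> x (s *\<^sub>R inv (\<psi> x) v)"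
      using that by (simp_all add: triv_add[OF t x] triv_scale[OF t x] triv_inv_right[OF t x])
    then show "vadd E x v v' \<in> fibre E x" "vscale E x s v \<in> fibre E x"
      using triv_fibre[OF t x] by simp_all
  qed
  fix us ws v assume uw: "set us \<subseteq> fibre E x \<and> set ws \<subseteq> fibre E x" and v: "v \<in> fibre E x"
  show "form1 E U \<psi> a x (us @ vadd E x v v' # ws) = form1 E U \<psi> a x (us @ v # ws) + form1 E U \<psi> a x (us @ v' # ws)"
    if v': "v' \<in> fibre E x" for v'
    using uw v v' x closed[OF v v'] by (auto simp: form1_def triv_coord_add[OF t x])
  show "form1 E U \<psi> a x (us @ vscale E x s v # ws) = s * form1 E U \<psi> a x (us @ v # ws)" for s
    using uw v x closed[OF v v] by (auto simp: form1_def triv_coord_scale[OF t x])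
next
  note t = local_triv_triv[OF U]
  fix V \<eta> and as assume V: "local_triv M E V \<eta>"
  have o: "open (U \<inter> V)" using triv_open[OF t] triv_open[OF local_triv_triv[OF V]] by auto
  show "smooth_fun M (U \<inter> V) (\<lambda>x. form1 E U \<psi> a x (map (\<lambda>b. \<eta> x (axis b 1)) as))"
  proof (cases "length as = 1")
    case True
    then obtain b where b: "as = [b]" by (auto simp: length_Suc_conv)
    have "smooth_fun M (U \<inter> V) (\<lambda>x. trans_mat \<eta> \<psi> x a b)"
      using trans_mat_smooth[OF M E V U] by (simp add: Int_commute)
    then show ?thesis
      by (rule smooth_fun_cong[OF M o]) (use triv_fibre[OF local_triv_triv[OF V]] in \<open>auto simp: b form1_def trans_mat_def\<close>)
  qed (simp add: form1_def smooth_fun_const)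
qed

lemma sum_form0:
  "x \<in> W \<Longrightarrow> (\<Sum>I\<in>UNIV. form0 W f x (map e (sorted_list_of_set I)) *\<^sub>R oprod \<theta> I) = f x *\<^sub>R 1"
  for e :: "'r::{finite,linorder} \<Rightarrow> 'v" and \<theta> :: "'r \<Rightarrow> 'a::real_algebra_1"
proof -
  assume x: "x \<in> W"
  have "form0 W f x (map e (sorted_list_of_set I)) *\<^sub>R oprod \<theta> I = (if I = {} then f x *\<^sub>R 1 else 0)" for I
    using x by (auto simp: form0_def)
  then show ?thesis by simp
qed

lemma sum_form1:
  fixes \<theta> :: "'r::{finite,linorder} \<Rightarrow> 'a::real_algebra_1"
  assumes t: "trivialisation E U \<psi>" and x: "x \<in> U"
  shows "(\<Sum>I\<in>UNIV. form1 E U \<psi> a x (map (\<lambda>b. \<psi> x (axis b 1)) (sorted_list_of_set I)) *\<^sub>R oprod \<theta> I) = \<theta> a"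
proof -
  have "form1 E U \<psi> a x (map (\<lambda>b. \<psi> x (axis b 1)) (sorted_list_of_set I)) *\<^sub>R oprod \<theta> I = (if I = {a} then \<theta> a else 0)" for I
  proof (cases "card I = 1")
    case True
    then obtain b where "I = {b}" by (auto simp: card_1_singleton_iff)
    then show ?thesis
      using x triv_fibre[OF t x] by (auto simp: form1_def triv_inv[OF t x] axis_nth_if oprod_def)
  next
    case False
    then show ?thesis by (auto simp: form1_def)
  qed
  then show ?thesis by simp
qed

text \<open>A monomial other than 1 contains some generator of positive degree, and its coefficient
  appears, up to a sign and for even generators a positive exponent, in the derivative by that
  generator at the monomial with one factor removed.\<close>

lemma coef_eq_0_of_cdiff:
  fixes q :: "('n::finite, 'r::{finite,linorder}) sp"
  assumes d: "\<And>a. cdiff (CU a) q = 0" "\<And>a. cdiff (CPU a) q = 0" "cdiff CP q = 0" "\<And>i. cdiff (CPX i) q = 0"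
    and one: "coef q one_mono = 0"
  shows "q = 0"
proof (rule sp_eqI)
  fix m :: "('n, 'r) smono"
  have c: "coef (cdiff z q) m' = 0" if "z \<in> range CU \<union> range CPU \<union> {CP} \<union> range CPX" for z m'
    using that d by auto
  consider "m = one_mono" | a where "a \<in> mU m" | a where "a \<in> mPU m" | "mP m \<noteq> 0" | i where "mPX m i \<noteq> 0"
    by (cases m) (auto simp: one_mono_def fun_eq_iff)
  then have "coef q m = 0"
  proof cases
    case 1 then show ?thesis using one by simp
  next
    case (2 a)
    then have "m\<lparr>mU := insert a (mU m - {a})\<rparr> = m" by (simp add: insert_absorb)
    then show ?thesis using c[of "CU a" "m\<lparr>mU := mU m - {a}\<rparr>"] by simp
  next
    case (3 a)
    then have "m\<lparr>mPU := insert a (mPU m - {a})\<rparr> = m" by (simp add: insert_absorb)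
    then show ?thesis using c[of "CPU a" "m\<lparr>mPU := mPU m - {a}\<rparr>"] by simp
  next
    case 4
    then have "m\<lparr>mP := Suc (mP m - 1)\<rparr> = m" by simp
    then show ?thesis using c[of CP "m\<lparr>mP := mP m - 1\<rparr>"] by (simp add: parity_sign_def)
  next
    case (5 i)
    then have "m\<lparr>mPX := (mPX m)(i := Suc (mPX m i - 1))\<rparr> = m" by simp
    then show ?thesis using c[of "CPX i" "m\<lparr>mPX := (mPX m)(i := mPX m i - 1)\<rparr>"] by (simp add: parity_sign_def)
  qed
  then show "coef q m = coef 0 m" by simp
qed

text \<open>The coefficient of \<open>u\<^sup>a p\<^sub>a\<close> is read off from both derivatives, which fixes the conformal factor.\<close>

lemma legendre_potential_unique:
  fixes p :: "('n::finite, 'r::{finite,linorder}) sp"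
  assumes d: "\<And>a. cdiff (CU a) p = - (\<rho> *\<^sub>R G (CPU a))" "\<And>a. cdiff (CPU a) p = G (CU a)"
    "cdiff CP p = \<rho> *\<^sub>R 1" "\<And>i. cdiff (CPX i) p = 0"
    and one: "coef p one_mono = 0"
  shows "\<rho> = 1" "p = leg CP"
proof -
  \<comment> \<open>Index types are nonempty, so the rank is at least 1 and there is a pair u^a, p_a
    for which the mixed derivative can be taken.\<close>
  obtain a :: 'r where True by simp
  have "coef (cdiff (CU a) p) (one_mono\<lparr>mPU := {a}\<rparr>) = - \<rho>"
    unfolding d by (simp add: gen_apply)
  moreover have "coef (cdiff (CPU a) p) (one_mono\<lparr>mU := {a}\<rparr>) = 1"
    unfolding d by (simp add: gen_apply)
  moreover have "(one_mono\<lparr>mPU := {a}, mU := {a}\<rparr> :: ('n, 'r) smono) = one_mono\<lparr>mU := {a}, mPU := {a}\<rparr>"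
    by (simp add: one_mono_def)
  ultimately show \<rho>: "\<rho> = 1" by simp
  have "p - leg CP = 0"
  proof (rule coef_eq_0_of_cdiff)
    show "coef (p - leg CP) one_mono = 0"
      by (simp add: one leg_simps coef_G_mult gen_apply)
  qed (simp_all add: cdiff_diff cdiff_leg_CP d \<rho> del: cdiff.simps)
  then show "p = leg CP" by simp
qed

context jet_setting
begin

lemma JC_self: "adapted M A L c \<Longrightarrow> x \<in> cdom c \<Longrightarrow> fins p \<Longrightarrow> evalp (JC c c x) p = p"
  by (rule JC_trivial[of c c "cdom c"]) (auto dest: adaptedD(6))

section \<open>The action on functions of an arbitrary morphism with the required properties\<close>

context
  fixes F
  assumes F: "contact_legendre M A L F"
begin

lemma F_nmor: "is_nmor (jet_manifold M A L) (jet_manifold M (dagger A L) L) F"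
  using F unfolding contact_legendre_def contactomorphism_def ndiffeo_def by blast

lemma F_base: "base F = id"
proof -
  have "base (ncomp (ext_fun M (dagger A L)) (pi_proj M (dagger A L) L) F) = base (tau_proj M A L)"
    using F unfolding contact_legendre_def by simp
  then show ?thesis by (simp add: ncomp_def pi_proj_def tau_proj_def)
qed

lemma F_pull:
  assumes W: "open W"
  shows "s \<in> jet_fun M (dagger A L) L W \<Longrightarrow> pull F W s \<in> jet_fun M A L W"
    "s \<in> jet_fun M (dagger A L) L W \<Longrightarrow> t \<in> jet_fun M (dagger A L) L W \<Longrightarrow>
      pull F W (\<lambda>c x m. s c x m + t c x m) = (\<lambda>c x m. pull F W s c x m + pull F W t c x m)"
    "s \<in> jet_fun M (dagger A L) L W \<Longrightarrow> t \<in> jet_fun M (dagger A L) L W \<Longrightarrow>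
      pull F W (\<lambda>c x. sp_mult (s c x) (t c x)) = (\<lambda>c x. sp_mult (pull F W s c x) (pull F W t c x))"
    "s \<in> jet_fun M (dagger A L) L W \<Longrightarrow> pull F W (\<lambda>c x m. r * s c x m) = (\<lambda>c x m. r * pull F W s c x m)"
    "s \<in> jet_fun M (dagger A L) L W \<Longrightarrow> open V \<Longrightarrow> V \<subseteq> W \<Longrightarrow>
      pull F V (\<lambda>c x m. if x \<in> V then s c x m else 0) = (\<lambda>c x m. if x \<in> V then pull F W s c x m else 0)"
    "s \<in> jet_fun M (dagger A L) L W \<Longrightarrow> x \<in> W \<Longrightarrow>
      body (jet_manifold M A L) (pull F W s) x = body (jet_manifold M (dagger A L) L) s x"
    "pull F W \<in> extensional (jet_fun M (dagger A L) L W)"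
proof -
  let ?X = "jet_manifold M A L" and ?Y = "jet_manifold M (dagger A L) L"
  note n = F_nmor[unfolded is_nmor_def F_base]
  show "pull F W \<in> extensional (jet_fun M (dagger A L) L W)"
    using n by (simp add: jet_manifold_def)
  note nW = n[THEN conjunct2, THEN conjunct2, THEN spec, THEN mp, OF W]
  note nW_in = nW[THEN conjunct1]
    and nW_ring = nW[THEN conjunct2, THEN conjunct2, THEN conjunct1]
    and nW_scale = nW[THEN conjunct2, THEN conjunct2, THEN conjunct2, THEN conjunct1]
    and nW_restr = nW[THEN conjunct2, THEN conjunct2, THEN conjunct2, THEN conjunct2, THEN conjunct2, THEN conjunct1]
    and nW_body = nW[THEN conjunct2, THEN conjunct2, THEN conjunct2, THEN conjunct2, THEN conjunct2, THEN conjunct2]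
  show "s \<in> jet_fun M (dagger A L) L W \<Longrightarrow> pull F W s \<in> jet_fun M A L W"
    using nW_in by (auto simp: jet_manifold_def)
  show "s \<in> jet_fun M (dagger A L) L W \<Longrightarrow> t \<in> jet_fun M (dagger A L) L W \<Longrightarrow>
      pull F W (\<lambda>c x m. s c x m + t c x m) = (\<lambda>c x m. pull F W s c x m + pull F W t c x m)"
    "s \<in> jet_fun M (dagger A L) L W \<Longrightarrow> t \<in> jet_fun M (dagger A L) L W \<Longrightarrow>
      pull F W (\<lambda>c x. sp_mult (s c x) (t c x)) = (\<lambda>c x. sp_mult (pull F W s c x) (pull F W t c x))"
    using nW_ring by (simp_all add: jet_manifold_def)
  show "s \<in> jet_fun M (dagger A L) L W \<Longrightarrow> pull F W (\<lambda>c x m. r * s c x m) = (\<lambda>c x m. r * pull F W s c x m)"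
    using nW_scale by (simp add: jet_manifold_def)
  show "s \<in> jet_fun M (dagger A L) L W \<Longrightarrow> open V \<Longrightarrow> V \<subseteq> W \<Longrightarrow>
      pull F V (\<lambda>c x m. if x \<in> V then s c x m else 0) = (\<lambda>c x m. if x \<in> V then pull F W s c x m else 0)"
    using nW_restr by (simp add: jet_manifold_def)
  show "s \<in> jet_fun M (dagger A L) L W \<Longrightarrow> x \<in> W \<Longrightarrow>
      body (jet_manifold M A L) (pull F W s) x = body (jet_manifold M (dagger A L) L) s x"
    using nW_body by (simp add: jet_manifold_def)
qed

lemma F_pi_proj:
  assumes "\<omega> \<in> ext_fun M (dagger A L) W"
  shows "pull F W (pull (pi_proj M (dagger A L) L) W \<omega>) = pull (tau_proj M A L) W \<omega>"
proof -
  have "pull (ncomp (ext_fun M (dagger A L)) (pi_proj M (dagger A L) L) F) W \<omega> = pull (tau_proj M A L) W \<omega>"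
    using F unfolding contact_legendre_def by simp
  then show ?thesis using assms by (simp add: ncomp_def pi_proj_def)
qed

lemma F_tau_tilde:
  assumes "\<omega> \<in> ext_fun M A W"
  shows "pull F W (pull (tau_tilde M A L) W \<omega>) = pull (pi_proj M A L) W \<omega>"
proof -
  have b: "base (tau_tilde M A L) = id" by (simp add: tau_tilde_def ncomp_def bidual_iso_def tau_proj_def)
  have "pull (ncomp (ext_fun M A) (tau_tilde M A L) F) W \<omega> = pull (pi_proj M A L) W \<omega>"
    using F unfolding contact_legendre_def by simp
  then show ?thesis using assms by (simp add: ncomp_def b)
qed

context
  fixes c assumes c: "adapted M A L c"
begin

text \<open>The functions over the domain of \<open>c\<close> on which \<open>F\<close> acts as the
  substitution \<open>leg\<close>. They form a subalgebra, which is shown to be everything by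
  exhibiting generators.\<close>

definition legendre_on :: "('m, 'n, 'r, 'v \<Rightarrow> 'w, 'w) jfun \<Rightarrow> bool" where
  "legendre_on s \<longleftrightarrow> s \<in> jet_fun M (dagger A L) L (cdom c) \<and>
     (\<forall>x\<in>cdom c. Sp (pull F (cdom c) s c x) = evalp leg (Sp (s (dual_chart A c) x)))"

lemma dual_c: "adapted M (dagger A L) L (dual_chart A c)" "cdom (dual_chart A c) = cdom c" "cmap (dual_chart A c) = cmap c"
  "afr (dual_chart A c) = dual_triv A (afr c) (lfr c)"
  using adapted_dual_chart[OF c] by (simp_all add: dual_chart_def)

lemma legendre_on_add:
  assumes "legendre_on s" "legendre_on t"
  shows "legendre_on (\<lambda>c x m. s c x m + t c x m)"
proof -
  interpret B: jet_setting M "dagger A L" L by (rule dual_setting)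
  have s: "s \<in> jet_fun M (dagger A L) L (cdom c)" and t: "t \<in> jet_fun M (dagger A L) L (cdom c)"
    using assms by (auto simp: legendre_on_def)
  show ?thesis
    using assms B.jet_fun_add[OF s t]
    by (simp add: legendre_on_def F_pull(2)[OF adaptedD(6)[OF c] s t] Sp_simps evalp_add B.jet_funD(6)[OF s] B.jet_funD(6)[OF t])
qed

lemma legendre_on_mult:
  assumes "legendre_on s" "legendre_on t"
  shows "legendre_on (\<lambda>c x. sp_mult (s c x) (t c x))"
proof -
  interpret B: jet_setting M "dagger A L" L by (rule dual_setting)
  have s: "s \<in> jet_fun M (dagger A L) L (cdom c)" and t: "t \<in> jet_fun M (dagger A L) L (cdom c)"
    using assms by (auto simp: legendre_on_def)
  show ?thesis
    using assms B.jet_fun_mult[OF s t]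
    by (simp add: legendre_on_def F_pull(3)[OF adaptedD(6)[OF c] s t] Sp_simps evalp_mult[OF deg_hom_leg] B.jet_funD(6)[OF s] B.jet_funD(6)[OF t])
qed

lemma legendre_on_scale:
  assumes "legendre_on s"
  shows "legendre_on (\<lambda>c x m. r * s c x m)"
proof -
  interpret B: jet_setting M "dagger A L" L by (rule dual_setting)
  have s: "s \<in> jet_fun M (dagger A L) L (cdom c)"
    using assms by (auto simp: legendre_on_def)
  show ?thesis
    using assms B.jet_fun_scale[OF s]
    by (simp add: legendre_on_def F_pull(4)[OF adaptedD(6)[OF c] s] Sp_simps evalp_scaleR)
qed

text \<open>A function of the base is a form of degree 0 on the dual side, and both projections pull
  it back to the same coefficient of the unit monomial. So arbitrary smooth coefficients are
  reached, not only polynomials in the coordinates x^i.\<close>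

lemma legendre_on_fun:
  assumes f: "smooth_fun M (cdom c) f"
  obtains s where "legendre_on s" "\<And>x. x \<in> cdom c \<Longrightarrow> Sp (s (dual_chart A c) x) = f x *\<^sub>R 1"
proof -
  interpret B: jet_setting M "dagger A L" L by (rule dual_setting)
  have \<omega>: "form0 (cdom c) f \<in> ext_fun M (dagger A L) (cdom c)"
    by (rule form0_in_ext_fun[OF M adaptedD(6)[OF c] f])
  let ?s = "pull (pi_proj M (dagger A L) L) (cdom c) (form0 (cdom c) f)"
  have v: "Sp (?s (dual_chart A c) x) = f x *\<^sub>R 1" if "x \<in> cdom c" for x
    using B.Sp_pi_proj[OF \<omega> dual_c(1), of x] that by (simp add: dual_c sum_form0)
  have "legendre_on ?s"
    using B.pi_proj_in_jet_fun[OF \<omega>] Sp_tau_proj[OF \<omega> c]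
    by (simp add: legendre_on_def F_pi_proj[OF \<omega>] v sum_form0 evalp_scaleR)
  with v show thesis using that by blast
qed

lemma legendre_on_CU:
  obtains s where "legendre_on s" "\<And>x. x \<in> cdom c \<Longrightarrow> Sp (s (dual_chart A c) x) = G (CU a)"
proof -
  interpret B: jet_setting M "dagger A L" L by (rule dual_setting)
  note tr = B.adaptedD(4)[OF dual_c(1), unfolded dual_c]
  let ?\<omega> = "form1 (dagger A L) (cdom c) (dual_triv A (afr c) (lfr c)) a"
  have \<omega>: "?\<omega> \<in> ext_fun M (dagger A L) (cdom c)"
    by (rule form1_in_ext_fun[OF M B.A B.adaptedD(2)[OF dual_c(1), unfolded dual_c]])
  let ?s = "pull (pi_proj M (dagger A L) L) (cdom c) ?\<omega>"
  have v: "Sp (?s (dual_chart A c) x) = G (CU a)" if "x \<in> cdom c" for x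
    using B.Sp_pi_proj[OF \<omega> dual_c(1), of x] that by (simp add: dual_c sum_form1[OF tr])
  have "legendre_on ?s"
    using B.pi_proj_in_jet_fun[OF \<omega>] Sp_tau_proj[OF \<omega> c]
    by (simp add: legendre_on_def F_pi_proj[OF \<omega>] v sum_form1[OF tr] evalp_gen leg_simps)
  with v show thesis using that by blast
qed

lemma legendre_on_CPU:
  obtains s where "legendre_on s" "\<And>x. x \<in> cdom c \<Longrightarrow> Sp (s (dual_chart A c) x) = G (CPU a)"
proof -
  let ?\<omega> = "form1 A (cdom c) (afr c) a"
  have \<omega>: "?\<omega> \<in> ext_fun M A (cdom c)"
    by (rule form1_in_ext_fun[OF M A adaptedD(2)[OF c]])
  let ?s = "pull (tau_tilde M A L) (cdom c) ?\<omega>"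
  have v: "Sp (?s (dual_chart A c) x) = G (CPU a)" if "x \<in> cdom c" for x
    using Sp_tau_tilde[OF \<omega> c, of x] that by (simp add: sum_form1[OF adaptedD(4)[OF c]])
  have "legendre_on ?s"
    using tau_tilde_in_jet_fun[OF \<omega>] Sp_pi_proj[OF \<omega> c]
    by (simp add: legendre_on_def F_tau_tilde[OF \<omega>] v sum_form1[OF adaptedD(4)[OF c]] evalp_gen leg_simps)
  with v show thesis using that by blast
qed

lemma legendre_on_cong:
  assumes "legendre_on s" "t \<in> jet_fun M (dagger A L) L (cdom c)"
    and "\<And>x. x \<in> cdom c \<Longrightarrow> Sp (s (dual_chart A c) x) = Sp (t (dual_chart A c) x)"
  shows "legendre_on t"
proof -
  interpret B: jet_setting M "dagger A L" L by (rule dual_setting)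
  have "s = t"
    by (rule B.jet_fun_determined[OF _ assms(2) dual_c(1)])
      (use assms in \<open>auto simp: legendre_on_def dual_c Sp_eq_iff\<close>)
  then show ?thesis using assms(1) by simp
qed

lemma coord_fun_self:
  assumes "x \<in> cdom c"
  shows "Sp (coord_fun M (dagger A L) L (dual_chart A c) w (dual_chart A c) x) = Sp (local_coord (dual_chart A c) w x)"
    "Sp (jet_fun_of M (dagger A L) L (dual_chart A c) (\<lambda>_. contact_form w) (dual_chart A c) x) = Sp (contact_form w)"
proof -
  interpret B: jet_setting M "dagger A L" L by (rule dual_setting)
  have x: "x \<in> cdom (dual_chart A c)" using assms by (simp add: dual_c)
  have f: "fins (Sp (local_coord (dual_chart A c) w x))" "fins (Sp (contact_form w :: ('n, 'r) spoly))"
    using fins_degree_le[of "Sp (local_coord (dual_chart A c) w x)" 2] B.local_coord_bounded(2)[OF dual_c(1)]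
      fins_degree_le[of "Sp (contact_form w :: ('n, 'r) spoly)" 2] contact_form_degree by auto
  show "Sp (coord_fun M (dagger A L) L (dual_chart A c) w (dual_chart A c) x) = Sp (local_coord (dual_chart A c) w x)"
    unfolding B.coord_fun_in_jet_fun(2)[OF dual_c(1) dual_c(1) x x] by (rule B.JC_self[OF dual_c(1) x f(1)])
  show "Sp (jet_fun_of M (dagger A L) L (dual_chart A c) (\<lambda>_. contact_form w) (dual_chart A c) x) = Sp (contact_form w)"
    unfolding B.contact_form_in_jet_fun(2)[OF dual_c(1) dual_c(1) x x] by (rule B.JC_self[OF dual_c(1) x f(2)])
qed

lemma coord_fun_dual_in_jet_fun:
  "coord_fun M (dagger A L) L (dual_chart A c) w \<in> jet_fun M (dagger A L) L (cdom c)"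
  "jet_fun_of M (dagger A L) L (dual_chart A c) (\<lambda>_. contact_form w) \<in> jet_fun M (dagger A L) L (cdom c)"
  using jet_setting.coord_fun_in_jet_fun(1)[OF dual_setting dual_c(1)]
    jet_setting.contact_form_in_jet_fun(1)[OF dual_setting dual_c(1)] by (simp_all add: dual_c)

lemma legendre_on_coord:
  "legendre_on (coord_fun M (dagger A L) L (dual_chart A c) (CX i))"
  "legendre_on (coord_fun M (dagger A L) L (dual_chart A c) (CU a))"
  "legendre_on (coord_fun M (dagger A L) L (dual_chart A c) (CPU a))"
proof -
  obtain s where s: "legendre_on s" "\<And>x. x \<in> cdom c \<Longrightarrow> Sp (s (dual_chart A c) x) = (cmap c x $ i) *\<^sub>R 1"
    using legendre_on_fun[OF coord_smooth[OF c, of i]] by metis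
  show "legendre_on (coord_fun M (dagger A L) L (dual_chart A c) (CX i))"
    by (rule legendre_on_cong[OF s(1) coord_fun_dual_in_jet_fun(1)]) (simp add: s(2) coord_fun_self Sp_local_coord dual_c)
  obtain t where t: "legendre_on t" "\<And>x. x \<in> cdom c \<Longrightarrow> Sp (t (dual_chart A c) x) = G (CU a)"
    using legendre_on_CU[of a] by metis
  show "legendre_on (coord_fun M (dagger A L) L (dual_chart A c) (CU a))"
    by (rule legendre_on_cong[OF t(1) coord_fun_dual_in_jet_fun(1)]) (simp add: t(2) coord_fun_self Sp_local_coord)
  obtain u where u: "legendre_on u" "\<And>x. x \<in> cdom c \<Longrightarrow> Sp (u (dual_chart A c) x) = G (CPU a)"
    using legendre_on_CPU[of a] by metis
  show "legendre_on (coord_fun M (dagger A L) L (dual_chart A c) (CPU a))"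
    by (rule legendre_on_cong[OF u(1) coord_fun_dual_in_jet_fun(1)]) (simp add: u(2) coord_fun_self Sp_local_coord)
qed

lemma contact_form_eq_scale:
  assumes "Sp (contact_form w) = - G w'" "\<And>x. Sp (local_coord (dual_chart A c) w' x) = G w'"
  shows "jet_fun_of M (dagger A L) L (dual_chart A c) (\<lambda>_. contact_form w) =
    (\<lambda>e x m. - 1 * coord_fun M (dagger A L) L (dual_chart A c) w' e x m)"
proof -
  interpret B: jet_setting M "dagger A L" L by (rule dual_setting)
  note s = coord_fun_dual_in_jet_fun(1)[of w']
  show ?thesis
  proof (rule B.jet_fun_determined[OF coord_fun_dual_in_jet_fun(2) B.jet_fun_scale[OF s] dual_c(1)])
    show "cdom c \<subseteq> cdom (dual_chart A c)" by (simp add: dual_c)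
    fix x assume x: "x \<in> cdom c"
    have "Sp (jet_fun_of M (dagger A L) L (dual_chart A c) (\<lambda>_. contact_form w) (dual_chart A c) x) =
        Sp (\<lambda>m. - 1 * coord_fun M (dagger A L) L (dual_chart A c) w' (dual_chart A c) x m)"
      using assms unfolding coord_fun_self(2)[OF x] Sp_simps(5) coord_fun_self(1)[OF x] by simp
    then show "jet_fun_of M (dagger A L) L (dual_chart A c) (\<lambda>_. contact_form w) (dual_chart A c) x =
        (\<lambda>m. - 1 * coord_fun M (dagger A L) L (dual_chart A c) w' (dual_chart A c) x m)"
      unfolding Sp_eq_iff .
  qed
qed

text \<open>These are the generators left open by the projections. The contact condition is
  evaluated in \<open>c\<close> and its own dual chart, where no transition functions intervene and
  the coefficients and differentials of the x^i, u^a and p_a are already known.\<close>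

lemma legendre_on_CP_CPX:
  "legendre_on (coord_fun M (dagger A L) L (dual_chart A c) CP)"
  "legendre_on (coord_fun M (dagger A L) L (dual_chart A c) (CPX k))"
proof -
  interpret B: jet_setting M "dagger A L" L by (rule dual_setting)
  let ?d = "dual_chart A c" and ?W = "cdom c"
  note oW = adaptedD(6)[OF c]
  define s where "s w = coord_fun M (dagger A L) L ?d w" for w
  define \<theta> where "\<theta> w = jet_fun_of M (dagger A L) L ?d (\<lambda>_. contact_form w)" for w
  define P where "P = pull F ?W (s CP) c"
  define Q where "Q i x = Sp (pull F ?W (s (CPX i)) c x)" for i x
  obtain \<rho> where \<rho>: "\<And>x z. x \<in> ?W \<Longrightarrow> Sp (pull_form M (dagger A L) L F ?d (\<lambda>w _. contact_form w) c z x) = \<rho> x *\<^sub>R Sp (contact_form z)"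
  proof -
    obtain \<rho> where \<rho>: "\<And>x z m. x \<in> ?W \<inter> base F -` cdom ?d \<Longrightarrow>
        pull_form M (dagger A L) L F ?d (\<lambda>w _. contact_form w) c z x m = \<rho> x * contact_form z m"
      using F c dual_c(1) unfolding contact_legendre_def contactomorphism_def by blast
    show thesis
      by (rule that[of \<rho>], rule sp_eqI) (use \<rho> in \<open>simp add: F_base dual_c\<close>)
  qed
  obtain one where one: "legendre_on one" "\<And>x. x \<in> ?W \<Longrightarrow> Sp (one ?d x) = 1 *\<^sub>R 1"
    using legendre_on_fun[OF smooth_fun_const] by metis
  have \<theta>_CP: "Sp (pull F ?W (\<theta> CP) c x) = 1" if "x \<in> ?W" for x
  proof -
    have "legendre_on (\<theta> CP)"
      unfolding \<theta>_def
      by (rule legendre_on_cong[OF one(1) coord_fun_dual_in_jet_fun(2)]) (simp add: coord_fun_self one(2) Sp_contact_form del: contact_form.simps)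
    then show ?thesis
      using that unfolding legendre_on_def \<theta>_def by (simp add: coord_fun_self Sp_contact_form del: contact_form.simps)
  qed
  have \<theta>_0: "Sp (pull F ?W (\<theta> w) c x) = 0" if "x \<in> ?W" "Sp (contact_form w :: ('n, 'r) spoly) = 0" for x w
  proof -
    have "legendre_on (\<theta> w)"
      unfolding \<theta>_def
      by (rule legendre_on_cong[OF legendre_on_scale[OF one(1), of 0] coord_fun_dual_in_jet_fun(2)])
        (simp add: coord_fun_self that(2) Sp_simps)
    then show ?thesis
      using that unfolding legendre_on_def \<theta>_def by (simp add: coord_fun_self)
  qed
  have \<theta>_CX: "Sp (pull F ?W (\<theta> (CX i)) c x) = - Q i x" for i x
  proof -
    have "\<theta> (CX i) = (\<lambda>e x m. - 1 * s (CPX i) e x m)"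
      unfolding \<theta>_def s_def by (rule contact_form_eq_scale) (simp_all only: Sp_contact_form Sp_local_coord)
    then show ?thesis
      using F_pull(4)[OF oW coord_fun_dual_in_jet_fun(1)[of "CPX i"], of "-1"] unfolding Q_def s_def by (simp add: Sp_simps)
  qed
  have \<theta>_CU: "Sp (pull F ?W (\<theta> (CU a)) c x) = - G (CU a)" if "x \<in> ?W" for a x
  proof -
    have "\<theta> (CU a) = (\<lambda>e x m. - 1 * s (CPU a) e x m)"
      unfolding \<theta>_def s_def by (rule contact_form_eq_scale) (simp_all only: Sp_contact_form Sp_local_coord)
    moreover have "Sp (pull F ?W (s (CPU a)) c x) = G (CU a)"
      using legendre_on_coord(3)[of a] that unfolding legendre_on_def s_def
      by (simp add: coord_fun_self Sp_local_coord evalp_gen leg_simps)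
    ultimately show ?thesis
      using F_pull(4)[OF oW coord_fun_dual_in_jet_fun(1)[of "CPU a"], of "-1"] unfolding s_def by (simp add: Sp_simps)
  qed
  \<comment> \<open>The coefficient of dz, with \<open>P\<close> and \<open>Q i\<close> as unknowns.
    Since \<open>cdiff z 1\<close> vanishes unless \<open>z\<close> is a base coordinate, the
    \<open>Q i\<close> enter only the equations for dx^k.\<close>
  have eq: "Sp (sdiff c P z x) -
      (\<Sum>i\<in>UNIV. Q i x * ((case z of CX k \<Rightarrow> cpderiv c k (\<lambda>y. cmap c y $ i) x | _ \<Rightarrow> cmap c x $ i) *\<^sub>R cdiff z 1)) -
      (\<Sum>a\<in>UNIV. G (CU a) * ((case z of CX k \<Rightarrow> 0 | _ \<Rightarrow> 1) *\<^sub>R cdiff z (G (CPU a)))) = \<rho> x *\<^sub>R Sp (contact_form z)"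
    if x: "x \<in> ?W" for x z
  proof -
    have dX: "Sp (sdiff c (pull F ?W (s (CX i)) c) z x) =
        (case z of CX k \<Rightarrow> cpderiv c k (\<lambda>y. cmap c y $ i) x | _ \<Rightarrow> cmap c x $ i) *\<^sub>R cdiff z 1" for i
    proof -
      have "Sp (sdiff c (pull F ?W (s (CX i)) c) z x) =
          (\<Sum>j\<in>{()}. (case z of CX k \<Rightarrow> cpderiv c k (\<lambda>y. cmap c y $ i) x | _ \<Rightarrow> cmap c x $ i) *\<^sub>R cdiff z 1)"
        by (rule sdiff_sum[OF c oW x x])
          (use legendre_on_coord(1)[of i] coord_smooth[OF c] in
            \<open>auto simp: legendre_on_def s_def coord_fun_self Sp_local_coord evalp_scaleR dual_c\<close>)
      then show ?thesis by simp
    qed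
    have dU: "Sp (sdiff c (pull F ?W (s (CU a)) c) z x) = (case z of CX k \<Rightarrow> 0 | _ \<Rightarrow> 1) *\<^sub>R cdiff z (G (CPU a))" for a
    proof -
      have "Sp (sdiff c (pull F ?W (s (CU a)) c) z x) =
          (\<Sum>j\<in>{()}. (case z of CX k \<Rightarrow> cpderiv c k (\<lambda>y. 1) x | _ \<Rightarrow> 1) *\<^sub>R cdiff z (G (CPU a)))"
        by (rule sdiff_sum[OF c oW x x])
          (use legendre_on_coord(2)[of a] smooth_fun_const in
            \<open>auto simp: legendre_on_def s_def coord_fun_self Sp_local_coord evalp_gen leg_simps\<close>)
      moreover have "(case z of CX k \<Rightarrow> cpderiv c k (\<lambda>y. 1) x | _ \<Rightarrow> 1) = (case z of CX k \<Rightarrow> 0 | _ \<Rightarrow> 1)"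
        by (cases z) (simp_all add: pderiv_chart_const[OF M adaptedD(1)[OF c] oW x x])
      ultimately show ?thesis by simp
    qed
    have "\<rho> x *\<^sub>R Sp (contact_form z) = (\<Sum>w\<in>UNIV. Sp (pull F ?W (\<theta> w) c x) * Sp (sdiff c (pull F ?W (s w) c) z x))"
      unfolding \<rho>[OF x, symmetric] Sp_pull_form \<theta>_def s_def by (simp add: dual_c)
    also have "\<dots> = Sp (sdiff c P z x) - (\<Sum>i\<in>UNIV. Q i x * Sp (sdiff c (pull F ?W (s (CX i)) c) z x)) -
        (\<Sum>a\<in>UNIV. G (CU a) * Sp (sdiff c (pull F ?W (s (CU a)) c) z x))"
      unfolding sum_coord \<theta>_CX \<theta>_CU[OF x] \<theta>_CP[OF x] \<theta>_0[OF x Sp_contact_form(4)] \<theta>_0[OF x Sp_contact_form(5)]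
      by (simp add: P_def sum_negf)
    finally show ?thesis unfolding dX dU by simp
  qed
  have PF: "\<rho> x = 1" "Sp (P x) = leg CP" if x: "x \<in> ?W" for x
  proof -
    have "cdiff (CU a) (Sp (P x)) = - (\<rho> x *\<^sub>R G (CPU a))" for a
      using eq[OF x, of "CU a"] by (simp only: Sp_contact_form cdiff_1 cdiff_CPU coord.case) (simp cong: if_cong)
    moreover have "cdiff (CPU a) (Sp (P x)) = G (CU a)" for a
      using eq[OF x, of "CPU a"]
      by (simp only: Sp_contact_form cdiff_1 cdiff_CPU coord.case) (simp add: if_distrib[of "\<lambda>q. _ * q"] cong: if_cong)
    moreover have "cdiff CP (Sp (P x)) = \<rho> x *\<^sub>R 1"
      using eq[OF x, of CP] by (simp only: Sp_contact_form cdiff_1 cdiff_CPU coord.case) simp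
    moreover have "cdiff (CPX i) (Sp (P x)) = 0" for i
      using eq[OF x, of "CPX i"] by (simp only: Sp_contact_form cdiff_1 cdiff_CPU coord.case) simp
    \<comment> \<open>The derivatives in positive directions leave the constant term open. It is
      zero because a morphism preserves values at points and p has value 0.\<close>
    moreover have "coef (Sp (P x)) one_mono = 0"
    proof -
      note sCP = coord_fun_dual_in_jet_fun(1)[of CP, folded s_def]
      have "P x one_mono = body (jet_manifold M (dagger A L) L) (s CP) x"
        unfolding P_def F_pull(6)[OF oW sCP x, symmetric] by (rule jet_body[OF F_pull(1)[OF oW sCP] c x x, symmetric])
      also have "\<dots> = coef (Sp (s CP ?d x)) one_mono"
        using B.jet_body[OF sCP dual_c(1) x] x by (simp add: dual_c)
      finally show ?thesis
        unfolding s_def coord_fun_self(1)[OF x] Sp_local_coord by (simp add: gen_apply)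
    qed
    ultimately show "\<rho> x = 1" "Sp (P x) = leg CP"
      using legendre_potential_unique[of "Sp (P x)" "\<rho> x"] by blast+
  qed
  show "legendre_on (coord_fun M (dagger A L) L ?d CP)"
    unfolding legendre_on_def
    using coord_fun_dual_in_jet_fun(1)[of CP] PF(2) by (simp add: P_def s_def coord_fun_self Sp_local_coord evalp_gen)
  \<comment> \<open>\<open>P\<close> now has constant coefficients and contributes nothing to dx^k,
    and the Kronecker delta from differentiating the coordinates isolates
    \<open>Q k\<close>.\<close>
  have "Q k x = G (CPX k)" if x: "x \<in> ?W" for x
  proof -
    have "Sp (sdiff c P (CX k) x) = (\<Sum>j\<in>{()}. (case CX k :: ('n, 'r) coord of CX k \<Rightarrow> cpderiv c k (\<lambda>y. 1) x | _ \<Rightarrow> 1) *\<^sub>R cdiff (CX k) (leg CP))"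
      by (rule sdiff_sum[OF c oW x x]) (use PF(2) smooth_fun_const in auto)
    then have "Sp (sdiff c P (CX k) x) = 0"
      by (simp add: pderiv_chart_const[OF M adaptedD(1)[OF c] oW x x])
    moreover have "(\<Sum>i\<in>UNIV. Q i x * (cpderiv c k (\<lambda>y. cmap c y $ i) x *\<^sub>R cdiff (CX k) 1)) = Q k x"
      unfolding cdiff_1 pderiv_chart_coordinate[OF M adaptedD(1)[OF c] oW x x]
      by (simp add: if_distrib[of "\<lambda>q. _ * q"] if_distrib[of "\<lambda>r. r *\<^sub>R _"] cong: if_cong)
    ultimately show ?thesis
      using eq[OF x, of "CX k"] PF(1)[OF x] by (simp only: Sp_contact_form coord.case) simp
  qed
  then show "legendre_on (coord_fun M (dagger A L) L ?d (CPX k))"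
    unfolding legendre_on_def
    using coord_fun_dual_in_jet_fun(1)[of "CPX k"]
    by (simp add: Q_def s_def coord_fun_self Sp_local_coord evalp_gen leg_simps)
qed

lemma legendre_on_mon:
  obtains s where "legendre_on s" "\<And>x. x \<in> cdom c \<Longrightarrow> Sp (s (dual_chart A c) x) = mon m"
proof -
  have "\<exists>s. legendre_on s \<and> (\<forall>x\<in>cdom c. Sp (s (dual_chart A c) x) = prod_list (map G zs))"
    if "set zs \<subseteq> range CU \<union> range CPU \<union> {CP} \<union> range CPX" for zs
    using that
  proof (induction zs)
    case Nil
    obtain one where "legendre_on one" "\<And>x. x \<in> cdom c \<Longrightarrow> Sp (one (dual_chart A c) x) = 1 *\<^sub>R 1"
      using legendre_on_fun[OF smooth_fun_const] by metis
    then show ?case by auto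
  next
    case (Cons z zs)
    then obtain s where s: "legendre_on s" "\<And>x. x \<in> cdom c \<Longrightarrow> Sp (s (dual_chart A c) x) = prod_list (map G zs)"
      by auto
    let ?t = "coord_fun M (dagger A L) L (dual_chart A c) z"
    have t: "legendre_on ?t" "\<And>x. x \<in> cdom c \<Longrightarrow> Sp (?t (dual_chart A c) x) = G z"
      using Cons.prems legendre_on_coord legendre_on_CP_CPX by (auto simp: coord_fun_self Sp_local_coord)
    show ?case
      using legendre_on_mult[OF t(1) s(1)] t(2) s(2)
      by (intro exI[of _ "\<lambda>e x. sp_mult (?t e x) (s e x)"]) (simp add: Sp_simps)
  qed
  from this[OF set_mono_factors[of m]] show thesis
    using that unfolding evalm_G[symmetric] evalm_def by blast
qed

text \<open>The degree bound presents \<open>s\<close>, over the whole chart, as a finite sum of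
  monomials with smooth coefficients, all of which lie in the subalgebra.\<close>

lemma legendre_on_all:
  assumes s: "s \<in> jet_fun M (dagger A L) L (cdom c)"
  shows "legendre_on s"
proof -
  interpret B: jet_setting M "dagger A L" L by (rule dual_setting)
  obtain k where k: "\<And>c x m. s c x m \<noteq> 0 \<Longrightarrow> mono_degree m \<le> k"
    using B.jet_funD(4)[OF s] by blast
  have "\<exists>t. legendre_on t \<and> (\<forall>x\<in>cdom c. Sp (t (dual_chart A c) x) = (\<Sum>m\<in>S. s (dual_chart A c) x m *\<^sub>R mon m))"
    if "finite S" for S
    using that
  proof (induction S)
    case empty
    obtain z where "legendre_on z" "\<And>x. x \<in> cdom c \<Longrightarrow> Sp (z (dual_chart A c) x) = 0 *\<^sub>R 1"
      using legendre_on_fun[OF smooth_fun_const] by metis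
    then show ?case by auto
  next
    case (insert m S)
    then obtain t where t: "legendre_on t" "\<And>x. x \<in> cdom c \<Longrightarrow> Sp (t (dual_chart A c) x) = (\<Sum>m\<in>S. s (dual_chart A c) x m *\<^sub>R mon m)"
      by auto
    have "smooth_fun M (cdom c) (\<lambda>x. s (dual_chart A c) x m)"
      using B.jet_funD(3)[OF s dual_c(1)] by (simp add: dual_c smooth_sp_def)
    then obtain f where f: "legendre_on f" "\<And>x. x \<in> cdom c \<Longrightarrow> Sp (f (dual_chart A c) x) = s (dual_chart A c) x m *\<^sub>R 1"
      using legendre_on_fun by metis
    obtain u where u: "legendre_on u" "\<And>x. x \<in> cdom c \<Longrightarrow> Sp (u (dual_chart A c) x) = mon m"
      using legendre_on_mon[of m] by metis
    show ?case
      using legendre_on_add[OF legendre_on_mult[OF f(1) u(1)] t(1)] f(2) u(2) t(2) insert.hyps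
      by (intro exI[of _ "\<lambda>e x m. sp_mult (f e x) (u e x) m + t e x m"]) (simp add: Sp_simps)
  qed
  from this[OF finite_degree_le[of k]] obtain t where t: "legendre_on t"
    "\<And>x. x \<in> cdom c \<Longrightarrow> Sp (t (dual_chart A c) x) = (\<Sum>m | mono_degree m \<le> k. s (dual_chart A c) x m *\<^sub>R mon m)"
    by auto
  show ?thesis
  proof (rule legendre_on_cong[OF t(1) s])
    fix x assume x: "x \<in> cdom c"
    have "evalp G (Sp (s (dual_chart A c) x)) = (\<Sum>m | mono_degree m \<le> k. s (dual_chart A c) x m *\<^sub>R mon m)"
      by (subst evalp_superset[OF finite_degree_le[of k]]) (use k in \<open>auto simp: evalm_G\<close>)
    then show "Sp (t (dual_chart A c) x) = Sp (s (dual_chart A c) x)"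
      using t(2)[OF x] by (simp add: evalp_G B.jet_funD(6)[OF s])
  qed
qed

end

text \<open>\<open>legendre_on\<close> concerns functions over an entire chart domain, so the chart
  is shrunk to its intersection with \<open>W\<close>. Compatibility with restrictions and
  \<open>jet_fun_chart_cong\<close> lead back to the original chart.\<close>

lemma F_pull_eq:
  assumes s: "s \<in> jet_fun M (dagger A L) L W" and c: "adapted M A L c" and x: "x \<in> W" "x \<in> cdom c"
  shows "Sp (pull F W s c x) = evalp leg (Sp (s (dual_chart A c) x))"
proof -
  interpret B: jet_setting M "dagger A L" L by (rule dual_setting)
  have W: "open W" by (rule B.jet_funD(1)[OF s])
  define V where "V = W \<inter> cdom c"
  have V: "open V" "V \<subseteq> W" "V \<subseteq> cdom c" "x \<in> V" using W adaptedD(6)[OF c] x by (auto simp: V_def)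
  let ?c = "c\<lparr>cdom := V\<rparr>"
  have c': "adapted M A L ?c" by (rule adapted_restrict[OF c V(1,3)])
  let ?s = "\<lambda>e x m. if x \<in> V then s e x m else 0"
  have sV: "?s \<in> jet_fun M (dagger A L) L V" by (rule B.jet_fun_restr[OF s V(1,2)])
  have "legendre_on ?c ?s" by (rule legendre_on_all[OF c']) (use sV in simp)
  then have "Sp (pull F V ?s ?c x) = evalp leg (Sp (?s (dual_chart A ?c) x))"
    using V(4) by (simp add: legendre_on_def[OF c'])
  moreover have "pull F V ?s ?c x = pull F W s ?c x"
    using V(4) by (simp add: F_pull(5)[OF W s V(1,2)])
  moreover have "pull F W s ?c x = pull F W s c x"
    by (rule jet_fun_chart_cong[OF F_pull(1)[OF W s] c' c V(1) _ V(3,4)]) auto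
  moreover have "?s (dual_chart A ?c) x = s (dual_chart A ?c) x" using V(4) by simp
  moreover have "s (dual_chart A ?c) x = s (dual_chart A c) x"
    by (rule B.jet_fun_chart_cong[OF s adapted_dual_chart[OF c'] adapted_dual_chart[OF c] V(1) _ _ V(4)])
      (use V(3) in \<open>auto simp: dual_chart_def\<close>)
  ultimately show ?thesis by simp
qed

lemma F_eq_F0: "F = F0"
proof -
  interpret T: leg_transport M A "dagger A L" L "dual_chart A" by (rule leg_transport_dual)
  have "pull F W s = pull F0 W s" for W s
  proof (cases "s \<in> jet_fun M (dagger A L) L W")
    case True
    note W = T.SB.jet_funD(1)[OF True]
    show ?thesis
    proof (rule T.pull_eqI[of W])
      show "Sp (pull F W s c x) = Sp (pull F0 W s c x)" if "adapted M A L c" "x \<in> W" "x \<in> cdom c" for c x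
        unfolding F_pull_eq[OF True that] leg_mor_pull(1)[OF True that] ..
      show "pull F W s c x = pull F0 W s c x" if "\<not> (adapted M A L c \<and> x \<in> W \<inter> cdom c)" for c x
        using jet_funD(2)[OF F_pull(1)[OF W True] that] leg_mor_pull(2)[OF True that] by simp
    qed
  next
    case False
    \<comment> \<open>Equality of records also compares the values off the sections; extensionality
      makes them \<open>undefined\<close> on both sides.\<close>
    have "pull F W \<in> extensional (jet_fun M (dagger A L) L W)"
      using F_nmor by (simp add: is_nmor_def jet_manifold_def)
    then show ?thesis using False by (simp add: extensional_def leg_mor_def)
  qed
  then have "pull F = pull F0" by (simp add: fun_eq_iff)
  then show ?thesis using F_base by (intro nmor.equality) simp_all
qed

end

text \<open>An equality of functions over \<open>cdom c\<close> has to be verified in every chart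
  \<open>e\<close>; \<open>JC_leg\<close> carries the computation from \<open>c\<close>, where it is
  the substitution itself, to \<open>e\<close>.\<close>

lemma F0_coordinates:
  assumes c: "adapted M A L c"
    and z: "\<And>x. evalp leg (Sp (local_coord (dual_chart A c) z x)) = P x"
    and t: "\<And>e x. adapted M A L e \<Longrightarrow> x \<in> cdom c \<Longrightarrow> x \<in> cdom e \<Longrightarrow> Sp (t e x) = evalp (JC e c x) (P x)"
    and t0: "\<And>e x. \<not> (adapted M A L e \<and> x \<in> cdom c \<inter> cdom e) \<Longrightarrow> t e x = (\<lambda>_. 0)"
  shows "pull F0 (cdom c) (coord_fun M (dagger A L) L (dual_chart A c) z) = t"
proof -
  interpret T: leg_transport M A "dagger A L" L "dual_chart A" by (rule leg_transport_dual)
  have cd: "cdom (dual_chart A c) = cdom c" by (simp add: dual_chart_def)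
  note dc = adapted_dual_chart[OF c]
  have s: "coord_fun M (dagger A L) L (dual_chart A c) z \<in> jet_fun M (dagger A L) L (cdom c)"
    using T.SB.coord_fun_in_jet_fun(1)[OF dc] by (simp add: cd)
  show ?thesis
  proof (rule T.pull_eqI[of "cdom c"])
    fix e x assume e: "adapted M A L e" and x: "x \<in> cdom c" "x \<in> cdom e"
    have "Sp (pull F0 (cdom c) (coord_fun M (dagger A L) L (dual_chart A c) z) e x) =
        evalp leg (evalp (JC (dual_chart A e) (dual_chart A c) x) (Sp (local_coord (dual_chart A c) z x)))"
      using T.SB.coord_fun_in_jet_fun(2)[OF dc adapted_dual_chart[OF e], of x z] x
      unfolding leg_mor_pull(1)[OF s e x] by (simp add: dual_chart_def)
    also have "\<dots> = evalp (JC e c x) (P x)"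
      unfolding JC_leg[OF e dual_pair_dual_chart c dual_pair_dual_chart x(2,1), symmetric] z ..
    finally show "Sp (pull F0 (cdom c) (coord_fun M (dagger A L) L (dual_chart A c) z) e x) = Sp (t e x)"
      using t[OF e x] by simp
  next
    fix e x assume "\<not> (adapted M A L e \<and> x \<in> cdom c \<inter> cdom e)"
    then show "pull F0 (cdom c) (coord_fun M (dagger A L) L (dual_chart A c) z) e x = t e x"
      using leg_mor_pull(2)[OF s] t0 by simp
  qed
qed

lemma F0_coordinate_formulas:
  assumes c: "adapted M A L c"
  shows "pull F0 (cdom c) (coord_fun M (dagger A L) L (dual_chart A c) (CX i)) = coord_fun M A L c (CX i)"
    "pull F0 (cdom c) (coord_fun M (dagger A L) L (dual_chart A c) (CU a)) = coord_fun M A L c (CPU a)"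
    "pull F0 (cdom c) (coord_fun M (dagger A L) L (dual_chart A c) CP) =
      (\<lambda>d y m. coord_fun M A L c CP d y m - (\<Sum>b\<in>UNIV. sp_mult (coord_fun M A L c (CU b) d y) (coord_fun M A L c (CPU b) d y) m))"
    "pull F0 (cdom c) (coord_fun M (dagger A L) L (dual_chart A c) (CPX i)) = coord_fun M A L c (CPX i)"
    "pull F0 (cdom c) (coord_fun M (dagger A L) L (dual_chart A c) (CPU a)) = coord_fun M A L c (CU a)"
proof -
  note co = coord_fun_in_jet_fun(2)[OF c] and co0 = jet_funD(2)[OF coord_fun_in_jet_fun(1)[OF c]]
  show "pull F0 (cdom c) (coord_fun M (dagger A L) L (dual_chart A c) (CX i)) = coord_fun M A L c (CX i)"
    by (rule F0_coordinates[OF c refl]) (simp_all add: co co0 Sp_local_coord evalp_scaleR dual_chart_def)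
  show "pull F0 (cdom c) (coord_fun M (dagger A L) L (dual_chart A c) (CU a)) = coord_fun M A L c (CPU a)"
    by (rule F0_coordinates[OF c refl]) (simp_all add: co co0 Sp_local_coord evalp_gen leg_simps)
  show "pull F0 (cdom c) (coord_fun M (dagger A L) L (dual_chart A c) (CPU a)) = coord_fun M A L c (CU a)"
    by (rule F0_coordinates[OF c refl]) (simp_all add: co co0 Sp_local_coord evalp_gen leg_simps)
  show "pull F0 (cdom c) (coord_fun M (dagger A L) L (dual_chart A c) (CPX i)) = coord_fun M A L c (CPX i)"
    by (rule F0_coordinates[OF c refl]) (simp_all add: co co0 Sp_local_coord evalp_gen leg_simps)
  have fp: "fins (\<Sum>b\<in>UNIV. G (CU b) * G (CPU b) :: ('n, 'r) sp)" by (intro fins_sum fins_mult fins_G)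
  have "evalp T (leg CP) = T CP - (\<Sum>b\<in>UNIV. T (CU b) * T (CPU b))" if "deg_hom T" for T :: "('n, 'r) coord \<Rightarrow> ('n, 'r) sp"
    unfolding leg_simps evalp_diff[OF fins_G(3) fp]
    by (simp only: evalp_sum fins_mult fins_G evalp_mult[OF that] evalp_gen)
  note leg_CP = this[OF deg_hom_JC]
  show "pull F0 (cdom c) (coord_fun M (dagger A L) L (dual_chart A c) CP) =
      (\<lambda>d y m. coord_fun M A L c CP d y m - (\<Sum>b\<in>UNIV. sp_mult (coord_fun M A L c (CU b) d y) (coord_fun M A L c (CPU b) d y) m))"
  proof (rule F0_coordinates[OF c])
    show "evalp leg (Sp (local_coord (dual_chart A c) CP x)) = leg CP" for x
      by (simp add: Sp_local_coord evalp_gen)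
  next
    fix e x assume e: "adapted M A L e" "x \<in> cdom c" "x \<in> cdom e"
    show "Sp (\<lambda>m. coord_fun M A L c CP e x m - (\<Sum>b\<in>UNIV. sp_mult (coord_fun M A L c (CU b) e x) (coord_fun M A L c (CPU b) e x) m)) =
        evalp (JC e c x) (leg CP)"
      unfolding Sp_simps Sp_sum leg_CP co[OF e] Sp_local_coord evalp_gen ..
  next
    fix e x assume e: "\<not> (adapted M A L e \<and> x \<in> cdom c \<inter> cdom e)"
    then show "(\<lambda>m. coord_fun M A L c CP e x m - (\<Sum>b\<in>UNIV. sp_mult (coord_fun M A L c (CU b) e x) (coord_fun M A L c (CPU b) e x) m)) = (\<lambda>_. 0)"
      unfolding co0[OF e] by (simp add: sp_mult_eq)
  qed
qed

end

theorem theorem3p16: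
  fixes M :: "('m::{t2_space,second_countable_topology}, 'n::{finite,linorder}) atlas"
    and A :: "('m, 'v, 'r::{finite,linorder}) vbundle"
    and L :: "('m, 'w, 1) vbundle"
  assumes "smooth_manifold M"
    and "vector_bundle M A"
    and "vector_bundle M L"
  shows "(\<exists>!F. contact_legendre M A L F) \<and>
    (\<forall>F c i a. contact_legendre M A L F \<and> adapted M A L c \<longrightarrow>
      (let x = coord_fun M A L c; x' = coord_fun M (dagger A L) L (dual_chart A c);
           F' = pull F (cdom c); X = jet_manifold M A L
       in F' (x' (CX i)) = x (CX i) \<and>
          F' (x' (CU a)) = x (CPU a) \<and>
          F' (x' CP) = (\<lambda>d y m. x CP d y m - (\<Sum>b\<in>UNIV. nmult X (x (CU b)) (x (CPU b)) d y m)) \<and>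
          F' (x' (CPX i)) = x (CPX i) \<and>
          F' (x' (CPU a)) = x (CU a)))"
proof -
  interpret jet_setting M A L
    by unfold_locales (rule assms)+
  show ?thesis
  proof (intro conjI allI impI)
    show "\<exists>!F. contact_legendre M A L F"
      using contact_legendre_F0 F_eq_F0 by blast
    fix F c i a
    assume "contact_legendre M A L F \<and> adapted M A L c"
    then have F: "F = F0" and c: "adapted M A L c" using F_eq_F0 by auto
    show "let x = coord_fun M A L c; x' = coord_fun M (dagger A L) L (dual_chart A c);
           F' = pull F (cdom c); X = jet_manifold M A L
       in F' (x' (CX i)) = x (CX i) \<and>
          F' (x' (CU a)) = x (CPU a) \<and>
          F' (x' CP) = (\<lambda>d y m. x CP d y m - (\<Sum>b\<in>UNIV. nmult X (x (CU b)) (x (CPU b)) d y m)) \<and>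
          F' (x' (CPX i)) = x (CPX i) \<and>
          F' (x' (CPU a)) = x (CU a)"
      using F0_coordinate_formulas[OF c] by (simp add: Let_def F jet_manifold_def)
  qed
qed

end
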